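(* Let $f\in L^2(E,\mu)\cap L^4(E,\mu)$ satisfy $\lambda_1>2\lambda_{\gamma(f)}$. Then for every nonzero $\nu\in\mathcal{M}_a(E)$, as $t\to\infty$, $$e^{\lambda_{\gamma(f)}t}\langle f,X_t\rangle\to\sum_{j=1}^{n_{\gamma(f)}}a_j^{\gamma(f)}H_\infty^{\gamma(f),j}\quad\text{in }L^2(\mathbb{P}_\nu).$$
   Context: Spatial motion. $E$ is a locally compact separable metric space, $\mu$ a $\sigma$-finite Borel measure on $E$ with full support, $\partial\notin E$ a cemetery point; every function $g$ on $E$ is extended by $g(\partial)=0$. $\xi=\{\xi_t,\Pi_x\}$ is a $\mu$-symmetric Hunt process on $E$ with lifetime $\zeta=\inf\{t>0:\xi_t=\partial\}$ and semigroup $P_t$, and there is a family $\{p_t(x,y):t>0\}$ of continuous, strictly positive, symmetric functions on $E\times E$ with $P_tg(x)=\int_E p_t(x,y)g(y)\,\mu(dy)$. With $\widetilde a_t(x):=p_t(x,x)$ assume: (a) $\int_E\widetilde a_t(x)\,\mu(dx)<\infty$ for every $t>0$; (b) there is $t_0>0$ with $\widetilde a_{t_0}\in L^2(E,\mu)$. Branching process. $\beta\ge0$ is a bounded measurable function on $E$ (branching rate) and $\{p_n(x):n=0,1,2,\dots\}$, $x\in E$, is an offspring distribution (measurable in $x$) with $\sup_{x\in E}\sum_{n\ge0}n^2p_n(x)<\infty$. In the branching system: each individual born at $x\in E$ moves according to $\Pi_x$; given its path $\xi$ and that it is alive at time $t$, it dies in $[t,t+dt)$ with probability $\beta(\xi_t)dt+o(dt)$;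 on dying at $x\in E$ it splits into $n$ individuals at $x$ with probability $p_n(x)$; an individual reaching $\partial$ disappears; individuals, once born, evolve independently. $X_t(B)$ is the number of individuals alive at time $t$ located in the Borel set $B\subset E$. $X=\{X_t,t\ge0\}$ is a Markov process with values in $\mathcal{M}_a(E)$, the space of finite atomic measures on $E$ (finite sums of Dirac masses); $\mathbb{P}_\nu$ is its law when $X_0=\nu$. For a measure $\nu$, $\langle g,\nu\rangle:=\int_E g\,d\nu$. Semigroup and eigenfunctions. $\alpha(x):=\beta(x)\big(\sum_{n\ge1}np_n(x)-1\big)$ and $T_tg(x):=\Pi_x\big[e^{\int_0^t\alpha(\xi_s)ds}g(\xi_t)\big]$ $(=\mathbb{P}_{\delta_x}\langle g,X_t\rangle)$. $T_t$ has a continuous, strictly positive, symmetric density $q_t(x,y)$ with respect to $\mu$, and $\{T_t\}$ is a strongly continuous semigroup of compact operators (for $t>0$) on $L^2(E,\mu)$; its generator $L$ has purely discrete spectrum with eigenvalues $-\lambda_1>-\lambda_2>-\lambda_3>\cdots$. The eigenvalue $-\lambda_1$ is simple, with a continuous strictly positive eigenfunction $\phi_1=\phi^{(1)}_1$, $\|\phi_1\|_2=1$. For $k>1$, $\{\phi^{(k)}_j:1\le j\le n_k\}$ is an orthonormal basis, consisting of continuous functions, of the (finite-dimensional) eigenspace of $-\lambda_k$; $n_1=1$. Supercriticality is assumed: $\lambda_1<0$. For $f\in L^2(E,\mu)$, $a_j^k:=\int_E f\phi^{(k)}_j\,d\mu$ and $\gamma(f):=\inf\{k\ge1:a_j^k\ne0\text{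 for some }1\le j\le n_k\}$, with $\inf\varnothing=\infty$ and $\lambda_\infty:=+\infty$. $H_t^{k,j}:=e^{\lambda_kt}\langle\phi_j^{(k)},X_t\rangle$. If $\lambda_1>2\lambda_k$, then for every nonzero $\nu\in\mathcal{M}_a(E)$, $H_t^{k,j}$ is an $L^2$-bounded martingale under $\mathbb{P}_\nu$, and $H_\infty^{k,j}:=\lim_{t\to\infty}H_t^{k,j}$ ($\mathbb{P}_\nu$-a.s. and in $L^2(\mathbb{P}_\nu)$). *)

theory Defs
  imports "HOL-Probability.Probability" "HOL-Library.Sublist" "HOL-Library.Extended_Nat"
begin

section \<open>Square integrable functions, operators and spectra\<close>

text \<open>Elements of $L^2$ are represented by functions; identities between them are stated
  almost everywhere or through the seminorm \<^term>\<open>L2_norm\<close>.\<close>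

definition L2_space :: "'b measure \<Rightarrow> ('b \<Rightarrow> real) set" where
  "L2_space M = {g \<in> borel_measurable M. integrable M (\<lambda>x. (g x)^2)}"

definition L4_space :: "'b measure \<Rightarrow> ('b \<Rightarrow> real) set" where
  "L4_space M = {g \<in> borel_measurable M. integrable M (\<lambda>x. (g x)^4)}"

definition L2_norm :: "'b measure \<Rightarrow> ('b \<Rightarrow> real) \<Rightarrow> real" where
  "L2_norm M g = sqrt (\<integral>x. (g x)^2 \<partial>M)"

text \<open>Membership in $L^2$ is required explicitly because the Bochner integral of a non-integrable
  function is 0.\<close>

definition L2_tendsto :: "'b measure \<Rightarrow> ('i \<Rightarrow> 'b \<Rightarrow> real) \<Rightarrow> ('b \<Rightarrow> real) \<Rightarrow> 'i filter \<Rightarrow> bool" where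
  "L2_tendsto M Y Z F \<longleftrightarrow>
     Z \<in> L2_space M \<and> (\<forall>\<^sub>F i in F. Y i \<in> L2_space M) \<and>
     ((\<lambda>i. L2_norm M (\<lambda>x. Y i x - Z x)) \<longlongrightarrow> 0) F"

definition L2_inner :: "'b measure \<Rightarrow> ('b \<Rightarrow> real) \<Rightarrow> ('b \<Rightarrow> real) \<Rightarrow> real" where
  "L2_inner M g h = (\<integral>x. g x * h x \<partial>M)"

definition strongly_continuous_semigroup ::
    "'b measure \<Rightarrow> (real \<Rightarrow> ('b \<Rightarrow> real) \<Rightarrow> 'b \<Rightarrow> real) \<Rightarrow> bool" where
  "strongly_continuous_semigroup M S \<longleftrightarrow>
     (\<forall>t\<ge>0. \<forall>g\<in>L2_space M. S t g \<in> L2_space M) \<and>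
     (\<forall>t\<ge>0. \<exists>C. \<forall>g\<in>L2_space M. L2_norm M (S t g) \<le> C * L2_norm M g) \<and>
     (\<forall>t\<ge>0. \<forall>g\<in>L2_space M. \<forall>h\<in>L2_space M. \<forall>a b.
        AE x in M. S t (\<lambda>y. a * g y + b * h y) x = a * S t g x + b * S t h x) \<and>
     (\<forall>g\<in>L2_space M. AE x in M. S 0 g x = g x) \<and>
     (\<forall>s\<ge>0. \<forall>t\<ge>0. \<forall>g\<in>L2_space M. AE x in M. S (s + t) g x = S s (S t g) x) \<and>
     (\<forall>g\<in>L2_space M. L2_tendsto M (\<lambda>t. S t g) g (at_right 0))"

definition compact_operator :: "'b measure \<Rightarrow> (('b \<Rightarrow> real) \<Rightarrow> 'b \<Rightarrow> real) \<Rightarrow> bool" where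
  "compact_operator M A \<longleftrightarrow>
     (\<forall>g :: nat \<Rightarrow> 'b \<Rightarrow> real. (\<forall>i. g i \<in> L2_space M) \<and> bounded (range (\<lambda>i. L2_norm M (g i))) \<longrightarrow>
        (\<exists>r h. strict_mono r \<and> L2_tendsto M (\<lambda>i. A (g (r i))) h sequentially))"

text \<open>The graph of the generator: \<open>generator M S g h\<close> says that $g$ is in its domain and $Lg = h$.\<close>

definition generator ::
    "'b measure \<Rightarrow> (real \<Rightarrow> ('b \<Rightarrow> real) \<Rightarrow> 'b \<Rightarrow> real) \<Rightarrow> ('b \<Rightarrow> real) \<Rightarrow> ('b \<Rightarrow> real) \<Rightarrow> bool" where
  "generator M S g h \<longleftrightarrow>
     g \<in> L2_space M \<and> L2_tendsto M (\<lambda>t x. (S t g x - g x) / t) h (at_right 0)"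

definition eigenspace ::
    "(('b \<Rightarrow> real) \<Rightarrow> ('b \<Rightarrow> real) \<Rightarrow> bool) \<Rightarrow> real \<Rightarrow> ('b \<Rightarrow> real) set" where
  "eigenspace L z = {g. L g (\<lambda>x. z * g x)}"

definition in_resolvent_set ::
    "'b measure \<Rightarrow> (('b \<Rightarrow> real) \<Rightarrow> ('b \<Rightarrow> real) \<Rightarrow> bool) \<Rightarrow> real \<Rightarrow> bool" where
  "in_resolvent_set M L z \<longleftrightarrow>
     (\<forall>g h. L g h \<and> (AE x in M. z * g x - h x = 0) \<longrightarrow> (AE x in M. g x = 0)) \<and>
     (\<exists>C. \<forall>k\<in>L2_space M. \<exists>g h. L g h \<and> (AE x in M. z * g x - h x = k x) \<and>
        L2_norm M g \<le> C * L2_norm M k)"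

text \<open>Only used for a self-adjoint operator on a real $L^2$ space, whose spectrum is real.\<close>

definition spectrum ::
    "'b measure \<Rightarrow> (('b \<Rightarrow> real) \<Rightarrow> ('b \<Rightarrow> real) \<Rightarrow> bool) \<Rightarrow> real set" where
  "spectrum M L = {z. \<not> in_resolvent_set M L z}"

definition orthonormal_basis_of ::
    "'b measure \<Rightarrow> ('b \<Rightarrow> real) set \<Rightarrow> nat \<Rightarrow> (nat \<Rightarrow> 'b \<Rightarrow> real) \<Rightarrow> bool" where
  "orthonormal_basis_of M V n e \<longleftrightarrow>
     (\<forall>j\<in>{1..n}. e j \<in> V) \<and>
     (\<forall>i\<in>{1..n}. \<forall>j\<in>{1..n}. L2_inner M (e i) (e j) = (if i = j then 1 else 0)) \<and>
     (\<forall>g\<in>V. \<exists>c. AE x in M. g x = (\<Sum>j=1..n. c j * e j x))"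

section \<open>Hunt processes\<close>

text \<open>The state space with its cemetery is \<^typ>\<open>'a option\<close>, the cemetery being \<^term>\<open>None\<close>. It
  carries the topology of the one-point compactification, in which the cemetery is isolated if the
  state space is already compact.\<close>

abbreviation (input) Edel_top :: "'a::topological_space option topology" where
  "Edel_top \<equiv> Alexandroff_compactification euclidean"

definition Edel :: "'a::topological_space option measure" where
  "Edel = sigma UNIV (Collect (openin Edel_top))"

definition ext :: "('a \<Rightarrow> 'b::zero) \<Rightarrow> 'a option \<Rightarrow> 'b" where
  "ext g y = (case y of None \<Rightarrow> 0 | Some x \<Rightarrow> g x)"

text \<open>The natural filtration of \<open>\<xi>\<close>, indexed by extended times so that index \<open>\<infinity>\<close>
  gives the $\sigma$-algebra generated by the whole path, and its right-continuous version.\<close>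

definition nat_filt :: "(real \<Rightarrow> 'w \<Rightarrow> 'a::topological_space option) \<Rightarrow> ennreal \<Rightarrow> 'w measure" where
  "nat_filt \<xi> t = sigma UNIV {\<xi> s -` B | s B. 0 \<le> s \<and> ennreal s \<le> t \<and> B \<in> sets Edel}"

abbreviation path_algebra :: "(real \<Rightarrow> 'w \<Rightarrow> 'a::topological_space option) \<Rightarrow> 'w measure" where
  "path_algebra \<xi> \<equiv> nat_filt \<xi> \<infinity>"

definition right_filt :: "(real \<Rightarrow> 'w \<Rightarrow> 'a::topological_space option) \<Rightarrow> ennreal \<Rightarrow> 'w measure" where
  "right_filt \<xi> t = sigma UNIV (sets (path_algebra \<xi>) \<inter> (\<Inter>s\<in>{t<..}. sets (nat_filt \<xi> s)))"

text \<open>Times are real numbers; only the values of \<open>\<xi>\<close> at times $\ge 0$ are meaningful. The initial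
  points of the family \<open>law\<close> range over the state space including the cemetery. The strong Markov
  property and quasi-left-continuity are required for stopping times of the right-continuous
  natural filtration.\<close>

locale hunt_process =
  fixes \<xi> :: "real \<Rightarrow> 'w \<Rightarrow> 'a::{metric_space, second_countable_topology} option"
    and law :: "'a option \<Rightarrow> 'w measure"
  assumes kernel: "law \<in> Edel \<rightarrow>\<^sub>M prob_algebra (path_algebra \<xi>)"
    and normal: "\<And>x. AE \<omega> in law x. \<xi> 0 \<omega> = x"
    and cemetery_absorbing: "\<And>s t \<omega>. 0 \<le> s \<Longrightarrow> s \<le> t \<Longrightarrow> \<xi> s \<omega> = None \<Longrightarrow> \<xi> t \<omega> = None"
    and shift: "\<And>t. 0 \<le> t \<Longrightarrow> \<exists>\<theta>. \<forall>\<omega>. \<forall>s\<ge>0. \<xi> s (\<theta> \<omega>) = \<xi> (s + t) \<omega>"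
    and right_continuous:
      "\<And>t \<omega>. 0 \<le> t \<Longrightarrow> limitin Edel_top (\<lambda>s. \<xi> s \<omega>) (\<xi> t \<omega>) (at_right t)"
    and left_limits:
      "\<And>t \<omega>. 0 < t \<Longrightarrow> \<exists>l. limitin Edel_top (\<lambda>s. \<xi> s \<omega>) l (at_left t)"
    and strong_markov:
      "\<And>x \<sigma> s B. stopping_time (right_filt \<xi>) \<sigma> \<Longrightarrow> 0 \<le> s \<Longrightarrow> B \<in> sets Edel \<Longrightarrow>
         AE \<omega> in law x. \<sigma> \<omega> < \<infinity> \<longrightarrow>
           real_cond_exp (law x) (filtration.pre_sigma UNIV (right_filt \<xi>) \<sigma>)
             (indicator {\<omega>'. \<xi> (enn2real (\<sigma> \<omega>') + s) \<omega>' \<in> B}) \<omega>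
           = measure (law (\<xi> (enn2real (\<sigma> \<omega>)) \<omega>)) {\<omega>'. \<xi> s \<omega>' \<in> B}"
    and quasi_left_continuous:
      "\<And>x \<sigma>n \<sigma>. (\<And>n::nat. stopping_time (right_filt \<xi>) (\<sigma>n n)) \<Longrightarrow>
         (\<And>\<omega>. incseq (\<lambda>n. \<sigma>n n \<omega>)) \<Longrightarrow> (\<And>\<omega>. (\<lambda>n. \<sigma>n n \<omega>) \<longlonglongrightarrow> \<sigma> \<omega>) \<Longrightarrow>
         AE \<omega> in law x. \<sigma> \<omega> < \<infinity> \<longrightarrow>
           limitin Edel_top (\<lambda>n. \<xi> (enn2real (\<sigma>n n \<omega>)) \<omega>) (\<xi> (enn2real (\<sigma> \<omega>)) \<omega>) sequentially"

section \<open>The spatial motion\<close>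

definition path_int :: "(real \<Rightarrow> 'w \<Rightarrow> 'a option) \<Rightarrow> ('a \<Rightarrow> real) \<Rightarrow> real \<Rightarrow> 'w \<Rightarrow> real" where
  "path_int \<xi> g t \<omega> = (LINT s:{0..t}|lborel. ext g (\<xi> s \<omega>))"

definition motion_sg ::
    "(real \<Rightarrow> 'w \<Rightarrow> 'a option) \<Rightarrow> ('a option \<Rightarrow> 'w measure) \<Rightarrow> real \<Rightarrow> ('a \<Rightarrow> real) \<Rightarrow> 'a \<Rightarrow> real" where
  "motion_sg \<xi> law t g x = (\<integral>\<omega>. ext g (\<xi> t \<omega>) \<partial>law (Some x))"

definition FK_sg ::
    "(real \<Rightarrow> 'w \<Rightarrow> 'a option) \<Rightarrow> ('a option \<Rightarrow> 'w measure) \<Rightarrow> ('a \<Rightarrow> real)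
      \<Rightarrow> real \<Rightarrow> ('a \<Rightarrow> real) \<Rightarrow> 'a \<Rightarrow> real" where
  "FK_sg \<xi> law \<alpha> t g x = (\<integral>\<omega>. exp (path_int \<xi> \<alpha> t \<omega>) * ext g (\<xi> t \<omega>) \<partial>law (Some x))"

text \<open>Continuous, strictly positive, symmetric densities of operators on functions. The identity for
  bounded nonnegative $g$ determines the kernels, and extends to all $g$ for which either side is
  defined.\<close>

definition nice_density ::
    "'a::metric_space measure \<Rightarrow> (real \<Rightarrow> ('a \<Rightarrow> real) \<Rightarrow> 'a \<Rightarrow> real) \<Rightarrow> (real \<Rightarrow> 'a \<Rightarrow> 'a \<Rightarrow> real) \<Rightarrow> bool" where
  "nice_density \<mu> S p \<longleftrightarrow> (\<forall>t>0.
     continuous_on UNIV (\<lambda>(x, y). p t x y) \<and>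
     (\<forall>x y. p t x y > 0) \<and> (\<forall>x y. p t x y = p t y x) \<and>
     (\<forall>g\<in>borel_measurable borel. (\<forall>x. 0 \<le> g x) \<and> bounded (range g) \<longrightarrow>
        (\<forall>x. ennreal (S t g x) = (\<integral>\<^sup>+y. ennreal (p t x y * g y) \<partial>\<mu>))))"

text \<open>The whole type \<^typ>\<open>'a\<close> is the state space $E$; for metric spaces, separability is second
  countability.\<close>

locale spatial_motion = hunt_process \<xi> law
  for \<xi> :: "real \<Rightarrow> 'w \<Rightarrow> 'a::{metric_space, second_countable_topology} option"
    and law :: "'a option \<Rightarrow> 'w measure" +
  fixes \<mu> :: "'a measure"
    and p :: "real \<Rightarrow> 'a \<Rightarrow> 'a \<Rightarrow> real"
  assumes locally_compact: "locally_compact_space (euclidean :: 'a topology)"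
    and borel_mu: "sets \<mu> = sets borel"
    and sigma_finite_mu: "sigma_finite_measure \<mu>"
    and full_support: "\<And>U. open U \<Longrightarrow> U \<noteq> {} \<Longrightarrow> emeasure \<mu> U > 0"
    and mu_symmetric:
      "\<And>t g h. 0 \<le> t \<Longrightarrow> g \<in> borel_measurable borel \<Longrightarrow> h \<in> borel_measurable borel \<Longrightarrow>
         (\<And>x. 0 \<le> g x) \<Longrightarrow> (\<And>x. 0 \<le> h x) \<Longrightarrow> bounded (range g) \<Longrightarrow> bounded (range h) \<Longrightarrow>
         (\<integral>\<^sup>+x. ennreal (motion_sg \<xi> law t g x * h x) \<partial>\<mu>)
         = (\<integral>\<^sup>+x. ennreal (g x * motion_sg \<xi> law t h x) \<partial>\<mu>)"
    and density_p: "nice_density \<mu> (motion_sg \<xi> law) p"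
    and diagonal_L1: "\<And>t. 0 < t \<Longrightarrow> (\<integral>\<^sup>+x. ennreal (p t x x) \<partial>\<mu>) < \<infinity>"
    and diagonal_L2: "\<exists>t0>0. (\<lambda>x. p t0 x x) \<in> L2_space \<mu>"

section \<open>The branching mechanism and the Feynman--Kac semigroup\<close>

definition branching_alpha :: "('a \<Rightarrow> real) \<Rightarrow> ('a \<Rightarrow> nat pmf) \<Rightarrow> 'a \<Rightarrow> real" where
  "branching_alpha \<beta> off x = \<beta> x * ((\<Sum>n. real n * pmf (off x) n) - 1)"

text \<open>The number \<open>nev\<close> of distinct eigenvalues is infinite unless $L^2(E,\mu)$ is finite-dimensional,
  as it is for a finite state space; the eigenvalues are $-\lambda_k$ for \<open>k \<in> ev_index nev\<close>.\<close>

definition ev_index :: "enat \<Rightarrow> nat set" where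
  "ev_index nev = {k. 1 \<le> k \<and> enat k \<le> nev}"

locale branching_model = spatial_motion \<xi> law \<mu> p
  for \<xi> :: "real \<Rightarrow> 'w \<Rightarrow> 'a::{metric_space, second_countable_topology} option"
    and law :: "'a option \<Rightarrow> 'w measure"
    and \<mu> :: "'a measure"
    and p :: "real \<Rightarrow> 'a \<Rightarrow> 'a \<Rightarrow> real" +
  fixes \<beta> :: "'a \<Rightarrow> real"
    and off :: "'a \<Rightarrow> nat pmf"
    and q :: "real \<Rightarrow> 'a \<Rightarrow> 'a \<Rightarrow> real"
    and nev :: enat
    and lam :: "nat \<Rightarrow> real"
    and dimE :: "nat \<Rightarrow> nat"
    and \<phi> :: "nat \<Rightarrow> nat \<Rightarrow> 'a \<Rightarrow> real"
  assumes beta_measurable: "\<beta> \<in> borel_measurable borel"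
    and beta_nonneg: "\<And>x. 0 \<le> \<beta> x"
    and beta_bounded: "bounded (range \<beta>)"
    and off_measurable: "\<And>n. (\<lambda>x. pmf (off x) n) \<in> borel_measurable borel"
    and off_second_moment: "(SUP x. \<Sum>n. ennreal (real n ^ 2 * pmf (off x) n)) < \<infinity>"
    and density_q: "nice_density \<mu> (FK_sg \<xi> law (branching_alpha \<beta> off)) q"
    and strongly_continuous:
      "strongly_continuous_semigroup \<mu> (FK_sg \<xi> law (branching_alpha \<beta> off))"
    and compact_sg: "\<And>t. 0 < t \<Longrightarrow> compact_operator \<mu> (FK_sg \<xi> law (branching_alpha \<beta> off) t)"
    and nev_pos: "1 \<le> nev"
    and spectrum_L:
      "spectrum \<mu> (generator \<mu> (FK_sg \<xi> law (branching_alpha \<beta> off))) = (\<lambda>k. - lam k) ` ev_index nev"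
    and lam_increasing: "strict_mono_on (ev_index nev) lam"
    and mult_pos: "\<And>k. k \<in> ev_index nev \<Longrightarrow> 1 \<le> dimE k"
    and eigenbasis: "\<And>k. k \<in> ev_index nev \<Longrightarrow>
      orthonormal_basis_of \<mu>
        (eigenspace (generator \<mu> (FK_sg \<xi> law (branching_alpha \<beta> off))) (- lam k)) (dimE k) (\<phi> k)"
    and phi_continuous: "\<And>k j. k \<in> ev_index nev \<Longrightarrow> j \<in> {1..dimE k} \<Longrightarrow> continuous_on UNIV (\<phi> k j)"
    and mult_1: "dimE 1 = 1"
    and phi_1_pos: "\<And>x. 0 < \<phi> 1 1 x"
    and supercritical: "lam 1 < 0"

section \<open>The branching particle system\<close>

text \<open>Individuals are labelled by lists: \<open>[i]\<close> is the $i$-th initial individual and \<open>i # u\<close> the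
  $i$-th child of \<open>u\<close>, so that the descendants of \<open>u\<close>, itself included, are the lists with suffix
  \<open>u\<close>; the empty list is not an individual. To each label belong a sample point \<open>m u\<close> of the motion,
  which runs from the birth of \<open>u\<close>; the age \<open>l u\<close> at which \<open>u\<close> dies by branching, \<open>\<infinity>\<close> if it never
  does; and the number \<open>n u\<close> of its children.\<close>

type_synonym label = "nat list"

fun birth_time :: "(label \<Rightarrow> ennreal) \<Rightarrow> label \<Rightarrow> ennreal" where
  "birth_time l [] = 0"
| "birth_time l [i] = 0"
| "birth_time l (i # j # u) = birth_time l (j # u) + l (j # u)"

text \<open>The birth place is \<^term>\<open>None\<close> for the labels which never come to life.\<close>

fun birth_place :: "(real \<Rightarrow> 'w \<Rightarrow> 'a option) \<Rightarrow> 'a list \<Rightarrow> (label \<Rightarrow> 'w) \<Rightarrow> (label \<Rightarrow> ennreal)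
    \<Rightarrow> (label \<Rightarrow> nat) \<Rightarrow> label \<Rightarrow> 'a option" where
  "birth_place \<xi> xs m l n [] = None"
| "birth_place \<xi> xs m l n [i] = (if i < length xs then Some (xs ! i) else None)"
| "birth_place \<xi> xs m l n (i # j # u) =
     (if birth_place \<xi> xs m l n (j # u) \<noteq> None \<and> l (j # u) < \<infinity> \<and> i < n (j # u)
      then \<xi> (enn2real (l (j # u))) (m (j # u)) else None)"

definition location :: "(real \<Rightarrow> 'w \<Rightarrow> 'a option) \<Rightarrow> (label \<Rightarrow> 'w) \<Rightarrow> (label \<Rightarrow> ennreal) \<Rightarrow> real
    \<Rightarrow> label \<Rightarrow> 'a option" where
  "location \<xi> m l t u = \<xi> (t - enn2real (birth_time l u)) (m u)"

definition alive :: "(real \<Rightarrow> 'w \<Rightarrow> 'a option) \<Rightarrow> 'a list \<Rightarrow> (label \<Rightarrow> 'w) \<Rightarrow> (label \<Rightarrow> ennreal)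
    \<Rightarrow> (label \<Rightarrow> nat) \<Rightarrow> real \<Rightarrow> label set" where
  "alive \<xi> xs m l n t = {u. birth_place \<xi> xs m l n u \<noteq> None \<and>
     birth_time l u \<le> ennreal t \<and> ennreal t < birth_time l u + l u \<and> location \<xi> m l t u \<noteq> None}"

text \<open>$X_t(B)$ is the number of $u$ alive at time $t$ with location in $B$.\<close>

definition population :: "(real \<Rightarrow> 'w \<Rightarrow> 'a::topological_space option) \<Rightarrow> 'a list \<Rightarrow> (label \<Rightarrow> 'w)
    \<Rightarrow> (label \<Rightarrow> ennreal) \<Rightarrow> (label \<Rightarrow> nat) \<Rightarrow> real \<Rightarrow> 'a measure" where
  "population \<xi> xs m l n t =
     distr (count_space (alive \<xi> xs m l n t)) borel (\<lambda>u. the (location \<xi> m l t u))"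

definition dirac_sum :: "'a::topological_space list \<Rightarrow> 'a measure" where
  "dirac_sum xs = distr (count_space {..<length xs}) borel (\<lambda>i. xs ! i)"

definition finite_atomic_measures :: "'a::topological_space measure set" where
  "finite_atomic_measures = range dirac_sum"

definition events_of :: "'m measure \<Rightarrow> 'b measure \<Rightarrow> ('m \<Rightarrow> 'b) \<Rightarrow> 'm set set" where
  "events_of M N Y = {Y -` A \<inter> space M | A. A \<in> sets N}"

text \<open>The events concerning the labels which are not descendants of \<open>u\<close>.\<close>

definition outside_events :: "'m measure \<Rightarrow> (real \<Rightarrow> 'w \<Rightarrow> 'a::topological_space option)
    \<Rightarrow> ('m \<Rightarrow> label \<Rightarrow> 'w) \<Rightarrow> ('m \<Rightarrow> label \<Rightarrow> ennreal) \<Rightarrow> ('m \<Rightarrow> label \<Rightarrow> nat) \<Rightarrow> label \<Rightarrow> 'm set set" where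
  "outside_events M \<xi> mot life kids u = (\<Union>v\<in>{v. \<not> suffix u v}.
     events_of M (path_algebra \<xi>) (\<lambda>\<omega>. mot \<omega> v) \<union>
     events_of M borel (\<lambda>\<omega>. life \<omega> v) \<union>
     events_of M (count_space UNIV) (\<lambda>\<omega>. kids \<omega> v))"

definition born_at :: "(real \<Rightarrow> 'w \<Rightarrow> 'a option) \<Rightarrow> 'a list \<Rightarrow> ('m \<Rightarrow> label \<Rightarrow> 'w)
    \<Rightarrow> ('m \<Rightarrow> label \<Rightarrow> ennreal) \<Rightarrow> ('m \<Rightarrow> label \<Rightarrow> nat) \<Rightarrow> label \<Rightarrow> 'm \<Rightarrow> 'a option" where
  "born_at \<xi> xs mot life kids u \<omega> = birth_place \<xi> xs (mot \<omega>) (life \<omega>) (kids \<omega>) u"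

definition branching_process :: "(real \<Rightarrow> 'w \<Rightarrow> 'a::topological_space option) \<Rightarrow> 'a list
    \<Rightarrow> ('m \<Rightarrow> label \<Rightarrow> 'w) \<Rightarrow> ('m \<Rightarrow> label \<Rightarrow> ennreal) \<Rightarrow> ('m \<Rightarrow> label \<Rightarrow> nat)
    \<Rightarrow> real \<Rightarrow> 'm \<Rightarrow> 'a measure" where
  "branching_process \<xi> xs mot life kids t \<omega> = population \<xi> xs (mot \<omega>) (life \<omega>) (kids \<omega>) t"

text \<open>A realisation, on a probability space \<open>M\<close>, of the system started from \<open>dirac_sum xs\<close>; thus
  \<open>M\<close> plays the role of $\mathbb{P}_\nu$. On the event that \<open>u\<close> is born, and conditionally on
  everything that concerns the labels which do not descend from \<open>u\<close>, its motion is distributed by \<open>law\<close> from its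
  birth place; given also its motion, it survives the branching up to age $t$ with probability
  $\exp(-\int_0^t \beta(\xi_s)\,ds)$, which is the meaning of dying at rate $\beta(\xi_s)$; given also
  its age at branching, its number of children has the offspring distribution at the place of death.
  Conditioning on all non-descendants encodes the independence of the individuals. As
  $\beta(\partial)=0$, almost surely no branching takes place at the cemetery;
  and almost surely it does not take place at a jump time of the motion, so the place of death can be
  read off the right-continuous path.\<close>

locale branching_system = branching_model \<xi> law \<mu> p \<beta> off q nev lam dimE \<phi> + prob_space M
  for \<xi> :: "real \<Rightarrow> 'w \<Rightarrow> 'a::{metric_space, second_countable_topology} option"
    and law :: "'a option \<Rightarrow> 'w measure"
    and \<mu> :: "'a measure"
    and p :: "real \<Rightarrow> 'a \<Rightarrow> 'a \<Rightarrow> real"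
    and \<beta> :: "'a \<Rightarrow> real"
    and off :: "'a \<Rightarrow> nat pmf"
    and q :: "real \<Rightarrow> 'a \<Rightarrow> 'a \<Rightarrow> real"
    and nev :: enat
    and lam :: "nat \<Rightarrow> real"
    and dimE :: "nat \<Rightarrow> nat"
    and \<phi> :: "nat \<Rightarrow> nat \<Rightarrow> 'a \<Rightarrow> real"
    and M :: "'m measure" +
  fixes xs :: "'a list"
    and mot :: "'m \<Rightarrow> label \<Rightarrow> 'w"
    and life :: "'m \<Rightarrow> label \<Rightarrow> ennreal"
    and kids :: "'m \<Rightarrow> label \<Rightarrow> nat"
  assumes mot_measurable: "\<And>u. (\<lambda>\<omega>. mot \<omega> u) \<in> M \<rightarrow>\<^sub>M path_algebra \<xi>"
    and life_measurable: "\<And>u. (\<lambda>\<omega>. life \<omega> u) \<in> M \<rightarrow>\<^sub>M borel"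
    and kids_measurable: "\<And>u. (\<lambda>\<omega>. kids \<omega> u) \<in> M \<rightarrow>\<^sub>M count_space UNIV"
    and motion_law:
      "\<And>u A. A \<in> sets (path_algebra \<xi>) \<Longrightarrow>
         AE \<omega> in M. born_at \<xi> xs mot life kids u \<omega> \<noteq> None \<longrightarrow>
           real_cond_exp M (sigma (space M) (outside_events M \<xi> mot life kids u))
             (indicator {\<omega>'. mot \<omega>' u \<in> A}) \<omega>
           = measure (law (born_at \<xi> xs mot life kids u \<omega>)) A"
    and branching_rate:
      "\<And>u t. 0 \<le> t \<Longrightarrow>
         AE \<omega> in M. born_at \<xi> xs mot life kids u \<omega> \<noteq> None \<longrightarrow>
           real_cond_exp M
             (sigma (space M) (outside_events M \<xi> mot life kids u \<union>
                events_of M (path_algebra \<xi>) (\<lambda>\<omega>'. mot \<omega>' u)))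
             (indicator {\<omega>'. ennreal t < life \<omega>' u}) \<omega>
           = exp (- path_int \<xi> \<beta> t (mot \<omega> u))"
    and offspring_law:
      "\<And>u k.
         AE \<omega> in M. born_at \<xi> xs mot life kids u \<omega> \<noteq> None \<and> life \<omega> u < \<infinity> \<and>
             \<xi> (enn2real (life \<omega> u)) (mot \<omega> u) \<noteq> None \<longrightarrow>
           real_cond_exp M
             (sigma (space M) (outside_events M \<xi> mot life kids u \<union>
                events_of M (path_algebra \<xi>) (\<lambda>\<omega>'. mot \<omega>' u) \<union>
                events_of M borel (\<lambda>\<omega>'. life \<omega>' u)))
             (indicator {\<omega>'. kids \<omega>' u = k}) \<omega>
           = pmf (off (the (\<xi> (enn2real (life \<omega> u)) (mot \<omega> u)))) k"

section \<open>Growth exponents and the limits of the martingales\<close>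

text \<open>The infimum of the empty set is \<open>\<infinity>\<close> in \<^typ>\<open>enat\<close>.\<close>

definition gamma_index :: "'a measure \<Rightarrow> enat \<Rightarrow> (nat \<Rightarrow> nat) \<Rightarrow> (nat \<Rightarrow> nat \<Rightarrow> 'a \<Rightarrow> real)
    \<Rightarrow> ('a \<Rightarrow> real) \<Rightarrow> enat" where
  "gamma_index \<mu> nev dimE \<phi> f =
     Inf {enat k | k. k \<in> ev_index nev \<and> (\<exists>j\<in>{1..dimE k}. L2_inner \<mu> f (\<phi> k j) \<noteq> 0)}"

definition lam_ext :: "(nat \<Rightarrow> real) \<Rightarrow> enat \<Rightarrow> ereal" where
  "lam_ext lam k = (case k of enat i \<Rightarrow> ereal (lam i) | \<infinity> \<Rightarrow> \<infinity>)"

definition H_martingale :: "(real \<Rightarrow> 'm \<Rightarrow> 'a measure) \<Rightarrow> (nat \<Rightarrow> real) \<Rightarrow> (nat \<Rightarrow> nat \<Rightarrow> 'a \<Rightarrow> real)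
    \<Rightarrow> nat \<Rightarrow> nat \<Rightarrow> real \<Rightarrow> 'm \<Rightarrow> real" where
  "H_martingale X lam \<phi> k j t \<omega> = exp (lam k * t) * (\<integral>x. \<phi> k j x \<partial>X t \<omega>)"

definition is_as_L2_limit :: "'m measure \<Rightarrow> (real \<Rightarrow> 'm \<Rightarrow> real) \<Rightarrow> ('m \<Rightarrow> real) \<Rightarrow> bool" where
  "is_as_L2_limit M Y Z \<longleftrightarrow>
     (AE \<omega> in M. ((\<lambda>t. Y t \<omega>) \<longlongrightarrow> Z \<omega>) at_top) \<and> L2_tendsto M Y Z at_top"

end

theory Submission
  imports Defs
begin

text \<open>Let \<open>k\<close> be the index at which the expansion of \<open>f\<close> starts, and split \<open>f = h + g\<close> where
  \<open>h = (\<Sum>j. a j * \<phi> k j)\<close> is its component in the \<open>k\<close>-th eigenspace. By linearity the rescaled integral of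
  \<open>h\<close> against the population is a combination of the martingales \<open>H_martingale\<close>, whose convergence is
  assumed. It remains to see that the second moment of the integral of \<open>g\<close> is of smaller order than
  \<open>exp (- 2 * lam k * t)\<close>.

  Write \<open>T\<close> for the Feynman--Kac semigroup. For a single ancestor at \<open>x\<close> the second moment at time \<open>t\<close> is
  \<open>T t (g\<^sup>2) x + (\<integral>\<^sub>0\<^sup>t T s (b * (T (t - s) g)\<^sup>2) x ds)\<close> with a bounded function \<open>b\<close>: a pair of
  individuals alive at time \<open>t\<close> is one individual counted twice, or its lines separate at some time
  \<open>s\<close> and are independent afterwards (lemmas \<open>many_to_two\<close> and \<open>variance_bound\<close>). These formulas hold
  for nonnegative functions without any integrability; for \<open>g\<close> of both signs, its positive and
  negative parts are combined and the finite mixed moment cancels. They are obtained by integrating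
  out the individuals of the tree one by one: conditionally on all labels that do not descend from
  \<open>u\<close>, the motion, the age at branching and the number of children of \<open>u\<close> have explicit laws, and the
  Markov property of the motion sums the contributions of all generations to the semigroup
  (\<open>Z_expectation\<close>).

  The remainder \<open>g\<close> is orthogonal to the eigenspaces up to the \<open>k\<close>-th one. As the semigroup is compact
  and symmetric and the spectrum of its generator consists of the numbers \<open>- lam m\<close>, the norm of
  \<open>T t g\<close> decays like \<open>exp (- l * t)\<close> for some \<open>l > lam k\<close>, while that of any function grows at most
  like \<open>exp (- lam 1 * t)\<close> (\<open>decay_orthogonal_to_eigenfunctions\<close>). As \<open>lam 1 > 2 * lam k\<close>, one may choose
  \<open>l\<close> with \<open>2 * l \<le> lam 1\<close>. Norms become pointwise bounds through the Cauchy--Schwarz inequality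
  \<open>(T r u x)\<^sup>2 \<le> const * p (2 * r) x x * (\<integral>u\<^sup>2)\<close>, and a diagonal of \<open>p\<close> in \<open>L\<^sup>2\<close> makes the bound
  stable under a further application of \<open>T\<close> (\<open>variance_integrand_decay\<close>). So the second moment is of order
  \<open>(1 + t) * exp (- 2 * l * t)\<close>. The bound needs \<open>g\<^sup>2\<close> in \<open>L\<^sup>2\<close>, which holds as \<open>f\<close> is in \<open>L\<^sup>4\<close> and the
  squares of the eigenfunctions are bounded by multiples of the diagonal of \<open>p\<close>.\<close>

text \<open>With this rule the simplifier would not recognise side conditions on \<open>\<infinity>\<close> in the form in which
  definitions and library facts state them.\<close>

declare infinity_ennreal_def [simp del]

section \<open>Square integrable functions\<close>

lemma L2_spaceD: "g \<in> L2_space M \<Longrightarrow> g \<in> borel_measurable M"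
  "g \<in> L2_space M \<Longrightarrow> integrable M (\<lambda>x. (g x)^2)"
  by (auto simp: L2_space_def)

lemma L2_mult_integrable:
  assumes "g \<in> L2_space M" "h \<in> L2_space M"
  shows "integrable M (\<lambda>x. g x * h x)"
proof (rule Bochner_Integration.integrable_bound)
  show "integrable M (\<lambda>x. (g x)^2 + (h x)^2)"
    using assms by (auto simp: L2_space_def)
  show "(\<lambda>x. g x * h x) \<in> borel_measurable M"
    using assms by (auto simp: L2_space_def)
  show "AE x in M. norm (g x * h x) \<le> norm ((g x)^2 + (h x)^2)"
  proof (intro AE_I2)
    fix x
    have "2 * (\<bar>g x\<bar> * \<bar>h x\<bar>) \<le> \<bar>g x\<bar>^2 + \<bar>h x\<bar>^2"
      using sum_squares_bound[of "\<bar>g x\<bar>" "\<bar>h x\<bar>"] by simp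
    moreover have "0 \<le> \<bar>g x\<bar> * \<bar>h x\<bar>" by simp
    ultimately have "\<bar>g x\<bar> * \<bar>h x\<bar> \<le> (g x)^2 + (h x)^2"
      unfolding power2_abs by linarith
    then show "norm (g x * h x) \<le> norm ((g x)^2 + (h x)^2)"
      by (simp add: abs_mult)
  qed
qed

lemma L2_lincomb:
  assumes "g \<in> L2_space M" "h \<in> L2_space M"
  shows "(\<lambda>x. a * g x + b * h x) \<in> L2_space M"
proof -
  have "integrable M (\<lambda>x. a^2 * (g x)^2 + b^2 * (h x)^2 + 2 * a * b * (g x * h x))"
    using assms L2_mult_integrable[OF assms] by (auto simp: L2_space_def)
  then show ?thesis
    using assms by (auto simp: L2_space_def power2_eq_square algebra_simps)
qed

lemma L2_diff: "g \<in> L2_space M \<Longrightarrow> h \<in> L2_space M \<Longrightarrow> (\<lambda>x. g x - h x) \<in> L2_space M"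
  using L2_lincomb[of g M h 1 "-1"] by simp

lemma L2_add: "g \<in> L2_space M \<Longrightarrow> h \<in> L2_space M \<Longrightarrow> (\<lambda>x. g x + h x) \<in> L2_space M"
  using L2_lincomb[of g M h 1 1] by simp

lemma L2_scale: "g \<in> L2_space M \<Longrightarrow> (\<lambda>x. a * g x) \<in> L2_space M"
  using L2_lincomb[of g M g a 0] by simp

lemma L2_zero: "(\<lambda>x. 0) \<in> L2_space M"
  by (simp add: L2_space_def)

lemma L2_sum: "(\<And>i. i \<in> I \<Longrightarrow> g i \<in> L2_space M) \<Longrightarrow> (\<lambda>x. \<Sum>i\<in>I. g i x) \<in> L2_space M"
proof (induction I rule: infinite_finite_induct)
  case (insert i I) then show ?case using L2_add[of "g i" M "\<lambda>x. \<Sum>i\<in>I. g i x"] by simp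
qed (auto simp: L2_zero)

lemma L2_cong_AE:
  assumes "g \<in> L2_space M" "h \<in> borel_measurable M" "AE x in M. g x = h x"
  shows "h \<in> L2_space M"
proof -
  have "integrable M (\<lambda>x. (h x)^2) \<longleftrightarrow> integrable M (\<lambda>x. (g x)^2)"
    using assms by (intro integrable_cong_AE) (auto simp: L2_space_def)
  then show ?thesis using assms by (auto simp: L2_space_def)
qed

lemma L2_norm_nonneg: "0 \<le> L2_norm M g"
  by (simp add: L2_norm_def integral_nonneg_AE)

lemma L2_norm_power2: "(L2_norm M g)^2 = L2_inner M g g"
  by (simp add: L2_norm_def L2_inner_def integral_nonneg_AE power2_eq_square)

lemma L2_inner_commute: "L2_inner M g h = L2_inner M h g"
  by (simp add: L2_inner_def mult.commute)

lemma L2_inner_lincomb: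
  assumes "g \<in> L2_space M" "h \<in> L2_space M" "k \<in> L2_space M"
  shows "L2_inner M (\<lambda>x. a * g x + b * h x) k = a * L2_inner M g k + b * L2_inner M h k"
proof -
  have "(\<integral>x. (a * g x + b * h x) * k x \<partial>M) = (\<integral>x. a * (g x * k x) + b * (h x * k x) \<partial>M)"
    by (simp add: algebra_simps)
  also have "\<dots> = a * (\<integral>x. g x * k x \<partial>M) + b * (\<integral>x. h x * k x \<partial>M)"
    using assms by (subst Bochner_Integration.integral_add) (auto intro!: L2_mult_integrable)
  finally show ?thesis by (simp add: L2_inner_def)
qed

lemma L2_inner_diff:
  assumes "g \<in> L2_space M" "h \<in> L2_space M" "k \<in> L2_space M"
  shows "L2_inner M (\<lambda>x. g x - h x) k = L2_inner M g k - L2_inner M h k"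
  using L2_inner_lincomb[OF assms, of 1 "-1"] by simp

lemma L2_inner_scale: "L2_inner M (\<lambda>x. a * g x) k = a * L2_inner M g k"
  by (simp add: L2_inner_def mult.assoc)

lemma L2_inner_cong_AE:
  assumes "g \<in> L2_space M" "g' \<in> L2_space M" "k \<in> L2_space M" "AE x in M. g x = g' x"
  shows "L2_inner M g k = L2_inner M g' k"
  unfolding L2_inner_def
  using assms by (intro integral_cong_AE) (auto simp: L2_space_def)

lemma L2_norm_cong_AE:
  assumes "g \<in> L2_space M" "g' \<in> L2_space M" "AE x in M. g x = g' x"
  shows "L2_norm M g = L2_norm M g'"
proof -
  have "(\<integral>x. (g x)^2 \<partial>M) = (\<integral>x. (g' x)^2 \<partial>M)"
    using assms by (intro integral_cong_AE) (auto simp: L2_space_def)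
  then show ?thesis by (simp add: L2_norm_def)
qed

lemma L2_norm_scale: "L2_norm M (\<lambda>x. a * g x) = \<bar>a\<bar> * L2_norm M g"
  by (simp add: L2_norm_def power_mult_distrib real_sqrt_mult)

lemma L2_norm_minus_commute: "L2_norm M (\<lambda>x. g x - h x) = L2_norm M (\<lambda>x. h x - g x)"
  by (simp add: L2_norm_def power2_commute)

lemma L2_norm_lincomb_power2:
  assumes "g \<in> L2_space M" "h \<in> L2_space M"
  shows "(L2_norm M (\<lambda>x. a * g x + b * h x))^2 =
    a^2 * (L2_norm M g)^2 + 2 * a * b * L2_inner M g h + b^2 * (L2_norm M h)^2"
proof -
  have L: "(\<lambda>x. a * g x + b * h x) \<in> L2_space M" using assms by (rule L2_lincomb)
  show ?thesis
    unfolding L2_norm_power2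
    by (simp add: L2_inner_lincomb[OF assms L] L2_inner_commute[of M _ "\<lambda>x. a * g x + b * h x"]
        L2_inner_lincomb[OF assms] assms L2_inner_commute[of M h g] algebra_simps power2_eq_square)
qed

lemma L2_Cauchy_Schwarz:
  assumes "g \<in> L2_space M" "h \<in> L2_space M"
  shows "\<bar>L2_inner M g h\<bar> \<le> L2_norm M g * L2_norm M h"
proof -
  define A B C where "A = (L2_norm M g)^2" and "B = L2_inner M g h" and "C = (L2_norm M h)^2"
  have pos: "0 \<le> a^2 * A + 2 * a * b * B + b^2 * C" for a b
    using L2_norm_lincomb_power2[OF assms, of a b] zero_le_power2[of "L2_norm M (\<lambda>x. a * g x + b * h x)"]
    unfolding A_def B_def C_def by linarith
  have "B^2 \<le> A * C"
  proof (cases "C = 0")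
    case True
    have "B = 0"
    proof (rule ccontr)
      assume "B \<noteq> 0"
      then show False using pos[of 1 "- (A + 1) / (2 * B)"] True by (auto simp: field_simps)
    qed
    then show ?thesis using True by simp
  next
    case False
    then have "C > 0" unfolding C_def by simp
    have "0 \<le> C * (A * C - B^2)"
      using pos[of C "- B"] by (simp add: algebra_simps power2_eq_square)
    then show ?thesis using \<open>C > 0\<close> by (simp add: zero_le_mult_iff)
  qed
  then have "\<bar>B\<bar>^2 \<le> (L2_norm M g * L2_norm M h)^2"
    by (simp add: A_def C_def power_mult_distrib)
  then show ?thesis
    unfolding B_def by (rule power2_le_imp_le) (simp add: L2_norm_nonneg)
qed

lemma L2_norm_triangle:
  assumes "g \<in> L2_space M" "h \<in> L2_space M"
  shows "L2_norm M (\<lambda>x. g x + h x) \<le> L2_norm M g + L2_norm M h"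
proof (rule power2_le_imp_le)
  show "(L2_norm M (\<lambda>x. g x + h x))^2 \<le> (L2_norm M g + L2_norm M h)^2"
    using L2_norm_lincomb_power2[OF assms, of 1 1] L2_Cauchy_Schwarz[OF assms]
    by (simp add: power2_sum)
qed (simp add: L2_norm_nonneg)

lemma L2_norm_triangle_diff:
  assumes "g \<in> L2_space M" "h \<in> L2_space M"
  shows "L2_norm M (\<lambda>x. g x - h x) \<le> L2_norm M g + L2_norm M h"
  using L2_norm_triangle[OF assms(1) L2_scale[OF assms(2), of "-1"]] L2_norm_scale[of M "-1" h]
  by simp

lemma L2_norm_zero_iff_AE:
  assumes "g \<in> L2_space M"
  shows "L2_norm M g = 0 \<longleftrightarrow> (AE x in M. g x = 0)"
proof -
  have "L2_norm M g = 0 \<longleftrightarrow> (\<integral>x. (g x)^2 \<partial>M) = 0" by (simp add: L2_norm_def)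
  also have "\<dots> \<longleftrightarrow> (AE x in M. (g x)^2 = 0)"
    using assms by (intro integral_nonneg_eq_0_iff_AE) (auto simp: L2_space_def)
  finally show ?thesis by simp
qed

lemma L2_norm_diff_zero_iff_AE:
  assumes "g \<in> L2_space M" "h \<in> L2_space M"
  shows "L2_norm M (\<lambda>x. g x - h x) = 0 \<longleftrightarrow> (AE x in M. g x = h x)"
  using L2_norm_zero_iff_AE[OF L2_diff[OF assms]] by simp

lemma L2_inner_tendsto:
  assumes "L2_tendsto M Y Z F" "\<And>i. Y i \<in> L2_space M" "k \<in> L2_space M"
  shows "((\<lambda>i. L2_inner M (Y i) k) \<longlongrightarrow> L2_inner M Z k) F"
proof -
  have Z: "Z \<in> L2_space M" and lim: "((\<lambda>i. L2_norm M (\<lambda>x. Y i x - Z x)) \<longlongrightarrow> 0) F"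
    using assms by (auto simp: L2_tendsto_def)
  have "((\<lambda>i. L2_inner M (Y i) k - L2_inner M Z k) \<longlongrightarrow> 0) F"
  proof (rule Lim_null_comparison)
    show "\<forall>\<^sub>F i in F. norm (L2_inner M (Y i) k - L2_inner M Z k) \<le> L2_norm M (\<lambda>x. Y i x - Z x) * L2_norm M k"
      using L2_Cauchy_Schwarz[OF L2_diff[OF assms(2) Z] assms(3)]
      by (intro always_eventually allI) (simp add: L2_inner_diff[OF assms(2) Z assms(3)])
    show "((\<lambda>i. L2_norm M (\<lambda>x. Y i x - Z x) * L2_norm M k) \<longlongrightarrow> 0) F"
      using tendsto_mult_right[OF lim, of "L2_norm M k"] by simp
  qed
  then show ?thesis by (rule LIM_zero_cancel)
qed

lemma L2_norm_tendsto:
  assumes "L2_tendsto M Y Z F" "\<And>i. Y i \<in> L2_space M"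
  shows "((\<lambda>i. L2_norm M (Y i)) \<longlongrightarrow> L2_norm M Z) F"
proof -
  have Z: "Z \<in> L2_space M" and lim: "((\<lambda>i. L2_norm M (\<lambda>x. Y i x - Z x)) \<longlongrightarrow> 0) F"
    using assms by (auto simp: L2_tendsto_def)
  have "((\<lambda>i. L2_norm M (Y i) - L2_norm M Z) \<longlongrightarrow> 0) F"
  proof (rule Lim_null_comparison[OF _ lim])
    show "\<forall>\<^sub>F i in F. norm (L2_norm M (Y i) - L2_norm M Z) \<le> L2_norm M (\<lambda>x. Y i x - Z x)"
    proof (intro always_eventually allI)
      fix i
      have "L2_norm M (\<lambda>x. Y i x) \<le> L2_norm M (\<lambda>x. Y i x - Z x) + L2_norm M Z"
        using L2_norm_triangle[OF L2_diff[OF assms(2) Z] Z, of i] by simp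
      moreover have "L2_norm M Z \<le> L2_norm M (\<lambda>x. Z x - Y i x) + L2_norm M (Y i)"
        using L2_norm_triangle[OF L2_diff[OF Z assms(2)] assms(2), of i i] by simp
      ultimately show "norm (L2_norm M (Y i) - L2_norm M Z) \<le> L2_norm M (\<lambda>x. Y i x - Z x)"
        using L2_norm_minus_commute[of M Z "Y i"] by (simp add: abs_le_iff)
    qed
  qed
  then show ?thesis by (rule LIM_zero_cancel)
qed

section \<open>Symmetric semigroups of compact operators\<close>

text \<open>The constant \<open>C\<close> is removed by taking roots: \<open>N t / exp (y * t)\<close> raised to the power
  \<open>2^n\<close> is at most its value at time \<open>2^n * t\<close>.\<close>

lemma squaring_removes_constant:
  fixes N :: "real \<Rightarrow> real"
  assumes nn: "\<And>t. 0 \<le> N t" and sq: "\<And>t. 0 \<le> t \<Longrightarrow> (N t)^2 \<le> N (2 * t) * a"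
    and bd: "\<And>t. 0 \<le> t \<Longrightarrow> N t \<le> C * exp (y * t) * a" and a: "0 \<le> a" and t: "0 \<le> t"
  shows "N t \<le> exp (y * t) * a"
proof (cases "a = 0")
  case True
  then show ?thesis using bd[OF t] by simp
next
  case False
  then have a: "0 < a" using a by simp
  define x where "x s = N s / (exp (y * s) * a)" for s
  have x0: "0 \<le> x s" for s using nn a by (simp add: x_def)
  have "(x s)^2 \<le> x (2 * s)" if "0 \<le> s" for s
  proof -
    have e: "exp (y * (2 * s)) = (exp (y * s))^2" by (simp add: exp_double[symmetric] mult_ac)
    have "(x s)^2 \<le> (N (2 * s) * a) / ((exp (y * s))^2 * a^2)"
      unfolding x_def power_divide power_mult_distrib by (rule divide_right_mono[OF sq[OF that]]) simp
    then show ?thesis using a by (simp add: x_def e power2_eq_square)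
  qed
  note sqx = this
  have pow: "(x t)^(2^n) \<le> x (2^n * t)" for n
  proof (induction n)
    case (Suc n)
    have "(x t)^(2^Suc n) = ((x t)^(2^n))^2" by (simp add: power_mult[symmetric] mult.commute)
    also have "\<dots> \<le> (x (2^n * t))^2" by (rule power_mono[OF Suc]) (simp add: x0)
    also have "\<dots> \<le> x (2 * (2^n * t))" using t by (intro sqx) simp
    finally show ?case by (simp add: mult.assoc)
  qed simp
  have xC: "x s \<le> C" if "0 \<le> s" for s using bd[OF that] a by (simp add: x_def divide_le_eq mult.assoc)
  have "x t \<le> 1"
  proof (rule ccontr)
    assume "\<not> x t \<le> 1"
    then obtain n where n: "C < (x t)^n" using real_arch_pow[of "x t" C] by auto
    also have "(x t)^n \<le> (x t)^(2^n)" using \<open>\<not> x t \<le> 1\<close> by (intro power_increasing) (auto intro: less_imp_le)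
    also have "\<dots> \<le> C" using pow[of n] xC[of "2^n * t"] t by simp
    finally show False by simp
  qed
  then show ?thesis using a by (simp add: x_def divide_le_eq)
qed

locale symmetric_L2_semigroup =
  fixes M :: "'b measure" and S :: "real \<Rightarrow> ('b \<Rightarrow> real) \<Rightarrow> 'b \<Rightarrow> real" and K :: real
  assumes sc: "strongly_continuous_semigroup M S"
    and symm: "\<And>t g h. 0 \<le> t \<Longrightarrow> g \<in> L2_space M \<Longrightarrow> h \<in> L2_space M \<Longrightarrow>
        L2_inner M (S t g) h = L2_inner M g (S t h)"
    and growth: "\<And>t g. 0 \<le> t \<Longrightarrow> g \<in> L2_space M \<Longrightarrow> L2_norm M (S t g) \<le> exp (K * t) * L2_norm M g"
    and K_nonneg: "0 \<le> K"
    and compact: "\<And>t. 0 < t \<Longrightarrow> compact_operator M (S t)"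
begin

lemma S_L2: "0 \<le> t \<Longrightarrow> g \<in> L2_space M \<Longrightarrow> S t g \<in> L2_space M"
  using sc by (auto simp: strongly_continuous_semigroup_def)

lemma S_linear: "0 \<le> t \<Longrightarrow> g \<in> L2_space M \<Longrightarrow> h \<in> L2_space M \<Longrightarrow>
   AE x in M. S t (\<lambda>y. a * g y + b * h y) x = a * S t g x + b * S t h x"
  using sc by (auto simp: strongly_continuous_semigroup_def)

lemma S_zero: "g \<in> L2_space M \<Longrightarrow> AE x in M. S 0 g x = g x"
  using sc by (auto simp: strongly_continuous_semigroup_def)

lemma S_add: "0 \<le> s \<Longrightarrow> 0 \<le> t \<Longrightarrow> g \<in> L2_space M \<Longrightarrow> AE x in M. S (s + t) g x = S s (S t g) x"
  using sc by (auto simp: strongly_continuous_semigroup_def)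

lemma S_diff_norm:
  assumes "0 \<le> t" "g \<in> L2_space M" "h \<in> L2_space M"
  shows "L2_norm M (\<lambda>x. S t g x - S t h x) = L2_norm M (S t (\<lambda>x. g x - h x))"
proof (rule L2_norm_cong_AE)
  show "AE x in M. S t g x - S t h x = S t (\<lambda>x. g x - h x) x"
    using S_linear[OF assms, of 1 "-1"] by auto
qed (use assms in \<open>auto intro!: L2_diff S_L2\<close>)

lemma S_diff_bound:
  assumes "0 \<le> t" "g \<in> L2_space M" "h \<in> L2_space M"
  shows "L2_norm M (\<lambda>x. S t g x - S t h x) \<le> exp (K * t) * L2_norm M (\<lambda>x. g x - h x)"
  using growth[OF assms(1) L2_diff[OF assms(2,3)]] S_diff_norm[OF assms] by simp

lemma S_scale: "0 \<le> t \<Longrightarrow> g \<in> L2_space M \<Longrightarrow> AE x in M. S t (\<lambda>y. a * g y) x = a * S t g x"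
  using S_linear[of t g g a 0] by simp

lemma norm_S_add:
  assumes "0 \<le> s" "0 \<le> t" "g \<in> L2_space M"
  shows "L2_norm M (S (s + t) g) = L2_norm M (S s (S t g))"
  using assms by (intro L2_norm_cong_AE S_add S_L2) auto

lemma inner_S_twice:
  assumes "0 \<le> t" "g \<in> L2_space M"
  shows "L2_inner M (S (2 * t) g) g = (L2_norm M (S t g))^2"
proof -
  have "L2_inner M (S (t + t) g) g = L2_inner M (S t (S t g)) g"
    using assms by (intro L2_inner_cong_AE S_add S_L2) auto
  also have "\<dots> = L2_inner M (S t g) (S t g)" using assms by (intro symm S_L2) auto
  finally show ?thesis by (simp add: L2_norm_power2)
qed

lemma exp_quotient_tendsto: "((\<lambda>h. \<bar>(exp (z * h) - 1) / h - z\<bar>) \<longlongrightarrow> 0) (at_right (0::real))"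
proof -
  have "((\<lambda>h. exp (z * h)) has_real_derivative z) (at 0)"
    by (auto intro!: derivative_eq_intros)
  then have "((\<lambda>h. (exp (z * h) - 1) / h) \<longlongrightarrow> z) (at 0)"
    by (simp add: has_field_derivative_iff)
  then have "((\<lambda>h. (exp (z * h) - 1) / h - z) \<longlongrightarrow> 0) (at_right 0)"
    by (simp add: LIM_zero filterlim_at_split)
  then show ?thesis by (rule tendsto_rabs_zero)
qed

text \<open>By definition of the generator the error \<open>d h\<close> of the claim at time \<open>h\<close> is of order \<open>o(h)\<close>. When
  \<open>[0, t]\<close> is cut into \<open>n\<close> equal steps, the errors of the steps add up to at most a constant times
  \<open>n * d (t / n)\<close>.\<close>

lemma eigenfunction_evolution:
  assumes gen: "generator M S g (\<lambda>x. z * g x)" and t: "0 \<le> t"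
  shows "AE x in M. S t g x = exp (z * t) * g x"
proof -
  have g: "g \<in> L2_space M" using gen by (simp add: generator_def)
  define d where "d h = L2_norm M (\<lambda>x. S h g x - exp (z * h) * g x)" for h
  have d0: "0 \<le> d h" for h by (simp add: d_def L2_norm_nonneg)
  have small: "((\<lambda>h. d h / h) \<longlongrightarrow> 0) (at_right 0)"
  proof (rule Lim_null_comparison)
    show "\<forall>\<^sub>F h in at_right 0. norm (d h / h) \<le>
        L2_norm M (\<lambda>x. (S h g x - g x) / h - z * g x) + \<bar>(exp (z * h) - 1) / h - z\<bar> * L2_norm M g"
      unfolding eventually_at_filter
    proof (intro always_eventually allI impI)
      fix h :: real assume "h \<noteq> 0" "h \<in> {0<..}"
      then have h: "0 < h" by simp
      have L1: "(\<lambda>x. (S h g x - g x) / h - z * g x) \<in> L2_space M"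
        using L2_diff[OF L2_scale[OF L2_diff[OF S_L2[OF less_imp_le[OF h] g] g], of "1/h"] L2_scale[OF g, of z]] by simp
      have "d h / h = L2_norm M (\<lambda>x. (1/h) * (S h g x - exp (z * h) * g x))"
        unfolding d_def L2_norm_scale using h by simp
      also have "(\<lambda>x. (1/h) * (S h g x - exp (z * h) * g x)) =
         (\<lambda>x. ((S h g x - g x) / h - z * g x) - ((exp (z * h) - 1) / h - z) * g x)"
        using h by (auto simp: fun_eq_iff field_simps)
      also have "L2_norm M \<dots> \<le> L2_norm M (\<lambda>x. (S h g x - g x) / h - z * g x)
         + L2_norm M (\<lambda>x. ((exp (z * h) - 1) / h - z) * g x)"
        by (rule L2_norm_triangle_diff[OF L1 L2_scale[OF g]])
      finally show "norm (d h / h) \<le> L2_norm M (\<lambda>x. (S h g x - g x) / h - z * g x)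
         + \<bar>(exp (z * h) - 1) / h - z\<bar> * L2_norm M g"
        using h d0[of h] by (simp add: L2_norm_scale)
    qed
    have "((\<lambda>h. L2_norm M (\<lambda>x. (S h g x - g x) / h - z * g x)) \<longlongrightarrow> 0) (at_right 0)"
      using gen by (simp add: generator_def L2_tendsto_def)
    then show "((\<lambda>h. L2_norm M (\<lambda>x. (S h g x - g x) / h - z * g x)
       + \<bar>(exp (z * h) - 1) / h - z\<bar> * L2_norm M g) \<longlongrightarrow> 0) (at_right 0)"
      by (intro tendsto_add_zero tendsto_mult_left_zero exp_quotient_tendsto)
  qed
  show ?thesis
  proof (cases "t = 0")
    case True
    then show ?thesis using S_zero[OF g] by simp
  next
    case False
    with t have t: "0 < t" by simp
    define c E where "c s = exp (- z * s) * d s" and "E = exp ((K + \<bar>z\<bar>) * t + \<bar>z\<bar> * t)" for s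
    have step: "c (s + h) \<le> E * d h + c s" if "0 \<le> h" "0 \<le> s" "s + h \<le> t" for h s
    proof -
      have eg: "(\<lambda>x. a * g x) \<in> L2_space M" for a by (rule L2_scale[OF g])
      have L: "S s g \<in> L2_space M" "S h g \<in> L2_space M" "S (s + h) g \<in> L2_space M"
        "S s (S h g) \<in> L2_space M" "S s (\<lambda>x. exp (z * h) * g x) \<in> L2_space M"
        using that g eg by (auto intro!: S_L2)
      have AE1: "AE x in M. S (s + h) g x = S s (S h g) x" by (rule S_add) (use that g in auto)
      have AE2: "AE x in M. S s (\<lambda>x. exp (z * h) * g x) x = exp (z * h) * S s g x"
        by (rule S_scale) (use that g in auto)
      have "d (s + h) = L2_norm M (\<lambda>x. (S s (S h g) x - S s (\<lambda>x. exp (z * h) * g x) x)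
          + exp (z * h) * (S s g x - exp (z * s) * g x))"
        unfolding d_def
      proof (rule L2_norm_cong_AE)
        show "AE x in M. S (s + h) g x - exp (z * (s + h)) * g x = (S s (S h g) x - S s (\<lambda>x. exp (z * h) * g x) x)
          + exp (z * h) * (S s g x - exp (z * s) * g x)"
          using AE1 AE2 by eventually_elim (simp add: algebra_simps exp_add)
      qed (intro L2_add L2_diff L2_scale L g)+
      also have "\<dots> \<le> L2_norm M (\<lambda>x. S s (S h g) x - S s (\<lambda>x. exp (z * h) * g x) x)
         + L2_norm M (\<lambda>x. exp (z * h) * (S s g x - exp (z * s) * g x))"
        by (intro L2_norm_triangle L2_add L2_diff L2_scale L g)
      also have "\<dots> \<le> exp (K * s) * d h + exp (z * h) * d s"
        unfolding d_def L2_norm_scale using S_diff_bound[OF that(2) L(2) eg, of "exp (z * h)"] by simp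
      finally have "c (s + h) \<le> exp (- z * (s + h)) * (exp (K * s) * d h + exp (z * h) * d s)"
        unfolding c_def by (rule mult_left_mono) simp
      also have "\<dots> = exp (K * s - z * (s + h)) * d h + c s"
        by (simp add: c_def distrib_left mult.assoc[symmetric] mult_exp_exp algebra_simps)
      also have "exp (K * s - z * (s + h)) * d h \<le> E * d h"
      proof -
        have "K * s \<le> K * t" using that K_nonneg by (intro mult_left_mono) auto
        moreover have "- z * (s + h) \<le> \<bar>z\<bar> * t" using that by (intro mult_mono) auto
        moreover have "0 \<le> \<bar>z\<bar> * t" using t by simp
        ultimately have "K * s - z * (s + h) \<le> (K + \<bar>z\<bar>) * t + \<bar>z\<bar> * t" unfolding distrib_right by linarith
        then show ?thesis using d0 by (simp add: E_def mult_right_mono)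
      qed
      finally show ?thesis by simp
    qed
    have cn: "c (real k * h) \<le> real k * (E * d h)" if h: "0 \<le> h" "real k * h \<le> t" for k h
      using h(2)
    proof (induction k)
      case 0
      have "d 0 = 0" unfolding d_def using S_zero[OF g] S_L2[OF _ g, of 0]
        by (simp add: L2_norm_diff_zero_iff_AE[OF _ g])
      then show ?case by (simp add: c_def)
    next
      case (Suc k)
      then have "real k * h + h \<le> t" by (simp add: algebra_simps)
      then have "c (real k * h + h) \<le> E * d h + c (real k * h)" "c (real k * h) \<le> real k * (E * d h)"
        using step[of h "real k * h"] Suc.IH h by auto
      then show ?case by (simp add: algebra_simps)
    qed
    have bound: "c t \<le> t * E * (d (t / real (Suc n)) / (t / real (Suc n)))" for n
      using cn[of "t / real (Suc n)" "Suc n"] t by (simp add: field_simps del: of_nat_Suc)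
    have "(\<lambda>n. t / real (Suc n)) \<longlonglongrightarrow> 0"
      using tendsto_mult_right_zero[OF LIMSEQ_inverse_real_of_nat, of t] by (simp add: field_simps)
    then have "filterlim (\<lambda>n. t / real (Suc n)) (at_right 0) sequentially"
      using t by (auto simp: filterlim_at intro!: always_eventually)
    from tendsto_mult_right_zero[OF filterlim_compose[OF small this], of "t * E"]
    have "c t \<le> 0" by (rule LIMSEQ_le_const) (use bound in blast)
    then have "d t = 0" using d0[of t] by (simp add: c_def mult_le_0_iff)
    then show ?thesis
      unfolding d_def using L2_norm_diff_zero_iff_AE[OF S_L2[OF _ g] L2_scale[OF g]] t by simp
  qed
qed

text \<open>Equality in the Cauchy--Schwarz inequality.\<close>

lemma extremal_is_eigenfunction:
  assumes g: "g \<in> L2_space M" and t: "0 \<le> t"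
    and N: "L2_norm M (S t g) = exp (y * t) * L2_norm M g" "L2_norm M (S (t / 2) g) = exp (y * (t / 2)) * L2_norm M g"
  shows "AE x in M. S t g x = exp (y * t) * g x"
proof -
  have St: "S t g \<in> L2_space M" by (rule S_L2[OF t g])
  have "L2_inner M (S t g) g = (exp (y * (t / 2)) * L2_norm M g)^2"
    using inner_S_twice[OF _ g, of "t / 2"] t by (simp add: N(2))
  also have "\<dots> = exp (y * t) * (L2_norm M g)^2" by (simp add: power_mult_distrib flip: exp_double)
  finally have "(L2_norm M (\<lambda>x. 1 * S t g x + (- exp (y * t)) * g x))^2 = 0"
    unfolding L2_norm_lincomb_power2[OF St g] N(1) by (simp add: power2_eq_square)
  then show ?thesis using L2_norm_diff_zero_iff_AE[OF St L2_scale[OF g], of "exp (y * t)"] by simp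
qed

lemma generator_of_eigenfunction:
  assumes g: "g \<in> L2_space M" and eig: "\<And>t. 0 \<le> t \<Longrightarrow> t \<le> 1 \<Longrightarrow> AE x in M. S t g x = exp (z * t) * g x"
  shows "generator M S g (\<lambda>x. z * g x)"
proof -
  have L: "(\<lambda>x. (S t g x - g x) / t) \<in> L2_space M" if "t \<in> {0<..<1}" for t
    using L2_scale[OF L2_diff[OF S_L2[OF _ g] g], of t "1/t"] that by simp
  have N: "\<bar>(exp (z * t) - 1) / t - z\<bar> * L2_norm M g = L2_norm M (\<lambda>x. (S t g x - g x) / t - z * g x)"
    if t: "t \<in> {0<..<1}" for t
    unfolding L2_norm_scale[symmetric]
  proof (rule L2_norm_cong_AE)
    have "AE x in M. S t g x = exp (z * t) * g x" using t by (intro eig) auto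
    then show "AE x in M. ((exp (z * t) - 1) / t - z) * g x = (S t g x - g x) / t - z * g x"
      by eventually_elim (use t in \<open>simp add: field_simps\<close>)
  qed (intro L2_diff L L2_scale g t)+
  have pos: "\<forall>\<^sub>F t in at_right (0::real). t \<in> {0<..<1}" by (rule eventually_at_right_real) simp
  have "((\<lambda>t. L2_norm M (\<lambda>x. (S t g x - g x) / t - z * g x)) \<longlongrightarrow> 0) (at_right 0)"
    by (rule Lim_transform_eventually[OF tendsto_mult_left_zero[OF exp_quotient_tendsto]])
       (rule eventually_mono[OF pos N])
  then show ?thesis
    unfolding generator_def L2_tendsto_def using g by (intro conjI L2_scale eventually_mono[OF pos L])
qed

lemma orthogonal_invariant:
  assumes "generator M S e (\<lambda>x. z * e x)" "g \<in> L2_space M" "0 \<le> t" "L2_inner M g e = 0"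
  shows "L2_inner M (S t g) e = 0"
proof -
  have e: "e \<in> L2_space M" using assms(1) by (simp add: generator_def)
  have "L2_inner M (S t g) e = L2_inner M g (S t e)" using assms e by (intro symm)
  also have "\<dots> = L2_inner M (S t e) g" by (rule L2_inner_commute)
  also have "\<dots> = L2_inner M (\<lambda>x. exp (z * t) * e x) g"
    using eigenfunction_evolution[OF assms(1,3)] assms e
    by (intro L2_inner_cong_AE) (auto intro!: S_L2 L2_scale)
  also have "\<dots> = exp (z * t) * L2_inner M e g" by (simp add: L2_inner_scale)
  finally show ?thesis using assms(4) by (simp add: L2_inner_commute[of M e])
qed

text \<open>Let \<open>\<rho>\<close> be the norm of \<open>S 1\<close> on the orthogonal complement \<open>H\<close> of \<open>B\<close>. By compactness, \<open>S 2\<close> maps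
  a maximising sequence to a sequence with a limit point \<open>h\<close>, for which the norms of \<open>S t h\<close>, \<open>t \<le> 2\<close>, are
  as large as \<open>\<rho>\<close> permits. Such an \<open>h\<close> is an eigenfunction in \<open>H\<close> with eigenvalue \<open>ln \<rho>\<close>, so that
  \<open>ln \<rho> \<le> z0\<close>.\<close>

lemma decay_orthogonal_to_eigenfunctions:
  fixes B :: "('b \<Rightarrow> real) set" and z0 :: real
  assumes B: "\<And>e. e \<in> B \<Longrightarrow> \<exists>z. generator M S e (\<lambda>x. z * e x)"
    and top: "\<And>g z. generator M S g (\<lambda>x. z * g x) \<Longrightarrow> (\<And>e. e \<in> B \<Longrightarrow> L2_inner M g e = 0) \<Longrightarrow>
        L2_norm M g \<noteq> 0 \<Longrightarrow> z \<le> z0"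
  shows "\<exists>C>0. \<forall>g\<in>L2_space M. (\<forall>e\<in>B. L2_inner M g e = 0) \<longrightarrow>
           (\<forall>t\<ge>0. L2_norm M (S t g) \<le> C * exp (z0 * t) * L2_norm M g)"
proof -
  define H where "H = {g \<in> L2_space M. \<forall>e\<in>B. L2_inner M g e = 0}"
  define \<rho> where "\<rho> = (SUP g\<in>{g\<in>H. L2_norm M g \<le> 1}. L2_norm M (S 1 g))"
  have BL: "e \<in> L2_space M" if "e \<in> B" for e using B[OF that] by (auto simp: generator_def)
  have HL: "g \<in> L2_space M" if "g \<in> H" for g using that by (simp add: H_def)
  have H_S: "S t g \<in> H" if "g \<in> H" "0 \<le> t" for g t
    using that B orthogonal_invariant[of _ _ g t] S_L2 by (fastforce simp: H_def)
  have H_scale: "(\<lambda>x. c * g x) \<in> H" if "g \<in> H" for g c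
    using that L2_scale[of g M c] by (auto simp: H_def L2_inner_scale)
  have zeroH: "(\<lambda>x. 0) \<in> H" by (auto simp: H_def L2_zero L2_inner_def)
  have bdd: "bdd_above ((\<lambda>g. L2_norm M (S 1 g)) ` {g\<in>H. L2_norm M g \<le> 1})"
  proof (rule bdd_aboveI2)
    fix g assume "g \<in> {g\<in>H. L2_norm M g \<le> 1}"
    then have "L2_norm M (S 1 g) \<le> exp K * L2_norm M g" "L2_norm M g \<le> 1"
      using growth[of 1 g] HL by auto
    then show "L2_norm M (S 1 g) \<le> exp K"
      by (meson exp_ge_zero mult_left_le order_trans)
  qed
  have \<rho>_bound1: "L2_norm M (S 1 g) \<le> \<rho>" if "g \<in> H" "L2_norm M g \<le> 1" for g
    unfolding \<rho>_def by (rule cSUP_upper[OF _ bdd]) (use that in auto)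
  have \<rho>0: "0 \<le> \<rho>"
    using order_trans[OF L2_norm_nonneg \<rho>_bound1[OF zeroH]] by (simp add: L2_norm_def)
  have \<rho>_bound: "L2_norm M (S 1 g) \<le> \<rho> * L2_norm M g" if g: "g \<in> H" for g
  proof (cases "L2_norm M g = 0")
    case True
    then show ?thesis using growth[of 1 g] HL[OF g] by simp
  next
    case False
    define n where "n = L2_norm M g"
    have n: "0 < n" using False L2_norm_nonneg[of M g] by (simp add: n_def)
    have "L2_norm M (S 1 (\<lambda>x. (1/n) * g x)) = L2_norm M (\<lambda>x. (1/n) * S 1 g x)"
      using HL[OF g] HL[OF H_scale[OF g]] by (intro L2_norm_cong_AE S_scale S_L2 L2_scale) auto
    moreover have "L2_norm M (S 1 (\<lambda>x. (1/n) * g x)) \<le> \<rho>"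
      using n by (intro \<rho>_bound1 H_scale g) (simp only: L2_norm_scale, simp add: n_def)
    ultimately show ?thesis using n by (simp only: L2_norm_scale) (simp add: n_def field_simps)
  qed
  have crude: "L2_norm M (S t g) \<le> exp (K + \<bar>y\<bar>) * exp (y * t) * L2_norm M g"
    if y: "\<rho> \<le> exp y" and g: "g \<in> H" and t: "0 \<le> t" for y g t
  proof -
    have gL: "g \<in> L2_space M" using HL[OF g] .
    have iter: "L2_norm M (S (real n) g) \<le> exp (y * real n) * L2_norm M g" for n
    proof (induction n)
      case 0
      show ?case using growth[of 0 g] gL by simp
    next
      case (Suc n)
      have "L2_norm M (S (1 + real n) g) = L2_norm M (S 1 (S (real n) g))"
        using gL by (intro norm_S_add) auto
      also have "\<dots> \<le> \<rho> * L2_norm M (S (real n) g)" using g by (intro \<rho>_bound H_S) auto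
      also have "\<dots> \<le> exp y * (exp (y * real n) * L2_norm M g)"
        using Suc y \<rho>0 by (intro mult_mono) (auto simp: L2_norm_nonneg)
      also have "\<dots> = exp (y * (1 + real n)) * L2_norm M g"
        by (simp only: distrib_left mult_1_right exp_add mult.assoc)
      finally show ?case by simp
    qed
    define n where "n = nat \<lfloor>t\<rfloor>"
    have n: "real n \<le> t" "t < real n + 1" using t by (auto simp: n_def)
    have "L2_norm M (S ((t - real n) + real n) g) = L2_norm M (S (t - real n) (S (real n) g))"
      using n gL by (intro norm_S_add) auto
    then have "L2_norm M (S t g) = L2_norm M (S (t - real n) (S (real n) g))" by simp
    also have "\<dots> \<le> exp (K * (t - real n)) * L2_norm M (S (real n) g)"
      using n gL by (intro growth S_L2) auto
    also have "\<dots> \<le> exp K * (exp (y * real n) * L2_norm M g)"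
      using n K_nonneg iter[of n] mult_left_mono[of "t - real n" 1 K]
      by (intro mult_mono) (auto simp: L2_norm_nonneg)
    also have "exp (y * real n) \<le> exp (\<bar>y\<bar>) * exp (y * t)"
    proof -
      have "y * (real n - t) \<le> \<bar>y\<bar> * 1"
        using n mult_left_mono[of "\<bar>real n - t\<bar>" 1 "\<bar>y\<bar>"] abs_ge_self[of "y * (real n - t)"]
        by (simp add: abs_mult)
      then show ?thesis by (simp add: exp_add[symmetric] algebra_simps)
    qed
    finally show ?thesis
      by (simp add: exp_add mult.assoc L2_norm_nonneg mult_right_mono)
  qed
  have sq: "(L2_norm M (S t g))^2 \<le> L2_norm M (S (2 * t) g) * L2_norm M g" if "g \<in> L2_space M" "0 \<le> t" for g t
    using inner_S_twice[OF that(2,1)] L2_Cauchy_Schwarz[OF S_L2[OF _ that(1)] that(1), of "2 * t"] that(2) by simp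
  have \<rho>_le: "\<rho> \<le> exp z0"
  proof (cases "\<rho> = 0")
    case False
    then have \<rho>: "0 < \<rho>" using \<rho>0 by simp
    define y where "y = ln \<rho>"
    have y: "\<rho> = exp y" using \<rho> by (simp add: y_def)
    have sharp: "L2_norm M (S t g) \<le> exp (y * t) * L2_norm M g" if "g \<in> H" "0 \<le> t" for g t
      by (rule squaring_removes_constant[of "\<lambda>t. L2_norm M (S t g)", OF L2_norm_nonneg sq[OF HL[OF that(1)]] _ L2_norm_nonneg that(2)])
        (use crude[of y g] y that in auto)
    have "\<exists>g. g \<in> H \<and> L2_norm M g \<le> 1 \<and> \<rho> - inverse (real (Suc n)) < L2_norm M (S 1 g)" for n
    proof -
      have "\<rho> - inverse (real (Suc n)) < \<rho>" by simp
      moreover have "{g\<in>H. L2_norm M g \<le> 1} \<noteq> {}" using zeroH by (auto simp: L2_norm_def)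
      ultimately show ?thesis unfolding \<rho>_def using less_cSUP_iff[OF _ bdd] by blast
    qed
    then obtain g where g: "\<And>n. g n \<in> H" "\<And>n. L2_norm M (g n) \<le> 1"
      "\<And>n. \<rho> - inverse (real (Suc n)) < L2_norm M (S 1 (g n))" by metis
    have gL: "g n \<in> L2_space M" for n using HL g by blast
    have "bounded (range (\<lambda>n. L2_norm M (g n)))"
      using g(2) by (intro boundedI[of _ 1]) (auto simp: L2_norm_nonneg)
    then obtain r h where r: "strict_mono r" and lim: "L2_tendsto M (\<lambda>i. S 2 (g (r i))) h sequentially"
      using compact[of 2, unfolded compact_operator_def, rule_format, of g] gL by fastforce
    have h: "h \<in> L2_space M" using lim by (simp add: L2_tendsto_def)
    have S2L: "S 2 (g n) \<in> L2_space M" for n using gL by (auto intro!: S_L2)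
    define a where "a n = L2_norm M (S 1 (g n))" for n
    have "a \<longlonglongrightarrow> \<rho>"
      unfolding a_def
    proof (rule tendsto_sandwich[where h = "\<lambda>_. \<rho>"])
      show "(\<lambda>n. \<rho> - inverse (real (Suc n))) \<longlonglongrightarrow> \<rho>"
        using LIMSEQ_inverse_real_of_nat_add_minus[of \<rho>] by simp
      show "\<forall>\<^sub>F n in sequentially. \<rho> - inverse (real (Suc n)) \<le> L2_norm M (S 1 (g n))"
        using g(3) by (auto intro!: always_eventually less_imp_le)
    qed (use \<rho>_bound1 g in \<open>auto intro!: always_eventually\<close>)
    then have ar: "(\<lambda>i. a (r i)) \<longlonglongrightarrow> \<rho>" using LIMSEQ_subseq_LIMSEQ[OF _ r] by (simp add: o_def)
    \<comment> \<open>Squaring loses nothing on functions of norm at most 1, so \<open>S 2 (g n)\<close> and \<open>S 4 (g n)\<close> are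
      asymptotically as large as possible, too.\<close>
    have sq1: "(L2_norm M (S t (g n)))^2 \<le> L2_norm M (S (2 * t) (g n))" if "0 \<le> t" for t n
      using sq[OF gL that, of n] mult_left_mono[OF g(2)[of n] L2_norm_nonneg[of M "S (2 * t) (g n)"]] by simp
    have a2: "(a n)^2 \<le> L2_norm M (S 2 (g n))" for n using sq1[of 1 n] by (simp add: a_def)
    have a4: "((a n)^2)^2 \<le> L2_norm M (S 2 (S 2 (g n)))" for n
      using power_mono[OF a2 zero_le_power2, of n 2] sq1[of 2 n] norm_S_add[of 2 2 "g n"] gL by simp
    have lim0: "(\<lambda>i. L2_norm M (\<lambda>x. S 2 (g (r i)) x - h x)) \<longlonglongrightarrow> 0"
      using lim by (simp add: L2_tendsto_def)
    have hlim: "(\<lambda>i. L2_norm M (S 2 (g (r i)))) \<longlonglongrightarrow> L2_norm M h" by (rule L2_norm_tendsto[OF lim S2L])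
    have lower: "\<rho>^2 \<le> L2_norm M h" by (rule LIMSEQ_le[OF tendsto_power[OF ar] hlim]) (use a2 in blast)
    have "L2_norm M (S 2 (g n)) \<le> \<rho>^2" for n
    proof -
      have "L2_norm M (S 2 (g n)) \<le> exp (y * 2) * 1"
        by (rule order_trans[OF sharp[OF g(1)] mult_left_mono[OF g(2)]]) auto
      moreover have "exp (y * 2) = \<rho>^2" using exp_double[of y] by (simp add: y mult.commute)
      ultimately show ?thesis by simp
    qed
    then have hn: "L2_norm M h = \<rho>^2"
      using lower LIMSEQ_le_const2[OF hlim, of "\<rho>^2"] by force
    have "(\<rho>^2)^2 \<le> L2_norm M (S 2 h)"
    proof (rule LIMSEQ_le[OF tendsto_power[OF tendsto_power[OF ar]]])
      show "(\<lambda>i. L2_norm M (S 2 h) + exp (K * 2) * L2_norm M (\<lambda>x. S 2 (g (r i)) x - h x)) \<longlonglongrightarrow> L2_norm M (S 2 h)"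
        using tendsto_add[OF tendsto_const tendsto_mult_right_zero[OF lim0]] by simp
      have S2h: "S 2 h \<in> L2_space M" and S4: "S 2 (S 2 (g n)) \<in> L2_space M" for n
        by (rule S_L2[OF _ h] S_L2[OF _ S2L], simp)+
      have "L2_norm M (S 2 (S 2 (g n))) \<le> L2_norm M (S 2 h) + exp (K * 2) * L2_norm M (\<lambda>x. S 2 (g n) x - h x)" for n
        using L2_norm_triangle[OF S2h L2_diff[OF S4 S2h], of n] S_diff_bound[OF _ S2L h, of 2 n] by simp
      then show "\<exists>N. \<forall>i\<ge>N. ((a (r i))^2)^2 \<le> L2_norm M (S 2 h) + exp (K * 2) * L2_norm M (\<lambda>x. S 2 (g (r i)) x - h x)"
        using a4 order_trans by blast
    qed
    then have top2: "exp (y * 2) * L2_norm M h \<le> L2_norm M (S 2 h)"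
      by (simp add: hn y power2_eq_square flip: exp_add)
    have orth: "L2_inner M h e = 0" if e: "e \<in> B" for e
    proof -
      have "(\<lambda>i. L2_inner M (S 2 (g (r i))) e) \<longlonglongrightarrow> L2_inner M h e"
        by (rule L2_inner_tendsto[OF lim S2L BL[OF e]])
      moreover have "L2_inner M (S 2 (g (r i))) e = 0" for i
        using H_S[OF g(1), of 2] e by (auto simp: H_def)
      ultimately show ?thesis by (simp add: LIMSEQ_const_iff)
    qed
    have hH: "h \<in> H" using h orth by (simp add: H_def)
    have N: "L2_norm M (S t h) = exp (y * t) * L2_norm M h" if t: "0 \<le> t" "t \<le> 2" for t
    proof (rule antisym[OF sharp[OF hH t(1)]])
      have "L2_norm M (S ((2 - t) + t) h) = L2_norm M (S (2 - t) (S t h))"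
        by (rule norm_S_add) (use t h in auto)
      also have "\<dots> \<le> exp (y * (2 - t)) * L2_norm M (S t h)" using t by (intro sharp H_S hH) auto
      finally have "exp (y * 2) * L2_norm M h \<le> exp (y * (2 - t)) * L2_norm M (S t h)" using top2 by simp
      then have "exp (- (y * (2 - t))) * (exp (y * 2) * L2_norm M h) \<le> exp (- (y * (2 - t))) * (exp (y * (2 - t)) * L2_norm M (S t h))"
        by (rule mult_left_mono) simp
      moreover have "exp (- (y * (2 - t))) * exp (y * 2) = exp (y * t)" "exp (- (y * (2 - t))) * exp (y * (2 - t)) = 1"
        by (simp_all add: mult_exp_exp algebra_simps)
      ultimately show "exp (y * t) * L2_norm M h \<le> L2_norm M (S t h)" by (simp only: mult.assoc[symmetric] mult_1_left)
    qed
    have "generator M S h (\<lambda>x. y * h x)"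
      by (intro generator_of_eigenfunction[OF h] extremal_is_eigenfunction[OF h]) (use N in auto)
    moreover have "L2_norm M h \<noteq> 0" using hn \<rho> by simp
    ultimately have "y \<le> z0" using top orth by blast
    then show ?thesis by (simp add: y)
  qed simp
  show ?thesis
    by (intro exI[of _ "exp (K + \<bar>z0\<bar>)"]) (use crude[OF \<rho>_le] in \<open>auto simp: H_def\<close>)
qed

end

section \<open>The path space and the Markov property\<close>

lemma space_Edel [simp]: "space Edel = UNIV"
  by (simp add: Edel_def space_measure_of_conv)

lemma sets_Edel: "sets Edel = sigma_sets UNIV (Collect (openin Edel_top))"
  by (simp add: Edel_def sets_measure_of)

lemma open_image_Some_Edel: "open U \<Longrightarrow> Some ` U \<in> sets Edel"
  unfolding sets_Edel by (intro sigma_sets.Basic) auto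

lemma None_Edel [measurable]: "{None} \<in> sets Edel"
proof -
  have "- (range Some) \<in> sets (Edel :: 'a::topological_space option measure)"
    using sets.compl_sets[OF open_image_Some_Edel[OF open_UNIV]] by (simp add: Compl_eq_Diff_UNIV)
  also have "- (range Some) = {None :: 'a option}" by (auto simp: image_iff)
  finally show ?thesis .
qed

lemma image_Some_Edel:
  assumes "B \<in> sets borel" shows "Some ` B \<in> sets Edel"
proof -
  have "B \<in> sigma_sets UNIV {S. open S}" using assms by (simp add: borel_def)
  then show ?thesis
  proof (induction B)
    case (Compl a)
    have "Some ` (UNIV - a) = (UNIV - Some ` a) - {None}"
    proof (rule set_eqI)
      fix x show "x \<in> Some ` (UNIV - a) \<longleftrightarrow> x \<in> (UNIV - Some ` a) - {None}" by (cases x) auto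
    qed
    then show ?case using sets.Diff[OF sets.compl_sets[OF Compl.IH] None_Edel] by simp
  next
    case (Union a)
    have "Some ` (\<Union>(range a)) = (\<Union>i. Some ` a i)" by auto
    then show ?case using sets.countable_UN[of "\<lambda>i. Some ` a i" UNIV Edel] Union.IH by auto
  qed (auto intro: open_image_Some_Edel)
qed

lemma Some_measurable [measurable]: "Some \<in> borel \<rightarrow>\<^sub>M Edel"
  unfolding Edel_def
proof (rule measurable_measure_of)
  fix V :: "'a option set" assume "V \<in> Collect (openin Edel_top)"
  then have "open (Some -` V)"
    using continuous_map_Some[of "euclidean :: 'a topology"]
    by (auto simp: continuous_map_def vimage_def)
  then show "Some -` V \<inter> space borel \<in> sets borel" by simp
qed auto

lemma ext_simps [simp]: "ext g None = 0" "ext g (Some x) = g x"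
  by (simp_all add: ext_def)

lemma ext_measurable:
  assumes g: "g \<in> borel \<rightarrow>\<^sub>M N" and 0: "(0::'b::zero) \<in> space N"
  shows "ext g \<in> Edel \<rightarrow>\<^sub>M N"
proof (rule measurableI)
  fix A assume A: "A \<in> sets N"
  have gA: "g -` A \<in> sets borel" using measurable_sets[OF g A] by simp
  have 1: "Some ` (g -` A) \<union> {None} \<in> sets Edel" by (rule sets.Un[OF image_Some_Edel[OF gA] None_Edel])
  show "ext g -` A \<inter> space Edel \<in> sets Edel"
  proof (cases "0 \<in> A")
    case True
    then have "ext g -` A \<inter> space Edel = Some ` (g -` A) \<union> {None}"
      by (auto simp: ext_def split: option.splits)
    then show ?thesis using 1 by metis
  next
    case False
    then have "ext g -` A \<inter> space Edel = Some ` (g -` A)"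
      by (auto simp: ext_def split: option.splits)
    then show ?thesis using image_Some_Edel[OF gA] by metis
  qed
next
  fix x show "ext g x \<in> space N"
    using 0 measurable_space[OF g, of "the x"] by (cases x) simp_all
qed

lemma ext_measurable_real [measurable]:
  "g \<in> borel_measurable borel \<Longrightarrow> (ext g :: _ \<Rightarrow> real) \<in> borel_measurable Edel"
  by (rule ext_measurable) auto

lemma ext_measurable_ennreal [measurable]:
  "g \<in> borel_measurable borel \<Longrightarrow> (ext g :: _ \<Rightarrow> ennreal) \<in> borel_measurable Edel"
  by (rule ext_measurable) auto

lemma sets_Edel_generated:
  "sets (Edel :: 'a::t2_space option measure) = sigma_sets UNIV {Some ` U | U. open U}"
proof (intro equalityI)
  show "sigma_sets UNIV {Some ` U | U. open U} \<subseteq> sets (Edel :: 'a option measure)"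
    using sets.sigma_sets_subset[of "{Some ` U | U. open U}" "Edel :: 'a option measure"]
    by (auto intro: open_image_Some_Edel)
next
  interpret S: sigma_algebra UNIV "sigma_sets UNIV {Some ` U | U. open (U :: 'a set)}"
    by (rule sigma_algebra_sigma_sets) auto
  have op: "Some ` U \<in> sigma_sets UNIV {Some ` U | U. open U}" if "open U" for U :: "'a set"
    using that by (intro sigma_sets.Basic) auto
  have "V \<in> sigma_sets UNIV {Some ` U | U. open U}" if V: "openin Edel_top V" for V :: "'a option set"
  proof -
    consider U where "open U" "V = Some ` U" | C where "closed C" "V = insert None (Some ` (UNIV - C))"
      using V by (auto simp: openin_Alexandroff_compactification)
    then show ?thesis
    proof cases
      case 1 then show ?thesis using op by simp
    next
      case 2
      have "V = UNIV - (Some ` UNIV - Some ` (- C))" using 2 by (auto simp: image_iff)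
      also have "\<dots> \<in> sigma_sets UNIV {Some ` U | U. open U}"
        using 2 by (intro S.Diff S.top op) auto
      finally show ?thesis .
    qed
  qed
  then show "sets (Edel :: 'a option measure) \<subseteq> sigma_sets UNIV {Some ` U | U. open U}"
    unfolding sets_Edel by (intro sigma_sets_mono) auto
qed

lemma space_nat_filt [simp]: "space (nat_filt \<xi> u) = UNIV"
  by (simp add: nat_filt_def space_measure_of_conv)

lemma sets_nat_filt:
  "sets (nat_filt \<xi> u) = sigma_sets UNIV {\<xi> s -` B | s B. 0 \<le> s \<and> ennreal s \<le> u \<and> B \<in> sets Edel}"
  by (simp add: nat_filt_def sets_measure_of)

lemma nat_filt_mono: "u \<le> v \<Longrightarrow> sets (nat_filt \<xi> u) \<subseteq> sets (nat_filt \<xi> v)"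
  unfolding sets_nat_filt by (rule sigma_sets_mono') (use order_trans in blast)

lemma coordinate_measurable:
  "0 \<le> s \<Longrightarrow> ennreal s \<le> u \<Longrightarrow> \<xi> s \<in> nat_filt \<xi> u \<rightarrow>\<^sub>M Edel"
  by (rule measurableI) (auto simp: sets_nat_filt intro!: sigma_sets.Basic)

lemma coordinate_path_algebra: "0 \<le> s \<Longrightarrow> \<xi> s \<in> path_algebra \<xi> \<rightarrow>\<^sub>M Edel"
  by (rule coordinate_measurable) (auto simp: infinity_ennreal_def)

lemma measurable_nat_filt_mono:
  "f \<in> nat_filt \<xi> u \<rightarrow>\<^sub>M N \<Longrightarrow> u \<le> v \<Longrightarrow> f \<in> nat_filt \<xi> v \<rightarrow>\<^sub>M N"
  using nat_filt_mono[of u v \<xi>] by (auto simp: measurable_def)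

text \<open>Both sides integrate \<open>f\<close>: one against the image under \<open>Z\<close> of the measure with density \<open>w\<close>, the other
  against a mixture of the measures \<open>\<kappa> x\<close>. These two measures agree on the generator \<open>G\<close>.\<close>

lemma kernel_disintegration:
  fixes w w' f :: "_ \<Rightarrow> ennreal"
  assumes w [measurable]: "w \<in> borel_measurable M" "w' \<in> borel_measurable M" and w_fin: "(\<integral>\<^sup>+x. w x \<partial>M) < \<infinity>"
    and Z [measurable]: "Z \<in> M \<rightarrow>\<^sub>M N"
    and \<kappa>: "\<kappa> \<in> M \<rightarrow>\<^sub>M subprob_algebra N"
    and gen: "sets N = sigma_sets (space N) G" "Int_stable G" "G \<subseteq> Pow (space N)"
    and exh: "range A \<subseteq> G" "(\<Union>i::nat. A i) = space N"
    and eq: "\<And>B. B \<in> G \<Longrightarrow>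
      (\<integral>\<^sup>+x. w x * indicator B (Z x) \<partial>M) = (\<integral>\<^sup>+x. w' x * emeasure (\<kappa> x) B \<partial>M)"
    and f: "f \<in> borel_measurable N"
  shows "(\<integral>\<^sup>+x. w x * f (Z x) \<partial>M) = (\<integral>\<^sup>+x. w' x * (\<integral>\<^sup>+z. f z \<partial>\<kappa> x) \<partial>M)"
proof (cases "space M = {}")
  case True
  then show ?thesis by (simp add: nn_integral_empty)
next
  case False
  define L where "L = distr (density M w) N Z"
  define R where "R = density M w' \<bind> \<kappa>"
  have \<kappa>': "\<kappa> \<in> density M w' \<rightarrow>\<^sub>M subprob_algebra N" using \<kappa> by simp
  have sR: "sets R = sets N"
    unfolding R_def by (rule sets_bind) (use False \<kappa> in \<open>auto dest: subprob_measurableD(2)\<close>)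
  have nL: "(\<integral>\<^sup>+y. h y \<partial>L) = (\<integral>\<^sup>+x. w x * h (Z x) \<partial>M)" if [measurable]: "h \<in> borel_measurable N" for h
    unfolding L_def by (simp add: nn_integral_distr nn_integral_density)
  have nR: "(\<integral>\<^sup>+y. h y \<partial>R) = (\<integral>\<^sup>+x. w' x * (\<integral>\<^sup>+z. h z \<partial>\<kappa> x) \<partial>M)" if h: "h \<in> borel_measurable N" for h
    unfolding R_def nn_integral_bind[OF h \<kappa>']
    by (rule nn_integral_density[OF w(2) measurable_compose[OF \<kappa> nn_integral_measurable_subprob_algebra[OF h]]])
  have "L = R"
  proof (rule measure_eqI_generator_eq[OF gen(2,3)])
    fix X assume X: "X \<in> G"
    then have XN: "X \<in> sets N" using gen by auto
    note Xm = borel_measurable_indicator[OF XN]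
    have "emeasure L X = (\<integral>\<^sup>+x. w x * indicator X (Z x) \<partial>M)" using nL[OF Xm] XN by (simp add: L_def)
    also have "\<dots> = (\<integral>\<^sup>+x. w' x * (\<integral>\<^sup>+z. indicator X z \<partial>\<kappa> x) \<partial>M)"
      unfolding eq[OF X] using XN by (intro nn_integral_cong) (simp add: subprob_measurableD(2)[OF \<kappa>])
    also have "\<dots> = emeasure R X" using nR[OF Xm] XN sR by simp
    finally show "emeasure L X = emeasure R X" .
  next
    fix i
    have "A i \<in> sets N" using exh gen by auto
    then have "emeasure L (A i) = (\<integral>\<^sup>+x. w x * indicator (A i) (Z x) \<partial>M)" using nL[of "indicator (A i)"] by (simp add: L_def)
    also have "\<dots> \<le> (\<integral>\<^sup>+x. w x \<partial>M)" by (intro nn_integral_mono) (auto simp: indicator_def)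
    finally show "emeasure L (A i) \<noteq> \<infinity>" using w_fin by (auto simp: top_unique infinity_ennreal_def)
  qed (use gen sR exh in \<open>auto simp: L_def\<close>)
  then show ?thesis using nL[OF f] nR[OF f] by simp
qed

lemma (in prob_space) nn_integral_real_cond_exp_indicator:
  assumes sub: "subalgebra M F" and D: "D \<inter> space M \<in> sets M" and A: "A \<in> sets F"
    and c: "c \<in> borel_measurable M" "\<And>w. 0 \<le> c w" "\<And>w. c w \<le> 1"
    and eq: "AE w in M. w \<in> A \<longrightarrow> real_cond_exp M F (indicator D) w = c w"
  shows "(\<integral>\<^sup>+w. indicator A w * indicator D w \<partial>M) = (\<integral>\<^sup>+w. indicator A w * ennreal (c w) \<partial>M)"
proof -
  interpret finite_measure_subalgebra M F by standard (rule sub)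
  have AM: "A \<in> sets M" using A sub by (auto simp: subalgebra_def)
  have DM: "(indicator D :: _ \<Rightarrow> real) \<in> borel_measurable M"
    using D by (simp add: borel_measurable_indicator_iff)
  have "(\<integral>w\<in>A. indicator D w \<partial>M) = (\<integral>w\<in>A. real_cond_exp M F (indicator D) w \<partial>M)"
  proof (rule real_cond_exp_intA[OF _ A])
    show "integrable M (indicator D :: _ \<Rightarrow> real)"
      using DM by (intro integrable_const_bound[where B=1]) (auto simp: indicator_def)
  qed
  also have "\<dots> = (\<integral>w\<in>A. c w \<partial>M)"
    unfolding set_lebesgue_integral_def
    using AM c(1) eq by (intro integral_cong_AE) (auto simp: indicator_def elim!: eventually_mono)
  finally have eq: "(\<integral>w\<in>A. indicator D w \<partial>M) = (\<integral>w\<in>A. c w \<partial>M)" .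
  have "(\<integral>\<^sup>+w. indicator A w * indicator D w \<partial>M) = (\<integral>\<^sup>+w. ennreal (indicator A w * indicator D w) \<partial>M)"
    by (intro nn_integral_cong) (auto simp: indicator_def)
  also have "\<dots> = ennreal (\<integral>w. indicator A w * indicator D w \<partial>M)"
  proof (rule nn_integral_eq_integral)
    show "integrable M (\<lambda>w. indicator A w * indicator D w :: real)"
      by (intro integrable_const_bound[where B=1] AE_I2 borel_measurable_times borel_measurable_indicator AM DM)
         (auto simp: indicator_def)
  qed (auto simp: indicator_def)
  also have "\<dots> = ennreal (\<integral>w. indicator A w * c w \<partial>M)"
    using eq by (simp add: set_lebesgue_integral_def)
  also have "\<dots> = (\<integral>\<^sup>+w. ennreal (indicator A w * c w) \<partial>M)"
  proof (rule nn_integral_eq_integral[symmetric])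
    show "integrable M (\<lambda>w. indicator A w * c w)"
      using c(2,3) by (intro integrable_const_bound[where B=1] AE_I2 borel_measurable_times borel_measurable_indicator AM c(1))
         (auto simp: indicator_def)
  qed (use c(2) in \<open>auto simp: indicator_def\<close>)
  also have "\<dots> = (\<integral>\<^sup>+w. indicator A w * ennreal (c w) \<partial>M)"
    by (intro nn_integral_cong) (auto simp: indicator_def)
  finally show ?thesis .
qed

context hunt_process
begin

lemma space_law [simp]: "space (law x) = UNIV" and sets_law [measurable_cong, simp]: "sets (law x) = sets (path_algebra \<xi>)"
  and prob_law: "prob_space (law x)"
proof -
  have "law x \<in> space (prob_algebra (path_algebra \<xi>))"
    using measurable_space[OF kernel, of x] by simp
  then show "sets (law x) = sets (path_algebra \<xi>)" "prob_space (law x)"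
    by (auto simp: space_prob_algebra)
  then show "space (law x) = UNIV" using sets_eq_imp_space_eq[of "law x" "path_algebra \<xi>"] by simp
qed

lemma law_subprob [measurable]: "law \<in> Edel \<rightarrow>\<^sub>M subprob_algebra (path_algebra \<xi>)"
  by (rule measurable_prob_algebraD[OF kernel])

lemma right_filt_filtration: "filtration UNIV (right_filt \<xi>)"
proof
  show "space (right_filt \<xi> i) = UNIV" for i by (simp add: right_filt_def space_measure_of_conv)
  show "sets (right_filt \<xi> i) \<subseteq> sets (right_filt \<xi> j)" if "i \<le> j" for i j
    unfolding right_filt_def using that
    by (simp add: sets_measure_of, intro sigma_sets_mono') auto
qed

lemma nat_filt_le_right_filt: "sets (nat_filt \<xi> u) \<subseteq> sets (right_filt \<xi> u)"
proof
  fix A assume A: "A \<in> sets (nat_filt \<xi> u)"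
  have "A \<in> sets (nat_filt \<xi> v)" if "u \<le> v" for v using A nat_filt_mono[OF that] by blast
  then have "A \<in> sets (path_algebra \<xi>) \<inter> (\<Inter>s\<in>{u<..}. sets (nat_filt \<xi> s))"
    by (auto simp: infinity_ennreal_def)
  then show "A \<in> sets (right_filt \<xi> u)"
    by (simp add: right_filt_def sets_measure_of)
qed

lemma right_filt_le_path: "sets (right_filt \<xi> u) \<subseteq> sets (path_algebra \<xi>)"
proof -
  interpret S: sigma_algebra UNIV "sets (path_algebra \<xi>)"
    using sets.sigma_algebra_axioms[of "path_algebra \<xi>"] by simp
  have "sets (sigma UNIV (sets (path_algebra \<xi>) \<inter> (\<Inter>s\<in>{u<..}. sets (nat_filt \<xi> s)))) =
     sigma_sets UNIV (sets (path_algebra \<xi>) \<inter> (\<Inter>s\<in>{u<..}. sets (nat_filt \<xi> s)))"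
    by (rule sets_measure_of) auto
  also have "\<dots> \<subseteq> sets (path_algebra \<xi>)" by (rule S.sigma_sets_subset) auto
  finally show ?thesis unfolding right_filt_def .
qed

text \<open>A fixed time is a stopping time, and the events of the natural filtration up to that time belong to
  its \<open>\<sigma>\<close>-algebra.\<close>

lemma simple_markov_set:
  assumes t: "0 \<le> t" and s: "0 \<le> s" and A: "A \<in> sets (nat_filt \<xi> (ennreal t))" and B: "B \<in> sets Edel"
  shows "(\<integral>\<^sup>+w. indicator A w * indicator B (\<xi> (t + s) w) \<partial>law x)
       = (\<integral>\<^sup>+w. indicator A w * emeasure (law (\<xi> t w)) {w'. \<xi> s w' \<in> B} \<partial>law x)"
proof -
  interpret prob_space "law x" by (rule prob_law)
  interpret F: filtration UNIV "right_filt \<xi>" by (rule right_filt_filtration)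
  define \<sigma> where "\<sigma> = (\<lambda>w::'w. ennreal t)"
  have st: "stopping_time (right_filt \<xi>) \<sigma>" unfolding \<sigma>_def by (rule stopping_time_const)
  have sp: "space (F.pre_sigma \<sigma>) = UNIV" by (rule F.space_pre_sigma)
  have "sets (F.pre_sigma \<sigma>) \<subseteq> sets (path_algebra \<xi>)"
  proof
    fix D assume "D \<in> sets (F.pre_sigma \<sigma>)"
    then have "{w \<in> D. \<sigma> w \<le> ennreal t} \<in> sets (right_filt \<xi> (ennreal t))"
      by (rule F.sets_pre_sigmaD[OF st])
    then show "D \<in> sets (path_algebra \<xi>)" using right_filt_le_path by (auto simp: \<sigma>_def)
  qed
  then have sub: "subalgebra (law x) (F.pre_sigma \<sigma>)" by (auto simp: subalgebra_def sp)
  have A': "A \<in> sets (F.pre_sigma \<sigma>)"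
  proof (rule F.sets_pre_sigmaI[OF st])
    fix r show "{w \<in> A. \<sigma> w \<le> r} \<in> sets (right_filt \<xi> r)"
      using A nat_filt_le_right_filt[of r] nat_filt_mono[of "ennreal t" r \<xi>]
      by (cases "ennreal t \<le> r") (auto simp: \<sigma>_def)
  qed
  define D where "D = {w. \<xi> (t + s) w \<in> B}"
  have xm: "\<xi> r \<in> law x \<rightarrow>\<^sub>M Edel" if "0 \<le> r" for r
    using coordinate_path_algebra[of r \<xi>] that by simp
  have DM: "D \<in> sets (law x)"
    using measurable_sets[OF xm[of "t + s"] B] t s by (simp add: D_def vimage_def)
  have mm: "(\<lambda>w. measure (law (\<xi> t w)) {w'. \<xi> s w' \<in> B}) \<in> borel_measurable (law x)"
  proof -
    have "{w'. \<xi> s w' \<in> B} \<in> sets (path_algebra \<xi>)"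
      using measurable_sets[OF coordinate_path_algebra[of s \<xi>] B] s by (simp add: vimage_def)
    then have "(\<lambda>y. measure (law y) {w'. \<xi> s w' \<in> B}) \<in> borel_measurable Edel"
      unfolding measure_def
      by (intro borel_measurable_enn2real measurable_compose[OF law_subprob measurable_emeasure_subprob_algebra])
    then show ?thesis by (rule measurable_compose[OF xm[OF t]])
  qed
  have AE: "AE w in law x. real_cond_exp (law x) (F.pre_sigma \<sigma>) (indicator D) w = measure (law (\<xi> t w)) {w'. \<xi> s w' \<in> B}"
    using strong_markov[OF st s B, of x] t by (simp add: \<sigma>_def D_def infinity_ennreal_def)
  have "(\<integral>\<^sup>+w. indicator A w * indicator B (\<xi> (t + s) w) \<partial>law x) = (\<integral>\<^sup>+w. indicator A w * indicator D w \<partial>law x)"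
    by (intro nn_integral_cong) (auto simp: D_def indicator_def)
  also have "\<dots> = (\<integral>\<^sup>+w. indicator A w * ennreal (measure (law (\<xi> t w)) {w'. \<xi> s w' \<in> B}) \<partial>law x)"
  proof (rule nn_integral_real_cond_exp_indicator[OF sub _ A' mm])
    show "D \<inter> space (law x) \<in> sets (law x)" using DM by simp
    show "measure (law (\<xi> t w)) {w'. \<xi> s w' \<in> B} \<le> 1" for w by (rule prob_space.prob_le_1[OF prob_law])
  qed (use AE in \<open>auto elim: eventually_mono\<close>)
  finally show ?thesis
    by (simp add: finite_measure.emeasure_eq_measure[OF prob_space.finite_measure[OF prob_law]])
qed

text \<open>Shift operators are only assumed to exist, so one is chosen for each time.\<close>

definition path_shift :: "real \<Rightarrow> 'w \<Rightarrow> 'w" where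
  "path_shift t = (SOME \<theta>. \<forall>w. \<forall>s\<ge>0. \<xi> s (\<theta> w) = \<xi> (s + t) w)"

lemma path_shift: "0 \<le> t \<Longrightarrow> 0 \<le> s \<Longrightarrow> \<xi> s (path_shift t w) = \<xi> (s + t) w"
  using someI_ex[OF shift[of t]] unfolding path_shift_def by blast

lemma path_shift_measurable [measurable]:
  assumes "0 \<le> t" shows "path_shift t \<in> path_algebra \<xi> \<rightarrow>\<^sub>M path_algebra \<xi>"
  unfolding nat_filt_def[of \<xi> \<infinity>]
proof (rule measurable_sigma_sets)
  fix V assume "V \<in> {\<xi> s -` B | s B. 0 \<le> s \<and> ennreal s \<le> \<infinity> \<and> B \<in> sets Edel}"
  then obtain s B where V: "V = \<xi> s -` B" "0 \<le> s" "B \<in> sets Edel" by auto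
  have "path_shift t -` V = \<xi> (s + t) -` B" using V assms by (auto simp: path_shift)
  also have "\<dots> \<in> sets (path_algebra \<xi>)"
    using measurable_sets[OF coordinate_path_algebra[of "s + t" \<xi>] V(3)] assms V by simp
  finally show "path_shift t -` V \<inter> space (sigma UNIV {\<xi> s -` B | s B. 0 \<le> s \<and> ennreal s \<le> \<infinity> \<and> B \<in> sets Edel})
     \<in> sets (sigma UNIV {\<xi> s -` B | s B. 0 \<le> s \<and> ennreal s \<le> \<infinity> \<and> B \<in> sets Edel})"
    by (simp add: nat_filt_def space_measure_of_conv)
qed (auto simp: sets_measure_of)

lemma law_coordinate: "0 \<le> r \<Longrightarrow> \<xi> r \<in> law x \<rightarrow>\<^sub>M Edel"
  using coordinate_path_algebra[of r \<xi>] by (simp add: measurable_cong_sets[OF sets_law refl])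

lemma nat_filt_sets_law: "A \<in> sets (nat_filt \<xi> u) \<Longrightarrow> A \<in> sets (law x)"
  using nat_filt_mono[of u \<infinity> \<xi>] by (auto simp: infinity_ennreal_def)

lemma law_indicator_finite: "A \<in> sets (nat_filt \<xi> u) \<Longrightarrow> (\<integral>\<^sup>+w. indicator A w \<partial>law x) < \<infinity>"
  using nat_filt_sets_law[of A u x] finite_measure.emeasure_finite[OF prob_space.finite_measure[OF prob_law]]
  by (simp add: less_top infinity_ennreal_def)

lemma simple_markov_fun:
  assumes t: "0 \<le> t" and s: "0 \<le> s" and A: "A \<in> sets (nat_filt \<xi> (ennreal t))" and f: "f \<in> borel_measurable Edel"
  shows "(\<integral>\<^sup>+w. indicator A w * f (\<xi> (t + s) w) \<partial>law x)
       = (\<integral>\<^sup>+w. indicator A w * (\<integral>\<^sup>+w'. f (\<xi> s w') \<partial>law (\<xi> t w)) \<partial>law x)"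
proof -
  have wA: "(indicator A :: 'w \<Rightarrow> ennreal) \<in> borel_measurable (law x)"
    using nat_filt_sets_law[OF A, of x] by simp
  have xs: "\<xi> s \<in> law y \<rightarrow>\<^sub>M Edel" for y by (rule law_coordinate[OF s])
  have K: "(\<lambda>y. distr (law y) Edel (\<xi> s)) \<in> Edel \<rightarrow>\<^sub>M subprob_algebra Edel"
    by (rule measurable_compose[OF law_subprob measurable_distr[OF coordinate_path_algebra[OF s]]])
  have "(\<integral>\<^sup>+w. indicator A w * f (\<xi> (t + s) w) \<partial>law x)
       = (\<integral>\<^sup>+w. indicator A w * (\<integral>\<^sup>+y. f y \<partial>distr (law (\<xi> t w)) Edel (\<xi> s)) \<partial>law x)"
  proof (rule kernel_disintegration[OF wA wA law_indicator_finite[OF A] _ _ sets.sigma_sets_eq[symmetric] sets.Int_stable sets.space_closed _ _ _ f])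
    show "range (\<lambda>i::nat. UNIV) \<subseteq> sets Edel" using sets.top[of Edel] by auto
    show "\<xi> (t + s) \<in> law x \<rightarrow>\<^sub>M Edel" using t s by (intro law_coordinate) auto
    show "(\<lambda>w. distr (law (\<xi> t w)) Edel (\<xi> s)) \<in> law x \<rightarrow>\<^sub>M subprob_algebra Edel"
      by (rule measurable_compose[OF law_coordinate[OF t] K])
    show "(\<integral>\<^sup>+w. indicator A w * indicator B (\<xi> (t + s) w) \<partial>law x)
       = (\<integral>\<^sup>+w. indicator A w * emeasure (distr (law (\<xi> t w)) Edel (\<xi> s)) B \<partial>law x)"
      if "B \<in> sets Edel" for B
      using simple_markov_set[OF t s A that] by (simp add: emeasure_distr[OF xs that] vimage_def)
  qed simp
  then show ?thesis using f by (simp add: nn_integral_distr[OF xs])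
qed

definition cylinder :: "(real \<times> 'a option set) set \<Rightarrow> 'w set" where
  "cylinder F = {w. \<forall>(s, B)\<in>F. \<xi> s w \<in> B}"

definition cylinder_data :: "(real \<times> 'a option set) set set" where
  "cylinder_data = {F. finite F \<and> (\<forall>(s, B)\<in>F. 0 \<le> s \<and> B \<in> sets Edel)}"

lemma cylinder_sets: "F \<in> cylinder_data \<Longrightarrow> cylinder F \<in> sets (path_algebra \<xi>)"
proof -
  assume F: "F \<in> cylinder_data"
  have "cylinder F = (\<Inter>(s, B)\<in>F. \<xi> s -` B) \<inter> space (path_algebra \<xi>)"
    by (auto simp: cylinder_def)
  also have "\<dots> \<in> sets (path_algebra \<xi>)"
  proof (cases "F = {}")
    case False
    have "(\<Inter>(s, B)\<in>F. \<xi> s -` B) \<in> sets (path_algebra \<xi>)"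
    proof (rule sets.finite_INT)
      fix i assume "i \<in> F"
      then have "0 \<le> fst i" "snd i \<in> sets Edel" using F by (auto simp: cylinder_data_def)
      then show "(case i of (s, B) \<Rightarrow> \<xi> s -` B) \<in> sets (path_algebra \<xi>)"
        using measurable_sets[OF coordinate_path_algebra[of "fst i" \<xi>], of "snd i"] by (simp add: split_beta)
    qed (use F False in \<open>auto simp: cylinder_data_def\<close>)
    then show ?thesis by simp
  next
    case True
    then show ?thesis using sets.top[of "path_algebra \<xi>"] by simp
  qed
  finally show ?thesis .
qed

lemma path_algebra_cylinders:
  "sets (path_algebra \<xi>) = sigma_sets UNIV (cylinder ` cylinder_data)"
proof
  show "sets (path_algebra \<xi>) \<subseteq> sigma_sets UNIV (cylinder ` cylinder_data)"
    unfolding sets_nat_filt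
  proof (rule sigma_sets_mono, safe)
    fix s :: real and B :: "'a option set" assume "0 \<le> s" "B \<in> sets Edel"
    then have "{(s, B)} \<in> cylinder_data" by (auto simp: cylinder_data_def)
    moreover have "\<xi> s -` B = cylinder {(s, B)}" by (auto simp: cylinder_def)
    ultimately show "\<xi> s -` B \<in> sigma_sets UNIV (cylinder ` cylinder_data)"
      by (auto intro: sigma_sets.Basic)
  qed
  show "sigma_sets UNIV (cylinder ` cylinder_data) \<subseteq> sets (path_algebra \<xi>)"
    using sets.sigma_sets_subset[of "cylinder ` cylinder_data" "path_algebra \<xi>"] cylinder_sets by auto
qed

lemma Int_stable_cylinders: "Int_stable (cylinder ` cylinder_data)"
proof (rule Int_stableI, safe)
  fix F G assume FG: "F \<in> cylinder_data" "G \<in> cylinder_data"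
  have "cylinder F \<inter> cylinder G = cylinder (F \<union> G)" by (auto simp: cylinder_def)
  moreover have "F \<union> G \<in> cylinder_data" using FG by (auto simp: cylinder_data_def)
  ultimately show "cylinder F \<inter> cylinder G \<in> cylinder ` cylinder_data" by auto
qed

lemma emeasure_law_measurable: "C \<in> sets (path_algebra \<xi>) \<Longrightarrow> (\<lambda>y. emeasure (law y) C) \<in> borel_measurable Edel"
  by (rule measurable_compose[OF law_subprob measurable_emeasure_subprob_algebra])

lemma emeasure_law_space: "emeasure (law x) UNIV = 1"
  using prob_space.emeasure_space_1[OF prob_law[of x]] by simp

text \<open>The earliest coordinate of the cylinder is split off; the rest is a cylinder for the path
  shifted to that time.\<close>

lemma markov_cylinder:
  assumes "F \<in> cylinder_data" "0 \<le> t" "A \<in> sets (nat_filt \<xi> (ennreal t))"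
  shows "(\<integral>\<^sup>+w. indicator A w * indicator (cylinder F) (path_shift t w) \<partial>law x)
       = (\<integral>\<^sup>+w. indicator A w * emeasure (law (\<xi> t w)) (cylinder F) \<partial>law x)"
  using assms
proof (induction "card F" arbitrary: F x t A rule: less_induct)
  case less
  note F = less.prems(1) and t = less.prems(2) and A = less.prems(3)
  show ?case
  proof (cases "F = {}")
    case True
    then show ?thesis by (simp add: cylinder_def emeasure_law_space)
  next
    case False
    have finF: "finite F" using F by (simp add: cylinder_data_def)
    obtain s B where sB: "(s, B) \<in> F" and min: "\<And>r C. (r, C) \<in> F \<Longrightarrow> s \<le> r"
    proof -
      have fin: "finite (fst ` F)" "fst ` F \<noteq> {}" using finF False by auto
      obtain p where p: "p \<in> F" "fst p = Min (fst ` F)" using Min_in[OF fin] by (metis imageE)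
      have "Min (fst ` F) \<le> r" if "(r, C) \<in> F" for r C
        using that fin by (intro Min_le) (auto intro: rev_image_eqI)
      then show ?thesis using that[of "fst p" "snd p"] p by (metis prod.collapse)
    qed
    have s: "0 \<le> s" and B: "B \<in> sets Edel" using F sB by (auto simp: cylinder_data_def)
    define F' where "F' = (\<lambda>(r, C). (r - s, C)) ` (F - {(s, B)})"
    have "card F' \<le> card (F - {(s, B)})" unfolding F'_def using finF by (intro card_image_le) auto
    also have "\<dots> < card F" using finF sB by (intro psubset_card_mono) auto
    finally have cF': "card F' < card F" .
    have F': "F' \<in> cylinder_data"
      using F min unfolding F'_def cylinder_data_def by auto
    have split: "w' \<in> cylinder F \<longleftrightarrow> \<xi> s w' \<in> B \<and> path_shift s w' \<in> cylinder F'" for w'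
    proof -
      have eq: "\<xi> (fst p - s) (path_shift s w') = \<xi> (fst p) w'" if "p \<in> F" for p
        using min[of "fst p" "snd p"] that s by (simp add: path_shift)
      have "path_shift s w' \<in> cylinder F' \<longleftrightarrow>
          (\<forall>p\<in>F - {(s, B)}. \<xi> (fst p - s) (path_shift s w') \<in> snd p)"
        by (simp add: cylinder_def F'_def split_beta)
      also have "\<dots> \<longleftrightarrow> (\<forall>p\<in>F - {(s, B)}. \<xi> (fst p) w' \<in> snd p)" using eq by simp
      finally have *: "path_shift s w' \<in> cylinder F' \<longleftrightarrow> (\<forall>p\<in>F - {(s, B)}. \<xi> (fst p) w' \<in> snd p)" .
      have "w' \<in> cylinder F \<longleftrightarrow> (\<forall>p\<in>insert (s, B) (F - {(s, B)}). \<xi> (fst p) w' \<in> snd p)"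
        using sB by (simp add: cylinder_def split_beta insert_absorb)
      then show ?thesis using * by (simp del: insert_Diff_single)
    qed
    define h where "h = (\<lambda>y. emeasure (law y) (cylinder F'))"
    have h: "h \<in> borel_measurable Edel"
      unfolding h_def by (rule emeasure_law_measurable[OF cylinder_sets[OF F']])
    define f where "f = (\<lambda>y. indicator B y * h y)"
    have f: "f \<in> borel_measurable Edel" unfolding f_def using h B by simp
    have cF: "emeasure (law y) (cylinder F) = (\<integral>\<^sup>+w'. f (\<xi> s w') \<partial>law y)" for y
    proof -
      define D where "D = \<xi> s -` B"
      have D: "D \<in> sets (nat_filt \<xi> (ennreal s))"
        using measurable_sets[OF coordinate_measurable[of s "ennreal s" \<xi>] B] s by (simp add: D_def)
      have "emeasure (law y) (cylinder F) = (\<integral>\<^sup>+w'. indicator (cylinder F) w' \<partial>law y)"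
        using cylinder_sets[OF F] by simp
      also have "\<dots> = (\<integral>\<^sup>+w'. indicator D w' * indicator (cylinder F') (path_shift s w') \<partial>law y)"
        by (intro nn_integral_cong) (auto simp: split D_def indicator_def)
      also have "\<dots> = (\<integral>\<^sup>+w'. indicator D w' * h (\<xi> s w') \<partial>law y)"
        unfolding h_def by (rule less.hyps[OF cF' F' s D])
      also have "\<dots> = (\<integral>\<^sup>+w'. f (\<xi> s w') \<partial>law y)"
        by (intro nn_integral_cong) (auto simp: D_def f_def indicator_def)
      finally show ?thesis .
    qed
    define A' where "A' = A \<inter> \<xi> (t + s) -` B"
    have "\<xi> (t + s) -` B \<in> sets (nat_filt \<xi> (ennreal (t + s)))"
      using measurable_sets[OF coordinate_measurable[of "t + s" "ennreal (t + s)" \<xi>] B] s t by simp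
    moreover have "A \<in> sets (nat_filt \<xi> (ennreal (t + s)))"
      using A nat_filt_mono[of "ennreal t" "ennreal (t + s)" \<xi>] s t by (auto simp: ennreal_leI)
    ultimately have A': "A' \<in> sets (nat_filt \<xi> (ennreal (t + s)))" unfolding A'_def by auto
    have shift2: "path_shift s (path_shift t w) \<in> cylinder F' \<longleftrightarrow> path_shift (t + s) w \<in> cylinder F'" for w
    proof -
      have "\<xi> r (path_shift s (path_shift t w)) = \<xi> r (path_shift (t + s) w)" if "0 \<le> r" for r
        using that s t by (simp add: path_shift add_ac)
      then show ?thesis using F' by (fastforce simp: cylinder_def cylinder_data_def)
    qed
    have "(\<integral>\<^sup>+w. indicator A w * indicator (cylinder F) (path_shift t w) \<partial>law x)
       = (\<integral>\<^sup>+w. indicator A' w * indicator (cylinder F') (path_shift (t + s) w) \<partial>law x)"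
      using s t by (intro nn_integral_cong)
        (auto simp: split A'_def indicator_def shift2 path_shift add_ac)
    also have "\<dots> = (\<integral>\<^sup>+w. indicator A' w * h (\<xi> (t + s) w) \<partial>law x)"
      unfolding h_def using s t by (intro less.hyps[OF cF' F' _ A']) auto
    also have "\<dots> = (\<integral>\<^sup>+w. indicator A w * f (\<xi> (t + s) w) \<partial>law x)"
      by (intro nn_integral_cong) (auto simp: A'_def f_def indicator_def)
    also have "\<dots> = (\<integral>\<^sup>+w. indicator A w * (\<integral>\<^sup>+w'. f (\<xi> s w') \<partial>law (\<xi> t w)) \<partial>law x)"
      by (rule simple_markov_fun[OF t s A f])
    finally show ?thesis by (simp add: cF)
  qed
qed

lemma markov_indicator:
  assumes t: "0 \<le> t" and A: "A \<in> sets (nat_filt \<xi> (ennreal t))" and f: "f \<in> borel_measurable (path_algebra \<xi>)"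
  shows "(\<integral>\<^sup>+y. indicator A y * f (path_shift t y) \<partial>law x)
       = (\<integral>\<^sup>+y. indicator A y * (\<integral>\<^sup>+y'. f y' \<partial>law (\<xi> t y)) \<partial>law x)"
proof -
  have w: "indicator A \<in> borel_measurable (law x)" using nat_filt_sets_law[OF A] by simp
  have Z: "path_shift t \<in> law x \<rightarrow>\<^sub>M path_algebra \<xi>"
    using path_shift_measurable[OF t] by (simp add: measurable_cong_sets[OF sets_law refl])
  have \<kappa>: "(\<lambda>y. law (\<xi> t y)) \<in> law x \<rightarrow>\<^sub>M subprob_algebra (path_algebra \<xi>)"
    by (rule measurable_compose[OF law_coordinate[OF t] law_subprob])
  show ?thesis
  proof (rule kernel_disintegration[OF w w law_indicator_finite[OF A] Z \<kappa> _ _ _ _ _ _ f])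
    show "sets (path_algebra \<xi>) = sigma_sets (space (path_algebra \<xi>)) (cylinder ` cylinder_data)"
      by (simp add: path_algebra_cylinders)
    have "UNIV = cylinder {}" "{} \<in> cylinder_data" by (auto simp: cylinder_def cylinder_data_def)
    then show "range (\<lambda>i::nat. UNIV) \<subseteq> cylinder ` cylinder_data" by auto
    show "(\<integral>\<^sup>+y. indicator A y * indicator B (path_shift t y) \<partial>law x)
       = (\<integral>\<^sup>+y. indicator A y * emeasure (law (\<xi> t y)) B \<partial>law x)" if "B \<in> cylinder ` cylinder_data" for B
      using that markov_cylinder[OF _ t A] by auto
  qed (use Int_stable_cylinders in auto)
qed

lemma law_integral_measurable:
  "f \<in> borel_measurable (path_algebra \<xi>) \<Longrightarrow> (\<lambda>y. \<integral>\<^sup>+w. f w \<partial>law y) \<in> borel_measurable Edel"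
  by (rule measurable_compose[OF law_subprob nn_integral_measurable_subprob_algebra])

lemma borel_measurable_law: "f \<in> borel_measurable (path_algebra \<xi>) \<Longrightarrow> f \<in> borel_measurable (law x)"
  by (simp add: measurable_cong_sets[OF sets_law refl])

text \<open>The two sides integrate \<open>Y\<close> against two measures on the \<open>\<sigma>\<close>-algebra of the past, which agree on
  events.\<close>

theorem markov_property:
  fixes Y :: "'w \<Rightarrow> ennreal"
  assumes t: "0 \<le> t" and Y: "Y \<in> borel_measurable (nat_filt \<xi> (ennreal t))"
    and f: "f \<in> borel_measurable (path_algebra \<xi>)"
  shows "(\<integral>\<^sup>+w. Y w * f (path_shift t w) \<partial>law x)
       = (\<integral>\<^sup>+w. Y w * (\<integral>\<^sup>+w'. f w' \<partial>law (\<xi> t w)) \<partial>law x)"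
proof -
  define f1 where "f1 = (\<lambda>w. f (path_shift t w))"
  define f2 where "f2 = (\<lambda>w. \<integral>\<^sup>+w'. f w' \<partial>law (\<xi> t w))"
  have f1: "f1 \<in> borel_measurable (law x)"
    unfolding f1_def using measurable_compose[OF path_shift_measurable[OF t] f] by (rule borel_measurable_law)
  have f2: "f2 \<in> borel_measurable (law x)"
    unfolding f2_def by (rule measurable_compose[OF law_coordinate[OF t] law_integral_measurable[OF f]])
  have YM: "g \<in> borel_measurable (law x)" if "g \<in> borel_measurable (nat_filt \<xi> (ennreal t))" for g :: "'w \<Rightarrow> ennreal"
    by (rule borel_measurable_law[OF measurable_nat_filt_mono[OF that]]) (auto simp: infinity_ennreal_def)
  have ind: "(\<integral>\<^sup>+w. indicator A w * f1 w \<partial>law x) = (\<integral>\<^sup>+w. indicator A w * f2 w \<partial>law x)"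
    if "A \<in> sets (nat_filt \<xi> (ennreal t))" for A
    unfolding f1_def f2_def by (rule markov_indicator[OF t that f])
  define D where "D h = distr (density (law x) h) (nat_filt \<xi> (ennreal t)) (\<lambda>w. w)" for h
  have D: "(\<integral>\<^sup>+w. g w \<partial>D h) = (\<integral>\<^sup>+w. g w * h w \<partial>law x)"
    if "h \<in> borel_measurable (law x)" "g \<in> borel_measurable (nat_filt \<xi> (ennreal t))" for g h
  proof -
    have "(\<lambda>w. w) \<in> density (law x) h \<rightarrow>\<^sub>M nat_filt \<xi> (ennreal t)"
      by (rule measurableI) (use nat_filt_sets_law[of _ "ennreal t" x] in auto)
    then show ?thesis using that YM[OF that(2)] by (simp add: D_def nn_integral_distr nn_integral_density mult.commute)
  qed
  have "D f1 = D f2"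
  proof (rule measure_eqI)
    fix A assume "A \<in> sets (D f1)"
    then have A: "A \<in> sets (nat_filt \<xi> (ennreal t))" by (simp add: D_def)
    have "emeasure (D h) A = (\<integral>\<^sup>+w. indicator A w * h w \<partial>law x)" if "h \<in> borel_measurable (law x)" for h
      using D[OF that, of "indicator A"] A by (simp add: D_def)
    then show "emeasure (D f1) A = emeasure (D f2) A" using ind[OF A] f1 f2 by simp
  qed (simp add: D_def)
  then have "(\<integral>\<^sup>+w. Y w * f1 w \<partial>law x) = (\<integral>\<^sup>+w. Y w * f2 w \<partial>law x)" using D[OF f1 Y] D[OF f2 Y] by simp
  then show ?thesis by (simp add: f1_def f2_def)
qed

lemma law_None:
  assumes "0 \<le> t" shows "AE w in law None. \<xi> t w = None"
  using normal[of None] by eventually_elim (use cemetery_absorbing[of 0 t] assms in auto)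

end

section \<open>Integrals along the paths\<close>

lemma bounded_set_integrable_Icc:
  fixes g :: "real \<Rightarrow> real"
  assumes [measurable]: "g \<in> borel_measurable borel" and B: "\<And>s. s \<in> {u..v} \<Longrightarrow> \<bar>g s\<bar> \<le> B"
  shows "set_integrable lborel {u..v} g"
proof -
  have "set_integrable lborel {u..v} (\<lambda>s. B)"
    unfolding set_integrable_def
    by (intro integrable_scaleR_left integrable_real_indicator) (auto simp: emeasure_lborel_Icc_eq infinity_ennreal_def)
  then show ?thesis
    by (rule set_integrable_bound)
       (auto simp: set_borel_measurable_def intro!: AE_I2 order_trans[OF B abs_ge_self])
qed

lemma set_integral_Icc_diff:
  fixes g :: "real \<Rightarrow> real"
  assumes [measurable]: "g \<in> borel_measurable borel" and B: "\<And>s. s \<in> {w..v} \<Longrightarrow> \<bar>g s\<bar> \<le> B"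
    and uv: "w \<le> u" "u \<le> v"
  shows "(LINT s:{w..v}|lborel. g s) - (LINT s:{w..u}|lborel. g s) = (LINT s:{u..v}|lborel. g s)"
proof -
  have "(LINT s:{w..u} \<union> {u..v}|lborel. g s) = (LINT s:{w..u}|lborel. g s) + (LINT s:{u..v}|lborel. g s)"
  proof (rule set_integral_Un_AE)
    have "AE x in lborel. x \<noteq> u" by (rule AE_lborel_singleton)
    then show "AE x in lborel. \<not> (x \<in> {w..u} \<and> x \<in> {u..v})" by eventually_elim auto
  qed (use uv in \<open>auto intro!: bounded_set_integrable_Icc[where B=B] B\<close>)
  moreover have "{w..u} \<union> {u..v} = {w..v}" using uv by auto
  ultimately show ?thesis by simp
qed

lemma set_integral_Icc_bound:
  fixes g :: "real \<Rightarrow> real"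
  assumes [measurable]: "g \<in> borel_measurable borel" and B: "\<And>s. s \<in> {u..v} \<Longrightarrow> \<bar>g s\<bar> \<le> B" and uv: "u \<le> v"
  shows "\<bar>LINT s:{u..v}|lborel. g s\<bar> \<le> B * (v - u)"
proof -
  have "norm (LINT s:{u..v}|lborel. g s) \<le> (LINT s:{u..v}|lborel. norm (g s))"
    by (intro set_integral_norm_bound bounded_set_integrable_Icc[where B=B]) (use B in auto)
  also have "\<dots> \<le> (LINT s:{u..v}|lborel. B)"
    by (intro set_integral_mono bounded_set_integrable_Icc[where B=B] bounded_set_integrable_Icc[where B="\<bar>B\<bar>"])
       (use B in auto)
  also have "\<dots> = B * (v - u)" using uv by (simp add: set_lebesgue_integral_def)
  finally show ?thesis by simp
qed

text \<open>The running integral \<open>A\<close> maps the measure with density \<open>a\<close> to Lebesgue measure: the points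
  where \<open>A\<close> exceeds \<open>x\<close> form an interval \<open>{s0<..t}\<close> with \<open>A s0 = x\<close>.\<close>

lemma nn_integral_running_integral:
  fixes a :: "real \<Rightarrow> real" and u :: "real \<Rightarrow> ennreal"
  assumes a [measurable]: "a \<in> borel_measurable borel" and bd: "\<And>s. 0 \<le> a s" "\<And>s. a s \<le> C" and t: "0 \<le> t"
    and u: "u \<in> borel_measurable borel"
  defines "A \<equiv> \<lambda>r. LINT s:{0..r}|lborel. a s"
  shows "(\<integral>\<^sup>+s. indicator {0..t} s * ennreal (a s) * u (A s) \<partial>lborel) = (\<integral>\<^sup>+x. u x * indicator {0..A t} x \<partial>lborel)"
proof -
  have ab: "\<bar>a s\<bar> \<le> C" for s using bd by simp
  have C0: "0 \<le> C" using bd order_trans by blast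
  have Am [measurable]: "A \<in> borel_measurable borel"
  proof -
    have "(\<lambda>r. \<integral>s. indicator {0..r} s * a s \<partial>lborel) \<in> borel_measurable borel"
      unfolding indicator_def atLeastAtMost_iff of_bool_def by measurable
    then show ?thesis by (simp add: A_def set_lebesgue_integral_def)
  qed
  have diff: "A v - A r = (LINT s:{r..v}|lborel. a s)" if "0 \<le> r" "r \<le> v" for r v
    unfolding A_def by (rule set_integral_Icc_diff[OF a ab that])
  have mono: "A r \<le> A v" if "0 \<le> r" "r \<le> v" for r v
  proof -
    have "0 \<le> (LINT s:{r..v}|lborel. a s)"
      unfolding set_lebesgue_integral_def by (rule Bochner_Integration.integral_nonneg) (simp add: bd(1))
    then show ?thesis using diff[OF that] by simp
  qed
  have lip: "\<bar>A v - A r\<bar> \<le> C * \<bar>v - r\<bar>" if "0 \<le> r" "0 \<le> v" for r v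
    using set_integral_Icc_bound[OF a ab, of r v] set_integral_Icc_bound[OF a ab, of v r] diff[of r v] diff[of v r] that
    by (cases "r \<le> v") (auto simp: abs_minus_commute)
  have "C-lipschitz_on {0..t} A"
    by (rule lipschitz_onI[OF _ C0]) (use lip in \<open>simp add: dist_real_def\<close>)
  then have cont: "continuous_on {0..t} A" by (rule lipschitz_on_continuous_on)
  have A0: "A 0 = 0" using set_integral_Icc_bound[OF a ab, of 0 0] by (simp add: A_def)
  have part: "(\<integral>\<^sup>+s. indicator {r..t} s * ennreal (a s) \<partial>lborel) = ennreal (A t - A r)" if r: "0 \<le> r" "r \<le> t" for r
  proof -
    have "ennreal (A t - A r) = (\<integral>\<^sup>+s. ennreal (indicator {r..t} s *\<^sub>R a s) \<partial>lborel)"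
      unfolding diff[OF r] set_lebesgue_integral_def
      by (rule nn_integral_eq_integral[symmetric])
         (use bounded_set_integrable_Icc[OF a ab] bd(1) in \<open>auto simp: set_integrable_def\<close>)
    also have "\<dots> = (\<integral>\<^sup>+s. indicator {r..t} s * ennreal (a s) \<partial>lborel)"
      by (intro nn_integral_cong) (auto simp: indicator_def)
    finally show ?thesis by simp
  qed
  define D where "D = density lborel (\<lambda>s. indicator {0..t} s * ennreal (a s))"
  have [measurable]: "A \<in> D \<rightarrow>\<^sub>M borel" by (simp add: D_def)
  have em: "emeasure (distr D borel A) {x<..} = (\<integral>\<^sup>+s. indicator {0..t} s * ennreal (a s) * indicator {s. x < A s} s \<partial>lborel)" for x
    unfolding D_def by (simp add: emeasure_distr emeasure_density vimage_def)
  have iv: "emeasure (density lborel (indicator {0..A t})) {x<..} = ennreal (max 0 (A t - max 0 x))" for x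
  proof -
    have "emeasure (density lborel (indicator {0..A t})) {x<..} = emeasure lborel ({0..A t} \<inter> {x<..})"
      by (simp add: emeasure_density flip: indicator_inter_arith)
    also have "\<dots> = emeasure lborel {max 0 x..A t}"
      by (rule emeasure_eq_AE) (use AE_lborel_singleton[of x] in \<open>auto elim: eventually_mono\<close>)
    finally show ?thesis by (simp add: emeasure_lborel_Icc_eq max_def)
  qed
  have "distr D borel A = density lborel (indicator {0..A t})"
  proof (rule measure_eqI_lessThan)
    fix x :: real
    show eq: "emeasure (distr D borel A) {x<..} = emeasure (density lborel (indicator {0..A t})) {x<..}"
    proof (cases "x < 0 \<or> A t \<le> x")
      case True
      then consider "x < 0" | "A t \<le> x" by blast
      then show ?thesis
      proof cases
        case 1
        have "indicator {0..t} s * ennreal (a s) * indicator {s. x < A s} s = indicator {0..t} s * ennreal (a s)" for s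
          using mono[of 0 s] A0 1 by (auto simp: indicator_def)
        then show ?thesis unfolding em iv using part[of 0] mono[of 0 t] A0 t 1 by (simp only:) simp
      next
        case 2
        have "indicator {0..t} s * ennreal (a s) * indicator {s. x < A s} s = 0" for s
          using mono[of s t] 2 by (auto simp: indicator_def)
        then show ?thesis unfolding em iv using 2 by (simp only:) simp
      qed
    next
      case False
      define W where "W = {0..t} \<inter> A -` {..x}"
      have "closed W" unfolding W_def by (rule continuous_closed_preimage[OF cont]) auto
      then have "compact W" by (simp add: W_def compact_eq_bounded_closed bounded_Int)
      moreover have "0 \<in> W" using False A0 t by (simp add: W_def)
      ultimately obtain r where r: "r \<in> W" "\<And>s. s \<in> W \<Longrightarrow> s \<le> r"
        using compact_attains_sup[of W] by blast
      have rt: "0 \<le> r" "r \<le> t" "A r \<le> x" using r(1) by (auto simp: W_def)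
      obtain r' where r': "r \<le> r'" "r' \<le> t" "A r' = x"
        using IVT'[of A r x t] rt False continuous_on_subset[OF cont, of "{r..t}"] by auto
      then have "r' = r" using r(2)[of r'] rt by (simp add: W_def)
      then have Ar: "A r = x" using r' by simp
      have "AE s in lborel. indicator {0..t} s * ennreal (a s) * indicator {s. x < A s} s = indicator {r..t} s * ennreal (a s)"
        using AE_lborel_singleton[of r]
      proof eventually_elim
        case (elim s)
        have "x < A s \<longleftrightarrow> r < s" if "0 \<le> s" "s \<le> t"
          using r(2)[of s] mono[of s r] that Ar unfolding W_def by (cases "s \<le> r") force+
        then show ?case using elim rt by (auto simp: indicator_def)
      qed
      then have "emeasure (distr D borel A) {x<..} = (\<integral>\<^sup>+s. indicator {r..t} s * ennreal (a s) \<partial>lborel)"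
        unfolding em by (rule nn_integral_cong_AE)
      then show ?thesis using part[OF rt(1,2)] False by (simp add: iv Ar)
    qed
    show "emeasure (distr D borel A) {x<..} < \<infinity>" unfolding eq iv by (simp add: infinity_ennreal_def)
  qed simp_all
  then have "(\<integral>\<^sup>+x. u x \<partial>distr D borel A) = (\<integral>\<^sup>+x. u x \<partial>density lborel (indicator {0..A t}))" by simp
  moreover have "(\<integral>\<^sup>+x. u x \<partial>distr D borel A) = (\<integral>\<^sup>+s. u (A s) \<partial>D)" using u by (simp add: nn_integral_distr)
  moreover have "(\<lambda>s. u (A s)) \<in> borel_measurable lborel" using u by measurable
  ultimately show ?thesis using u by (simp add: D_def nn_integral_density mult.commute)
qed

context spatial_motion
begin

text \<open>Convergence to a point of the state space is tested from one side by open sets and from the other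
  by closed sets whose complement is open in the compactification; sets with compact closure serve
  both purposes.\<close>

lemma relatively_compact_basis:
  "\<exists>\<V> :: 'a set set. countable \<V> \<and> (\<forall>V\<in>\<V>. open V \<and> compact (closure V)) \<and>
     (\<forall>U x. open U \<longrightarrow> x \<in> U \<longrightarrow> (\<exists>V\<in>\<V>. x \<in> V \<and> closure V \<subseteq> U))"
proof -
  obtain \<B> :: "'a set set" where \<B>: "countable \<B>" "topological_basis \<B>"
    using ex_countable_basis by blast
  define \<V> where "\<V> = {V \<in> \<B>. compact (closure V)}"
  have "\<exists>V\<in>\<V>. x \<in> V \<and> closure V \<subseteq> U" if U: "open U" "x \<in> U" for U x
  proof -
    obtain N K where NK: "open N" "compact K" "x \<in> N" "N \<subseteq> K"
      using locally_compact unfolding locally_compact_space_def by (simp add: Bex_def) blast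
    obtain e where e: "0 < e" "cball x e \<subseteq> U \<inter> N"
      using U NK open_contains_cball[of "U \<inter> N"] open_Int[of U N] by (metis IntI)
    obtain V where V: "V \<in> \<B>" "x \<in> V" "V \<subseteq> ball x e"
      using topological_basisE[OF \<B>(2) open_ball[of x e], of x] e by auto
    have "closure V \<subseteq> cball x e"
      using closure_mono[OF V(3)] closure_minimal[OF ball_subset_cball closed_cball, of x e] by blast
    then have sub: "closure V \<subseteq> U" "closure V \<subseteq> K" using e NK by auto
    have "compact (K \<inter> closure V)" by (rule compact_Int_closed[OF NK(2) closed_closure])
    then have "compact (closure V)" using sub by (simp add: Int_absorb1)
    then show ?thesis using V sub by (auto simp: \<V>_def)
  qed
  moreover have "countable \<V>" "\<forall>V\<in>\<V>. open V \<and> compact (closure V)"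
    using \<B> topological_basis_open[OF \<B>(2)] by (auto simp: \<V>_def)
  ultimately show ?thesis by blast
qed

lemma closed_compact_image_Some_complement:
  "compact K \<Longrightarrow> closed K \<Longrightarrow> openin Edel_top (- (Some ` (K :: 'a set)))"
proof -
  assume "compact K" "closed K"
  then have "closedin Edel_top (Some ` K)" by simp
  then show ?thesis by (simp add: closedin_def Compl_eq_Diff_UNIV UNIV_option_conv)
qed

text \<open>By right continuity the path at time \<open>r\<close> is the limit of its values at the next point of a grid of
  mesh \<open>1 / (m + 1)\<close>. It lies in an open set \<open>U\<close> iff these values eventually stay in the closure of one of
  countably many smaller sets. The function \<open>c\<close> is either the identity or caps the time at \<open>s\<close>, which
  keeps the approximation in the past of \<open>s\<close>.\<close>

lemma progressively_measurable:
  assumes c: "(c = (\<lambda>r. r) \<and> u = \<infinity>) \<or> (\<exists>s\<ge>0. c = (\<lambda>r. min r s) \<and> u = ennreal s)"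
  shows "(\<lambda>(r, w). \<xi> (c (max 0 r)) w) \<in> borel \<Otimes>\<^sub>M nat_filt \<xi> u \<rightarrow>\<^sub>M Edel"
proof -
  let ?N = "(borel :: real measure) \<Otimes>\<^sub>M nat_filt \<xi> u"
  have spN: "space ?N = UNIV" by (simp add: space_pair_measure)
  define a where "a m k = (real k + 1) / real (Suc m)" for m k :: nat
  define k where "k m r = nat \<lfloor>max 0 r * real (Suc m)\<rfloor>" for m and r :: real
  have a_bounds: "max 0 r < a m (k m r)" "a m (k m r) \<le> max 0 r + 1 / real (Suc m)" for m r
  proof -
    have "0 \<le> max 0 r * real (Suc m)" by simp
    then have "real (k m r) \<le> max 0 r * real (Suc m)" "max 0 r * real (Suc m) < real (k m r) + 1"
      unfolding k_def by linarith+
    then have "max 0 r < (real (k m r) + 1) / real (Suc m)" "real (k m r) / real (Suc m) \<le> max 0 r"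
      by (simp_all only: pos_less_divide_eq pos_divide_le_eq of_nat_0_less_iff zero_less_Suc)
    then show "max 0 r < a m (k m r)" "a m (k m r) \<le> max 0 r + 1 / real (Suc m)"
      unfolding a_def add_divide_distrib by auto
  qed
  have a_lim: "filterlim (\<lambda>m. a m (k m r)) (at_right (max 0 r)) sequentially" for r
  proof -
    have "(\<lambda>m. a m (k m r)) \<longlonglongrightarrow> max 0 r"
    proof (rule tendsto_sandwich[where f = "\<lambda>_. max 0 r" and h = "\<lambda>m. max 0 r + 1 / real (Suc m)"])
      show "(\<lambda>m. max 0 r + 1 / real (Suc m)) \<longlonglongrightarrow> max 0 r"
        using LIMSEQ_inverse_real_of_nat_add[of "max 0 r"] by (simp add: inverse_eq_divide)
      show "\<forall>\<^sub>F m in sequentially. max 0 r \<le> a m (k m r)"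
        "\<forall>\<^sub>F m in sequentially. a m (k m r) \<le> max 0 r + 1 / real (Suc m)"
        using a_bounds by (auto intro!: always_eventually less_imp_le)
    qed auto
    then show ?thesis
      unfolding filterlim_at using a_bounds(1)[THEN less_imp_neq, THEN not_sym] a_bounds(1)
      by (auto intro!: always_eventually)
  qed
  have a0: "0 \<le> a m i" for m i by (simp add: a_def)
  have lim: "limitin Edel_top (\<lambda>m. \<xi> (c (a m (k m r))) w) (\<xi> (c (max 0 r)) w) sequentially" for r w
    using c
  proof
    assume "c = (\<lambda>r. r) \<and> u = \<infinity>"
    then show ?thesis
      using right_continuous[of "max 0 r" w] a_lim[of r] unfolding limitin_def filterlim_iff by auto
  next
    assume "\<exists>s\<ge>0. c = (\<lambda>r. min r s) \<and> u = ennreal s"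
    then obtain s where s: "0 \<le> s" "c = (\<lambda>r. min r s)" by auto
    show ?thesis
    proof (cases "max 0 r < s")
      case True
      have "\<forall>\<^sub>F x in at_right (max 0 r). x < s"
        using True eventually_at_right_field by blast
      then have "\<forall>\<^sub>F m in sequentially. a m (k m r) < s" using a_lim[of r] unfolding filterlim_iff by blast
      then have ev: "\<forall>\<^sub>F m in sequentially. c (a m (k m r)) = a m (k m r)"
        by eventually_elim (simp add: s)
      have "limitin Edel_top (\<lambda>m. \<xi> (a m (k m r)) w) (\<xi> (max 0 r) w) sequentially"
        using right_continuous[of "max 0 r" w] a_lim[of r] unfolding limitin_def filterlim_iff by auto
      then have "limitin Edel_top (\<lambda>m. \<xi> (c (a m (k m r))) w) (\<xi> (max 0 r) w) sequentially"
        by (rule limitin_transform_eventually[rotated]) (use ev in \<open>eventually_elim, simp\<close>)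
      moreover have "c (max 0 r) = max 0 r" using True s by simp
      ultimately show ?thesis by simp
    next
      case False
      have "c (a m (k m r)) = s" "c (max 0 r) = s" for m using a_bounds(1)[of r m] False s by auto
      moreover have "limitin Edel_top (\<lambda>m::nat. \<xi> s w) (\<xi> s w) sequentially"
        by (cases "\<xi> s w") (simp_all add: limitin_def)
      ultimately show ?thesis by simp
    qed
  qed
  have step: "(\<lambda>(r, w). \<xi> (c (a m (k m r))) w) \<in> ?N \<rightarrow>\<^sub>M Edel" for m
  proof -
    have c1: "0 \<le> c (a m i)" "ennreal (c (a m i)) \<le> u" for i
      using c a0[of m i] by (auto simp: infinity_ennreal_def intro: ennreal_leI)
    have "(\<lambda>p. \<xi> (c (a m (k m (fst p)))) (snd p)) \<in> ?N \<rightarrow>\<^sub>M Edel"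
    proof (rule measurable_compose_countable[where g = "\<lambda>p. k m (fst p)" and f = "\<lambda>i p. \<xi> (c (a m i)) (snd p)"])
      show "(\<lambda>p. \<xi> (c (a m i)) (snd p)) \<in> ?N \<rightarrow>\<^sub>M Edel" for i
        by (rule measurable_compose[OF measurable_snd coordinate_measurable[OF c1]])
      show "(\<lambda>p. k m (fst p)) \<in> ?N \<rightarrow>\<^sub>M count_space UNIV"
        unfolding k_def by measurable
    qed
    then show ?thesis by (simp add: split_beta')
  qed
  obtain \<V> :: "'a set set" where \<V>: "countable \<V>" "\<And>V. V \<in> \<V> \<Longrightarrow> open V" "\<And>V. V \<in> \<V> \<Longrightarrow> compact (closure V)"
    "\<And>U x. open U \<Longrightarrow> x \<in> U \<Longrightarrow> \<exists>V\<in>\<V>. x \<in> V \<and> closure V \<subseteq> U"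
    using relatively_compact_basis by blast
  define f where "f = (\<lambda>m (r, w). \<xi> (c (a m (k m r))) w)"
  have f: "f m \<in> ?N \<rightarrow>\<^sub>M Edel" for m unfolding f_def by (rule step)
  show ?thesis
  proof (rule measurable_sigma_sets[OF sets_Edel_generated])
    fix W :: "'a option set" assume "W \<in> {Some ` U | U. open U}"
    then obtain U where U: "W = Some ` U" "open U" by auto
    define \<W> where "\<W> = {V \<in> \<V>. closure V \<subseteq> U}"
    have eq: "\<xi> (c (max 0 r)) w \<in> W \<longleftrightarrow> (\<exists>V\<in>\<W>. \<exists>n. \<forall>m\<in>{n..}. f m (r, w) \<in> Some ` closure V)" for r w
    proof
      assume "\<xi> (c (max 0 r)) w \<in> W"
      then obtain x where x: "\<xi> (c (max 0 r)) w = Some x" "x \<in> U" using U by auto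
      obtain V where V: "V \<in> \<V>" "x \<in> V" "closure V \<subseteq> U" using \<V>(4)[OF U(2) x(2)] by blast
      have "openin Edel_top (Some ` V)" using \<V>(2)[OF V(1)] by simp
      then have "\<forall>\<^sub>F m in sequentially. \<xi> (c (a m (k m r))) w \<in> Some ` V"
        using lim[of r w] x V unfolding limitin_def by auto
      then obtain n where n: "\<And>m. n \<le> m \<Longrightarrow> \<xi> (c (a m (k m r))) w \<in> Some ` V"
        by (auto simp: eventually_sequentially)
      have "f m (r, w) \<in> Some ` closure V" if "m \<in> {n..}" for m
        using n[of m] that closure_subset[of V] by (auto simp: f_def)
      moreover have "V \<in> \<W>" using V by (simp add: \<W>_def)
      ultimately show "\<exists>V\<in>\<W>. \<exists>n. \<forall>m\<in>{n..}. f m (r, w) \<in> Some ` closure V" by blast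
    next
      assume "\<exists>V\<in>\<W>. \<exists>n. \<forall>m\<in>{n..}. f m (r, w) \<in> Some ` closure V"
      then obtain V n where V: "V \<in> \<W>" and n: "\<And>m. n \<le> m \<Longrightarrow> f m (r, w) \<in> Some ` closure V" by auto
      have "\<xi> (c (max 0 r)) w \<in> Some ` closure V"
      proof (rule ccontr)
        assume "\<xi> (c (max 0 r)) w \<notin> Some ` closure V"
        moreover have "openin Edel_top (- (Some ` closure V))"
          using V \<V>(3) by (intro closed_compact_image_Some_complement) (auto simp: \<W>_def)
        ultimately have "\<forall>\<^sub>F m in sequentially. \<xi> (c (a m (k m r))) w \<in> - (Some ` closure V)"
          using lim[of r w] unfolding limitin_def by blast
        then obtain n' where "\<And>m. n' \<le> m \<Longrightarrow> \<xi> (c (a m (k m r))) w \<notin> Some ` closure V"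
          by (auto simp: eventually_sequentially)
        then show False using n[of "max n n'"] by (auto simp: f_def)
      qed
      then show "\<xi> (c (max 0 r)) w \<in> W" using V U by (auto simp: \<W>_def)
    qed
    have "(\<lambda>(r, w). \<xi> (c (max 0 r)) w) -` W \<inter> space ?N =
        (\<Union>V\<in>\<W>. \<Union>n. \<Inter>m\<in>{n..}. f m -` (Some ` closure V) \<inter> space ?N)"
    proof (rule set_eqI)
      fix p show "p \<in> (\<lambda>(r, w). \<xi> (c (max 0 r)) w) -` W \<inter> space ?N \<longleftrightarrow>
        p \<in> (\<Union>V\<in>\<W>. \<Union>n. \<Inter>m\<in>{n..}. f m -` (Some ` closure V) \<inter> space ?N)"
        using eq[of "fst p" "snd p"] by (simp add: spN split_beta)
    qed
    also have "\<dots> \<in> sets ?N"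
    proof (rule sets.countable_UN'')
      show "countable \<W>" using \<V>(1) by (auto simp: \<W>_def intro: countable_subset)
      fix V assume "V \<in> \<W>"
      have "Some ` closure V \<in> sets Edel" by (rule image_Some_Edel) simp
      then have 1: "f m -` (Some ` closure V) \<inter> space ?N \<in> sets ?N" for m
        by (rule measurable_sets[OF f])
      have "(\<Inter>m\<in>{n..}. f m -` (Some ` closure V) \<inter> space ?N) \<in> sets ?N" for n
        by (rule sets.countable_INT') (use 1 in auto)
      then show "(\<Union>n. \<Inter>m\<in>{n..}. f m -` (Some ` closure V) \<inter> space ?N) \<in> sets ?N"
        by (intro sets.countable_UN) auto
    qed
    finally show "(\<lambda>(r, w). \<xi> (c (max 0 r)) w) -` W \<inter> space ?N \<in> sets ?N" .
  qed auto
qed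

lemma xi_measurable:
  assumes f: "f \<in> borel_measurable N" and h: "h \<in> N \<rightarrow>\<^sub>M path_algebra \<xi>"
  shows "(\<lambda>x. \<xi> (max 0 (f x)) (h x)) \<in> N \<rightarrow>\<^sub>M Edel"
  using measurable_compose[OF measurable_Pair[OF f h] progressively_measurable[of "\<lambda>r. r" \<infinity>]] by simp

lemma xi_measurable_capped:
  assumes f: "f \<in> borel_measurable N" and h: "h \<in> N \<rightarrow>\<^sub>M nat_filt \<xi> (ennreal s)" and s: "0 \<le> s"
  shows "(\<lambda>x. \<xi> (min (max 0 (f x)) s) (h x)) \<in> N \<rightarrow>\<^sub>M Edel"
  using measurable_compose[OF measurable_Pair[OF f h] progressively_measurable[of "\<lambda>r. min r s" "ennreal s"]] s by auto

lemma path_measurable: "(\<lambda>s. \<xi> (max 0 s) w) \<in> borel \<rightarrow>\<^sub>M Edel"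
  by (rule xi_measurable) auto

lemma path_int_max: "path_int \<xi> g t w = (LINT s:{0..t}|lborel. ext g (\<xi> (max 0 s) w))"
  unfolding path_int_def by (rule set_lebesgue_integral_cong) auto

lemma path_int_measurable:
  assumes g: "g \<in> borel_measurable borel" and f: "f \<in> borel_measurable N" and h: "h \<in> N \<rightarrow>\<^sub>M path_algebra \<xi>"
  shows "(\<lambda>x. path_int \<xi> g (f x) (h x)) \<in> borel_measurable N"
proof -
  have [measurable]: "(\<lambda>p. ext g (\<xi> (max 0 (snd p)) (h (fst p)))) \<in> borel_measurable (N \<Otimes>\<^sub>M lborel)"
    by (intro measurable_compose[OF xi_measurable ext_measurable_real[OF g]] measurable_compose[OF measurable_fst h]) auto
  note [measurable] = f
  have "(\<lambda>(x, s). indicator {0..f x} s * ext g (\<xi> (max 0 s) (h x))) \<in> borel_measurable (N \<Otimes>\<^sub>M lborel)"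
    unfolding indicator_def atLeastAtMost_iff of_bool_def split_beta' by measurable
  then have "(\<lambda>x. \<integral>s. indicator {0..f x} s * ext g (\<xi> (max 0 s) (h x)) \<partial>lborel) \<in> borel_measurable N"
    by (rule lborel.borel_measurable_lebesgue_integral)
  then show ?thesis by (simp add: path_int_max set_lebesgue_integral_def)
qed

lemma path_int_adapted:
  assumes g: "g \<in> borel_measurable borel" and t: "0 \<le> t"
  shows "path_int \<xi> g t \<in> borel_measurable (nat_filt \<xi> (ennreal t))"
proof -
  let ?N = "nat_filt \<xi> (ennreal t)"
  have [measurable]: "(\<lambda>p. ext g (\<xi> (min (max 0 (snd p)) t) (fst p))) \<in> borel_measurable (?N \<Otimes>\<^sub>M lborel)"
    by (intro measurable_compose[OF xi_measurable_capped ext_measurable_real[OF g]] measurable_fst t) auto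
  have "(\<lambda>(x, s). indicator {0..t} s * ext g (\<xi> (min (max 0 s) t) x)) \<in> borel_measurable (?N \<Otimes>\<^sub>M lborel)"
    unfolding split_beta' by measurable
  then have "(\<lambda>x. \<integral>s. indicator {0..t} s * ext g (\<xi> (min (max 0 s) t) x) \<partial>lborel) \<in> borel_measurable ?N"
    by (rule lborel.borel_measurable_lebesgue_integral)
  moreover have "path_int \<xi> g t = (\<lambda>x. \<integral>s. indicator {0..t} s * ext g (\<xi> (min (max 0 s) t) x) \<partial>lborel)"
    unfolding path_int_def set_lebesgue_integral_def
    by (intro ext Bochner_Integration.integral_cong) (auto simp: indicator_def)
  ultimately show ?thesis by simp
qed

lemma path_ext_measurable: "g \<in> borel_measurable borel \<Longrightarrow> (\<lambda>s. ext g (\<xi> (max 0 s) w) :: real) \<in> borel_measurable borel"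
  by (rule measurable_compose[OF path_measurable ext_measurable_real])

lemma ext_bound: "(\<And>x. \<bar>g x\<bar> \<le> C) \<Longrightarrow> \<bar>ext g y :: real\<bar> \<le> C"
  by (cases y) (auto intro: order_trans[OF abs_ge_zero])

lemma path_int_bound:
  assumes "g \<in> borel_measurable borel" "\<And>x. \<bar>g x\<bar> \<le> C" "0 \<le> t"
  shows "\<bar>path_int \<xi> g t w\<bar> \<le> C * t"
  unfolding path_int_max
  using set_integral_Icc_bound[OF path_ext_measurable[OF assms(1)] ext_bound[OF assms(2)] assms(3)] by simp

lemma path_int_nonneg: "(\<And>x. 0 \<le> g x) \<Longrightarrow> 0 \<le> path_int \<xi> g t w"
  unfolding path_int_def set_lebesgue_integral_def
  by (intro Bochner_Integration.integral_nonneg) (auto simp: ext_def split: option.splits)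

lemma path_int_shift:
  assumes g: "g \<in> borel_measurable borel" "\<And>x. \<bar>g x\<bar> \<le> C" and s: "0 \<le> s" and t: "0 \<le> t"
  shows "path_int \<xi> g t (path_shift s w) = path_int \<xi> g (s + t) w - path_int \<xi> g s w"
proof -
  have "path_int \<xi> g (s + t) w - path_int \<xi> g s w = (LINT r:{s..s+t}|lborel. ext g (\<xi> (max 0 r) w))"
    unfolding path_int_max
    by (rule set_integral_Icc_diff[OF path_ext_measurable[OF g(1)] ext_bound[OF g(2)]]) (use s t in auto)
  also have "\<dots> = (\<integral>r. indicator {s..s+t} r * ext g (\<xi> (max 0 r) w) \<partial>lborel)"
    by (simp add: set_lebesgue_integral_def)
  also have "\<dots> = (\<integral>r. indicator {s..s+t} (s + 1 * r) * ext g (\<xi> (max 0 (s + 1 * r)) w) \<partial>lborel)"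
    using lborel_integral_real_affine[of 1 "\<lambda>r. indicator {s..s+t} r * ext g (\<xi> (max 0 r) w)" s] by simp
  also have "\<dots> = (\<integral>r. indicator {0..t} r * ext g (\<xi> r (path_shift s w)) \<partial>lborel)"
    using s by (intro Bochner_Integration.integral_cong) (auto simp: indicator_def path_shift add.commute)
  finally show ?thesis by (simp add: path_int_def set_lebesgue_integral_def)
qed

lemma path_int_diff:
  assumes g: "g \<in> borel_measurable borel" "\<And>x. \<bar>g x\<bar> \<le> C" and h: "h \<in> borel_measurable borel" "\<And>x. \<bar>h x\<bar> \<le> D"
  shows "path_int \<xi> (\<lambda>x. g x - h x) t w = path_int \<xi> g t w - path_int \<xi> h t w"
proof -
  have "ext (\<lambda>x. g x - h x) y = ext g y - ext h y" for y by (cases y) auto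
  then show ?thesis
    unfolding path_int_max
    using bounded_set_integrable_Icc[OF path_ext_measurable[OF g(1)] ext_bound[OF g(2)]]
      bounded_set_integrable_Icc[OF path_ext_measurable[OF h(1)] ext_bound[OF h(2)]]
    by (subst set_integral_diff(2)[symmetric]) simp_all
qed

end

section \<open>Expected generations\<close>

lemma nn_integral_nat_pmf: "(\<integral>\<^sup>+k. f k \<partial>measure_pmf P) = (\<Sum>k. ennreal (pmf P k) * f k)"
  by (simp add: nn_integral_measure_pmf nn_integral_count_space_nat)

context branching_model
begin

abbreviation alpha :: "'a \<Rightarrow> real" where "alpha \<equiv> branching_alpha \<beta> off"

text \<open>The probability of not branching before age \<open>s\<close>, given the path.\<close>

abbreviation surv :: "real \<Rightarrow> 'w \<Rightarrow> real" where
  "surv s w \<equiv> exp (- path_int \<xi> \<beta> s w)"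

text \<open>The density of branching at age \<open>s\<close>, with \<open>c\<close> in place of the branching rate.\<close>

abbreviation branch_dens :: "('a \<Rightarrow> ennreal) \<Rightarrow> real \<Rightarrow> 'w \<Rightarrow> ennreal" where
  "branch_dens c s w \<equiv> indicator {0..} s * ennreal (surv s w) * ext c (\<xi> (max 0 s) w)"

definition off_mean :: "'a \<Rightarrow> real" where "off_mean x = (\<Sum>n. real n * pmf (off x) n)"

definition birth_rate :: "'a \<Rightarrow> real" where "birth_rate x = \<beta> x * off_mean x"

lemma offspring_bound: "\<exists>D\<ge>0. \<forall>x. (\<Sum>n. ennreal (real n ^ 2 * pmf (off x) n)) \<le> ennreal D"
proof -
  define m where "m = (\<lambda>x. \<Sum>n. ennreal (real n ^ 2 * pmf (off x) n))"
  have fin: "(SUP x. m x) < top" using off_second_moment unfolding m_def infinity_ennreal_def .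
  have "m x \<le> ennreal (enn2real (SUP x. m x))" for x
    unfolding ennreal_enn2real[OF fin] by (rule SUP_upper[OF UNIV_I])
  then have "\<forall>x. m x \<le> ennreal (enn2real (SUP x. m x))" by (rule allI)
  then show ?thesis unfolding m_def by (intro exI[of _ "enn2real (SUP x. \<Sum>n. ennreal (real n ^ 2 * pmf (off x) n))"] conjI enn2real_nonneg)
qed

definition off_bound :: real where
  "off_bound = (SOME D. 0 \<le> D \<and> (\<forall>x. (\<Sum>n. ennreal (real n ^ 2 * pmf (off x) n)) \<le> ennreal D))"

lemma off_bound: "0 \<le> off_bound" "(\<Sum>n. ennreal (real n ^ 2 * pmf (off x) n)) \<le> ennreal off_bound"
  using someI_ex[OF offspring_bound[unfolded Bex_def]] unfolding off_bound_def by auto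

lemma off_summable: "summable (\<lambda>n. real n ^ 2 * pmf (off x) n)" "(\<Sum>n. real n ^ 2 * pmf (off x) n) \<le> off_bound"
proof -
  have fin: "(\<Sum>n. ennreal (real n ^ 2 * pmf (off x) n)) \<noteq> top"
    using off_bound(2)[of x] by (auto simp: top_unique)
  then show s: "summable (\<lambda>n. real n ^ 2 * pmf (off x) n)"
    by (intro summable_suminf_not_top) auto
  have eq: "ennreal (\<Sum>n. real n ^ 2 * pmf (off x) n) = (\<Sum>n. ennreal (real n ^ 2 * pmf (off x) n))"
    by (rule suminf_ennreal[symmetric, OF _ fin]) auto
  show "(\<Sum>n. real n ^ 2 * pmf (off x) n) \<le> off_bound"
    using ord_eq_le_trans[OF eq off_bound(2)] ennreal_le_iff[OF off_bound(1)] by blast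
qed

lemma off_mean: "summable (\<lambda>n. real n * pmf (off x) n)" "0 \<le> off_mean x" "off_mean x \<le> off_bound"
proof -
  have le: "real n * pmf (off x) n \<le> real n ^ 2 * pmf (off x) n" for n
    by (intro mult_right_mono) (cases n, auto simp: power2_eq_square)
  show s: "summable (\<lambda>n. real n * pmf (off x) n)"
    using le by (intro summable_comparison_test'[OF off_summable(1)[of x], of 0]) auto
  show "0 \<le> off_mean x" unfolding off_mean_def by (rule suminf_nonneg[OF s]) auto
  show "off_mean x \<le> off_bound"
    unfolding off_mean_def using suminf_le[OF le s off_summable(1)] off_summable(2)[of x] by linarith
qed

lemma mean_offspring: "(\<integral>\<^sup>+k. of_nat k \<partial>measure_pmf (off x)) = ennreal (off_mean x)"
proof -
  have "(\<integral>\<^sup>+k. of_nat k \<partial>measure_pmf (off x)) = (\<Sum>k. ennreal (real k * pmf (off x) k))"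
    unfolding nn_integral_nat_pmf by (intro suminf_cong) (simp add: ennreal_mult'' mult.commute flip: ennreal_of_nat_eq_real_of_nat)
  also have "\<dots> = ennreal (off_mean x)"
    unfolding off_mean_def using off_mean(1) by (intro suminf_ennreal2) auto
  finally show ?thesis .
qed

lemma pair_offspring: "(\<integral>\<^sup>+k. of_nat (k * (k - 1)) \<partial>measure_pmf (off x)) \<le> ennreal off_bound"
proof -
  have "(\<integral>\<^sup>+k. of_nat (k * (k - 1)) \<partial>measure_pmf (off x)) \<le> (\<Sum>k. ennreal (real k ^ 2 * pmf (off x) k))"
    unfolding nn_integral_nat_pmf
  proof (intro suminf_le)
    fix k
    have "ennreal (pmf (off x) k) * of_nat (k * (k - 1)) = ennreal (pmf (off x) k * real (k * (k - 1)))"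
      by (simp only: ennreal_of_nat_eq_real_of_nat ennreal_mult'' of_nat_0_le_iff)
    also have "\<dots> \<le> ennreal (real k ^ 2 * pmf (off x) k)"
    proof (rule ennreal_leI)
      have "k * (k - 1) \<le> k ^ 2" by (simp add: power2_eq_square)
      then have "real (k * (k - 1)) \<le> real k ^ 2" by (metis of_nat_le_iff of_nat_power)
      then show "pmf (off x) k * real (k * (k - 1)) \<le> real k ^ 2 * pmf (off x) k"
        by (subst mult.commute) (intro mult_right_mono, auto)
    qed
    finally show "ennreal (pmf (off x) k) * of_nat (k * (k - 1)) \<le> ennreal (real k ^ 2 * pmf (off x) k)" .
  qed auto
  then show ?thesis using off_bound(2) by (rule order_trans)
qed

lemma off_mean_measurable [measurable]: "off_mean \<in> borel_measurable borel"
  unfolding off_mean_def using off_measurable by (intro borel_measurable_suminf) measurable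

lemma beta_measurable' [measurable]: "\<beta> \<in> borel_measurable borel" by (rule beta_measurable)

lemma birth_rate_measurable [measurable]: "birth_rate \<in> borel_measurable borel"
  unfolding birth_rate_def by measurable

definition beta_bound :: real where "beta_bound = (SOME C. \<forall>x. \<bar>\<beta> x\<bar> \<le> C)"

lemma beta_bound: "\<bar>\<beta> x\<bar> \<le> beta_bound" "0 \<le> beta_bound"
proof -
  have "\<exists>C. \<forall>x. \<bar>\<beta> x\<bar> \<le> C" using beta_bounded by (auto simp: bounded_iff)
  then have *: "\<forall>x. \<bar>\<beta> x\<bar> \<le> beta_bound" unfolding beta_bound_def by (rule someI_ex)
  then show "\<bar>\<beta> x\<bar> \<le> beta_bound" by blast
  show "0 \<le> beta_bound" using * by (meson abs_ge_zero order_trans)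
qed

lemma birth_rate_bound: "0 \<le> birth_rate x" "\<bar>birth_rate x\<bar> \<le> beta_bound * off_bound"
proof -
  show *: "0 \<le> birth_rate x" using beta_nonneg off_mean(2) by (simp add: birth_rate_def)
  have "\<beta> x * off_mean x \<le> beta_bound * off_bound"
    using beta_bound(1)[of x] beta_bound(2) off_mean[of x] beta_nonneg[of x] by (intro mult_mono) auto
  then show "\<bar>birth_rate x\<bar> \<le> beta_bound * off_bound" using * by (simp add: birth_rate_def)
qed

lemma alpha_eq: "alpha = (\<lambda>x. birth_rate x - \<beta> x)"
  by (auto simp: branching_alpha_def birth_rate_def off_mean_def algebra_simps)

definition growth_rate :: real where "growth_rate = beta_bound * off_bound + beta_bound"

lemma growth_rate_nonneg: "0 \<le> growth_rate"
  using beta_bound(2) off_bound(1) by (simp add: growth_rate_def)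

lemma alpha_measurable [measurable]: "alpha \<in> borel_measurable borel"
  unfolding alpha_eq by measurable

lemma alpha_bound: "\<bar>alpha x\<bar> \<le> growth_rate"
  unfolding alpha_eq growth_rate_def using birth_rate_bound[of x] beta_bound(1)[of x] by linarith

lemma path_int_alpha: "path_int \<xi> alpha t w = path_int \<xi> birth_rate t w - path_int \<xi> \<beta> t w"
  unfolding alpha_eq by (rule path_int_diff[OF birth_rate_measurable birth_rate_bound(2) beta_measurable beta_bound(1)])

text \<open>\<open>mean_gen n t g y\<close> will turn out to be the expected sum of \<open>g\<close> over the positions at time
  \<open>t\<close> of the \<open>n\<close>-th generation of descendants of an individual born at \<open>y\<close>.\<close>

definition mean_gen :: "nat \<Rightarrow> real \<Rightarrow> ('a \<Rightarrow> ennreal) \<Rightarrow> 'a option \<Rightarrow> ennreal" where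
  "mean_gen n t g y = (\<integral>\<^sup>+w. ennreal (surv t w * (path_int \<xi> birth_rate t w)^n / fact n)
      * ext g (\<xi> t w) \<partial>law y)"

text \<open>The Feynman--Kac semigroup on functions with values in \<open>[0, \<infinity>]\<close>.\<close>

definition FK :: "real \<Rightarrow> ('a \<Rightarrow> ennreal) \<Rightarrow> 'a option \<Rightarrow> ennreal" where
  "FK t g y = (\<integral>\<^sup>+w. ennreal (exp (path_int \<xi> alpha t w)) * ext g (\<xi> t w) \<partial>law y)"

text \<open>Integration of \<open>\<psi>\<close> over the age and place at which an individual born at \<open>y\<close> branches,
  where the density of the age is \<open>c\<close> instead of the branching rate.\<close>

definition branch_int :: "('a \<Rightarrow> ennreal) \<Rightarrow> (real \<Rightarrow> 'a option \<Rightarrow> ennreal) \<Rightarrow> 'a option \<Rightarrow> ennreal" where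
  "branch_int c \<psi> y = (\<integral>\<^sup>+w. \<integral>\<^sup>+s. branch_dens c s w * \<psi> s (\<xi> (max 0 s) w) \<partial>lborel \<partial>law y)"

lemma law_measurableI: "f \<in> path_algebra \<xi> \<rightarrow>\<^sub>M N \<Longrightarrow> f \<in> law y \<rightarrow>\<^sub>M N"
  by (simp add: measurable_cong_sets[OF sets_law refl])

lemma xi_snd_measurable [measurable]:
  "(\<lambda>p. \<xi> (max 0 (fst p)) (snd p)) \<in> borel \<Otimes>\<^sub>M path_algebra \<xi> \<rightarrow>\<^sub>M Edel"
  "(\<lambda>p. \<xi> (max 0 (fst p)) (snd p)) \<in> lborel \<Otimes>\<^sub>M path_algebra \<xi> \<rightarrow>\<^sub>M Edel"
  by (rule xi_measurable; simp)+

lemma path_int_pair_measurable: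
  assumes "g \<in> borel_measurable borel"
  shows "(\<lambda>p. path_int \<xi> g (fst p) (snd p)) \<in> borel_measurable (borel \<Otimes>\<^sub>M path_algebra \<xi>)"
  by (rule path_int_measurable[OF assms]) auto

lemma path_int_path_measurable:
  assumes "g \<in> borel_measurable borel" shows "path_int \<xi> g t \<in> borel_measurable (path_algebra \<xi>)"
  by (rule path_int_measurable[OF assms]) auto

lemma xi_max: "0 \<le> t \<Longrightarrow> \<xi> (max 0 t) = \<xi> t" by simp

lemma mean_gen_integrand_measurable:
  assumes "g \<in> borel_measurable borel"
  shows "(\<lambda>p. ennreal (surv (fst p) (snd p) * (path_int \<xi> birth_rate (fst p) (snd p))^n / fact n)
      * ext g (\<xi> (max 0 (fst p)) (snd p))) \<in> borel_measurable (borel \<Otimes>\<^sub>M path_algebra \<xi>)"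
proof -
  note [measurable] = path_int_pair_measurable[OF beta_measurable] path_int_pair_measurable[OF birth_rate_measurable]
    measurable_compose[OF xi_snd_measurable(1) ext_measurable_ennreal[OF assms]]
  show ?thesis by measurable
qed

lemma law_integral_pair_measurable:
  fixes f :: "real \<times> 'w \<Rightarrow> ennreal"
  assumes f: "f \<in> borel_measurable (borel \<Otimes>\<^sub>M path_algebra \<xi>)"
  shows "(\<lambda>p. \<integral>\<^sup>+w. f (fst p, w) \<partial>law (snd p)) \<in> borel_measurable (borel \<Otimes>\<^sub>M Edel)"
proof (rule nn_integral_measurable_subprob_algebra2[where N="path_algebra \<xi>"])
  show "(\<lambda>p. law (snd p)) \<in> borel \<Otimes>\<^sub>M Edel \<rightarrow>\<^sub>M subprob_algebra (path_algebra \<xi>)"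
    by (rule measurable_compose[OF measurable_snd law_subprob])
  show "(\<lambda>(p, w). f (fst p, w)) \<in> borel_measurable ((borel \<Otimes>\<^sub>M Edel) \<Otimes>\<^sub>M path_algebra \<xi>)"
    unfolding split_beta' by (rule measurable_compose[OF _ f]) measurable
qed

lemma mean_gen_measurable:
  assumes "g \<in> borel_measurable borel"
  shows "(\<lambda>p. mean_gen n (max 0 (fst p)) g (snd p)) \<in> borel_measurable (borel \<Otimes>\<^sub>M Edel)"
proof -
  have "(\<lambda>p. (max 0 (fst p), snd p)) \<in> borel \<Otimes>\<^sub>M Edel \<rightarrow>\<^sub>M (borel :: real measure) \<Otimes>\<^sub>M Edel" by measurable
  from measurable_compose[OF this law_integral_pair_measurable[OF mean_gen_integrand_measurable[OF assms, of n]]]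
  show ?thesis by (simp add: mean_gen_def)
qed

lemma exp_series_ennreal:
  assumes "0 \<le> (x::real)" shows "(\<Sum>n. ennreal (x^n / fact n)) = ennreal (exp x)"
proof -
  have "(\<lambda>n. x^n / fact n) sums exp x" using exp_converges[of x] by (simp add: divide_inverse mult.commute)
  then show ?thesis using assms by (subst suminf_ennreal2) (auto simp: sums_iff)
qed

text \<open>As \<open>alpha = birth_rate - \<beta>\<close>, this is the exponential series of the integral of \<open>birth_rate\<close>.\<close>

lemma mean_gen_sums_FK:
  assumes g: "g \<in> borel_measurable borel" and t: "0 \<le> t"
  shows "(\<Sum>n. mean_gen n t g y) = FK t g y"
proof -
  note [measurable] = path_int_path_measurable[OF beta_measurable, THEN law_measurableI]
    path_int_path_measurable[OF birth_rate_measurable, THEN law_measurableI]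
    measurable_compose[OF law_coordinate[OF t] ext_measurable_ennreal[OF g]]
  have "(\<Sum>n. mean_gen n t g y) = (\<integral>\<^sup>+w. (\<Sum>n. ennreal (surv t w * (path_int \<xi> birth_rate t w)^n / fact n)
      * ext g (\<xi> t w)) \<partial>law y)"
    unfolding mean_gen_def by (rule nn_integral_suminf[symmetric]) measurable
  also have "\<dots> = FK t g y"
    unfolding FK_def
  proof (intro nn_integral_cong)
    fix w
    let ?B = "path_int \<xi> birth_rate t w" and ?b = "path_int \<xi> \<beta> t w"
    have B: "0 \<le> ?B" by (rule path_int_nonneg[OF birth_rate_bound(1)])
    have "(\<Sum>n. ennreal (exp (- ?b) * ?B^n / fact n) * ext g (\<xi> t w)) =
        (\<Sum>n. ennreal (exp (- ?b)) * ext g (\<xi> t w) * ennreal (?B^n / fact n))"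
      using B by (intro suminf_cong) (simp add: ennreal_mult[symmetric] mult_ac flip: times_divide_eq_right)
    also have "\<dots> = ennreal (exp (- ?b)) * ext g (\<xi> t w) * ennreal (exp ?B)"
      by (simp add: ennreal_suminf_cmult exp_series_ennreal[OF B])
    also have "\<dots> = ennreal (exp (path_int \<xi> alpha t w)) * ext g (\<xi> t w)"
      by (simp add: path_int_alpha exp_diff exp_minus divide_inverse ennreal_mult mult_ac)
    finally show "(\<Sum>n. ennreal (exp (- ?b) * ?B^n / fact n) * ext g (\<xi> t w)) = ennreal (exp (path_int \<xi> alpha t w)) * ext g (\<xi> t w)" .
  qed
  finally show ?thesis .
qed

text \<open>Substitution of the increasing function \<open>s \<mapsto> path_int \<xi> g s w\<close>, and the fundamental theorem of
  calculus.\<close>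

lemma path_nn_chain_rule:
  fixes u U :: "real \<Rightarrow> real"
  assumes g: "g \<in> borel_measurable borel" "\<And>x. 0 \<le> g x" "\<And>x. \<bar>g x\<bar> \<le> C"
    and U: "\<And>x. (U has_real_derivative u x) (at x)" and u: "continuous_on UNIV u"
    and pos: "\<And>x. 0 \<le> x \<Longrightarrow> x \<le> path_int \<xi> g t w \<Longrightarrow> 0 \<le> u x" and t: "0 \<le> t"
  shows "(\<integral>\<^sup>+s. indicator {0..t} s * ennreal (ext g (\<xi> (max 0 s) w) * u (path_int \<xi> g s w)) \<partial>lborel)
     = ennreal (U (path_int \<xi> g t w) - U 0)"
proof -
  have um: "u \<in> borel_measurable borel" using u by (rule borel_measurable_continuous_onI)
  have "0 \<le> C" using g(3) by (meson abs_ge_zero order_trans)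
  then have b: "0 \<le> ext g y" "ext g y \<le> C" for y
    using g(2) abs_le_D1[OF g(3)] by (cases y; simp)+
  have pos': "0 \<le> u x" if "x \<in> {0..path_int \<xi> g t w}" for x using that pos by simp
  have A: "path_int \<xi> g r w = (LINT s:{0..r}|lborel. ext g (\<xi> (max 0 s) w))" for r by (rule path_int_max)
  have "(\<integral>\<^sup>+s. indicator {0..t} s * ennreal (ext g (\<xi> (max 0 s) w) * u (path_int \<xi> g s w)) \<partial>lborel)
     = (\<integral>\<^sup>+x. ennreal (u x) * indicator {0..path_int \<xi> g t w} x \<partial>lborel)"
    unfolding A ennreal_mult'[OF b(1)] mult.assoc[symmetric]
    by (rule nn_integral_running_integral[OF path_ext_measurable[OF g(1)] b t]) (use um in measurable)
  also have "\<dots> = ennreal (U (path_int \<xi> g t w) - U 0)"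
    by (rule nn_integral_FTC_Icc[OF um has_field_derivative_at_within[OF U] pos' path_int_nonneg[OF g(2)]])
  finally show ?thesis .
qed

lemma branch_int_swap:
  assumes c: "c \<in> borel_measurable borel" and \<psi>: "(\<lambda>p. \<psi> (fst p) (snd p)) \<in> borel_measurable (borel \<Otimes>\<^sub>M Edel)"
  shows "branch_int c \<psi> y = (\<integral>\<^sup>+s. indicator {0..} s * (\<integral>\<^sup>+w. ennreal (surv s w)
      * ext c (\<xi> (max 0 s) w) * \<psi> s (\<xi> (max 0 s) w) \<partial>law y) \<partial>lborel)"
    and "(\<lambda>p. branch_dens c (fst p) (snd p) * \<psi> (fst p) (\<xi> (max 0 (fst p)) (snd p))) \<in> borel_measurable (borel \<Otimes>\<^sub>M path_algebra \<xi>)"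
proof -
  interpret prob_space "law y" by (rule prob_law)
  interpret pair_sigma_finite lborel "law y" ..
  have [measurable]: "(\<lambda>p. \<psi> (fst p) (\<xi> (max 0 (fst p)) (snd p))) \<in> borel_measurable (borel \<Otimes>\<^sub>M path_algebra \<xi>)"
    using measurable_compose[OF measurable_Pair[OF measurable_fst xi_snd_measurable(1)] \<psi>] by simp
  note [measurable] = path_int_pair_measurable[OF beta_measurable] c
    measurable_compose[OF xi_snd_measurable(1) ext_measurable_ennreal[OF c]]
  show m: "(\<lambda>p. branch_dens c (fst p) (snd p) * \<psi> (fst p) (\<xi> (max 0 (fst p)) (snd p))) \<in> borel_measurable (borel \<Otimes>\<^sub>M path_algebra \<xi>)"
    by measurable
  have s: "sets (borel \<Otimes>\<^sub>M path_algebra \<xi>) = sets (lborel \<Otimes>\<^sub>M law y)"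
    by (rule sets_pair_measure_cong) auto
  have m': "(\<lambda>(s, w). branch_dens c s w * \<psi> s (\<xi> (max 0 s) w)) \<in> borel_measurable (lborel \<Otimes>\<^sub>M law y)"
    using m unfolding measurable_cong_sets[OF s refl] split_beta' .
  have "branch_int c \<psi> y = (\<integral>\<^sup>+s. (\<integral>\<^sup>+w. branch_dens c s w * \<psi> s (\<xi> (max 0 s) w) \<partial>law y) \<partial>lborel)"
    unfolding branch_int_def by (rule Fubini'[OF m'])
  also have "\<dots> = (\<integral>\<^sup>+s. indicator {0..} s * (\<integral>\<^sup>+w. ennreal (surv s w)
      * ext c (\<xi> (max 0 s) w) * \<psi> s (\<xi> (max 0 s) w) \<partial>law y) \<partial>lborel)"
    by (intro nn_integral_cong) (auto simp: indicator_def)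
  finally show "branch_int c \<psi> y = \<dots>" .
qed

text \<open>One more branching raises the generation by one: by the Markov property both sides integrate
  over paths, and along each path the identity is
  \<open>\<integral>\<^sub>0\<^sup>t b\<^sub>s (\<integral>\<^sub>s\<^sup>t b)\<^sup>n / n! ds = (\<integral>\<^sub>0\<^sup>t b)\<^sup>n\<^sup>+\<^sup>1 / (n + 1)!\<close>.\<close>

lemma branch_int_mean_gen:
  assumes g: "g \<in> borel_measurable borel" and t: "0 \<le> t"
  shows "branch_int (\<lambda>x. ennreal (birth_rate x)) (\<lambda>s z. indicator {..t} s * mean_gen n (t - s) g z) y = mean_gen (Suc n) t g y"
proof -
  interpret P: prob_space "law y" by (rule prob_law)
  interpret pair_sigma_finite lborel "law y" ..
  define f where "f = (\<lambda>r v. ennreal (surv r v * (path_int \<xi> birth_rate r v)^n / fact n) * ext g (\<xi> r v))"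
  have f: "f r \<in> borel_measurable (path_algebra \<xi>)" if r: "0 \<le> r" for r
  proof -
    note [measurable] = path_int_path_measurable[OF beta_measurable] path_int_path_measurable[OF birth_rate_measurable]
      measurable_compose[OF coordinate_path_algebra[OF r] ext_measurable_ennreal[OF g]]
    show ?thesis unfolding f_def by measurable
  qed
  define w where "w = (\<lambda>s v. ennreal (surv s v) * ext (\<lambda>x. ennreal (birth_rate x)) (\<xi> (max 0 s) v))"
  define B where "B = (\<lambda>s v. path_int \<xi> birth_rate s v)"
  have extb: "ext (\<lambda>x. ennreal (birth_rate x)) z = ennreal (ext birth_rate z)" for z by (cases z) auto
  have \<psi>m: "(\<lambda>p. indicator {..t} (fst p) * mean_gen n (t - fst p) g (snd p)) \<in> borel_measurable (borel \<Otimes>\<^sub>M Edel)"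
  proof -
    have "(\<lambda>p. (t - fst p, snd p)) \<in> borel \<Otimes>\<^sub>M Edel \<rightarrow>\<^sub>M (borel :: real measure) \<Otimes>\<^sub>M Edel" by measurable
    note [measurable] = measurable_compose[OF this mean_gen_measurable[OF g, of n], simplified]
    have "(\<lambda>p. indicator {..t} (fst p) * mean_gen n (max 0 (t - fst p)) g (snd p)) \<in> borel_measurable (borel \<Otimes>\<^sub>M Edel)"
      by measurable
    also have "(\<lambda>p. indicator {..t} (fst p) * mean_gen n (max 0 (t - fst p)) g (snd p)) = (\<lambda>p. indicator {..t} (fst p) * mean_gen n (t - fst p) g (snd p))"
      by (auto simp: fun_eq_iff indicator_def)
    finally show ?thesis .
  qed
  have inner: "(\<integral>\<^sup>+v. w s v * (indicator {..t} s * mean_gen n (t - s) g (\<xi> (max 0 s) v)) \<partial>law y)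
     = (\<integral>\<^sup>+v. indicator {0..t} s * (ennreal (surv t v) * ext g (\<xi> t v) *
          ennreal (ext birth_rate (\<xi> (max 0 s) v) * ((B t v - B s v)^n / fact n))) \<partial>law y)" if s0: "0 \<le> s" for s
  proof (cases "s \<le> t")
    case True
    have ws: "w s \<in> borel_measurable (nat_filt \<xi> (ennreal s))"
    proof -
      note [measurable] = path_int_adapted[OF beta_measurable s0] measurable_compose[OF coordinate_measurable[OF s0 order_refl] ext_measurable_ennreal[of "\<lambda>x. ennreal (birth_rate x)"]]
      show ?thesis unfolding w_def xi_max[OF s0] by measurable
    qed
    have "(\<integral>\<^sup>+v. w s v * (indicator {..t} s * mean_gen n (t - s) g (\<xi> (max 0 s) v)) \<partial>law y)
       = (\<integral>\<^sup>+v. w s v * (\<integral>\<^sup>+v'. f (t - s) v' \<partial>law (\<xi> s v)) \<partial>law y)"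
      using True s0 by (simp add: mean_gen_def f_def)
    also have "\<dots> = (\<integral>\<^sup>+v. w s v * f (t - s) (path_shift s v) \<partial>law y)"
      by (rule markov_property[symmetric, OF s0 ws f]) (use True in simp)
    also have "\<dots> = (\<integral>\<^sup>+v. indicator {0..t} s * (ennreal (surv t v) * ext g (\<xi> t v) *
          ennreal (ext birth_rate (\<xi> (max 0 s) v) * ((B t v - B s v)^n / fact n))) \<partial>law y)"
    proof (intro nn_integral_cong)
      fix v
      define b1 b2 where "b1 = path_int \<xi> \<beta> s v" and "b2 = path_int \<xi> \<beta> t v"
      have 1: "path_int \<xi> \<beta> (t - s) (path_shift s v) = b2 - b1"
        using path_int_shift[OF beta_measurable beta_bound(1) s0, of "t - s" v] True by (simp add: b1_def b2_def)
      have 2: "path_int \<xi> birth_rate (t - s) (path_shift s v) = B t v - B s v"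
        using path_int_shift[OF birth_rate_measurable birth_rate_bound(2) s0, of "t - s" v] True by (simp add: B_def)
      have 3: "\<xi> (t - s) (path_shift s v) = \<xi> t v" using True s0 by (simp add: path_shift)
      have 4: "0 \<le> B t v - B s v" unfolding 2[symmetric] by (rule path_int_nonneg[OF birth_rate_bound(1)])
      define x where "x = (B t v - B s v)^n / fact n"
      have x: "0 \<le> x" using 4 by (simp add: x_def)
      define eb where "eb = ext birth_rate (\<xi> (max 0 s) v)"
      have eb: "0 \<le> eb" unfolding eb_def using birth_rate_bound(1) by (cases "\<xi> (max 0 s) v") auto
      have "ennreal (exp (- b1)) * ennreal eb * ennreal (exp (- (b2 - b1)) * x) = ennreal (exp (- b2)) * ennreal (eb * x)"
        using x eb by (simp add: ennreal_mult[symmetric] mult_ac flip: exp_add)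
      then show "w s v * f (t - s) (path_shift s v) = indicator {0..t} s * (ennreal (surv t v) * ext g (\<xi> t v) *
          ennreal (ext birth_rate (\<xi> (max 0 s) v) * ((B t v - B s v)^n / fact n)))"
        unfolding w_def f_def 1 2 3 extb b1_def[symmetric] b2_def[symmetric] x_def[symmetric] eb_def[symmetric] times_divide_eq_right[symmetric]
        using True s0 by (simp add: mult_ac)
    qed
    finally show ?thesis .
  next
    case False
    then show ?thesis by simp
  qed
  have "branch_int (\<lambda>x. ennreal (birth_rate x)) (\<lambda>s z. indicator {..t} s * mean_gen n (t - s) g z) y
    = (\<integral>\<^sup>+s. indicator {0..} s * (\<integral>\<^sup>+v. w s v * (indicator {..t} s * mean_gen n (t - s) g (\<xi> (max 0 s) v)) \<partial>law y) \<partial>lborel)"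
    unfolding w_def by (rule branch_int_swap(1)[OF _ \<psi>m]) measurable
  also have "\<dots> = (\<integral>\<^sup>+s. (\<integral>\<^sup>+v. indicator {0..t} s * (ennreal (surv t v) * ext g (\<xi> t v) *
          ennreal (ext birth_rate (\<xi> (max 0 s) v) * ((B t v - B s v)^n / fact n))) \<partial>law y) \<partial>lborel)"
    using inner by (intro nn_integral_cong) (auto simp: indicator_def)
  also have "\<dots> = (\<integral>\<^sup>+v. (\<integral>\<^sup>+s. indicator {0..t} s * (ennreal (surv t v) * ext g (\<xi> t v) *
          ennreal (ext birth_rate (\<xi> (max 0 s) v) * ((B t v - B s v)^n / fact n))) \<partial>lborel) \<partial>law y)"
  proof (rule Fubini'[symmetric])
    have sp: "sets (borel \<Otimes>\<^sub>M path_algebra \<xi>) = sets (lborel \<Otimes>\<^sub>M law y)"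
      by (rule sets_pair_measure_cong) auto
    note [measurable] = path_int_path_measurable[OF beta_measurable] path_int_path_measurable[OF birth_rate_measurable]
      path_int_pair_measurable[OF birth_rate_measurable]
      measurable_compose[OF coordinate_path_algebra[OF t] ext_measurable_ennreal[OF g]]
      measurable_compose[OF xi_snd_measurable(1) ext_measurable_real[OF birth_rate_measurable]]
    have "(\<lambda>p. indicator {0..t} (fst p) * (ennreal (surv t (snd p)) * ext g (\<xi> t (snd p)) *
          ennreal (ext birth_rate (\<xi> (max 0 (fst p)) (snd p)) * ((B t (snd p) - B (fst p) (snd p))^n / fact n)))) \<in> borel_measurable (borel \<Otimes>\<^sub>M path_algebra \<xi>)"
      unfolding B_def by measurable
    then show "(\<lambda>(s, v). indicator {0..t} s * (ennreal (surv t v) * ext g (\<xi> t v) *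
          ennreal (ext birth_rate (\<xi> (max 0 s) v) * ((B t v - B s v)^n / fact n)))) \<in> borel_measurable (lborel \<Otimes>\<^sub>M law y)"
      unfolding measurable_cong_sets[OF sp refl] split_beta' .
  qed
  also have "\<dots> = mean_gen (Suc n) t g y"
    unfolding mean_gen_def
  proof (intro nn_integral_cong)
    fix v
    define c where "c = B t v"
    have c0: "0 \<le> c" unfolding c_def B_def by (rule path_int_nonneg[OF birth_rate_bound(1)])
    have "(\<integral>\<^sup>+s. indicator {0..t} s * ennreal (ext birth_rate (\<xi> (max 0 s) v) * ((c - path_int \<xi> birth_rate s v)^n / fact n)) \<partial>lborel)
       = ennreal (- ((c - path_int \<xi> birth_rate t v)^Suc n / fact (Suc n)) - (- ((c - 0)^Suc n / fact (Suc n))))"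
    proof (rule path_nn_chain_rule[OF birth_rate_measurable birth_rate_bound, where u = "\<lambda>x. (c - x)^n / fact n" and U = "\<lambda>x. - ((c - x)^Suc n / fact (Suc n))"])
      show "((\<lambda>x. - ((c - x) ^ Suc n / fact (Suc n))) has_real_derivative (c - x) ^ n / fact n) (at x)" for x
      proof -
        have "((\<lambda>x. - ((c - x) ^ Suc n / fact (Suc n))) has_real_derivative
            - ((1 + real n) * ((0 - 1) * (c - x) ^ n) / fact (Suc n))) (at x)"
          by (rule DERIV_minus[OF DERIV_cdivide[OF DERIV_power_Suc[OF DERIV_diff[OF DERIV_const DERIV_ident]]]])
        moreover have "- ((1 + real n) * ((0 - 1) * (c - x) ^ n) / fact (Suc n)) = (c - x) ^ n / fact n"
          by (simp add: fact_Suc)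
        ultimately show ?thesis by metis
      qed
      show "continuous_on UNIV (\<lambda>x. (c - x) ^ n / fact n)" by (intro continuous_intros) auto
      show "0 \<le> (c - x) ^ n / fact n" if "x \<le> path_int \<xi> birth_rate t v" for x
        using that by (simp add: c_def B_def)
    qed (rule t)
    also have "\<dots> = ennreal (c^Suc n / fact (Suc n))" by (simp add: c_def B_def)
    finally have I: "(\<integral>\<^sup>+s. indicator {0..t} s * ennreal (ext birth_rate (\<xi> (max 0 s) v) * ((B t v - B s v)^n / fact n)) \<partial>lborel)
       = ennreal (c^Suc n / fact (Suc n))" by (simp add: c_def B_def)
    have m: "(\<lambda>s. indicator {0..t} s * ennreal (ext birth_rate (\<xi> (max 0 s) v) * ((B t v - B s v)^n / fact n))) \<in> borel_measurable lborel"
    proof -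
      have "(\<lambda>s. path_int \<xi> birth_rate s v) \<in> borel_measurable borel"
        by (rule path_int_measurable[OF birth_rate_measurable]) auto
      note [measurable] = this path_ext_measurable[OF birth_rate_measurable, of v]
      show ?thesis unfolding B_def by measurable
    qed
    have "(\<integral>\<^sup>+s. indicator {0..t} s * (ennreal (surv t v) * ext g (\<xi> t v) *
          ennreal (ext birth_rate (\<xi> (max 0 s) v) * ((B t v - B s v)^n / fact n))) \<partial>lborel)
       = (\<integral>\<^sup>+s. (ennreal (surv t v) * ext g (\<xi> t v)) * (indicator {0..t} s *
          ennreal (ext birth_rate (\<xi> (max 0 s) v) * ((B t v - B s v)^n / fact n))) \<partial>lborel)"
      by (intro nn_integral_cong) (simp add: mult_ac)
    also have "\<dots> = (ennreal (surv t v) * ext g (\<xi> t v)) * ennreal (c^Suc n / fact (Suc n))"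
      unfolding I[symmetric] by (rule nn_integral_cmult[OF m])
    also have "\<dots> = ennreal (surv t v * path_int \<xi> birth_rate t v ^ Suc n / fact (Suc n)) * ext g (\<xi> t v)"
    proof -
      have e: "ennreal (surv t v) * ennreal (c^Suc n / fact (Suc n)) = ennreal (surv t v * (c^Suc n / fact (Suc n)))"
        using c0 by (intro ennreal_mult[symmetric]) auto
      have "(a * x) * b = (a * b) * x" for a x b :: ennreal by (simp only: ac_simps)
      from this[of _ "ext g (\<xi> t v)"] show ?thesis
        by (simp only: e) (simp only: c_def B_def times_divide_eq_right)
    qed
    finally show "(\<integral>\<^sup>+s. indicator {0..t} s * (ennreal (surv t v) * ext g (\<xi> t v) *
          ennreal (ext birth_rate (\<xi> (max 0 s) v) * ((B t v - B s v)^n / fact n))) \<partial>lborel)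
       = ennreal (surv t v * path_int \<xi> birth_rate t v ^ Suc n / fact (Suc n)) * ext g (\<xi> t v)" .
  qed
  finally show ?thesis .
qed

lemma death_before:
  assumes t: "0 \<le> t"
  shows "(\<integral>\<^sup>+s. indicator {0..t} s * ennreal (ext \<beta> (\<xi> (max 0 s) w) * surv s w) \<partial>lborel)
     = ennreal (1 - surv t w)"
proof -
  have "(\<integral>\<^sup>+s. indicator {0..t} s * ennreal (ext \<beta> (\<xi> (max 0 s) w) * surv s w) \<partial>lborel)
     = ennreal (- surv t w - (- exp (- 0)))"
  proof (rule path_nn_chain_rule[OF beta_measurable beta_nonneg beta_bound(1), where u = "\<lambda>x. exp (- x)" and U = "\<lambda>x. - exp (- x)"])
    show "((\<lambda>x. - exp (- x)) has_real_derivative exp (- x)) (at x)" for x :: real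
      by (auto intro!: derivative_eq_intros)
    show "continuous_on UNIV (\<lambda>x::real. exp (- x))" by (intro continuous_intros)
  qed (use t in simp_all)
  then show ?thesis by simp
qed

end

section \<open>Densities of the semigroups\<close>

lemma SUP_min_of_nat: "(SUP n. min x (of_nat n)) = (x :: ennreal)"
proof (rule antisym)
  show "(SUP n. min x (of_nat n)) \<le> x" by (rule SUP_least) simp
  show "x \<le> (SUP n. min x (of_nat n))"
  proof (cases "x = top")
    case True
    then have "min x (of_nat n) = of_nat n" for n by simp
    then show ?thesis by (simp only: ennreal_SUP_of_nat_eq_top top_greatest)
  next
    case False
    then obtain n where "x < of_nat n" using ennreal_Ex_less_of_nat[of x] by (auto simp: less_top)
    then have "x = min x (of_nat n)" by simp
    also have "\<dots> \<le> (SUP n. min x (of_nat n))" by (rule SUP_upper) simp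
    finally show ?thesis .
  qed
qed

lemma L2_nn_integral:
  assumes "g \<in> L2_space M"
  shows "(\<integral>\<^sup>+x. ennreal \<bar>g x\<bar> ^ 2 \<partial>M) = ennreal ((L2_norm M g)^2)"
proof -
  have "(\<integral>\<^sup>+x. ennreal \<bar>g x\<bar> ^ 2 \<partial>M) = (\<integral>\<^sup>+x. ennreal ((g x)^2) \<partial>M)"
    by (simp add: ennreal_power)
  also have "\<dots> = ennreal (\<integral>x. (g x)^2 \<partial>M)"
    using assms by (intro nn_integral_eq_integral) (auto simp: L2_space_def)
  finally show ?thesis by (simp add: L2_norm_def integral_nonneg_AE)
qed

lemma nice_density_pos: "nice_density M S k \<Longrightarrow> 0 < t \<Longrightarrow> 0 < k t x y"
  unfolding nice_density_def by blast

lemma nice_density_sym: "nice_density M S k \<Longrightarrow> 0 < t \<Longrightarrow> k t x y = k t y x"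
  unfolding nice_density_def by blast

lemma nice_density_integral:
  assumes "nice_density M S k" "0 < t" "g \<in> borel_measurable borel" "\<And>x. 0 \<le> g x" "bounded (range g)"
  shows "ennreal (S t g x) = (\<integral>\<^sup>+y. ennreal (k t x y * g y) \<partial>M)"
  using assms unfolding nice_density_def by blast

lemma nice_density_continuous: "nice_density M S k \<Longrightarrow> 0 < t \<Longrightarrow> continuous_on UNIV (\<lambda>(x, y). k t x y)"
  unfolding nice_density_def by blast

context branching_model
begin

declare borel_mu [measurable_cong]

lemma space_mu [simp]: "space \<mu> = UNIV"
  using sets_eq_imp_space_eq[OF borel_mu] by simp

lemma ext_ennreal_measurable [measurable]: "g \<in> borel_measurable borel \<Longrightarrow> 0 \<le> t \<Longrightarrow> (\<lambda>w. ext g (\<xi> t w) :: ennreal) \<in> borel_measurable (law y)"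
  by (rule measurable_compose[OF law_coordinate ext_measurable_ennreal])

lemma ext_real_measurable [measurable]: "g \<in> borel_measurable borel \<Longrightarrow> 0 \<le> t \<Longrightarrow> (\<lambda>w. ext g (\<xi> t w) :: real) \<in> borel_measurable (law y)"
  by (rule measurable_compose[OF law_coordinate ext_measurable_real])

text \<open>Monotone convergence extends the identity from bounded functions to functions with values in
  \<open>[0, \<infinity>]\<close>. The weight \<open>W\<close> is 1 for the motion and the exponential functional for the Feynman--Kac
  semigroup.\<close>

lemma density_representation:
  fixes W :: "'w \<Rightarrow> real" and k :: "'a \<Rightarrow> real" and g :: "'a \<Rightarrow> ennreal"
  assumes W: "W \<in> borel_measurable (path_algebra \<xi>)" "\<And>w. 0 \<le> W w" "\<And>w. W w \<le> C"
    and t: "0 \<le> t" and k: "k \<in> borel_measurable borel" "\<And>z. 0 \<le> k z"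
    and D: "\<And>g. g \<in> borel_measurable borel \<Longrightarrow> (\<forall>x. 0 \<le> g x) \<Longrightarrow> bounded (range g) \<Longrightarrow>
       ennreal (\<integral>w. W w * ext g (\<xi> t w) \<partial>law y) = (\<integral>\<^sup>+z. ennreal (k z * g z) \<partial>\<mu>)"
    and g [measurable]: "g \<in> borel_measurable borel"
  shows "(\<integral>\<^sup>+w. ennreal (W w) * ext g (\<xi> t w) \<partial>law y) = (\<integral>\<^sup>+z. ennreal (k z) * g z \<partial>\<mu>)"
proof -
  interpret prob_space "law y" by (rule prob_law)
  have WM [measurable]: "W \<in> borel_measurable (law y)" using W(1) by (rule law_measurableI)
  note [measurable] = k(1)
  define h where "h n x = enn2real (min (g x) (of_nat n))" for n x
  have hm [measurable]: "h n \<in> borel_measurable borel" for n unfolding h_def by measurable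
  have h: "0 \<le> h n x" "h n x \<le> real n" "ennreal (h n x) = min (g x) (of_nat n)" for n x
  proof -
    have fin: "min (g x) (of_nat n) < top" by (simp add: min_less_iff_disj of_nat_less_top)
    show "0 \<le> h n x" by (simp add: h_def)
    show eq: "ennreal (h n x) = min (g x) (of_nat n)" unfolding h_def by (rule ennreal_enn2real[OF fin])
    have "ennreal (h n x) \<le> ennreal (real n)" unfolding eq by (simp add: ennreal_of_nat_eq_real_of_nat)
    then show "h n x \<le> real n" by (simp add: ennreal_le_iff)
  qed
  have approx: "(\<integral>\<^sup>+w. ennreal (W w) * ext (\<lambda>x. min (g x) (of_nat n)) (\<xi> t w) \<partial>law y) = (\<integral>\<^sup>+z. ennreal (k z) * min (g z) (of_nat n) \<partial>\<mu>)" for n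
  proof -
    have e0: "0 \<le> ext (h n) z" "ext (h n) z \<le> real n" "ennreal (ext (h n) z) = ext (\<lambda>x. min (g x) (of_nat n)) z" for z
      using h[of n] by (cases z, auto)+
    have "(\<integral>\<^sup>+w. ennreal (W w) * ext (\<lambda>x. min (g x) (of_nat n)) (\<xi> t w) \<partial>law y) = (\<integral>\<^sup>+w. ennreal (W w * ext (h n) (\<xi> t w)) \<partial>law y)"
      by (intro nn_integral_cong) (simp add: ennreal_mult W e0(1) flip: e0(3))
    also have "\<dots> = ennreal (\<integral>w. W w * ext (h n) (\<xi> t w) \<partial>law y)"
    proof (rule nn_integral_eq_integral)
      have "\<bar>W w * ext (h n) (\<xi> t w)\<bar> \<le> C * real n" for w
        using W(2,3)[of w] e0(1,2)[of "\<xi> t w"] order_trans[OF W(2,3)[of w]]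
        by (simp add: abs_mult) (intro mult_mono, auto)
      then show "integrable (law y) (\<lambda>w. W w * ext (h n) (\<xi> t w))"
        using t by (intro integrable_const_bound[where B="C * real n"] borel_measurable_times WM ext_real_measurable hm) auto
    qed (use W e0 in auto)
    also have "\<dots> = (\<integral>\<^sup>+z. ennreal (k z * h n z) \<partial>\<mu>)"
      using h(1,2)[of n] by (intro D hm) (auto intro!: boundedI[of _ "real n"])
    also have "\<dots> = (\<integral>\<^sup>+z. ennreal (k z) * min (g z) (of_nat n) \<partial>\<mu>)"
      using k h by (intro nn_integral_cong) (simp add: ennreal_mult)
    finally show ?thesis .
  qed
  have mono: "min a (of_nat m) \<le> min a (of_nat n)" if "m \<le> n" for m n and a :: ennreal
    using that by (intro min.mono) auto
  have extS: "ext g z = (SUP n. ext (\<lambda>x. min (g x) (of_nat n)) z)" for z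
    by (cases z) (auto simp: SUP_min_of_nat)
  have extmono: "ext (\<lambda>x. min (g x) (of_nat m)) z \<le> ext (\<lambda>x. min (g x) (of_nat n)) z" if "m \<le> n" for m n z
    using mono[OF that] by (cases z) auto
  have "(\<integral>\<^sup>+w. ennreal (W w) * ext g (\<xi> t w) \<partial>law y) = (\<integral>\<^sup>+w. (SUP n. ennreal (W w) * ext (\<lambda>x. min (g x) (of_nat n)) (\<xi> t w)) \<partial>law y)"
    unfolding extS by (simp add: SUP_mult_left_ennreal)
  also have "\<dots> = (SUP n. \<integral>\<^sup>+w. ennreal (W w) * ext (\<lambda>x. min (g x) (of_nat n)) (\<xi> t w) \<partial>law y)"
  proof (rule nn_integral_monotone_convergence_SUP)
    show "incseq (\<lambda>n w. ennreal (W w) * ext (\<lambda>x. min (g x) (of_nat n)) (\<xi> t w))"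
      by (auto simp: incseq_def le_fun_def intro!: mult_left_mono extmono)
    show "(\<lambda>w. ennreal (W w) * ext (\<lambda>x. min (g x) (of_nat n)) (\<xi> t w)) \<in> borel_measurable (law y)" for n
      by (intro borel_measurable_times_ennreal measurable_compose[OF WM measurable_ennreal] ext_ennreal_measurable t) measurable
  qed
  also have "\<dots> = (SUP n. \<integral>\<^sup>+z. ennreal (k z) * min (g z) (of_nat n) \<partial>\<mu>)" unfolding approx ..
  also have "\<dots> = (\<integral>\<^sup>+z. (SUP n. ennreal (k z) * min (g z) (of_nat n)) \<partial>\<mu>)"
  proof (rule nn_integral_monotone_convergence_SUP[symmetric])
    show "incseq (\<lambda>n z. ennreal (k z) * min (g z) (of_nat n))"
      by (auto simp: incseq_def le_fun_def intro!: mult_left_mono mono)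
    show "(\<lambda>z. ennreal (k z) * min (g z) (of_nat n)) \<in> borel_measurable \<mu>" for n by measurable
  qed
  also have "\<dots> = (\<integral>\<^sup>+z. ennreal (k z) * g z \<partial>\<mu>)"
    by (simp add: SUP_mult_left_ennreal[symmetric] SUP_min_of_nat)
  finally show ?thesis .
qed

lemma kernel_measurable:
  assumes "nice_density \<mu> S k" "0 < t"
  shows "(\<lambda>p. k t (fst p) (snd p)) \<in> borel_measurable (borel \<Otimes>\<^sub>M borel)" "k t x \<in> borel_measurable borel" "(\<lambda>z. k t z x) \<in> borel_measurable borel"
proof -
  have c: "continuous_on UNIV (\<lambda>(x, y). k t x y)" by (rule nice_density_continuous[OF assms])
  then show m: "(\<lambda>p. k t (fst p) (snd p)) \<in> borel_measurable (borel \<Otimes>\<^sub>M borel)"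
    using borel_measurable_continuous_onI[OF c] by (simp add: borel_prod split_beta')
  show "k t x \<in> borel_measurable borel"
    using measurable_compose[OF measurable_Pair[OF measurable_const measurable_ident] m, of x] by simp
  show "(\<lambda>z. k t z x) \<in> borel_measurable borel"
    using measurable_compose[OF measurable_Pair[OF measurable_ident measurable_const] m, of x] by simp
qed

lemma exp_path_int_bound:
  assumes "0 \<le> t" shows "exp (path_int \<xi> alpha t w) \<le> exp (growth_rate * t)" "exp (- path_int \<xi> alpha t w) \<le> exp (growth_rate * t)"
  using path_int_bound[OF alpha_measurable alpha_bound assms, of w] by auto

lemma FK_density:
  assumes t: "0 < t" and g: "g \<in> borel_measurable borel"
  shows "FK t g (Some x) = (\<integral>\<^sup>+z. ennreal (q t x z) * g z \<partial>\<mu>)"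
  unfolding FK_def
proof (rule density_representation[where C = "exp (growth_rate * t)"])
  show "(\<lambda>w. exp (path_int \<xi> alpha t w)) \<in> borel_measurable (path_algebra \<xi>)"
    using path_int_path_measurable[OF alpha_measurable] by measurable
  show "ennreal (\<integral>w. exp (path_int \<xi> alpha t w) * ext g (\<xi> t w) \<partial>law (Some x)) = (\<integral>\<^sup>+z. ennreal (q t x z * g z) \<partial>\<mu>)"
    if "g \<in> borel_measurable borel" "\<forall>x. 0 \<le> g x" "bounded (range g)" for g
    using nice_density_integral[OF density_q t that(1) _ that(3), of x] that(2) by (simp add: FK_sg_def)
  show "0 \<le> q t x z" for z by (rule less_imp_le[OF nice_density_pos[OF density_q t]])
  show "0 \<le> t" using t by simp
  then show "exp (path_int \<xi> alpha t w) \<le> exp (growth_rate * t)" for w by (rule exp_path_int_bound(1))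
  show "q t x \<in> borel_measurable borel" by (rule kernel_measurable(2)[OF density_q t])
qed (rule exp_ge_zero g)+

text \<open>The semigroup of the motion on functions with values in \<open>[0, \<infinity>]\<close>.\<close>

definition PT :: "real \<Rightarrow> ('a \<Rightarrow> ennreal) \<Rightarrow> 'a option \<Rightarrow> ennreal" where
  "PT t g y = (\<integral>\<^sup>+w. ext g (\<xi> t w) \<partial>law y)"

lemma PT_density:
  assumes t: "0 < t" and g: "g \<in> borel_measurable borel"
  shows "PT t g (Some x) = (\<integral>\<^sup>+z. ennreal (p t x z) * g z \<partial>\<mu>)"
proof -
  have "(\<integral>\<^sup>+w. ennreal ((\<lambda>w. 1) w) * ext g (\<xi> t w) \<partial>law (Some x)) = (\<integral>\<^sup>+z. ennreal (p t x z) * g z \<partial>\<mu>)"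
  proof (rule density_representation[where C = 1])
    show "ennreal (\<integral>w. 1 * ext g (\<xi> t w) \<partial>law (Some x)) = (\<integral>\<^sup>+z. ennreal (p t x z * g z) \<partial>\<mu>)"
      if "g \<in> borel_measurable borel" "\<forall>x. 0 \<le> g x" "bounded (range g)" for g
      using nice_density_integral[OF density_p t that(1) _ that(3), of x] that(2) by (simp add: motion_sg_def)
    show "0 \<le> p t x z" for z by (rule less_imp_le[OF nice_density_pos[OF density_p t]])
    show "0 \<le> t" using t by simp
    show "p t x \<in> borel_measurable borel" by (rule kernel_measurable(2)[OF density_p t])
  qed (use g in simp_all)
  then show ?thesis by (simp add: PT_def)
qed

lemma ext_Some: "f None = 0 \<Longrightarrow> ext (\<lambda>x. f (Some x)) y = f y"
  by (cases y) auto

lemma PT_None: "0 \<le> t \<Longrightarrow> PT t g None = 0"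
proof -
  assume "0 \<le> t"
  then have "PT t g None = (\<integral>\<^sup>+w. 0 \<partial>law None)"
    unfolding PT_def using law_None[of t] by (intro nn_integral_cong_AE) (auto elim: eventually_mono)
  then show ?thesis by simp
qed

lemma FK_None: "0 \<le> t \<Longrightarrow> FK t g None = 0"
proof -
  assume "0 \<le> t"
  then have "FK t g None = (\<integral>\<^sup>+w. 0 \<partial>law None)"
    unfolding FK_def using law_None[of t] by (intro nn_integral_cong_AE) (auto elim: eventually_mono)
  then show ?thesis by simp
qed

lemma FK_measurable:
  assumes g: "g \<in> borel_measurable borel"
  shows "(\<lambda>p. FK (max 0 (fst p)) g (snd p)) \<in> borel_measurable (borel \<Otimes>\<^sub>M Edel)"
proof -
  have "(\<lambda>p. ennreal (exp (path_int \<xi> alpha (fst p) (snd p))) * ext g (\<xi> (max 0 (fst p)) (snd p))) \<in> borel_measurable (borel \<Otimes>\<^sub>M path_algebra \<xi>)"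
    using path_int_pair_measurable[OF alpha_measurable] measurable_compose[OF xi_snd_measurable(1) ext_measurable_ennreal[OF g]]
    by measurable
  note m = law_integral_pair_measurable[OF this]
  have "(\<lambda>p. (max 0 (fst p), snd p)) \<in> borel \<Otimes>\<^sub>M Edel \<rightarrow>\<^sub>M (borel :: real measure) \<Otimes>\<^sub>M Edel" by measurable
  from measurable_compose[OF this m] show ?thesis by (simp add: FK_def)
qed

lemma FK_measurable_place:
  assumes "g \<in> borel_measurable borel" "0 \<le> t"
  shows "FK t g \<in> borel_measurable Edel" "(\<lambda>x. FK t g (Some x)) \<in> borel_measurable borel"
proof -
  show *: "FK t g \<in> borel_measurable Edel"
    using measurable_compose[OF measurable_Pair[OF measurable_const measurable_ident] FK_measurable[OF assms(1)], of t] assms(2) by simp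
  show "(\<lambda>x. FK t g (Some x)) \<in> borel_measurable borel"
    by (rule measurable_compose[OF Some_measurable *])
qed

lemma FK_semigroup:
  assumes s: "0 \<le> s" and t: "0 \<le> t" and g: "g \<in> borel_measurable borel"
  shows "FK (s + t) g y = FK s (\<lambda>x. FK t g (Some x)) y"
proof -
  define f where "f = (\<lambda>w. ennreal (exp (path_int \<xi> alpha t w)) * ext g (\<xi> t w))"
  have f: "f \<in> borel_measurable (path_algebra \<xi>)"
    unfolding f_def using path_int_path_measurable[OF alpha_measurable]
      measurable_compose[OF coordinate_path_algebra[OF t] ext_measurable_ennreal[OF g]] by measurable
  have Y: "(\<lambda>w. ennreal (exp (path_int \<xi> alpha s w))) \<in> borel_measurable (nat_filt \<xi> (ennreal s))"
    using path_int_adapted[OF alpha_measurable s] by measurable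
  have "FK (s + t) g y = (\<integral>\<^sup>+w. ennreal (exp (path_int \<xi> alpha s w)) * f (path_shift s w) \<partial>law y)"
    unfolding FK_def
  proof (intro nn_integral_cong)
    fix w
    have 1: "path_int \<xi> alpha (s + t) w = path_int \<xi> alpha s w + path_int \<xi> alpha t (path_shift s w)"
      using path_int_shift[OF alpha_measurable alpha_bound s t, of w] by simp
    show "ennreal (exp (path_int \<xi> alpha (s + t) w)) * ext g (\<xi> (s + t) w) = ennreal (exp (path_int \<xi> alpha s w)) * f (path_shift s w)"
      using s t by (simp add: f_def 1 path_shift exp_add ennreal_mult add.commute mult.assoc)
  qed
  also have "\<dots> = (\<integral>\<^sup>+w. ennreal (exp (path_int \<xi> alpha s w)) * (\<integral>\<^sup>+w'. f w' \<partial>law (\<xi> s w)) \<partial>law y)"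
    by (rule markov_property[OF s Y f])
  also have "\<dots> = FK s (\<lambda>x. FK t g (Some x)) y"
    unfolding FK_def[of s] ext_Some[of "FK t g", OF FK_None[OF t]] by (simp add: FK_def f_def)
  finally show ?thesis .
qed

lemma PT_semigroup:
  assumes s: "0 \<le> s" and t: "0 \<le> t" and g: "g \<in> borel_measurable borel"
  shows "PT (s + t) g y = PT s (\<lambda>x. PT t g (Some x)) y"
proof -
  have f: "(\<lambda>w. ext g (\<xi> t w)) \<in> borel_measurable (path_algebra \<xi>)"
    by (rule measurable_compose[OF coordinate_path_algebra[OF t] ext_measurable_ennreal[OF g]])
  have "PT (s + t) g y = (\<integral>\<^sup>+w. 1 * ext g (\<xi> t (path_shift s w)) \<partial>law y)"
    unfolding PT_def using s t by (intro nn_integral_cong) (simp add: path_shift add.commute)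
  also have "\<dots> = (\<integral>\<^sup>+w. 1 * (\<integral>\<^sup>+w'. ext g (\<xi> t w') \<partial>law (\<xi> s w)) \<partial>law y)"
    by (rule markov_property[OF s _ f]) simp
  also have "\<dots> = PT s (\<lambda>x. PT t g (Some x)) y"
    unfolding PT_def[of s] ext_Some[of "PT t g", OF PT_None[OF t]] by (simp add: PT_def)
  finally show ?thesis .
qed

lemma FK_mono: "(\<And>x. g x \<le> h x) \<Longrightarrow> FK t g y \<le> FK t h y"
  unfolding FK_def by (intro nn_integral_mono mult_left_mono) (auto simp: ext_def split: option.splits)

lemma FK_cmult:
  assumes "g \<in> borel_measurable borel" "0 \<le> t"
  shows "FK t (\<lambda>x. c * g x) y = c * FK t g y"
proof -
  have [measurable]: "(\<lambda>w. path_int \<xi> alpha t w) \<in> borel_measurable (law y)"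
    by (rule law_measurableI[OF path_int_path_measurable[OF alpha_measurable]])
  note [measurable] = ext_ennreal_measurable[OF assms]
  have e: "ext (\<lambda>x. c * g x) z = c * ext g z" for z by (cases z) auto
  have "FK t (\<lambda>x. c * g x) y = (\<integral>\<^sup>+w. c * (ennreal (exp (path_int \<xi> alpha t w)) * ext g (\<xi> t w)) \<partial>law y)"
    unfolding FK_def e by (simp add: mult_ac)
  also have "\<dots> = c * FK t g y" unfolding FK_def by (rule nn_integral_cmult) measurable
  finally show ?thesis .
qed

lemma FK_add:
  assumes "g \<in> borel_measurable borel" "h \<in> borel_measurable borel" "0 \<le> t"
  shows "FK t (\<lambda>x. g x + h x) y = FK t g y + FK t h y"
proof -
  have [measurable]: "(\<lambda>w. path_int \<xi> alpha t w) \<in> borel_measurable (law y)"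
    by (rule law_measurableI[OF path_int_path_measurable[OF alpha_measurable]])
  note [measurable] = ext_ennreal_measurable[OF assms(1,3)] ext_ennreal_measurable[OF assms(2,3)]
  have e: "ext (\<lambda>x. g x + h x) z = ext g z + ext h z" for z by (cases z) auto
  show ?thesis unfolding FK_def e distrib_left by (rule nn_integral_add) measurable
qed

lemma FK_le_PT:
  assumes "g \<in> borel_measurable borel" "0 \<le> t"
  shows "FK t g y \<le> ennreal (exp (growth_rate * t)) * PT t g y"
proof -
  have "FK t g y \<le> (\<integral>\<^sup>+w. ennreal (exp (growth_rate * t)) * ext g (\<xi> t w) \<partial>law y)"
    unfolding FK_def using exp_path_int_bound(1)[OF assms(2)] by (intro nn_integral_mono mult_right_mono ennreal_leI) auto
  also have "\<dots> = ennreal (exp (growth_rate * t)) * PT t g y"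
    unfolding PT_def by (rule nn_integral_cmult[OF ext_ennreal_measurable[OF assms]])
  finally show ?thesis .
qed

lemma FK_Jensen:
  assumes "g \<in> borel_measurable borel" "0 \<le> t"
  shows "(FK t g y)^2 \<le> ennreal (exp (growth_rate * t)) * FK t (\<lambda>x. (g x)^2) y"
proof -
  interpret prob_space "law y" by (rule prob_law)
  have [measurable]: "(\<lambda>w. path_int \<xi> alpha t w) \<in> borel_measurable (law y)"
    by (rule law_measurableI[OF path_int_path_measurable[OF alpha_measurable]])
  note [measurable] = ext_ennreal_measurable[OF assms]
  define W where "W = (\<lambda>w. ennreal (exp (path_int \<xi> alpha t w / 2)))"
  have [measurable]: "W \<in> borel_measurable (law y)" unfolding W_def by measurable
  have W2: "W w * W w = ennreal (exp (path_int \<xi> alpha t w))" for w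
    by (simp add: W_def ennreal_mult[symmetric] exp_add[symmetric])
  have e: "ext (\<lambda>x. (g x)^2) z = (ext g z)^2" for z by (cases z) auto
  have "(FK t g y)^2 = (\<integral>\<^sup>+w. W w * (W w * ext g (\<xi> t w)) \<partial>law y)^2"
    unfolding FK_def by (simp add: W2[symmetric] mult.assoc)
  also have "\<dots> \<le> (\<integral>\<^sup>+w. (W w)^2 \<partial>law y) * (\<integral>\<^sup>+w. (W w * ext g (\<xi> t w))^2 \<partial>law y)"
    by (rule Cauchy_Schwarz_nn_integral) measurable
  also have "(\<integral>\<^sup>+w. (W w * ext g (\<xi> t w))^2 \<partial>law y) = FK t (\<lambda>x. (g x)^2) y"
    unfolding FK_def e W2[symmetric] by (simp add: power2_eq_square mult_ac)
  also have "(\<integral>\<^sup>+w. (W w)^2 \<partial>law y) \<le> (\<integral>\<^sup>+w. ennreal (exp (growth_rate * t)) \<partial>law y)"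
    using exp_path_int_bound(1)[OF assms(2)]
    by (intro nn_integral_mono) (simp add: power2_eq_square W2 ennreal_leI)
  also have "\<dots> = ennreal (exp (growth_rate * t))" by (simp add: emeasure_law_space)
  finally show ?thesis by (simp add: mult_right_mono)
qed

text \<open>The semigroup property identifies \<open>p (2 * t) x y\<close> with \<open>\<integral>p t x z * p t z y dz\<close> for almost every
  \<open>y\<close>. As \<open>\<mu>\<close> has full support, such \<open>y\<close> exist arbitrarily close to \<open>x\<close>, and Fatou's lemma passes to the
  limit \<open>y = x\<close>.\<close>

lemma kernel_diagonal:
  assumes t: "0 < t"
  shows "(\<integral>\<^sup>+z. ennreal (p t x z)^2 \<partial>\<mu>) \<le> ennreal (p (2 * t) x x)"
proof -
  interpret sigma_finite_measure \<mu> by (rule sigma_finite_mu)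
  interpret mm: pair_sigma_finite \<mu> \<mu> ..
  have t2: "0 < 2 * t" using t by simp
  note pm [measurable] = kernel_measurable[OF density_p t]
  note pm2 [measurable] = kernel_measurable[OF density_p t2]
  note sym = nice_density_sym[OF density_p t] and pos = nice_density_pos[OF density_p t]
  define h where "h = (\<lambda>y. \<integral>\<^sup>+z. ennreal (p t x z) * ennreal (p t z y) \<partial>\<mu>)"
  have hm [measurable]: "h \<in> borel_measurable borel"
  proof -
    have "(\<lambda>(y, z). ennreal (p t x z) * ennreal (p t z y)) \<in> borel_measurable (borel \<Otimes>\<^sub>M \<mu>)"
    proof -
      have "(\<lambda>p'. (snd p', fst p')) \<in> (borel :: 'a measure) \<Otimes>\<^sub>M \<mu> \<rightarrow>\<^sub>M borel \<Otimes>\<^sub>M borel" by measurable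
      note [measurable] = measurable_compose[OF this pm(1), simplified]
      show ?thesis unfolding split_beta' by measurable
    qed
    then show ?thesis unfolding h_def by (rule borel_measurable_nn_integral)
  qed
  have deq: "density \<mu> h = density \<mu> (\<lambda>y. ennreal (p (2 * t) x y))"
  proof (rule measure_eqI)
    fix B assume "B \<in> sets (density \<mu> h)"
    then have Bm: "B \<in> sets \<mu>" by simp
    then have B [measurable]: "B \<in> sets borel" by (simp only: borel_mu)
    have gB: "(indicator B :: 'a \<Rightarrow> ennreal) \<in> borel_measurable borel" by measurable
    have "emeasure (density \<mu> (\<lambda>y. ennreal (p (2 * t) x y))) B = (\<integral>\<^sup>+y. ennreal (p (2 * t) x y) * indicator B y \<partial>\<mu>)"
      by (rule emeasure_density[OF _ Bm]) measurable
    also have "\<dots> = PT (t + t) (indicator B) (Some x)"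
      by (simp only: PT_density[OF t2 gB] mult_2[symmetric])
    also have "\<dots> = PT t (\<lambda>z. PT t (indicator B) (Some z)) (Some x)"
      using t by (intro PT_semigroup gB) auto
    also have "\<dots> = (\<integral>\<^sup>+z. ennreal (p t x z) * (\<integral>\<^sup>+y. ennreal (p t z y) * indicator B y \<partial>\<mu>) \<partial>\<mu>)"
      unfolding PT_density[OF t gB] by (rule PT_density[OF t]) measurable
    also have "\<dots> = (\<integral>\<^sup>+z. (\<integral>\<^sup>+y. ennreal (p t x z) * ennreal (p t z y) * indicator B y \<partial>\<mu>) \<partial>\<mu>)"
      by (simp add: nn_integral_cmult[symmetric] mult.assoc)
    also have "\<dots> = (\<integral>\<^sup>+y. (\<integral>\<^sup>+z. ennreal (p t x z) * ennreal (p t z y) * indicator B y \<partial>\<mu>) \<partial>\<mu>)"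
    proof (rule mm.Fubini')
      have "(\<lambda>p'. (snd p', fst p')) \<in> \<mu> \<Otimes>\<^sub>M \<mu> \<rightarrow>\<^sub>M borel \<Otimes>\<^sub>M borel" by measurable
      note [measurable] = measurable_compose[OF this pm(1), simplified]
      show "(\<lambda>(y, z). ennreal (p t x z) * ennreal (p t z y) * indicator B y) \<in> borel_measurable (\<mu> \<Otimes>\<^sub>M \<mu>)"
        unfolding split_beta' by measurable
    qed
    also have "\<dots> = (\<integral>\<^sup>+y. h y * indicator B y \<partial>\<mu>)"
      unfolding h_def by (intro nn_integral_cong nn_integral_multc) measurable
    also have "\<dots> = emeasure (density \<mu> h) B"
      by (rule emeasure_density[OF _ Bm, symmetric]) measurable
    finally show "emeasure (density \<mu> h) B = emeasure (density \<mu> (\<lambda>y. ennreal (p (2 * t) x y))) B" ..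
  qed simp
  have AE_eq: "AE y in \<mu>. h y = ennreal (p (2 * t) x y)"
    by (rule density_unique[OF _ _ deq]) measurable
  have "\<exists>y. dist x y < 1 / real (Suc n) \<and> h y = ennreal (p (2 * t) x y)" for n
  proof (rule ccontr)
    assume "\<not> ?thesis"
    then have "AE y in \<mu>. y \<notin> ball x (1 / real (Suc n))" using AE_eq by (auto elim!: eventually_mono)
    then have "emeasure \<mu> (ball x (1 / real (Suc n))) = 0"
      by (subst (asm) AE_iff_measurable[OF _ refl]) (auto simp: borel_mu ball_def)
    moreover have "ball x (1 / real (Suc n)) \<noteq> {}" by simp
    ultimately show False using full_support[of "ball x (1 / real (Suc n))"] by simp
  qed
  then obtain y where y: "\<And>n. dist x (y n) < 1 / real (Suc n)" "\<And>n. h (y n) = ennreal (p (2 * t) x (y n))" by metis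
  have y_lim: "y \<longlonglongrightarrow> x"
  proof (rule tendsto_dist_iff[THEN iffD2], rule tendsto_sandwich[where f = "\<lambda>_. 0" and h = "\<lambda>n. 1 / real (Suc n)"])
    show "(\<lambda>n. 1 / real (Suc n)) \<longlonglongrightarrow> 0" by (rule LIMSEQ_Suc[OF lim_1_over_n])
  qed (use y in \<open>auto intro!: always_eventually less_imp_le simp: dist_commute\<close>)
  have cont: "(\<lambda>n. p s a (y n)) \<longlonglongrightarrow> p s a x" if "0 < s" for s a
  proof -
    have "continuous_on UNIV (\<lambda>(x, y). p s x y)" by (rule nice_density_continuous[OF density_p that])
    then have "isCont (\<lambda>(x, y). p s x y) (a, x)" by (simp add: continuous_on_eq_continuous_at)
    then show ?thesis
      using isCont_tendsto_compose[of "(a, x)" "\<lambda>(x, y). p s x y" "\<lambda>n. (a, y n)" sequentially] tendsto_Pair[OF tendsto_const y_lim, of a] by simp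
  qed
  have "(\<integral>\<^sup>+z. ennreal (p t x z)^2 \<partial>\<mu>) = (\<integral>\<^sup>+z. liminf (\<lambda>n. ennreal (p t x z * p t z (y n))) \<partial>\<mu>)"
  proof (intro nn_integral_cong)
    fix z
    have "(\<lambda>n. ennreal (p t x z * p t z (y n))) \<longlonglongrightarrow> ennreal (p t x z * p t z x)"
      by (intro tendsto_intros cont t)
    then have "liminf (\<lambda>n. ennreal (p t x z * p t z (y n))) = ennreal (p t x z * p t z x)"
      by (intro lim_imp_Liminf) auto
    then show "ennreal (p t x z)^2 = liminf (\<lambda>n. ennreal (p t x z * p t z (y n)))"
      using ennreal_mult[OF less_imp_le[OF pos[of x z]] less_imp_le[OF pos[of x z]]]
      by (simp only: sym[of z x] power2_eq_square)
  qed
  also have "\<dots> \<le> liminf (\<lambda>n. \<integral>\<^sup>+z. ennreal (p t x z * p t z (y n)) \<partial>\<mu>)"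
    by (rule nn_integral_liminf) measurable
  also have "\<dots> = liminf (\<lambda>n. ennreal (p (2 * t) x (y n)))"
  proof -
    have "ennreal (p t x z * p t z (y n)) = ennreal (p t x z) * ennreal (p t z (y n))" for z n
      by (rule ennreal_mult[OF less_imp_le[OF pos] less_imp_le[OF pos]])
    then have "(\<integral>\<^sup>+z. ennreal (p t x z * p t z (y n)) \<partial>\<mu>) = h (y n)" for n by (simp only: h_def)
    then show ?thesis by (simp only: y(2))
  qed
  also have "\<dots> = ennreal (p (2 * t) x x)"
    by (intro lim_imp_Liminf) (auto intro!: tendsto_ennrealI cont[OF t2])
  finally show ?thesis .
qed

text \<open>The Cauchy--Schwarz inequality against the density \<open>p t x\<close>.\<close>

lemma FK_pointwise:
  assumes t: "0 < t" and g [measurable]: "g \<in> borel_measurable borel"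
  shows "(FK t g (Some x))^2 \<le> ennreal (exp (2 * growth_rate * t) * p (2 * t) x x) * (\<integral>\<^sup>+z. (g z)^2 \<partial>\<mu>)"
proof -
  note pm [measurable] = kernel_measurable[OF density_p t]
  have "(FK t g (Some x))^2 \<le> (ennreal (exp (growth_rate * t)) * (\<integral>\<^sup>+z. ennreal (p t x z) * g z \<partial>\<mu>))^2"
    using FK_le_PT[OF g, of t "Some x"] t unfolding PT_density[OF t g] by (intro power_mono) auto
  also have "\<dots> = ennreal (exp (growth_rate * t))^2 * (\<integral>\<^sup>+z. ennreal (p t x z) * g z \<partial>\<mu>)^2"
    by (rule power_mult_distrib)
  also have "\<dots> \<le> ennreal (exp (growth_rate * t))^2 * ((\<integral>\<^sup>+z. ennreal (p t x z)^2 \<partial>\<mu>) * (\<integral>\<^sup>+z. (g z)^2 \<partial>\<mu>))"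
    by (intro mult_left_mono Cauchy_Schwarz_nn_integral) measurable
  also have "\<dots> \<le> ennreal (exp (growth_rate * t))^2 * (ennreal (p (2 * t) x x) * (\<integral>\<^sup>+z. (g z)^2 \<partial>\<mu>))"
    by (intro mult_left_mono mult_right_mono kernel_diagonal[OF t]) auto
  also have "\<dots> = ennreal (exp (2 * growth_rate * t) * p (2 * t) x x) * (\<integral>\<^sup>+z. (g z)^2 \<partial>\<mu>)"
  proof -
    have e: "exp (2 * growth_rate * t) = exp (growth_rate * t)^2"
      using exp_double[of "growth_rate * t"] by (simp only: mult.assoc)
    have "0 < p (2 * t) x x" using t by (intro nice_density_pos[OF density_p]) simp
    then have "ennreal (exp (growth_rate * t)^2 * p (2 * t) x x) = ennreal (exp (growth_rate * t)^2) * ennreal (p (2 * t) x x)"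
      by (intro ennreal_mult zero_le_power2 less_imp_le)
    also have "ennreal (exp (growth_rate * t)^2) = ennreal (exp (growth_rate * t))^2"
      by (rule ennreal_power[symmetric]) (rule exp_ge_zero)
    finally show ?thesis unfolding e by (simp only: mult.assoc)
  qed
  finally show ?thesis .
qed

end

section \<open>Decay of the Feynman--Kac semigroup\<close>

context branching_model
begin

abbreviation TS :: "real \<Rightarrow> ('a \<Rightarrow> real) \<Rightarrow> 'a \<Rightarrow> real" where
  "TS \<equiv> FK_sg \<xi> law alpha"

lemma weight_measurable: "(\<lambda>w. exp (path_int \<xi> alpha t w)) \<in> borel_measurable (law y)"
  using law_measurableI[OF path_int_path_measurable[OF alpha_measurable]] by measurable

lemma L2_borel: "g \<in> L2_space \<mu> \<Longrightarrow> g \<in> borel_measurable borel"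
  by (simp add: L2_space_def measurable_cong_sets[OF borel_mu refl])

lemma FK_norm:
  "FK t (\<lambda>x. ennreal \<bar>g x\<bar>) y = (\<integral>\<^sup>+w. ennreal (norm (exp (path_int \<xi> alpha t w) * ext g (\<xi> t w))) \<partial>law y)"
proof -
  have "ext (\<lambda>x. ennreal \<bar>g x\<bar>) z = ennreal \<bar>ext g z\<bar>" for z by (cases z) auto
  then show ?thesis by (simp add: FK_def abs_mult ennreal_mult)
qed

lemma TS_abs: "ennreal \<bar>TS t g x\<bar> \<le> FK t (\<lambda>x. ennreal \<bar>g x\<bar>) (Some x)"
  unfolding FK_norm FK_sg_def
  using integral_norm_bound_ennreal[of "law (Some x)" "\<lambda>w. exp (path_int \<xi> alpha t w) * ext g (\<xi> t w)"]
  by (cases "integrable (law (Some x)) (\<lambda>w. exp (path_int \<xi> alpha t w) * ext g (\<xi> t w))")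
     (simp_all add: not_integrable_integral_eq)

lemma TS_nonneg:
  assumes u: "u \<in> borel_measurable borel" "\<And>x. 0 \<le> u x" and t: "0 \<le> t"
    and fin: "FK t (\<lambda>x. ennreal (u x)) (Some x) < top"
  shows "integrable (law (Some x)) (\<lambda>w. exp (path_int \<xi> alpha t w) * ext u (\<xi> t w))"
    and "ennreal (TS t u x) = FK t (\<lambda>x. ennreal (u x)) (Some x)" and "0 \<le> TS t u x"
proof -
  have ab: "(\<lambda>x. ennreal \<bar>u x\<bar>) = (\<lambda>x. ennreal (u x))" using u(2) by simp
  have pos: "0 \<le> ext u z" for z using u(2) by (cases z) auto
  show int: "integrable (law (Some x)) (\<lambda>w. exp (path_int \<xi> alpha t w) * ext u (\<xi> t w))"
  proof (rule integrableI_bounded)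
    show "(\<lambda>w. exp (path_int \<xi> alpha t w) * ext u (\<xi> t w)) \<in> borel_measurable (law (Some x))"
      by (intro borel_measurable_times weight_measurable ext_real_measurable u t)
    show "(\<integral>\<^sup>+w. ennreal (norm (exp (path_int \<xi> alpha t w) * ext u (\<xi> t w))) \<partial>law (Some x)) < \<infinity>"
      using fin unfolding FK_norm[symmetric] ab infinity_ennreal_def .
  qed
  have "ennreal (TS t u x) = (\<integral>\<^sup>+w. ennreal (exp (path_int \<xi> alpha t w) * ext u (\<xi> t w)) \<partial>law (Some x))"
    unfolding FK_sg_def using pos by (intro nn_integral_eq_integral[symmetric] int) auto
  also have "\<dots> = FK t (\<lambda>x. ennreal \<bar>u x\<bar>) (Some x)" unfolding FK_norm using pos by simp
  finally show "ennreal (TS t u x) = FK t (\<lambda>x. ennreal (u x)) (Some x)" by (simp only: ab)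
  show "0 \<le> TS t u x" unfolding FK_sg_def using pos by (intro integral_nonneg_AE) auto
qed

lemma TS_diff:
  assumes u: "u \<in> borel_measurable borel" "\<And>x. 0 \<le> u x" and v: "v \<in> borel_measurable borel" "\<And>x. 0 \<le> v x"
    and t: "0 \<le> t" and fin: "FK t (\<lambda>x. ennreal (u x)) (Some x) < top" "FK t (\<lambda>x. ennreal (v x)) (Some x) < top"
  shows "TS t (\<lambda>x. u x - v x) x = TS t u x - TS t v x"
proof -
  have "ext (\<lambda>x. u x - v x) z = ext u z - ext v z" for z by (cases z) auto
  then show ?thesis
    unfolding FK_sg_def
    using Bochner_Integration.integral_diff[OF TS_nonneg(1)[OF u t fin(1)] TS_nonneg(1)[OF v t fin(2)]]
    by (simp add: right_diff_distrib)
qed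

lemma FK_finite_L2:
  assumes g: "g \<in> L2_space \<mu>" and t: "0 < t"
  shows "FK t (\<lambda>x. ennreal \<bar>g x\<bar>) (Some x) < top"
proof -
  note gm = L2_borel[OF g]
  have "(FK t (\<lambda>x. ennreal \<bar>g x\<bar>) (Some x))^2 \<le> ennreal (exp (2 * growth_rate * t) * p (2 * t) x x) * (\<integral>\<^sup>+z. (ennreal \<bar>g z\<bar>)^2 \<partial>\<mu>)"
    by (rule FK_pointwise[OF t]) (use gm in measurable)
  also have "\<dots> < top" unfolding L2_nn_integral[OF g] by (simp add: ennreal_mult_less_top)
  finally show ?thesis by (simp add: power2_eq_square ennreal_mult_less_top) (auto simp: less_top)
qed

lemma FK_symmetric:
  assumes t: "0 < t" and g: "g \<in> borel_measurable borel" and h: "h \<in> borel_measurable borel"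
  shows "(\<integral>\<^sup>+x. FK t g (Some x) * h x \<partial>\<mu>) = (\<integral>\<^sup>+x. g x * FK t h (Some x) \<partial>\<mu>)"
proof -
  interpret sigma_finite_measure \<mu> by (rule sigma_finite_mu)
  interpret mm: pair_sigma_finite \<mu> \<mu> ..
  note [measurable] = kernel_measurable[OF density_q t] g h
  have "(\<integral>\<^sup>+x. FK t g (Some x) * h x \<partial>\<mu>) = (\<integral>\<^sup>+x. (\<integral>\<^sup>+y. ennreal (q t x y) * g y * h x \<partial>\<mu>) \<partial>\<mu>)"
    unfolding FK_density[OF t g] by (intro nn_integral_cong nn_integral_multc[symmetric]) measurable
  also have "\<dots> = (\<integral>\<^sup>+y. (\<integral>\<^sup>+x. ennreal (q t x y) * g y * h x \<partial>\<mu>) \<partial>\<mu>)"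
  proof (rule mm.Fubini')
    have "(\<lambda>p'. (snd p', fst p')) \<in> \<mu> \<Otimes>\<^sub>M \<mu> \<rightarrow>\<^sub>M borel \<Otimes>\<^sub>M borel" by measurable
    note [measurable] = measurable_compose[OF this kernel_measurable(1)[OF density_q t], simplified]
    show "(\<lambda>(y, x). ennreal (q t x y) * g y * h x) \<in> borel_measurable (\<mu> \<Otimes>\<^sub>M \<mu>)"
      unfolding split_beta' by measurable
  qed
  also have "\<dots> = (\<integral>\<^sup>+y. g y * (\<integral>\<^sup>+x. ennreal (q t y x) * h x \<partial>\<mu>) \<partial>\<mu>)"
  proof (intro nn_integral_cong)
    fix y
    have "(\<integral>\<^sup>+x. ennreal (q t x y) * g y * h x \<partial>\<mu>) = (\<integral>\<^sup>+x. g y * (ennreal (q t y x) * h x) \<partial>\<mu>)"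
      using nice_density_sym[OF density_q t, of y] by (intro nn_integral_cong) (simp add: mult_ac)
    also have "\<dots> = g y * (\<integral>\<^sup>+x. ennreal (q t y x) * h x \<partial>\<mu>)" by (rule nn_integral_cmult) measurable
    finally show "(\<integral>\<^sup>+x. ennreal (q t x y) * g y * h x \<partial>\<mu>) = g y * (\<integral>\<^sup>+x. ennreal (q t y x) * h x \<partial>\<mu>)" .
  qed
  finally show ?thesis by (simp only: FK_density[OF t h])
qed

lemma FK_one: "0 \<le> t \<Longrightarrow> FK t (\<lambda>x. 1) y \<le> ennreal (exp (growth_rate * t))"
proof -
  assume t: "0 \<le> t"
  have "FK t (\<lambda>x. 1) y \<le> ennreal (exp (growth_rate * t)) * PT t (\<lambda>x. 1) y"
    by (rule FK_le_PT[OF _ t]) measurable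
  also have "PT t (\<lambda>x. 1) y \<le> (\<integral>\<^sup>+w. 1 \<partial>law y)"
    unfolding PT_def by (intro nn_integral_mono) (auto simp: ext_def split: option.splits)
  also have "\<dots> = 1" by (simp add: emeasure_law_space)
  finally show ?thesis by (simp add: mult_left_mono)
qed

lemma FK_L2_bound:
  assumes t: "0 < t" and g: "g \<in> borel_measurable borel"
  shows "(\<integral>\<^sup>+x. (FK t g (Some x))^2 \<partial>\<mu>) \<le> ennreal (exp (growth_rate * t))^2 * (\<integral>\<^sup>+x. (g x)^2 \<partial>\<mu>)"
proof -
  let ?c = "ennreal (exp (growth_rate * t))"
  note [measurable] = g
  have g2: "(\<lambda>x. (g x)^2) \<in> borel_measurable borel" by measurable
  note Fm [measurable] = FK_measurable_place(2)[OF g2 less_imp_le[OF t]]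
  have "(\<integral>\<^sup>+x. (FK t g (Some x))^2 \<partial>\<mu>) \<le> (\<integral>\<^sup>+x. ?c * FK t (\<lambda>x. (g x)^2) (Some x) \<partial>\<mu>)"
    by (intro nn_integral_mono FK_Jensen g less_imp_le[OF t])
  also have "\<dots> = ?c * (\<integral>\<^sup>+x. FK t (\<lambda>x. (g x)^2) (Some x) * 1 \<partial>\<mu>)"
    by (simp only: mult_1_right) (rule nn_integral_cmult, measurable)
  also have "(\<integral>\<^sup>+x. FK t (\<lambda>x. (g x)^2) (Some x) * 1 \<partial>\<mu>) = (\<integral>\<^sup>+x. (g x)^2 * FK t (\<lambda>x. 1) (Some x) \<partial>\<mu>)"
    by (rule FK_symmetric[OF t g2]) measurable
  also have "\<dots> \<le> (\<integral>\<^sup>+x. ?c * (g x)^2 \<partial>\<mu>)"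
    by (intro nn_integral_mono, subst mult.commute) (intro mult_right_mono FK_one less_imp_le[OF t], simp)
  also have "\<dots> = ?c * (\<integral>\<^sup>+x. (g x)^2 \<partial>\<mu>)" by (rule nn_integral_cmult) measurable
  finally show ?thesis by (simp add: power2_eq_square mult.assoc mult_left_mono)
qed

lemma TS_L2: "0 \<le> t \<Longrightarrow> g \<in> L2_space \<mu> \<Longrightarrow> TS t g \<in> L2_space \<mu>"
  using strongly_continuous unfolding strongly_continuous_semigroup_def by blast

lemma TS_growth:
  assumes t: "0 \<le> t" and g: "g \<in> L2_space \<mu>"
  shows "L2_norm \<mu> (TS t g) \<le> exp (growth_rate * t) * L2_norm \<mu> g"
proof (cases "t = 0")
  case True
  have "AE x in \<mu>. TS 0 g x = g x"
    using strongly_continuous g unfolding strongly_continuous_semigroup_def by blast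
  then have "L2_norm \<mu> (TS 0 g) = L2_norm \<mu> g" by (intro L2_norm_cong_AE TS_L2 g order_refl)
  then show ?thesis using True by simp
next
  case False
  with t have t: "0 < t" by simp
  have gm: "(\<lambda>x. ennreal \<bar>g x\<bar>) \<in> borel_measurable borel" using L2_borel[OF g] by measurable
  have "ennreal ((L2_norm \<mu> (TS t g))^2) = (\<integral>\<^sup>+x. ennreal \<bar>TS t g x\<bar> ^ 2 \<partial>\<mu>)"
    by (rule L2_nn_integral[symmetric, OF TS_L2[OF less_imp_le[OF t] g]])
  also have "\<dots> \<le> (\<integral>\<^sup>+x. (FK t (\<lambda>x. ennreal \<bar>g x\<bar>) (Some x))^2 \<partial>\<mu>)"
    by (intro nn_integral_mono power_mono TS_abs) auto
  also have "\<dots> \<le> ennreal (exp (growth_rate * t))^2 * (\<integral>\<^sup>+x. (ennreal \<bar>g x\<bar>)^2 \<partial>\<mu>)"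
    by (rule FK_L2_bound[OF t gm])
  also have "\<dots> = ennreal ((exp (growth_rate * t) * L2_norm \<mu> g)^2)"
    unfolding L2_nn_integral[OF g] by (simp add: ennreal_power ennreal_mult[symmetric] power_mult_distrib)
  finally have "(L2_norm \<mu> (TS t g))^2 \<le> (exp (growth_rate * t) * L2_norm \<mu> g)^2"
    by (subst (asm) ennreal_le_iff) auto
  then show ?thesis by (rule power2_le_imp_le) (simp add: L2_norm_nonneg)
qed

lemma pos_neg_parts:
  assumes "g \<in> L2_space \<mu>"
  shows "(\<lambda>x. max 0 (g x)) \<in> L2_space \<mu>" "(\<lambda>x. max 0 (- g x)) \<in> L2_space \<mu>"
    and "g = (\<lambda>x. max 0 (g x) - max 0 (- g x))"
proof -
  have gm [measurable]: "g \<in> borel_measurable \<mu>" and gi: "integrable \<mu> (\<lambda>x. (g x)^2)"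
    using assms by (auto simp: L2_space_def)
  have "integrable \<mu> (\<lambda>x. (max 0 (g x))^2)" "integrable \<mu> (\<lambda>x. (max 0 (- g x))^2)"
    by (rule Bochner_Integration.integrable_bound[OF gi]; auto simp: max_def)+
  then show "(\<lambda>x. max 0 (g x)) \<in> L2_space \<mu>" "(\<lambda>x. max 0 (- g x)) \<in> L2_space \<mu>"
    by (simp_all add: L2_space_def)
  show "g = (\<lambda>x. max 0 (g x) - max 0 (- g x))" by (auto simp: max_def)
qed

lemma TS_L2_nonneg:
  assumes u: "u \<in> L2_space \<mu>" "\<And>x. 0 \<le> u x" and t: "0 < t"
  shows "ennreal (TS t u x) = FK t (\<lambda>x. ennreal (u x)) (Some x)" "0 \<le> TS t u x"
    "FK t (\<lambda>x. ennreal (u x)) (Some x) < top"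
proof -
  show fin: "FK t (\<lambda>x. ennreal (u x)) (Some x) < top" using FK_finite_L2[OF u(1) t, of x] u(2) by simp
  show "ennreal (TS t u x) = FK t (\<lambda>x. ennreal (u x)) (Some x)" "0 \<le> TS t u x"
    using TS_nonneg[OF L2_borel[OF u(1)] u(2) less_imp_le[OF t] fin] by auto
qed

lemma TS_parts:
  assumes g: "g \<in> L2_space \<mu>" and t: "0 < t"
  shows "TS t g x = TS t (\<lambda>x. max 0 (g x)) x - TS t (\<lambda>x. max 0 (- g x)) x"
proof -
  note P = pos_neg_parts[OF g]
  have "TS t (\<lambda>x. max 0 (g x) - max 0 (- g x)) x = TS t (\<lambda>x. max 0 (g x)) x - TS t (\<lambda>x. max 0 (- g x)) x"
    by (intro TS_diff L2_borel[OF P(1)] L2_borel[OF P(2)] less_imp_le[OF t] TS_L2_nonneg(3)[OF P(1) _ t] TS_L2_nonneg(3)[OF P(2) _ t]) auto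
  then show ?thesis using P(3) by simp
qed

lemma TS_symmetric_nonneg:
  assumes u: "u \<in> L2_space \<mu>" "\<And>x. 0 \<le> u x" and v: "v \<in> L2_space \<mu>" "\<And>x. 0 \<le> v x" and t: "0 < t"
  shows "L2_inner \<mu> (TS t u) v = L2_inner \<mu> u (TS t v)"
proof -
  have 1: "ennreal (L2_inner \<mu> a b) = (\<integral>\<^sup>+x. ennreal (a x) * ennreal (b x) \<partial>\<mu>)" "0 \<le> L2_inner \<mu> a b"
    if "a \<in> L2_space \<mu>" "b \<in> L2_space \<mu>" "\<And>x. 0 \<le> a x" "\<And>x. 0 \<le> b x" for a b
  proof -
    show "ennreal (L2_inner \<mu> a b) = (\<integral>\<^sup>+x. ennreal (a x) * ennreal (b x) \<partial>\<mu>)"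
      unfolding L2_inner_def using that L2_mult_integrable[OF that(1,2)]
      by (simp add: nn_integral_eq_integral flip: ennreal_mult)
    show "0 \<le> L2_inner \<mu> a b" unfolding L2_inner_def using that by (intro integral_nonneg_AE) auto
  qed
  have "ennreal (L2_inner \<mu> (TS t u) v) = (\<integral>\<^sup>+x. ennreal (TS t u x) * ennreal (v x) \<partial>\<mu>)"
    by (intro 1 TS_L2 u v less_imp_le[OF t] TS_L2_nonneg(2)[OF u t])
  also have "\<dots> = (\<integral>\<^sup>+x. ennreal (u x) * ennreal (TS t v x) \<partial>\<mu>)"
    unfolding TS_L2_nonneg(1)[OF u t] TS_L2_nonneg(1)[OF v t]
    by (rule FK_symmetric[OF t]) (use L2_borel[OF u(1)] L2_borel[OF v(1)] in measurable)
  also have "\<dots> = ennreal (L2_inner \<mu> u (TS t v))"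
    by (intro 1(1)[symmetric] TS_L2 u v less_imp_le[OF t] TS_L2_nonneg(2)[OF v t])
  finally show ?thesis
    using 1(2)[OF TS_L2[OF less_imp_le[OF t] u(1)] v(1) TS_L2_nonneg(2)[OF u t] v(2)]
      1(2)[OF u(1) TS_L2[OF less_imp_le[OF t] v(1)] u(2) TS_L2_nonneg(2)[OF v t]]
    by (simp add: ennreal_inj)
qed

lemma TS_symmetric:
  assumes t: "0 \<le> t" and g: "g \<in> L2_space \<mu>" and h: "h \<in> L2_space \<mu>"
  shows "L2_inner \<mu> (TS t g) h = L2_inner \<mu> g (TS t h)"
proof (cases "t = 0")
  case True
  have "AE x in \<mu>. TS 0 g x = g x" if "g \<in> L2_space \<mu>" for g
    using strongly_continuous that unfolding strongly_continuous_semigroup_def by blast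
  then have "L2_inner \<mu> (TS 0 g) h = L2_inner \<mu> g h" "L2_inner \<mu> (TS 0 h) g = L2_inner \<mu> h g"
    using g h by (auto intro!: L2_inner_cong_AE TS_L2)
  then show ?thesis using True by (simp add: L2_inner_commute)
next
  case False
  with t have t: "0 < t" by simp
  have P1: "L2_inner \<mu> (TS t g) h = L2_inner \<mu> (TS t (\<lambda>x. max 0 (g x))) (\<lambda>x. max 0 (h x)) - L2_inner \<mu> (TS t (\<lambda>x. max 0 (g x))) (\<lambda>x. max 0 (- h x))
     - L2_inner \<mu> (TS t (\<lambda>x. max 0 (- g x))) (\<lambda>x. max 0 (h x)) + L2_inner \<mu> (TS t (\<lambda>x. max 0 (- g x))) (\<lambda>x. max 0 (- h x))"
    if g: "g \<in> L2_space \<mu>" and h: "h \<in> L2_space \<mu>" for g h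
  proof -
    note G = pos_neg_parts[OF g] and H = pos_neg_parts[OF h]
    have "TS t g = (\<lambda>x. TS t (\<lambda>x. max 0 (g x)) x - TS t (\<lambda>x. max 0 (- g x)) x)"
      by (rule ext) (rule TS_parts[OF g t])
    then have 1: "L2_inner \<mu> (TS t g) k = L2_inner \<mu> (TS t (\<lambda>x. max 0 (g x))) k - L2_inner \<mu> (TS t (\<lambda>x. max 0 (- g x))) k"
      if "k \<in> L2_space \<mu>" for k
      using L2_inner_diff[OF TS_L2[OF less_imp_le[OF t] G(1)] TS_L2[OF less_imp_le[OF t] G(2)] that] by simp
    have 2: "L2_inner \<mu> k h = L2_inner \<mu> k (\<lambda>x. max 0 (h x)) - L2_inner \<mu> k (\<lambda>x. max 0 (- h x))"
      if "k \<in> L2_space \<mu>" for k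
      using L2_inner_diff[OF H(1,2) that] H(3) L2_inner_commute[of \<mu> k] by metis
    show ?thesis
      unfolding 1[OF h] 2[OF TS_L2[OF less_imp_le[OF t] G(1)]] 2[OF TS_L2[OF less_imp_le[OF t] G(2)]] by simp
  qed
  note G = pos_neg_parts[OF g] and H = pos_neg_parts[OF h]
  have sw: "L2_inner \<mu> (TS t u) v = L2_inner \<mu> (TS t v) u" if "u \<in> L2_space \<mu>" "v \<in> L2_space \<mu>" "\<And>x. 0 \<le> u x" "\<And>x. 0 \<le> v x" for u v
    using TS_symmetric_nonneg[OF that(1,3,2,4) t] by (simp add: L2_inner_commute)
  have "L2_inner \<mu> (TS t g) h = L2_inner \<mu> (TS t h) g"
    unfolding P1[OF g h] P1[OF h g]
    using sw[OF G(1) H(1)] sw[OF G(1) H(2)] sw[OF G(2) H(1)] sw[OF G(2) H(2)] by simp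
  then show ?thesis by (simp add: L2_inner_commute)
qed

sublocale FKsg: symmetric_L2_semigroup \<mu> TS growth_rate
proof
  show "strongly_continuous_semigroup \<mu> TS" by (rule strongly_continuous)
  show "L2_inner \<mu> (TS t g) h = L2_inner \<mu> g (TS t h)"
    if "0 \<le> t" "g \<in> L2_space \<mu>" "h \<in> L2_space \<mu>" for t g h by (rule TS_symmetric[OF that])
  show "L2_norm \<mu> (TS t g) \<le> exp (growth_rate * t) * L2_norm \<mu> g"
    if "0 \<le> t" "g \<in> L2_space \<mu>" for t g by (rule TS_growth[OF that])
  show "0 \<le> growth_rate" by (rule growth_rate_nonneg)
  show "compact_operator \<mu> (TS t)" if "0 < t" for t by (rule compact_sg[OF that])
qed

lemma TS_add:
  assumes s: "0 \<le> s" and t: "0 < t" and g: "g \<in> L2_space \<mu>"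
  shows "TS (s + t) g x = TS s (TS t g) x"
proof -
  note G = pos_neg_parts[OF g]
  have st: "0 < s + t" using s t by simp
  define u v where "u = (\<lambda>x. max 0 (g x))" and "v = (\<lambda>x. max 0 (- g x))"
  have u: "u \<in> L2_space \<mu>" "\<And>x. 0 \<le> u x" and v: "v \<in> L2_space \<mu>" "\<And>x. 0 \<le> v x"
    using G by (auto simp: u_def v_def)
  have F: "FK s (\<lambda>x. ennreal (TS t w x)) (Some x) = FK (s + t) (\<lambda>x. ennreal (w x)) (Some x)"
    if w: "w \<in> L2_space \<mu>" "\<And>x. 0 \<le> w x" for w
    unfolding TS_L2_nonneg(1)[OF w t]
    by (rule FK_semigroup[symmetric, OF s less_imp_le[OF t]]) (use L2_borel[OF w(1)] in measurable)
  have fin: "FK s (\<lambda>x. ennreal (TS t w x)) (Some x) < top" if w: "w \<in> L2_space \<mu>" "\<And>x. 0 \<le> w x" for w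
    unfolding F[OF w] by (rule TS_L2_nonneg(3)[OF w st])
  have eq: "TS s (TS t w) x = TS (s + t) w x" if w: "w \<in> L2_space \<mu>" "\<And>x. 0 \<le> w x" for w
  proof -
    note N = TS_nonneg[OF L2_borel[OF TS_L2[OF less_imp_le[OF t] w(1)]] TS_L2_nonneg(2)[OF w t] s fin[OF w]]
    have "ennreal (TS s (TS t w) x) = ennreal (TS (s + t) w x)"
      unfolding N(2) F[OF w] by (rule TS_L2_nonneg(1)[OF w st, symmetric])
    then show ?thesis using N(3) TS_L2_nonneg(2)[OF w st, of x] by (simp add: ennreal_inj)
  qed
  have "TS s (TS t g) x = TS s (\<lambda>y. TS t u y - TS t v y) x"
    unfolding u_def v_def TS_parts[OF g t, abs_def] ..
  also have "\<dots> = TS s (TS t u) x - TS s (TS t v) x"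
    by (intro TS_diff L2_borel TS_L2 u v less_imp_le[OF t] s fin TS_L2_nonneg(2)[OF u t] TS_L2_nonneg(2)[OF v t])
  also have "\<dots> = TS (s + t) g x"
    unfolding eq[OF u] eq[OF v] unfolding u_def v_def by (rule TS_parts[OF g st, symmetric])
  finally show ?thesis ..
qed

lemma TS_pointwise:
  assumes r: "0 < r" and t: "0 < t" and g: "g \<in> L2_space \<mu>"
  shows "(TS (r + t) g x)^2 \<le> exp (2 * growth_rate * r) * p (2 * r) x x * (L2_norm \<mu> (TS t g))^2"
proof -
  have h: "TS t g \<in> L2_space \<mu>" by (rule TS_L2[OF less_imp_le[OF t] g])
  have pp: "0 \<le> p (2 * r) x x" using r by (intro less_imp_le nice_density_pos[OF density_p]) simp
  have "ennreal ((TS (r + t) g x)^2) = ennreal \<bar>TS r (TS t g) x\<bar> ^ 2"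
    by (simp add: TS_add[OF less_imp_le[OF r] t g] ennreal_power)
  also have "\<dots> \<le> (FK r (\<lambda>x. ennreal \<bar>TS t g x\<bar>) (Some x))^2"
    by (intro power_mono TS_abs) auto
  also have "\<dots> \<le> ennreal (exp (2 * growth_rate * r) * p (2 * r) x x) * (\<integral>\<^sup>+z. (ennreal \<bar>TS t g z\<bar>)^2 \<partial>\<mu>)"
    by (rule FK_pointwise[OF r]) (use L2_borel[OF h] in measurable)
  also have "\<dots> = ennreal (exp (2 * growth_rate * r) * p (2 * r) x x * (L2_norm \<mu> (TS t g))^2)"
    unfolding L2_nn_integral[OF h] using pp by (intro ennreal_mult[symmetric]) auto
  finally show ?thesis by (rule ennreal_le_iff[THEN iffD1, rotated]) (use pp in auto)
qed

lemma TS_Jensen: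
  assumes g: "g \<in> borel_measurable borel" and r: "0 \<le> r"
  shows "ennreal ((TS r g y)^2) \<le> ennreal (exp (growth_rate * r)) * FK r (\<lambda>x. ennreal ((g x)^2)) (Some y)"
proof -
  have "ennreal ((TS r g y)^2) = ennreal \<bar>TS r g y\<bar> ^ 2" by (simp add: ennreal_power)
  also have "\<dots> \<le> (FK r (\<lambda>x. ennreal \<bar>g x\<bar>) (Some y))^2" by (intro power_mono TS_abs) auto
  also have "\<dots> \<le> ennreal (exp (growth_rate * r)) * FK r (\<lambda>x. (ennreal \<bar>g x\<bar>)^2) (Some y)"
    by (rule FK_Jensen[OF _ r]) (use g in measurable)
  finally show ?thesis by (simp add: ennreal_power)
qed

text \<open>Estimates at a fixed starting point. The diagonal \<open>p (2 * r) z z\<close> is in \<open>L\<^sup>2\<close>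
  for a suitable \<open>r\<close>, so it converts an \<open>L\<^sup>2\<close> bound on \<open>TS t g\<close> into a pointwise one that can
  be integrated against the semigroup once more.\<close>

lemma FK_pointwise_decay:
  assumes r: "0 < r" and h: "h \<in> L2_space \<mu>" "\<And>z. 0 \<le> h z"
    and decay: "\<And>t. 0 \<le> t \<Longrightarrow> L2_norm \<mu> (TS t h) \<le> B * exp (- l * t)" and B: "0 \<le> B"
  shows "\<exists>C\<ge>0. \<forall>t\<ge>2 * r. FK t (\<lambda>z. ennreal (h z)) (Some x) \<le> ennreal (C * exp (- l * t))"
proof -
  define D where "D = exp (2 * growth_rate * r) * p (2 * r) x x"
  have D: "0 \<le> D" unfolding D_def using r by (intro mult_nonneg_nonneg less_imp_le[OF nice_density_pos[OF density_p]]) auto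
  have "FK t (\<lambda>z. ennreal (h z)) (Some x) \<le> ennreal ((sqrt D * B * exp (l * r)) * exp (- l * t))" if t: "2 * r \<le> t" for t
  proof -
    have t0: "0 < t" "0 < t - r" using r t by auto
    have "(TS t h x)^2 \<le> D * (L2_norm \<mu> (TS (t - r) h))^2"
      using TS_pointwise[OF r t0(2) h(1), of x] by (simp add: D_def)
    also have "\<dots> \<le> D * (B * exp (- l * (t - r)))^2"
      using D decay[of "t - r"] t0 by (intro mult_left_mono power_mono L2_norm_nonneg) auto
    also have "\<dots> = (sqrt D * (B * exp (- l * (t - r))))^2" using D by (simp add: power_mult_distrib)
    finally have "TS t h x \<le> sqrt D * (B * exp (- l * (t - r)))"
      by (rule power2_le_imp_le) (use D B in auto)
    also have "\<dots> = (sqrt D * B * exp (l * r)) * exp (- l * t)"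
    proof -
      have "exp (- l * (t - r)) = exp (l * r) * exp (- l * t)" by (simp add: exp_add[symmetric] algebra_simps)
      then show ?thesis by simp
    qed
    finally show ?thesis unfolding TS_L2_nonneg(1)[OF h t0(1), symmetric] by (rule ennreal_leI)
  qed
  then show ?thesis using D B by (intro exI[of _ "sqrt D * B * exp (l * r)"]) auto
qed

text \<open>For \<open>s\<close> away from both ends of \<open>[0, t]\<close>, the inner square is bounded pointwise by the diagonal of \<open>p\<close>
  and the outer semigroup is estimated at this one function. Near the ends there is no time left for one of
  the two steps; Jensen's inequality then trades the square of \<open>TS\<close> for an application of \<open>FK\<close>,
  so that \<open>s\<close> can be moved to \<open>2 * r\<close> or to \<open>t\<close>.\<close>

lemma variance_integrand_decay:
  assumes r: "0 < r" and diag: "(\<lambda>z. p (2 * r) z z) \<in> L2_space \<mu>"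
    and g: "g \<in> L2_space \<mu>" and g2: "(\<lambda>z. (g z)^2) \<in> L2_space \<mu>"
    and decay: "\<And>t. 0 \<le> t \<Longrightarrow> L2_norm \<mu> (TS t g) \<le> B * exp (- l * t)" and B: "0 \<le> B"
    and top: "\<And>t h. 0 \<le> t \<Longrightarrow> h \<in> L2_space \<mu> \<Longrightarrow> L2_norm \<mu> (TS t h) \<le> B * exp (- (2 * l) * t) * L2_norm \<mu> h"
  shows "\<exists>C\<ge>0. \<forall>t>4 * r. \<forall>s\<in>{0..t}. FK s (\<lambda>z. ennreal ((TS (t - s) g z)^2)) (Some x) \<le> ennreal (C * exp (- (2 * l) * t))"
    and "\<exists>C\<ge>0. \<forall>t>4 * r. FK t (\<lambda>z. ennreal ((g z)^2)) (Some x) \<le> ennreal (C * exp (- (2 * l) * t))"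
proof -
  define a where "a = (\<lambda>z. p (2 * r) z z)"
  have a: "a \<in> L2_space \<mu>" "\<And>z. 0 \<le> a z"
    using diag r by (auto simp: a_def intro!: less_imp_le[OF nice_density_pos[OF density_p]])
  have "\<exists>C\<ge>0. \<forall>t\<ge>2 * r. FK t (\<lambda>z. ennreal (h z)) (Some x) \<le> ennreal (C * exp (- (2 * l) * t))"
    if h: "h \<in> L2_space \<mu>" "\<And>z. 0 \<le> h z" for h
    by (rule FK_pointwise_decay[OF r h, where B = "B * L2_norm \<mu> h"])
       (use top h B in \<open>auto simp: L2_norm_nonneg mult_ac\<close>)
  note * = this
  obtain Ca where Ca: "0 \<le> Ca" "\<And>t. 2 * r \<le> t \<Longrightarrow> FK t (\<lambda>z. ennreal (a z)) (Some x) \<le> ennreal (Ca * exp (- (2 * l) * t))"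
    using *[OF a] by blast
  obtain Cg where Cg: "0 \<le> Cg" "\<And>t. 2 * r \<le> t \<Longrightarrow> FK t (\<lambda>z. ennreal ((g z)^2)) (Some x) \<le> ennreal (Cg * exp (- (2 * l) * t))"
    using *[OF g2] by auto
  show "\<exists>C\<ge>0. \<forall>t>4 * r. FK t (\<lambda>z. ennreal ((g z)^2)) (Some x) \<le> ennreal (C * exp (- (2 * l) * t))"
    using Cg r by (intro exI[of _ Cg]) auto
  define k where "k = exp (2 * growth_rate * r)"
  have k1: "1 \<le> k" using growth_rate_nonneg r by (simp add: k_def)
  have gm: "g \<in> borel_measurable borel" by (rule L2_borel[OF g])
  define C1 where "C1 = k * B^2 * exp (2 * l * r) * Ca"
  have C1: "0 \<le> C1" using k1 Ca by (simp add: C1_def)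
  have case1: "FK s (\<lambda>z. ennreal ((TS (t - s) g z)^2)) (Some x) \<le> ennreal (C1 * exp (- (2 * l) * t))"
    if s: "2 * r \<le> s" "s \<le> t - 2 * r" for s t
  proof -
    define c where "c = k * (B * exp (- l * (t - s - r)))^2"
    have c: "0 \<le> c" using k1 by (simp add: c_def)
    have pt: "(TS (t - s) g z)^2 \<le> c * a z" for z
    proof -
      have tsr: "0 < t - s - r" using s r by simp
      have "(TS (r + (t - s - r)) g z)^2 \<le> k * a z * (L2_norm \<mu> (TS (t - s - r) g))^2"
        unfolding k_def a_def by (rule TS_pointwise[OF r tsr g])
      also have "\<dots> \<le> k * a z * (B * exp (- l * (t - s - r)))^2"
        using decay[of "t - s - r"] tsr a(2)[of z] k1 by (intro mult_left_mono power_mono L2_norm_nonneg) auto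
      finally show ?thesis by (simp add: c_def mult_ac)
    qed
    have s0: "0 \<le> s" using s r by simp
    have am: "(\<lambda>z. ennreal (a z)) \<in> borel_measurable borel" using L2_borel[OF a(1)] by measurable
    have "FK s (\<lambda>z. ennreal ((TS (t - s) g z)^2)) (Some x) \<le> FK s (\<lambda>z. ennreal c * ennreal (a z)) (Some x)"
      using pt c a(2) by (intro FK_mono) (simp add: ennreal_mult[symmetric] ennreal_leI)
    also have "\<dots> = ennreal c * FK s (\<lambda>z. ennreal (a z)) (Some x)" by (rule FK_cmult[OF am s0])
    also have "\<dots> \<le> ennreal c * ennreal (Ca * exp (- (2 * l) * s))" by (intro mult_left_mono Ca s) auto
    also have "\<dots> = ennreal (c * (Ca * exp (- (2 * l) * s)))" using c Ca by (intro ennreal_mult[symmetric]) auto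
    also have "c * (Ca * exp (- (2 * l) * s)) = C1 * exp (- (2 * l) * t)"
    proof -
      have "(exp (- l * (t - s - r)))^2 * exp (- (2 * l) * s) = exp (2 * l * r) * exp (- (2 * l) * t)"
        by (simp add: power2_eq_square exp_add[symmetric] algebra_simps)
      then show ?thesis by (simp add: c_def C1_def power_mult_distrib mult_ac)
    qed
    finally show ?thesis .
  qed
  have case2: "FK s (\<lambda>z. ennreal ((TS (t - s) g z)^2)) (Some x) \<le> ennreal (k * C1 * exp (- (2 * l) * t))"
    if s: "0 \<le> s" "s \<le> 2 * r" and t: "4 * r < t" for s t
  proof -
    define h where "h = TS (t - 2 * r) g"
    have h: "h \<in> L2_space \<mu>" unfolding h_def using t r by (intro TS_L2 g) auto
    have hm: "(\<lambda>z. ennreal ((h z)^2)) \<in> borel_measurable borel" using L2_borel[OF h] by measurable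
    have u0: "0 \<le> 2 * r - s" using s by simp
    have e: "TS (t - s) g z = TS (2 * r - s) h z" for z
      using TS_add[OF u0 _ g, of "t - 2 * r" z] t r by (simp add: h_def)
    have "FK s (\<lambda>z. ennreal ((TS (t - s) g z)^2)) (Some x) \<le> FK s (\<lambda>z. ennreal k * FK (2 * r - s) (\<lambda>z. ennreal ((h z)^2)) (Some z)) (Some x)"
    proof (rule FK_mono)
      fix z
      have "ennreal ((TS (t - s) g z)^2) \<le> ennreal (exp (growth_rate * (2 * r - s))) * FK (2 * r - s) (\<lambda>z. ennreal ((h z)^2)) (Some z)"
        unfolding e by (rule TS_Jensen[OF L2_borel[OF h] u0])
      also have "\<dots> \<le> ennreal k * FK (2 * r - s) (\<lambda>z. ennreal ((h z)^2)) (Some z)"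
        unfolding k_def using s growth_rate_nonneg by (intro mult_right_mono ennreal_leI) (auto simp: algebra_simps)
      finally show "ennreal ((TS (t - s) g z)^2) \<le> ennreal k * FK (2 * r - s) (\<lambda>z. ennreal ((h z)^2)) (Some z)" .
    qed
    also have "\<dots> = ennreal k * FK (s + (2 * r - s)) (\<lambda>z. ennreal ((h z)^2)) (Some x)"
      by (simp only: FK_cmult[OF FK_measurable_place(2)[OF hm u0] s(1)] FK_semigroup[OF s(1) u0 hm])
    also have "\<dots> \<le> ennreal k * ennreal (C1 * exp (- (2 * l) * t))"
      using case1[of "2 * r" t] t r by (intro mult_left_mono) (auto simp: h_def)
    also have "\<dots> = ennreal (k * C1 * exp (- (2 * l) * t))"
      using k1 C1 by (simp add: ennreal_mult[symmetric] mult.assoc)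
    finally show ?thesis .
  qed
  have case3: "FK s (\<lambda>z. ennreal ((TS (t - s) g z)^2)) (Some x) \<le> ennreal (k * Cg * exp (- (2 * l) * t))"
    if s: "t - 2 * r \<le> s" "s \<le> t" and t: "4 * r < t" for s t
  proof -
    have g2m: "(\<lambda>z. ennreal ((g z)^2)) \<in> borel_measurable borel" using gm by measurable
    have u0: "0 \<le> t - s" and s0: "0 \<le> s" using s t r by auto
    have "FK s (\<lambda>z. ennreal ((TS (t - s) g z)^2)) (Some x) \<le> FK s (\<lambda>z. ennreal k * FK (t - s) (\<lambda>z. ennreal ((g z)^2)) (Some z)) (Some x)"
    proof (rule FK_mono)
      fix z
      have "ennreal ((TS (t - s) g z)^2) \<le> ennreal (exp (growth_rate * (t - s))) * FK (t - s) (\<lambda>z. ennreal ((g z)^2)) (Some z)"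
        by (rule TS_Jensen[OF gm u0])
      also have "\<dots> \<le> ennreal k * FK (t - s) (\<lambda>z. ennreal ((g z)^2)) (Some z)"
      proof -
        have "growth_rate * (t - s) \<le> growth_rate * (2 * r)" using s growth_rate_nonneg by (intro mult_left_mono) auto
        then show ?thesis unfolding k_def by (intro mult_right_mono ennreal_leI) (auto simp: mult_ac)
      qed
      finally show "ennreal ((TS (t - s) g z)^2) \<le> ennreal k * FK (t - s) (\<lambda>z. ennreal ((g z)^2)) (Some z)" .
    qed
    also have "\<dots> = ennreal k * FK (s + (t - s)) (\<lambda>z. ennreal ((g z)^2)) (Some x)"
      by (simp only: FK_cmult[OF FK_measurable_place(2)[OF g2m u0] s0] FK_semigroup[OF s0 u0 g2m])
    also have "\<dots> \<le> ennreal k * ennreal (Cg * exp (- (2 * l) * t))"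
      using Cg(2)[of t] t r by (intro mult_left_mono) auto
    also have "\<dots> = ennreal (k * Cg * exp (- (2 * l) * t))"
      using k1 Cg by (simp add: ennreal_mult[symmetric] mult.assoc)
    finally show ?thesis .
  qed
  define C where "C = k * C1 + k * Cg"
  have kC: "0 \<le> k * C1" "0 \<le> k * Cg" "C1 \<le> k * C1"
    using k1 C1 Cg(1) mult_right_mono[OF k1 C1] by simp_all
  have C: "0 \<le> C" "C1 \<le> C" "k * C1 \<le> C" "k * Cg \<le> C"
    unfolding C_def using kC by linarith+
  have "FK s (\<lambda>z. ennreal ((TS (t - s) g z)^2)) (Some x) \<le> ennreal (C * exp (- (2 * l) * t))"
    if t: "4 * r < t" and s: "s \<in> {0..t}" for s t
  proof -
    have up: "ennreal (D * exp (- (2 * l) * t)) \<le> ennreal (C * exp (- (2 * l) * t))" if "D \<le> C" for D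
      using that by (intro ennreal_leI mult_right_mono) auto
    consider "s \<le> 2 * r" | "2 * r \<le> s" "s \<le> t - 2 * r" | "t - 2 * r \<le> s" by linarith
    then show ?thesis
    proof cases
      case 1 then show ?thesis using order_trans[OF case2 up[OF C(3)]] s t by simp
    next
      case 2 then show ?thesis using order_trans[OF case1 up[OF C(2)]] by simp
    next
      case 3 then show ?thesis using order_trans[OF case3 up[OF C(4)]] s t by simp
    qed
  qed
  then show "\<exists>C\<ge>0. \<forall>t>4 * r. \<forall>s\<in>{0..t}. FK s (\<lambda>z. ennreal ((TS (t - s) g z)^2)) (Some x) \<le> ennreal (C * exp (- (2 * l) * t))"
    using C(1) by blast
qed

end

section \<open>Disintegration of the tree\<close>

lemma events_of_subset: "f \<in> M \<rightarrow>\<^sub>M N \<Longrightarrow> events_of M N f \<subseteq> sets M"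
  by (auto simp: events_of_def)

lemma subalgebra_sigma:
  assumes "E \<subseteq> sets M" shows "subalgebra M (sigma (space M) E)"
  unfolding subalgebra_def
proof
  have E: "E \<subseteq> Pow (space M)" using assms sets.space_closed by blast
  show "space (sigma (space M) E) = space M" using E by (rule space_measure_of)
  show "sets (sigma (space M) E) \<subseteq> sets M"
    unfolding sets_measure_of[OF E] by (rule sets.sigma_sets_subset[OF assms])
qed

lemma measurable_sigma_of_events:
  assumes f: "f \<in> M \<rightarrow>\<^sub>M N" and E: "events_of M N f \<subseteq> E" "E \<subseteq> sets M"
  shows "f \<in> sigma (space M) E \<rightarrow>\<^sub>M N"
proof -
  have EP: "E \<subseteq> Pow (space M)" using E(2) sets.space_closed by blast
  have sp: "space (sigma (space M) E) = space M" using EP by (rule space_measure_of)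
  show ?thesis
  proof (rule measurableI)
    fix x assume "x \<in> space (sigma (space M) E)"
    then show "f x \<in> space N" unfolding sp by (rule measurable_space[OF f])
  next
    fix A assume "A \<in> sets N"
    then have "f -` A \<inter> space M \<in> E" using E(1) by (auto simp: events_of_def)
    then show "f -` A \<inter> space (sigma (space M) E) \<in> sets (sigma (space M) E)"
      unfolding sp sets_measure_of[OF EP] by (rule sigma_sets.Basic)
  qed
qed

lemma measurable_sigma_mono:
  assumes f: "f \<in> sigma S E \<rightarrow>\<^sub>M N" and E: "E \<subseteq> E'" "E' \<subseteq> Pow S"
  shows "f \<in> sigma S E' \<rightarrow>\<^sub>M N"
proof -
  have EP: "E \<subseteq> Pow S" using E by blast
  have sp: "space (sigma S E) = space (sigma S E')" using E(2) EP by (simp only: space_measure_of)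
  have "sets (sigma S E) \<subseteq> sets (sigma S E')"
    unfolding sets_measure_of[OF EP] sets_measure_of[OF E(2)] by (rule sigma_sets_mono'[OF E(1)])
  then show ?thesis using f unfolding measurable_def sp by blast
qed

text \<open>A conditional distribution that is known on a generator disintegrates every functional of the
  conditioning \<open>\<sigma>\<close>-algebra and the conditioned variable. The conditional law may be defective, the
  missing mass being the event that \<open>Z\<close> is not observed, i.e. that \<open>D\<close> fails.\<close>

lemma disintegration:
  fixes \<Phi> :: "'m \<times> 'z \<Rightarrow> ennreal"
  assumes M: "prob_space M" and sub: "subalgebra M F" and Z: "Z \<in> M \<rightarrow>\<^sub>M N" and \<kappa>: "\<kappa> \<in> F \<rightarrow>\<^sub>M subprob_algebra N"
    and S: "S \<in> sets F" and D: "D \<in> sets M"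
    and gen: "sets N = sigma_sets (space N) E" "Int_stable E" "E \<subseteq> Pow (space N)"
    and exh: "range A \<subseteq> E" "(\<Union>i::nat. A i) = space N"
    and cond: "\<And>C F0. C \<in> E \<Longrightarrow> F0 \<in> sets F \<Longrightarrow> F0 \<subseteq> S \<Longrightarrow>
       (\<integral>\<^sup>+y. indicator (F0 \<inter> D) y * indicator C (Z y) \<partial>M) = (\<integral>\<^sup>+y. indicator F0 y * emeasure (\<kappa> y) C \<partial>M)"
    and \<Phi>: "\<Phi> \<in> borel_measurable (F \<Otimes>\<^sub>M N)"
  shows "(\<integral>\<^sup>+y. indicator (S \<inter> D) y * \<Phi> (y, Z y) \<partial>M) = (\<integral>\<^sup>+y. indicator S y * (\<integral>\<^sup>+z. \<Phi> (y, z) \<partial>\<kappa> y) \<partial>M)"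
proof -
  interpret prob_space M by (rule M)
  have spF: "space F = space M" and SM: "S \<in> sets M" using sub S by (auto simp: subalgebra_def)
  have idF: "(\<lambda>y. y) \<in> M \<rightarrow>\<^sub>M F" by (rule measurable_from_subalg[OF sub measurable_ident_sets[OF refl]])
  have Z': "(\<lambda>y. (y, Z y)) \<in> M \<rightarrow>\<^sub>M F \<Otimes>\<^sub>M N" by (rule measurable_Pair[OF idF Z])
  define \<kappa>' where "\<kappa>' = (\<lambda>y. distr (\<kappa> y) (F \<Otimes>\<^sub>M N) (Pair y))"
  have "\<kappa>' \<in> F \<rightarrow>\<^sub>M subprob_algebra (F \<Otimes>\<^sub>M N)"
    unfolding \<kappa>'_def by (rule measurable_distr2[OF _ \<kappa>]) simp
  then have \<kappa>': "\<kappa>' \<in> M \<rightarrow>\<^sub>M subprob_algebra (F \<Otimes>\<^sub>M N)" by (rule measurable_from_subalg[OF sub])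
  have s\<kappa>: "sets (\<kappa> y) = sets N" if "y \<in> space M" for y
    using subprob_measurableD(2)[OF \<kappa>] that spF by simp
  have Pm: "Pair y \<in> \<kappa> y \<rightarrow>\<^sub>M F \<Otimes>\<^sub>M N" if "y \<in> space M" for y
    using that spF by (simp add: measurable_cong_sets[OF s\<kappa>[OF that] refl])
  define G where "G = {a \<times> b | a b. a \<in> sets F \<and> b \<in> E}"
  have G: "G \<subseteq> Pow (space (F \<Otimes>\<^sub>M N))"
    using gen(3) sets.space_closed[of F] by (auto simp: G_def space_pair_measure)
  have "sets (F \<Otimes>\<^sub>M N) = sets (sigma (space F \<times> space N) G)"
    unfolding G_def
  proof (rule sets_pair_eq[where Ca = "{space F}" and Cb = "range A"])
    show "sets F = sigma_sets (space F) (sets F)" by (rule sets.sigma_sets_eq[symmetric])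
  qed (use sets.space_closed[of F] gen exh in auto)
  also have "\<dots> = sigma_sets (space (F \<Otimes>\<^sub>M N)) G"
    using G by (simp add: space_pair_measure sets_measure_of)
  finally have gen': "sets (F \<Otimes>\<^sub>M N) = sigma_sets (space (F \<Otimes>\<^sub>M N)) G" .
  have "Int_stable G"
  proof (rule Int_stableI)
    fix X Y assume "X \<in> G" "Y \<in> G"
    then obtain a b c d where "X = a \<times> b" "Y = c \<times> d" "a \<in> sets F" "c \<in> sets F" "b \<in> E" "d \<in> E"
      by (auto simp: G_def)
    moreover have "(a \<times> b) \<inter> (c \<times> d) = (a \<inter> c) \<times> (b \<inter> d)" by auto
    moreover have "b \<inter> d \<in> E" using gen(2) \<open>b \<in> E\<close> \<open>d \<in> E\<close> by (auto simp: Int_stable_def)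
    ultimately have "X \<inter> Y = (a \<inter> c) \<times> (b \<inter> d) \<and> a \<inter> c \<in> sets F \<and> b \<inter> d \<in> E" by auto
    then show "X \<inter> Y \<in> G" unfolding G_def by blast
  qed
  have w: "(indicator (S \<inter> D) :: _ \<Rightarrow> ennreal) \<in> borel_measurable M" and w': "(indicator S :: _ \<Rightarrow> ennreal) \<in> borel_measurable M"
    using SM D by auto
  have fin: "(\<integral>\<^sup>+y. indicator (S \<inter> D) y \<partial>M) < \<infinity>"
    using SM D by (simp add: infinity_ennreal_def top.not_eq_extremum[symmetric])
  have "(\<integral>\<^sup>+y. indicator (S \<inter> D) y * \<Phi> (y, Z y) \<partial>M) = (\<integral>\<^sup>+y. indicator S y * (\<integral>\<^sup>+z. \<Phi> z \<partial>\<kappa>' y) \<partial>M)"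
  proof (rule kernel_disintegration[OF w w' fin Z' \<kappa>' gen' \<open>Int_stable G\<close> G _ _ _ \<Phi>])
    show "range (\<lambda>i. space F \<times> A i) \<subseteq> G" using exh by (auto simp: G_def)
    show "(\<Union>i. space F \<times> A i) = space (F \<Otimes>\<^sub>M N)" using exh(2) by (auto simp: space_pair_measure)
    fix X assume "X \<in> G"
    then obtain a b where X: "X = a \<times> b" "a \<in> sets F" "b \<in> E" by (auto simp: G_def)
    have bN: "b \<in> sets N" using X(3) gen by auto
    have XF: "X \<in> sets (F \<Otimes>\<^sub>M N)" using X(1,2) bN by simp
    have "(\<integral>\<^sup>+y. indicator (S \<inter> D) y * indicator X (y, Z y) \<partial>M) = (\<integral>\<^sup>+y. indicator ((a \<inter> S) \<inter> D) y * indicator b (Z y) \<partial>M)"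
      by (intro nn_integral_cong) (auto simp: X(1) indicator_def)
    also have "\<dots> = (\<integral>\<^sup>+y. indicator (a \<inter> S) y * emeasure (\<kappa> y) b \<partial>M)"
      using X S by (intro cond) auto
    also have "\<dots> = (\<integral>\<^sup>+y. indicator S y * emeasure (\<kappa>' y) X \<partial>M)"
    proof (intro nn_integral_cong)
      fix y assume y: "y \<in> space M"
      have "emeasure (\<kappa>' y) X = emeasure (\<kappa> y) (Pair y -` X \<inter> space (\<kappa> y))"
        unfolding \<kappa>'_def by (rule emeasure_distr[OF Pm[OF y] XF])
      also have "Pair y -` X \<inter> space (\<kappa> y) = (if y \<in> a then b else {})"
        using sets.sets_into_space[OF bN] sets_eq_imp_space_eq[OF s\<kappa>[OF y]] by (auto simp: X(1))
      finally show "indicator (a \<inter> S) y * emeasure (\<kappa> y) b = indicator S y * emeasure (\<kappa>' y) X"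
        by (auto simp: indicator_def)
    qed
    finally show "(\<integral>\<^sup>+y. indicator (S \<inter> D) y * indicator X (y, Z y) \<partial>M) = (\<integral>\<^sup>+y. indicator S y * emeasure (\<kappa>' y) X \<partial>M)" .
  qed
  also have "\<dots> = (\<integral>\<^sup>+y. indicator S y * (\<integral>\<^sup>+z. \<Phi> (y, z) \<partial>\<kappa> y) \<partial>M)"
  proof (intro nn_integral_cong)
    fix y assume y: "y \<in> space M"
    have "(\<integral>\<^sup>+z. \<Phi> z \<partial>\<kappa>' y) = (\<integral>\<^sup>+z. \<Phi> (y, z) \<partial>\<kappa> y)"
      unfolding \<kappa>'_def by (rule nn_integral_distr[OF Pm[OF y]]) (simp add: \<Phi>)
    then show "indicator S y * (\<integral>\<^sup>+z. \<Phi> z \<partial>\<kappa>' y) = indicator S y * (\<integral>\<^sup>+z. \<Phi> (y, z) \<partial>\<kappa> y)" by (simp only:)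
  qed
  finally show ?thesis .
qed

lemma not_None_pred: "f \<in> N \<rightarrow>\<^sub>M Edel \<Longrightarrow> Measurable.pred N (\<lambda>x. f x \<noteq> None)"
proof -
  assume f: "f \<in> N \<rightarrow>\<^sub>M Edel"
  have "f -` {None} \<inter> space N \<in> sets N" by (rule measurable_sets[OF f None_Edel])
  then have "Measurable.pred N (\<lambda>x. f x = None)" by (simp add: pred_def vimage_def Int_def conj_commute)
  then show ?thesis by measurable
qed

context branching_model
begin

text \<open>The law of the age at branching along a given path, as a measure on the finite ages.\<close>

definition age_law :: "'w \<Rightarrow> real measure" where
  "age_law w = density lborel (\<lambda>s. indicator {0..} s * ennreal (ext \<beta> (\<xi> (max 0 s) w) * surv s w))"

lemma age_density_measurable:
  "(\<lambda>s. indicator {0..} s * ennreal (ext \<beta> (\<xi> (max 0 s) w) * surv s w)) \<in> borel_measurable lborel"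
proof -
  have "(\<lambda>s. path_int \<xi> \<beta> s w) \<in> borel_measurable borel"
    by (rule path_int_measurable[OF beta_measurable]) auto
  note [measurable] = this path_ext_measurable[OF beta_measurable, of w]
  show ?thesis by measurable
qed

lemma sets_age_law [simp]: "sets (age_law w) = sets borel" and space_age_law [simp]: "space (age_law w) = UNIV"
  by (simp_all add: age_law_def)

lemma nn_integral_age_law:
  assumes "f \<in> borel_measurable borel"
  shows "(\<integral>\<^sup>+s. f s \<partial>age_law w) = (\<integral>\<^sup>+s. indicator {0..} s * ennreal (ext \<beta> (\<xi> (max 0 s) w) * surv s w) * f s \<partial>lborel)"
  unfolding age_law_def by (rule nn_integral_density[OF age_density_measurable]) (use assms in simp)

lemma emeasure_age_law_atMost: "emeasure (age_law w) {..t} = (if t < 0 then 0 else ennreal (1 - surv t w))"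
proof -
  have "emeasure (age_law w) {..t} = (\<integral>\<^sup>+s. indicator {0..} s * ennreal (ext \<beta> (\<xi> (max 0 s) w) * surv s w) * indicator {..t} s \<partial>lborel)"
    unfolding age_law_def by (rule emeasure_density[OF age_density_measurable]) simp
  also have "\<dots> = (\<integral>\<^sup>+s. indicator {0..t} s * ennreal (ext \<beta> (\<xi> (max 0 s) w) * surv s w) \<partial>lborel)"
    by (intro nn_integral_cong) (auto simp: indicator_def)
  also have "\<dots> = (if t < 0 then 0 else ennreal (1 - surv t w))"
    using death_before[of t w] by simp
  finally show ?thesis .
qed

lemma age_law_total: "emeasure (age_law w) UNIV = (SUP n::nat. ennreal (1 - surv (real n) w))"
proof -
  have "(\<Union>n::nat. {..real n}) = UNIV" using real_arch_simple by auto
  moreover have "(SUP n::nat. emeasure (age_law w) {..real n}) = emeasure (age_law w) (\<Union>n::nat. {..real n})"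
    by (rule SUP_emeasure_incseq) (auto simp: incseq_def)
  ultimately show ?thesis by (simp add: emeasure_age_law_atMost)
qed

lemma age_law_kernel: "age_law \<in> path_algebra \<xi> \<rightarrow>\<^sub>M subprob_algebra borel"
proof (rule measurable_subprob_algebra_generated[where G = "range (\<lambda>a. {..a})" and \<Omega> = UNIV])
  show "sets (borel :: real measure) = sigma_sets UNIV (range (\<lambda>a. {..a}))"
    by (subst borel_eq_atMost) (simp add: sets_measure_of)
  show "Int_stable (range (\<lambda>a::real. {..a}))"
  proof (rule Int_stableI, safe)
    fix a b :: real
    have "{..a} \<inter> {..b} = {..min a b}" by auto
    then show "{..a} \<inter> {..b} \<in> range (\<lambda>a. {..a})" by simp
  qed
  note [measurable] = path_int_path_measurable[OF beta_measurable]
  show "subprob_space (age_law w)" for w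
  proof
    have "emeasure (age_law w) UNIV \<le> 1"
      unfolding age_law_total by (rule SUP_least) (simp add: ennreal_le_1)
    then show "emeasure (age_law w) (space (age_law w)) \<le> 1" by simp
  qed simp
  show "(\<lambda>w. emeasure (age_law w) A) \<in> borel_measurable (path_algebra \<xi>)" if R: "A \<in> range (\<lambda>a. {..a})" for A
  proof -
    obtain a where A: "A = {..a}" using R by auto
    show ?thesis unfolding A emeasure_age_law_atMost by (cases "a < 0") (simp_all, measurable)
  qed
  show "(\<lambda>w. emeasure (age_law w) UNIV) \<in> borel_measurable (path_algebra \<xi>)"
    unfolding age_law_total by measurable
qed auto

text \<open>The laws form a kernel on all of the compactification; at the cemetery there are no children.\<close>

definition off_law :: "'a option \<Rightarrow> nat measure" where
  "off_law z = (case z of None \<Rightarrow> measure_pmf (return_pmf 0) | Some x \<Rightarrow> measure_pmf (off x))"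

abbreviation singletons :: "nat set set" where "singletons \<equiv> insert {} (range (\<lambda>k. {k}))"

lemma singletons_generate: "sets (count_space (UNIV :: nat set)) = sigma_sets UNIV singletons"
proof -
  have "C \<in> sigma_sets UNIV singletons" for C :: "nat set"
  proof -
    have "C = (\<Union>k. if k \<in> C then {k} else {})" by auto
    also have "\<dots> \<in> sigma_sets UNIV singletons"
      by (intro sigma_sets.Union sigma_sets.Basic) auto
    finally show ?thesis .
  qed
  then show ?thesis by auto
qed

lemma singletons_Int_stable: "Int_stable singletons"
  by (rule Int_stableI) auto

lemma off_law_kernel: "off_law \<in> Edel \<rightarrow>\<^sub>M subprob_algebra (count_space UNIV)"
proof (rule measurable_subprob_algebra_generated[OF singletons_generate singletons_Int_stable])
  have sp: "prob_space (off_law z)" for z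
    by (cases z) (simp_all add: off_law_def measure_pmf.prob_space_axioms)
  then show "subprob_space (off_law z)" for z by (rule prob_space_imp_subprob_space)
  show s: "sets (off_law z) = sets (count_space UNIV)" for z by (cases z) (simp_all add: off_law_def)
  have "space (off_law z) = UNIV" for z by (cases z) (simp_all add: off_law_def)
  then have "emeasure (off_law z) UNIV = 1" for z using prob_space.emeasure_space_1[OF sp[of z]] by simp
  then show "(\<lambda>z. emeasure (off_law z) UNIV) \<in> borel_measurable Edel" by simp
  have "(\<lambda>z. emeasure (off_law z) {k}) \<in> borel_measurable Edel" for k
  proof -
    have "emeasure (off_law z) {k} = ext (\<lambda>x. ennreal (pmf (off x) k)) z + indicator {None} z * indicator {0} k" for z
      by (cases z) (auto simp: off_law_def emeasure_pmf_single indicator_def)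
    moreover have "(\<lambda>z. ext (\<lambda>x. ennreal (pmf (off x) k)) z + indicator {None} z * indicator {0} k) \<in> borel_measurable Edel"
      using off_measurable[of k] None_Edel by measurable
    ultimately show ?thesis by simp
  qed
  then show "(\<lambda>z. emeasure (off_law z) A) \<in> borel_measurable Edel" if "A \<in> singletons" for A using that by auto
qed auto

end

context branching_system
begin

abbreviation B :: "label \<Rightarrow> 'm \<Rightarrow> 'a option" where
  "B u w \<equiv> born_at \<xi> xs mot life kids u w"

definition rb :: "label \<Rightarrow> 'm \<Rightarrow> real" where "rb u w = enn2real (birth_time (life w) u)"

definition age :: "label \<Rightarrow> 'm \<Rightarrow> real" where "age u w = enn2real (life w u)"

definition death_place :: "label \<Rightarrow> 'm \<Rightarrow> 'a option" where "death_place u w = \<xi> (age u w) (mot w u)"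

lemma age_nonneg: "0 \<le> age u w" and rb_nonneg: "0 \<le> rb u w"
  by (simp_all add: age_def rb_def)

lemma B_Nil [simp]: "B [] w = None"
  by (simp add: born_at_def)

lemma B_root: "B [i] w = (if i < length xs then Some (xs ! i) else None)"
  by (simp add: born_at_def)

lemma B_child: "u \<noteq> [] \<Longrightarrow> B (i # u) w =
    (if B u w \<noteq> None \<and> life w u < \<infinity> \<and> i < kids w u then death_place u w else None)"
  by (cases u) (auto simp: born_at_def death_place_def age_def)

lemma birth_time_child: "u \<noteq> [] \<Longrightarrow> birth_time l (i # u) = birth_time l u + l u"
  by (cases u) auto

lemma birth_time_finite: "B u w \<noteq> None \<Longrightarrow> birth_time (life w) u < \<infinity>"
proof (induction u)
  case (Cons i u)
  then show ?case by (cases "u = []") (auto simp: birth_time_child B_child infinity_ennreal_def split: if_splits)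
qed simp

lemma birth_time_eq: "B u w \<noteq> None \<Longrightarrow> birth_time (life w) u = ennreal (rb u w)"
  using birth_time_finite[of u w] by (simp add: rb_def infinity_ennreal_def)

lemma rb_child:
  assumes "u \<noteq> []" "B (i # u) w \<noteq> None" shows "rb (i # u) w = rb u w + age u w"
proof -
  have "B u w \<noteq> None" "life w u < \<infinity>" using assms by (auto simp: B_child split: if_splits)
  then have "birth_time (life w) u < top" "life w u < top" using birth_time_finite by (auto simp: infinity_ennreal_def)
  then show ?thesis by (simp add: rb_def age_def birth_time_child[OF assms(1)] enn2real_plus)
qed

abbreviation OE :: "label \<Rightarrow> 'm set set" where "OE u \<equiv> outside_events M \<xi> mot life kids u"

text \<open>What is known before the motion of \<open>u\<close> (\<open>G\<close>), before its age at branching (\<open>Gm\<close>) and before the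
  number of its children (\<open>Gl\<close>).\<close>

definition G :: "label \<Rightarrow> 'm measure" where "G u = sigma (space M) (OE u)"

definition Gm :: "label \<Rightarrow> 'm measure" where
  "Gm u = sigma (space M) (OE u \<union> events_of M (path_algebra \<xi>) (\<lambda>w. mot w u))"

definition Gl :: "label \<Rightarrow> 'm measure" where
  "Gl u = sigma (space M) (OE u \<union> events_of M (path_algebra \<xi>) (\<lambda>w. mot w u) \<union> events_of M borel (\<lambda>w. life w u))"

lemma OE_sets: "OE u \<subseteq> sets M"
  unfolding outside_events_def
  using events_of_subset[OF mot_measurable] events_of_subset[OF life_measurable] events_of_subset[OF kids_measurable] by blast

lemma Gm_events: "OE u \<union> events_of M (path_algebra \<xi>) (\<lambda>w. mot w u) \<subseteq> sets M"
  using OE_sets events_of_subset[OF mot_measurable] by blast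

lemma Gl_events: "OE u \<union> events_of M (path_algebra \<xi>) (\<lambda>w. mot w u) \<union> events_of M borel (\<lambda>w. life w u) \<subseteq> sets M"
  using Gm_events events_of_subset[OF life_measurable] by blast

lemma sub_G: "subalgebra M (G u)" and sub_Gm: "subalgebra M (Gm u)" and sub_Gl: "subalgebra M (Gl u)"
  unfolding G_def Gm_def Gl_def by (rule subalgebra_sigma[OF OE_sets] subalgebra_sigma[OF Gm_events] subalgebra_sigma[OF Gl_events])+

lemma space_G [simp]: "space (G u) = space M" "space (Gm u) = space M" "space (Gl u) = space M"
  using sub_G sub_Gm sub_Gl by (auto simp: subalgebra_def)

lemma sets_Pow: "E \<subseteq> sets M \<Longrightarrow> E \<subseteq> Pow (space M)"
  using sets.space_closed by blast

lemma G_to_Gm: "f \<in> G u \<rightarrow>\<^sub>M N \<Longrightarrow> f \<in> Gm u \<rightarrow>\<^sub>M N"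
  unfolding G_def Gm_def by (erule measurable_sigma_mono) (use sets_Pow[OF Gm_events] in auto)

lemma Gm_to_Gl: "f \<in> Gm u \<rightarrow>\<^sub>M N \<Longrightarrow> f \<in> Gl u \<rightarrow>\<^sub>M N"
  unfolding Gl_def Gm_def by (erule measurable_sigma_mono) (use sets_Pow[OF Gl_events] in auto)

lemma G_to_M: "f \<in> G u \<rightarrow>\<^sub>M N \<Longrightarrow> f \<in> M \<rightarrow>\<^sub>M N"
  by (rule measurable_from_subalg[OF sub_G])

lemma mot_Gm: "(\<lambda>w. mot w u) \<in> Gm u \<rightarrow>\<^sub>M path_algebra \<xi>"
  unfolding Gm_def by (rule measurable_sigma_of_events[OF mot_measurable _ Gm_events]) auto

lemma life_Gl: "(\<lambda>w. life w u) \<in> Gl u \<rightarrow>\<^sub>M borel"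
  unfolding Gl_def by (rule measurable_sigma_of_events[OF life_measurable _ Gl_events]) auto

lemma component_G:
  assumes "\<not> suffix u v"
  shows "(\<lambda>w. mot w v) \<in> G u \<rightarrow>\<^sub>M path_algebra \<xi>" "(\<lambda>w. life w v) \<in> G u \<rightarrow>\<^sub>M borel"
    "(\<lambda>w. kids w v) \<in> G u \<rightarrow>\<^sub>M count_space UNIV"
proof -
  have "events_of M (path_algebra \<xi>) (\<lambda>w. mot w v) \<subseteq> OE u" "events_of M borel (\<lambda>w. life w v) \<subseteq> OE u"
    "events_of M (count_space UNIV) (\<lambda>w. kids w v) \<subseteq> OE u"
    using assms unfolding outside_events_def by blast+
  note ev = this
  show "(\<lambda>w. mot w v) \<in> G u \<rightarrow>\<^sub>M path_algebra \<xi>"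
    unfolding G_def by (rule measurable_sigma_of_events[OF mot_measurable ev(1) OE_sets])
  show "(\<lambda>w. life w v) \<in> G u \<rightarrow>\<^sub>M borel"
    unfolding G_def by (rule measurable_sigma_of_events[OF life_measurable ev(2) OE_sets])
  show "(\<lambda>w. kids w v) \<in> G u \<rightarrow>\<^sub>M count_space UNIV"
    unfolding G_def by (rule measurable_sigma_of_events[OF kids_measurable ev(3) OE_sets])
qed

lemma G_mono:
  assumes "suffix u v" "f \<in> G u \<rightarrow>\<^sub>M N" shows "f \<in> G v \<rightarrow>\<^sub>M N"
proof -
  have "OE u \<subseteq> OE v"
    unfolding outside_events_def using suffix_order.trans[OF assms(1)] by blast
  then show ?thesis
    unfolding G_def by (rule measurable_sigma_mono[OF assms(2)[unfolded G_def] _ sets_Pow[OF OE_sets]])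
qed

text \<open>The birth of \<open>v\<close> is determined by the strict ancestors of \<open>v\<close>.\<close>

lemma birth_G:
  assumes "\<And>v'. strict_suffix v' v \<Longrightarrow> \<not> suffix u v'"
  shows "B v \<in> G u \<rightarrow>\<^sub>M Edel" "(\<lambda>w. birth_time (life w) v) \<in> borel_measurable (G u)"
proof -
  have "B v \<in> G u \<rightarrow>\<^sub>M Edel \<and> (\<lambda>w. birth_time (life w) v) \<in> borel_measurable (G u)"
    using assms
  proof (induction v)
    case Nil
    have "B [] = (\<lambda>w. None)" by (rule ext) simp
    then show ?case by simp
  next
    case (Cons i v)
    show ?case
    proof (cases "v = []")
      case True
      have "B [i] = (\<lambda>w. if i < length xs then Some (xs ! i) else None)" by (rule ext) (rule B_root)
      then show ?thesis using True by simp
    next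
      case False
      have sv: "strict_suffix v (i # v)" by (simp add: strict_suffix_def suffix_ConsI)
      have v: "\<not> suffix u v" by (rule Cons.prems[OF sv])
      have prems: "\<not> suffix u v'" if "strict_suffix v' v" for v'
        by (rule Cons.prems[OF suffix_order.less_trans[OF that sv]])
      note [measurable] = component_G(2,3)[OF v]
      have IH: "B v \<in> G u \<rightarrow>\<^sub>M Edel" "(\<lambda>w. birth_time (life w) v) \<in> borel_measurable (G u)"
        using Cons.IH[OF prems] by blast+
      note [measurable] = not_None_pred[OF IH(1)] IH(2)
      have "(\<lambda>w. enn2real (life w v)) \<in> borel_measurable (G u)" by measurable
      from xi_measurable[OF this component_G(1)[OF v]]
      have dp: "death_place v \<in> G u \<rightarrow>\<^sub>M Edel" by (simp add: death_place_def[abs_def] age_def)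
      have "(\<lambda>w. if B v w \<noteq> None \<and> life w v < \<infinity> \<and> i < kids w v then death_place v w else None) \<in> G u \<rightarrow>\<^sub>M Edel"
        by (rule measurable_If[OF dp]) measurable
      moreover have "B (i # v) = (\<lambda>w. if B v w \<noteq> None \<and> life w v < \<infinity> \<and> i < kids w v then death_place v w else None)"
        by (rule ext) (rule B_child[OF False])
      moreover have "(\<lambda>w. birth_time (life w) (i # v)) \<in> borel_measurable (G u)"
        unfolding birth_time_child[OF False] by measurable
      ultimately show ?thesis by simp
    qed
  qed
  then show "B v \<in> G u \<rightarrow>\<^sub>M Edel" "(\<lambda>w. birth_time (life w) v) \<in> borel_measurable (G u)" by auto
qed

lemma not_suffix_strict: "strict_suffix v' u \<Longrightarrow> \<not> suffix u v'"
  by (auto simp: strict_suffix_def suffix_order.antisym)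

lemma B_G: "B u \<in> G u \<rightarrow>\<^sub>M Edel" and rb_G: "rb u \<in> borel_measurable (G u)"
proof -
  show "B u \<in> G u \<rightarrow>\<^sub>M Edel" by (rule birth_G(1)) (rule not_suffix_strict)
  have [measurable]: "(\<lambda>w. birth_time (life w) u) \<in> borel_measurable (G u)"
    by (rule birth_G(2)) (rule not_suffix_strict)
  show "rb u \<in> borel_measurable (G u)" unfolding rb_def[abs_def] by measurable
qed

lemma death_place_Gl: "death_place u \<in> Gl u \<rightarrow>\<^sub>M Edel" and age_Gl: "age u \<in> borel_measurable (Gl u)"
proof -
  note [measurable] = life_Gl[of u]
  have 1: "(\<lambda>w. enn2real (life w u)) \<in> borel_measurable (Gl u)" by measurable
  then show "age u \<in> borel_measurable (Gl u)" by (simp add: age_def[abs_def])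
  show "death_place u \<in> Gl u \<rightarrow>\<^sub>M Edel"
    using xi_measurable[OF 1 Gm_to_Gl[OF mot_Gm]] by (simp add: death_place_def[abs_def] age_def)
qed

definition born :: "label \<Rightarrow> 'm set" where "born u = {w \<in> space M. B u w \<noteq> None}"

lemma born_G: "born u \<in> sets (G u)" "born u \<in> sets (Gm u)" "born u \<in> sets (Gl u)" "born u \<in> sets M"
proof -
  have 1: "Measurable.pred N (\<lambda>x. B u x \<noteq> None) \<Longrightarrow> space N = space M \<Longrightarrow> born u \<in> sets N" for N
    by (simp add: pred_def born_def)
  show "born u \<in> sets (G u)" by (rule 1[OF not_None_pred[OF B_G]]) simp
  show "born u \<in> sets (Gm u)" by (rule 1[OF not_None_pred[OF G_to_Gm[OF B_G]]]) simp
  show "born u \<in> sets (Gl u)" by (rule 1[OF not_None_pred[OF Gm_to_Gl[OF G_to_Gm[OF B_G]]]]) simp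
  show "born u \<in> sets M" by (rule 1[OF not_None_pred[OF G_to_M[OF B_G]]]) simp
qed

lemma prob_M: "prob_space M" by (rule prob_space_axioms)

lemma motion_disintegration:
  assumes \<Phi>: "\<Phi> \<in> borel_measurable (G u \<Otimes>\<^sub>M path_algebra \<xi>)"
  shows "(\<integral>\<^sup>+y. indicator (born u) y * \<Phi> (y, mot y u) \<partial>M) = (\<integral>\<^sup>+y. indicator (born u) y * (\<integral>\<^sup>+w. \<Phi> (y, w) \<partial>law (B u y)) \<partial>M)"
proof -
  have \<kappa>: "(\<lambda>y. law (B u y)) \<in> G u \<rightarrow>\<^sub>M subprob_algebra (path_algebra \<xi>)"
    by (rule measurable_compose[OF B_G law_subprob])
  have "(\<integral>\<^sup>+y. indicator (born u \<inter> space M) y * \<Phi> (y, mot y u) \<partial>M) = (\<integral>\<^sup>+y. indicator (born u) y * (\<integral>\<^sup>+w. \<Phi> (y, w) \<partial>law (B u y)) \<partial>M)"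
  proof (rule disintegration[OF prob_M sub_G mot_measurable \<kappa> born_G(1) sets.top _ _ _ _ _ _ \<Phi>, where E = "sets (path_algebra \<xi>)" and A = "\<lambda>_. UNIV"])
    show "sets (path_algebra \<xi>) = sigma_sets (space (path_algebra \<xi>)) (sets (path_algebra \<xi>))"
      by (rule sets.sigma_sets_eq[symmetric])
    show "Int_stable (sets (path_algebra \<xi>))" by (auto simp: Int_stable_def)
    show "range (\<lambda>_. UNIV) \<subseteq> sets (path_algebra \<xi>)" using sets.top[of "path_algebra \<xi>"] by auto
    fix C F0 assume C: "C \<in> sets (path_algebra \<xi>)" and F0: "F0 \<in> sets (G u)" "F0 \<subseteq> born u"
    have F0': "F0 \<inter> space M = F0" using F0(2) by (auto simp: born_def)
    have "(\<integral>\<^sup>+y. indicator (F0 \<inter> space M) y * indicator C (mot y u) \<partial>M) = (\<integral>\<^sup>+y. indicator F0 y * indicator {y'. mot y' u \<in> C} y \<partial>M)"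
      unfolding F0' by (intro nn_integral_cong) (auto simp: indicator_def)
    also have "\<dots> = (\<integral>\<^sup>+y. indicator F0 y * ennreal (measure (law (B u y)) C) \<partial>M)"
    proof (rule nn_integral_real_cond_exp_indicator[OF sub_G _ F0(1)])
      show "{y'. mot y' u \<in> C} \<inter> space M \<in> sets M"
        using measurable_sets[OF mot_measurable[of u] C] by (simp add: vimage_def)
      show "(\<lambda>y. measure (law (B u y)) C) \<in> borel_measurable M"
        unfolding measure_def
        by (intro borel_measurable_enn2real measurable_compose[OF G_to_M[OF B_G] emeasure_law_measurable[OF C]])
      show "measure (law (B u y)) C \<le> 1" for y by (rule prob_space.prob_le_1[OF prob_law])
      show "AE y in M. y \<in> F0 \<longrightarrow> real_cond_exp M (G u) (indicator {y'. mot y' u \<in> C}) y = measure (law (B u y)) C"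
        using motion_law[OF C, of u] unfolding G_def[symmetric]
      proof eventually_elim
        case (elim y)
        then show ?case using F0(2) by (auto simp: born_def)
      qed
    qed simp
    also have "\<dots> = (\<integral>\<^sup>+y. indicator F0 y * emeasure (law (B u y)) C \<partial>M)"
      by (simp add: finite_measure.emeasure_eq_measure[OF prob_space.finite_measure[OF prob_law]])
    finally show "(\<integral>\<^sup>+y. indicator (F0 \<inter> space M) y * indicator C (mot y u) \<partial>M) = (\<integral>\<^sup>+y. indicator F0 y * emeasure (law (B u y)) C \<partial>M)" .
  qed auto
  moreover have "born u \<inter> space M = born u" by (auto simp: born_def)
  ultimately show ?thesis by simp
qed

definition branched :: "label \<Rightarrow> 'm set" where "branched u = {w \<in> space M. life w u < \<infinity>}"

lemma branched_sets: "branched u \<in> sets M" "branched u \<in> sets (Gl u)"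
proof -
  note [measurable] = life_measurable[of u] life_Gl[of u]
  show "branched u \<in> sets M" unfolding branched_def by measurable
  have "{w \<in> space (Gl u). life w u < \<infinity>} \<in> sets (Gl u)" by measurable
  then show "branched u \<in> sets (Gl u)" by (simp add: branched_def)
qed

text \<open>The branching rate prescribes the probability that the age exceeds \<open>t\<close>. Its complement within the
  birth of \<open>u\<close> is the event that \<open>u\<close> branches at an age of at most \<open>t\<close>.\<close>

lemma age_disintegration:
  assumes \<Phi>: "\<Phi> \<in> borel_measurable (Gm u \<Otimes>\<^sub>M borel)"
  shows "(\<integral>\<^sup>+w. indicator (born u \<inter> branched u) w * \<Phi> (w, age u w) \<partial>M) = (\<integral>\<^sup>+w. indicator (born u) w * (\<integral>\<^sup>+s. \<Phi> (w, s) \<partial>age_law (mot w u)) \<partial>M)"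
proof -
  have \<kappa>: "(\<lambda>w. age_law (mot w u)) \<in> Gm u \<rightarrow>\<^sub>M subprob_algebra borel"
    by (rule measurable_compose[OF mot_Gm age_law_kernel])
  note lm [measurable] = life_measurable[of u]
  have ageM: "age u \<in> borel_measurable M" unfolding age_def[abs_def] by measurable
  show ?thesis
  proof (rule disintegration[OF prob_M sub_Gm ageM \<kappa> born_G(2) branched_sets(1) _ _ _ _ _ _ \<Phi>, where E = "range (\<lambda>a. {..a})" and A = "\<lambda>n. {..real n}"])
    show "sets (borel :: real measure) = sigma_sets (space borel) (range (\<lambda>a. {..a}))"
      by (subst borel_eq_atMost) (simp add: sets_measure_of)
    show "Int_stable (range (\<lambda>a::real. {..a}))"
    proof (rule Int_stableI, safe)
      fix a b :: real
      have "{..a} \<inter> {..b} = {..min a b}" by auto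
      then show "{..a} \<inter> {..b} \<in> range (\<lambda>a. {..a})" by simp
    qed
    show "(\<Union>i::nat. {..real i}) = space borel" using real_arch_simple by auto
    fix C F0 assume "C \<in> range (\<lambda>a::real. {..a})" and F0: "F0 \<in> sets (Gm u)" "F0 \<subseteq> born u"
    then obtain t where C: "C = {..t}" by auto
    have F0M: "F0 \<in> sets M" using F0(1) sub_Gm by (auto simp: subalgebra_def)
    show "(\<integral>\<^sup>+w. indicator (F0 \<inter> branched u) w * indicator C (age u w) \<partial>M) = (\<integral>\<^sup>+w. indicator F0 w * emeasure (age_law (mot w u)) C \<partial>M)"
    proof (cases "t < 0")
      case True
      have a1: "indicator (F0 \<inter> branched u) w * indicator C (age u w) = (0 :: ennreal)" for w
        using True age_nonneg[of u w] by (auto simp: C indicator_def)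
      have a2: "indicator F0 w * emeasure (age_law (mot w u)) C = (0 :: ennreal)" for w
        using True by (simp add: C emeasure_age_law_atMost)
      show ?thesis by (simp only: a1 a2)
    next
      case False
      then have t: "0 \<le> t" by simp
      define e where "e = (\<lambda>w. surv t (mot w u))"
      have e: "e \<in> borel_measurable M" "0 \<le> e w" "e w \<le> 1" for w
      proof -
        note [measurable] = measurable_compose[OF mot_measurable path_int_path_measurable[OF beta_measurable]]
        show "e \<in> borel_measurable M" unfolding e_def by measurable
        show "0 \<le> e w" "e w \<le> 1" using path_int_nonneg[OF beta_nonneg] by (auto simp: e_def)
      qed
      note [measurable] = F0M e(1)
      define X where "X = (\<integral>\<^sup>+w. indicator F0 w * indicator {w'. ennreal t < life w' u} w \<partial>M)"
      have X: "X = (\<integral>\<^sup>+w. indicator F0 w * ennreal (e w) \<partial>M)"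
        unfolding X_def
      proof (rule nn_integral_real_cond_exp_indicator[OF sub_Gm _ F0(1) e])
        have "{w \<in> space M. ennreal t < life w u} \<in> sets M" by measurable
        then show "{w'. ennreal t < life w' u} \<inter> space M \<in> sets M" by (simp add: Int_def conj_commute)
        show "AE w in M. w \<in> F0 \<longrightarrow> real_cond_exp M (Gm u) (indicator {w'. ennreal t < life w' u}) w = e w"
          using branching_rate[OF t, of u] unfolding Gm_def[symmetric] e_def
        proof eventually_elim
          case (elim w)
          then show ?case using F0(2) by (auto simp: born_def)
        qed
      qed
      have X_fin: "X \<noteq> top"
      proof -
        have "X \<le> (\<integral>\<^sup>+w. 1 \<partial>M)" unfolding X_def by (intro nn_integral_mono) (auto simp: indicator_def)
        then show ?thesis using emeasure_space_1 by (auto simp: top_unique)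
      qed
      have m1: "(\<lambda>w. indicator {w'. ennreal t < life w' u} w :: ennreal) \<in> borel_measurable M"
        unfolding indicator_def of_bool_def by measurable
      have m2: "(\<lambda>w. indicator (F0 \<inter> branched u) w * indicator C (age u w) :: ennreal) \<in> borel_measurable M"
        using branched_sets(1)[of u] ageM by (intro borel_measurable_times_ennreal borel_measurable_indicator measurable_compose[OF ageM]) (auto simp: C)
      have "(\<integral>\<^sup>+w. indicator (F0 \<inter> branched u) w * indicator C (age u w) \<partial>M) + X
         = (\<integral>\<^sup>+w. indicator (F0 \<inter> branched u) w * indicator C (age u w) + indicator F0 w * indicator {w'. ennreal t < life w' u} w \<partial>M)"
        unfolding X_def using m1 by (intro nn_integral_add[symmetric] m2) measurable
      also have "\<dots> = (\<integral>\<^sup>+w. indicator F0 w \<partial>M)"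
      proof (intro nn_integral_cong)
        fix w assume w: "w \<in> space M"
        have "(life w u < \<infinity> \<and> age u w \<le> t) \<longleftrightarrow> \<not> ennreal t < life w u"
        proof (cases "life w u")
          case (real r)
          then show ?thesis using t by (simp add: age_def infinity_ennreal_def ennreal_less_iff not_less)
        next
          case top
          then show ?thesis by (simp add: infinity_ennreal_def)
        qed
        then show "indicator (F0 \<inter> branched u) w * indicator C (age u w) + indicator F0 w * indicator {w'. ennreal t < life w' u} w = (indicator F0 w :: ennreal)"
          using w by (auto simp: C branched_def indicator_def)
      qed
      also have "\<dots> = (\<integral>\<^sup>+w. indicator F0 w * ennreal (1 - e w) + indicator F0 w * ennreal (e w) \<partial>M)"
        using e(2,3) by (intro nn_integral_cong) (simp add: distrib_left[symmetric] flip: ennreal_plus)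
      also have "\<dots> = (\<integral>\<^sup>+w. indicator F0 w * ennreal (1 - e w) \<partial>M) + X"
        unfolding X by (rule nn_integral_add) measurable
      finally have "(\<integral>\<^sup>+w. indicator (F0 \<inter> branched u) w * indicator C (age u w) \<partial>M) = (\<integral>\<^sup>+w. indicator F0 w * ennreal (1 - e w) \<partial>M)"
        using X_fin by (simp add: ennreal_add_left_cancel add.commute[of _ X] infinity_ennreal_def)
      then show ?thesis using t by (simp add: C emeasure_age_law_atMost e_def)
    qed
  qed auto
qed

lemma kids_disintegration:
  assumes \<Phi>: "\<Phi> \<in> borel_measurable (Gl u \<Otimes>\<^sub>M count_space UNIV)"
  defines "S \<equiv> {w \<in> space M. B u w \<noteq> None \<and> life w u < \<infinity> \<and> death_place u w \<noteq> None}"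
  shows "(\<integral>\<^sup>+w. indicator S w * \<Phi> (w, kids w u) \<partial>M) = (\<integral>\<^sup>+w. indicator S w * (\<integral>\<^sup>+k. \<Phi> (w, k) \<partial>off_law (death_place u w)) \<partial>M)"
proof -
  have \<kappa>: "(\<lambda>w. off_law (death_place u w)) \<in> Gl u \<rightarrow>\<^sub>M subprob_algebra (count_space UNIV)"
    by (rule measurable_compose[OF death_place_Gl off_law_kernel])
  have S: "S \<in> sets (Gl u)"
  proof -
    have "S = born u \<inter> branched u \<inter> {w \<in> space (Gl u). death_place u w \<noteq> None}"
      by (auto simp: S_def born_def branched_def)
    moreover have "{w \<in> space (Gl u). death_place u w \<noteq> None} \<in> sets (Gl u)"
      using not_None_pred[OF death_place_Gl] by (simp add: pred_def)
    ultimately show ?thesis using born_G(3) branched_sets(2) by auto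
  qed
  have "(\<integral>\<^sup>+w. indicator (S \<inter> space M) w * \<Phi> (w, kids w u) \<partial>M) = (\<integral>\<^sup>+w. indicator S w * (\<integral>\<^sup>+k. \<Phi> (w, k) \<partial>off_law (death_place u w)) \<partial>M)"
  proof (rule disintegration[OF prob_M sub_Gl kids_measurable \<kappa> S sets.top _ singletons_Int_stable _ _ _ _ \<Phi>, where A = "\<lambda>i. {i}"])
    show "sets (count_space (UNIV :: nat set)) = sigma_sets (space (count_space UNIV)) singletons"
      using singletons_generate by simp
    fix C :: "nat set" and F0 assume "C \<in> singletons" and F0: "F0 \<in> sets (Gl u)" "F0 \<subseteq> S"
    then consider "C = {}" | k where "C = {k}" by auto
    then show "(\<integral>\<^sup>+w. indicator (F0 \<inter> space M) w * indicator C (kids w u) \<partial>M) = (\<integral>\<^sup>+w. indicator F0 w * emeasure (off_law (death_place u w)) C \<partial>M)"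
    proof cases
      case 1 then show ?thesis by simp
    next
      case (2 k)
      have F0': "F0 \<inter> space M = F0" using F0(2) by (auto simp: S_def)
      define c where "c = (\<lambda>w. measure (off_law (death_place u w)) {k})"
      have ol: "prob_space (off_law z)" for z
        by (cases z) (simp_all add: off_law_def measure_pmf.prob_space_axioms)
      have "(\<integral>\<^sup>+w. indicator (F0 \<inter> space M) w * indicator C (kids w u) \<partial>M) = (\<integral>\<^sup>+w. indicator F0 w * indicator {w'. kids w' u = k} w \<partial>M)"
        unfolding F0' 2 by (intro nn_integral_cong) (auto simp: indicator_def)
      also have "\<dots> = (\<integral>\<^sup>+w. indicator F0 w * ennreal (c w) \<partial>M)"
      proof (rule nn_integral_real_cond_exp_indicator[OF sub_Gl _ F0(1)])
        show "{w'. kids w' u = k} \<inter> space M \<in> sets M"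
          using measurable_sets[OF kids_measurable[of u], of "{k}"] by (simp add: vimage_def)
        have "{k} \<in> sets (count_space UNIV)" by simp
        from measurable_compose[OF measurable_from_subalg[OF sub_Gl \<kappa>] measurable_emeasure_subprob_algebra[OF this]]
        show "c \<in> borel_measurable M" unfolding c_def measure_def by (rule borel_measurable_enn2real)
        show "c w \<le> 1" for w unfolding c_def by (rule prob_space.prob_le_1[OF ol])
        show "AE w in M. w \<in> F0 \<longrightarrow> real_cond_exp M (Gl u) (indicator {w'. kids w' u = k}) w = c w"
          using offspring_law[of u k] unfolding Gl_def[symmetric] age_def[symmetric] death_place_def[symmetric]
        proof eventually_elim
          case (elim w)
          show ?case
          proof
            assume "w \<in> F0"
            then have Sw: "B u w \<noteq> None" "life w u < \<infinity>" "death_place u w \<noteq> None" using F0(2) by (auto simp: S_def)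
            then obtain x where x: "death_place u w = Some x" by auto
            show "real_cond_exp M (Gl u) (indicator {w'. kids w' u = k}) w = c w"
              using elim Sw by (simp add: c_def x off_law_def measure_pmf_single)
          qed
        qed
      qed (simp add: c_def)
      also have "\<dots> = (\<integral>\<^sup>+w. indicator F0 w * emeasure (off_law (death_place u w)) C \<partial>M)"
        unfolding c_def 2 by (simp add: finite_measure.emeasure_eq_measure[OF prob_space.finite_measure[OF ol]])
      finally show ?thesis .
    qed
  qed auto
  moreover have "S \<inter> space M = S" by (auto simp: S_def)
  ultimately show ?thesis by simp
qed

end

section \<open>The branching of one individual\<close>

lemma suminf_indicator_lessThan: "(\<Sum>i. if i < k then c else (0::ennreal)) = of_nat k * c"
proof -
  have "(\<Sum>i. if i < k then c else 0) = (\<Sum>i\<in>{..<k}. if i < k then c else 0)"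
    by (rule suminf_finite) auto
  then show ?thesis by simp
qed

lemma suminf_pairs_lessThan:
  "(\<Sum>i. \<Sum>j. if i \<noteq> j \<and> i < k \<and> j < k then c else (0::ennreal)) = of_nat (k * (k - 1)) * c"
proof -
  have inner: "(\<Sum>j. if i \<noteq> j \<and> i < k \<and> j < k then c else 0) = (if i < k then of_nat (k - 1) * c else 0)" for i
  proof -
    have "(\<Sum>j. if i \<noteq> j \<and> i < k \<and> j < k then c else 0) = (\<Sum>j\<in>{..<k} - {i}. if i \<noteq> j \<and> i < k \<and> j < k then c else 0)"
      by (rule suminf_finite) auto
    also have "\<dots> = (\<Sum>j\<in>{..<k} - {i}. if i < k then c else 0)"
      by (rule sum.cong) auto
    finally show ?thesis by simp
  qed
  show ?thesis unfolding inner suminf_indicator_lessThan by (simp add: mult.assoc)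
qed

context branching_model
begin

lemma branch_integrand_measurable:
  assumes c: "c \<in> borel_measurable borel" and \<psi>: "(\<lambda>p. \<psi> (fst p) (snd p)) \<in> borel_measurable (borel \<Otimes>\<^sub>M Edel)"
    and r: "r \<in> borel_measurable N" and w: "w \<in> N \<rightarrow>\<^sub>M path_algebra \<xi>"
  shows "(\<lambda>x. \<integral>\<^sup>+s. branch_dens c s (w x) * \<psi> (r x + s) (\<xi> (max 0 s) (w x)) \<partial>lborel) \<in> borel_measurable N"
proof -
  let ?P = "N \<Otimes>\<^sub>M lborel"
  have sm: "(\<lambda>p. snd p) \<in> borel_measurable ?P" by measurable
  have wm: "(\<lambda>p. w (fst p)) \<in> ?P \<rightarrow>\<^sub>M path_algebra \<xi>" by (rule measurable_compose[OF measurable_fst w])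
  have rm: "(\<lambda>p. r (fst p) + snd p) \<in> borel_measurable ?P"
    using measurable_compose[OF measurable_fst r, of lborel] sm by measurable
  note xm = xi_measurable[OF sm wm]
  note [measurable] = path_int_measurable[OF beta_measurable sm wm] measurable_compose[OF xm ext_measurable_ennreal[OF c]]
    measurable_compose[OF measurable_Pair[OF rm xm] \<psi>, simplified]
  show ?thesis
    by (rule lborel.borel_measurable_nn_integral) (unfold split_beta', measurable)
qed

text \<open>The expected sum of \<open>\<psi>\<close> over the births of the children (their time and place) of an individual born
  at time \<open>b\<close> in \<open>z\<close>.\<close>

definition Kop :: "(real \<Rightarrow> 'a option \<Rightarrow> ennreal) \<Rightarrow> real \<Rightarrow> 'a option \<Rightarrow> ennreal" where
  "Kop \<psi> b z = branch_int (\<lambda>x. ennreal (birth_rate x)) (\<lambda>s. \<psi> (b + s)) z"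

abbreviation jm :: "(real \<Rightarrow> 'a option \<Rightarrow> ennreal) \<Rightarrow> bool" where
  "jm \<psi> \<equiv> (\<lambda>p. \<psi> (fst p) (snd p)) \<in> borel_measurable (borel \<Otimes>\<^sub>M Edel)"

lemma branch_int_shift_measurable:
  assumes c: "c \<in> borel_measurable borel" and \<psi>: "jm \<psi>"
  shows "jm (\<lambda>b. branch_int c (\<lambda>s. \<psi> (b + s)))"
proof -
  have "(\<lambda>x. \<integral>\<^sup>+s. branch_dens c s (snd x) * \<psi> (fst x + s) (\<xi> (max 0 s) (snd x)) \<partial>lborel) \<in> borel_measurable (borel \<Otimes>\<^sub>M path_algebra \<xi>)"
    by (rule branch_integrand_measurable[OF c \<psi>]) auto
  from law_integral_pair_measurable[OF this] show ?thesis by (simp add: branch_int_def)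
qed

lemma Kop_measurable: "jm \<psi> \<Longrightarrow> jm (Kop \<psi>)"
  unfolding Kop_def by (rule branch_int_shift_measurable) measurable

lemma Kop_pow_measurable: "jm \<psi> \<Longrightarrow> jm ((Kop ^^ n) \<psi>)"
  by (induction n) (auto intro: Kop_measurable)

text \<open>The expected sum of \<open>g\<close> over the \<open>n\<close>-th generation at time \<open>t\<close>, for an ancestor born at time \<open>b\<close> in
  \<open>z\<close>; \<open>FKm\<close> below is the corresponding sum over all generations.\<close>

definition alive_mean :: "nat \<Rightarrow> real \<Rightarrow> ('a \<Rightarrow> ennreal) \<Rightarrow> real \<Rightarrow> 'a option \<Rightarrow> ennreal" where
  "alive_mean n t g b z = (if b \<le> t then mean_gen n (t - b) g z else 0)"

lemma alive_mean_measurable: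
  assumes "g \<in> borel_measurable borel" shows "jm (alive_mean n t g)"
proof -
  have "(\<lambda>p. (t - fst p, snd p)) \<in> borel \<Otimes>\<^sub>M Edel \<rightarrow>\<^sub>M (borel :: real measure) \<Otimes>\<^sub>M Edel" by measurable
  note [measurable] = measurable_compose[OF this mean_gen_measurable[OF assms, of n], simplified]
  have "(\<lambda>p. if fst p \<le> t then mean_gen n (max 0 (t - fst p)) g (snd p) else 0) \<in> borel_measurable (borel \<Otimes>\<^sub>M Edel)"
    by measurable
  also have "(\<lambda>p. if fst p \<le> t then mean_gen n (max 0 (t - fst p)) g (snd p) else 0) = (\<lambda>p. alive_mean n t g (fst p) (snd p))"
    by (auto simp: fun_eq_iff alive_mean_def)
  finally show ?thesis .
qed

lemma branch_int_zero: "(\<And>s z. 0 \<le> s \<Longrightarrow> \<psi> s z = 0) \<Longrightarrow> branch_int c \<psi> y = 0"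
proof -
  assume "\<And>s z. 0 \<le> s \<Longrightarrow> \<psi> s z = 0"
  then have z: "branch_dens c s w * \<psi> s (\<xi> (max 0 s) w) = 0" for s w
    by (simp add: indicator_def)
  show ?thesis unfolding branch_int_def z by simp
qed

lemma Kop_alive_mean:
  assumes g: "g \<in> borel_measurable borel"
  shows "Kop (alive_mean n t g) = alive_mean (Suc n) t g"
proof (intro ext)
  fix b z
  show "Kop (alive_mean n t g) b z = alive_mean (Suc n) t g b z"
  proof (cases "b \<le> t")
    case True
    have "(\<lambda>s. alive_mean n t g (b + s)) = (\<lambda>s z. indicator {..t - b} s * mean_gen n (t - b - s) g z)"
      by (intro ext) (auto simp: alive_mean_def indicator_def diff_diff_eq)
    then show ?thesis
      using branch_int_mean_gen[OF g, of "t - b" n z] True by (simp add: Kop_def alive_mean_def)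
  next
    case False
    then have "Kop (alive_mean n t g) b z = 0" unfolding Kop_def by (intro branch_int_zero) (simp add: alive_mean_def)
    then show ?thesis using False by (simp add: alive_mean_def)
  qed
qed

lemma Kop_pow_alive_mean: "g \<in> borel_measurable borel \<Longrightarrow> (Kop ^^ n) (alive_mean 0 t g) = alive_mean n t g"
  by (induction n) (simp_all add: Kop_alive_mean)

definition FKm :: "real \<Rightarrow> ('a \<Rightarrow> ennreal) \<Rightarrow> real \<Rightarrow> 'a option \<Rightarrow> ennreal" where
  "FKm t g b z = (if b \<le> t then FK (t - b) g z else 0)"

lemma alive_mean_sums: "g \<in> borel_measurable borel \<Longrightarrow> (\<Sum>n. alive_mean n t g b z) = FKm t g b z"
  by (simp add: alive_mean_def FKm_def mean_gen_sums_FK)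

lemma FKm_measurable:
  assumes "g \<in> borel_measurable borel" shows "jm (FKm t g)"
proof -
  have "(\<lambda>p. \<Sum>n. alive_mean n t g (fst p) (snd p)) \<in> borel_measurable (borel \<Otimes>\<^sub>M Edel)"
    using alive_mean_measurable[OF assms] by measurable
  then show ?thesis by (simp add: alive_mean_sums[OF assms])
qed

end

context branching_system
begin

lemma off_integral_measurable: "(\<lambda>x. \<integral>\<^sup>+k. c k \<partial>measure_pmf (off x)) \<in> borel_measurable borel" for c :: "nat \<Rightarrow> ennreal"
  unfolding nn_integral_nat_pmf using off_measurable by measurable

text \<open>The number of children of \<open>u\<close>, its age at branching and its motion are integrated out in this order,
  each given what precedes it.\<close>

lemma branch_step:
  fixes c :: "nat \<Rightarrow> ennreal"
  assumes Y: "Y \<in> borel_measurable (G u)" and \<psi>: "jm \<psi>"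
  shows "(\<integral>\<^sup>+y. Y y * (if B u y \<noteq> None \<and> life y u < \<infinity> \<and> death_place u y \<noteq> None
       then c (kids y u) * \<psi> (rb u y + age u y) (death_place u y) else 0) \<partial>M)
    = (\<integral>\<^sup>+y. indicator (born u) y * (Y y * branch_int (\<lambda>x. ennreal (\<beta> x) * (\<integral>\<^sup>+k. c k \<partial>measure_pmf (off x))) (\<lambda>s. \<psi> (rb u y + s)) (B u y)) \<partial>M)"
proof -
  define m where "m = (\<lambda>x. \<integral>\<^sup>+k. c k \<partial>measure_pmf (off x))"
  have mm [measurable]: "m \<in> borel_measurable borel" unfolding m_def by (rule off_integral_measurable)
  define S where "S = {y \<in> space M. B u y \<noteq> None \<and> life y u < \<infinity> \<and> death_place u y \<noteq> None}"
  define P1 where "P1 = (\<lambda>(y, k). Y y * (c k * \<psi> (rb u y + age u y) (death_place u y)))"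
  define P2 where "P2 = (\<lambda>(y, s). Y y * (ext m (\<xi> (max 0 s) (mot y u)) * \<psi> (rb u y + s) (\<xi> (max 0 s) (mot y u))))"
  have P1m: "P1 \<in> borel_measurable (Gl u \<Otimes>\<^sub>M count_space UNIV)"
  proof -
    have rm: "(\<lambda>y. rb u y + age u y) \<in> borel_measurable (Gl u)"
      using Gm_to_Gl[OF G_to_Gm[OF rb_G]] age_Gl by measurable
    note [measurable] = Gm_to_Gl[OF G_to_Gm[OF Y]] measurable_compose[OF measurable_Pair[OF rm death_place_Gl] \<psi>, simplified]
    have [measurable]: "c \<in> borel_measurable (count_space UNIV)" by simp
    show ?thesis unfolding P1_def split_beta' by measurable
  qed
  have P2m: "P2 \<in> borel_measurable (Gm u \<Otimes>\<^sub>M borel)"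
  proof -
    let ?P = "Gm u \<Otimes>\<^sub>M (borel :: real measure)"
    have sm: "(\<lambda>p. snd p) \<in> borel_measurable ?P" by measurable
    have rm: "(\<lambda>p. rb u (fst p) + snd p) \<in> borel_measurable ?P"
      using measurable_compose[OF measurable_fst G_to_Gm[OF rb_G]] sm by measurable
    note xm = xi_measurable[OF sm measurable_compose[OF measurable_fst mot_Gm[of u]]]
    note [measurable] = G_to_Gm[OF Y] measurable_compose[OF xm ext_measurable_ennreal[OF mm]]
      measurable_compose[OF measurable_Pair[OF rm xm] \<psi>, simplified]
    show ?thesis unfolding P2_def split_beta' by measurable
  qed
  have "(\<integral>\<^sup>+y. Y y * (if B u y \<noteq> None \<and> life y u < \<infinity> \<and> death_place u y \<noteq> None
       then c (kids y u) * \<psi> (rb u y + age u y) (death_place u y) else 0) \<partial>M) = (\<integral>\<^sup>+y. indicator S y * P1 (y, kids y u) \<partial>M)"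
    by (intro nn_integral_cong) (auto simp: S_def P1_def indicator_def)
  also have "\<dots> = (\<integral>\<^sup>+y. indicator S y * (\<integral>\<^sup>+k. P1 (y, k) \<partial>off_law (death_place u y)) \<partial>M)"
    unfolding S_def by (rule kids_disintegration[OF P1m])
  also have "\<dots> = (\<integral>\<^sup>+y. indicator (born u \<inter> branched u) y * P2 (y, age u y) \<partial>M)"
  proof (intro nn_integral_cong)
    fix y assume y: "y \<in> space M"
    have x: "\<xi> (max 0 (age u y)) (mot y u) = death_place u y" using age_nonneg[of u y] by (simp add: death_place_def)
    show "indicator S y * (\<integral>\<^sup>+k. P1 (y, k) \<partial>off_law (death_place u y)) = indicator (born u \<inter> branched u) y * P2 (y, age u y)"
    proof (cases "death_place u y")
      case None
      then show ?thesis using x by (simp add: S_def P2_def)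
    next
      case (Some a)
      have "(\<integral>\<^sup>+k. P1 (y, k) \<partial>off_law (death_place u y)) = (\<integral>\<^sup>+k. Y y * \<psi> (rb u y + age u y) (death_place u y) * c k \<partial>measure_pmf (off a))"
        by (simp add: P1_def Some off_law_def mult_ac)
      also have "\<dots> = Y y * \<psi> (rb u y + age u y) (death_place u y) * m a"
        unfolding m_def by (rule nn_integral_cmult) simp
      finally have "(\<integral>\<^sup>+k. P1 (y, k) \<partial>off_law (death_place u y)) = P2 (y, age u y)"
        using x by (simp add: P2_def Some mult_ac)
      moreover have "indicator S y = (indicator (born u \<inter> branched u) y :: ennreal)"
        using y Some by (simp add: S_def born_def branched_def indicator_def)
      ultimately show ?thesis by simp
    qed
  qed
  also have "\<dots> = (\<integral>\<^sup>+y. indicator (born u) y * (\<integral>\<^sup>+s. P2 (y, s) \<partial>age_law (mot y u)) \<partial>M)"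
    by (rule age_disintegration[OF P2m])
  also have "\<dots> = (\<integral>\<^sup>+y. indicator (born u) y * (Y y * (\<integral>\<^sup>+s. branch_dens (\<lambda>x. ennreal (\<beta> x) * m x) s (mot y u) * \<psi> (rb u y + s) (\<xi> (max 0 s) (mot y u)) \<partial>lborel)) \<partial>M)"
  proof (intro nn_integral_cong arg_cong2[where f = "(*)"] refl)
    fix y assume y: "y \<in> space M"
    have "(\<lambda>s. P2 (y, s)) \<in> borel_measurable borel"
      using measurable_compose[OF measurable_Pair1' P2m] y by simp
    then have "(\<integral>\<^sup>+s. P2 (y, s) \<partial>age_law (mot y u)) =
        (\<integral>\<^sup>+s. indicator {0..} s * ennreal (ext \<beta> (\<xi> (max 0 s) (mot y u)) * surv s (mot y u)) * P2 (y, s) \<partial>lborel)"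
      by (rule nn_integral_age_law)
    also have "\<dots> = (\<integral>\<^sup>+s. Y y * (branch_dens (\<lambda>x. ennreal (\<beta> x) * m x) s (mot y u) * \<psi> (rb u y + s) (\<xi> (max 0 s) (mot y u))) \<partial>lborel)"
    proof (intro nn_integral_cong)
      fix s
      have "ennreal (ext \<beta> z * e) * ext m z = ennreal e * ext (\<lambda>x. ennreal (\<beta> x) * m x) z" if "0 \<le> e" for z e
        using that beta_nonneg by (cases z) (simp_all add: ennreal_mult mult_ac)
      from this[of "surv s (mot y u)" "\<xi> (max 0 s) (mot y u)"]
      show "indicator {0..} s * ennreal (ext \<beta> (\<xi> (max 0 s) (mot y u)) * surv s (mot y u)) * P2 (y, s)
        = Y y * (branch_dens (\<lambda>x. ennreal (\<beta> x) * m x) s (mot y u) * \<psi> (rb u y + s) (\<xi> (max 0 s) (mot y u)))"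
        unfolding P2_def by (simp only: split mult.assoc mult.left_commute[of _ "Y y"]) (simp only: mult.assoc[symmetric] exp_ge_zero)
    qed
    also have "\<dots> = Y y * (\<integral>\<^sup>+s. branch_dens (\<lambda>x. ennreal (\<beta> x) * m x) s (mot y u) * \<psi> (rb u y + s) (\<xi> (max 0 s) (mot y u)) \<partial>lborel)"
    proof (rule nn_integral_cmult)
      note xm = path_measurable[of "mot y u"]
      have bm: "(\<lambda>x. ennreal (\<beta> x) * m x) \<in> borel_measurable borel" by measurable
      have rm: "(\<lambda>s. rb u y + s) \<in> borel_measurable borel" by measurable
      have "(\<lambda>s. path_int \<xi> \<beta> s (mot y u)) \<in> borel_measurable borel"
        by (rule path_int_measurable[OF beta_measurable]) auto
      note [measurable] = this measurable_compose[OF xm ext_measurable_ennreal[OF bm]]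
        measurable_compose[OF measurable_Pair[OF rm xm] \<psi>, simplified]
      show "(\<lambda>s. branch_dens (\<lambda>x. ennreal (\<beta> x) * m x) s (mot y u) * \<psi> (rb u y + s) (\<xi> (max 0 s) (mot y u))) \<in> borel_measurable lborel"
        by measurable
    qed
    finally show "(\<integral>\<^sup>+s. P2 (y, s) \<partial>age_law (mot y u)) = Y y * (\<integral>\<^sup>+s. branch_dens (\<lambda>x. ennreal (\<beta> x) * m x) s (mot y u) * \<psi> (rb u y + s) (\<xi> (max 0 s) (mot y u)) \<partial>lborel)" .
  qed
  also have "\<dots> = (\<integral>\<^sup>+y. indicator (born u) y * (Y y * branch_int (\<lambda>x. ennreal (\<beta> x) * m x) (\<lambda>s. \<psi> (rb u y + s)) (B u y)) \<partial>M)"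
  proof -
    define P4 where "P4 = (\<lambda>(y, w). \<integral>\<^sup>+s. branch_dens (\<lambda>x. ennreal (\<beta> x) * m x) s w * \<psi> (rb u y + s) (\<xi> (max 0 s) w) \<partial>lborel)"
    have bm: "(\<lambda>x. ennreal (\<beta> x) * m x) \<in> borel_measurable borel" by measurable
    have P4m: "P4 \<in> borel_measurable (G u \<Otimes>\<^sub>M path_algebra \<xi>)"
      unfolding P4_def split_beta'
      by (rule branch_integrand_measurable[OF bm \<psi> measurable_compose[OF measurable_fst rb_G] measurable_snd])
    have YP: "(\<lambda>p. Y (fst p) * P4 p) \<in> borel_measurable (G u \<Otimes>\<^sub>M path_algebra \<xi>)"
      using Y P4m by measurable
    have "(\<integral>\<^sup>+y. indicator (born u) y * (Y y * P4 (y, mot y u)) \<partial>M) = (\<integral>\<^sup>+y. indicator (born u) y * (\<integral>\<^sup>+w. Y y * P4 (y, w) \<partial>law (B u y)) \<partial>M)"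
      using motion_disintegration[OF YP] by simp
    also have "\<dots> = (\<integral>\<^sup>+y. indicator (born u) y * (Y y * (\<integral>\<^sup>+w. P4 (y, w) \<partial>law (B u y))) \<partial>M)"
    proof (intro nn_integral_cong arg_cong2[where f = "(*)"] refl)
      fix y assume y: "y \<in> space M"
      have "(\<lambda>w. P4 (y, w)) \<in> borel_measurable (path_algebra \<xi>)"
        using measurable_compose[OF measurable_Pair1' P4m] y by simp
      then show "(\<integral>\<^sup>+w. Y y * P4 (y, w) \<partial>law (B u y)) = Y y * (\<integral>\<^sup>+w. P4 (y, w) \<partial>law (B u y))"
        by (intro nn_integral_cmult borel_measurable_law)
    qed
    finally show ?thesis by (simp only: P4_def split branch_int_def)
  qed
  finally show ?thesis by (simp only: m_def)
qed

text \<open>The contribution of \<open>u\<close> itself to the integral of \<open>g\<close> against the population at time \<open>t\<close>.\<close>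

definition av :: "real \<Rightarrow> ('a \<Rightarrow> ennreal) \<Rightarrow> label \<Rightarrow> 'm \<Rightarrow> ennreal" where
  "av t g u w = (if B u w \<noteq> None \<and> rb u w \<le> t \<and> ennreal (t - rb u w) < life w u
     then ext g (\<xi> (t - rb u w) (mot w u)) else 0)"

text \<open>Surviving the age \<open>r\<close> is the complement of branching at an age of at most \<open>r\<close>. Truncation of \<open>X\<close>
  makes the integrals finite, so that they may be subtracted.\<close>

lemma survival:
  assumes X: "X \<in> borel_measurable (Gm u)" and r: "r \<in> borel_measurable (Gm u)" "\<And>w. 0 \<le> r w"
  shows "(\<integral>\<^sup>+w. indicator (born u) w * (X w * (if ennreal (r w) < life w u then 1 else 0)) \<partial>M)
     = (\<integral>\<^sup>+w. indicator (born u) w * (X w * ennreal (surv (r w) (mot w u))) \<partial>M)"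
proof -
  define e where "e = (\<lambda>w. surv (r w) (mot w u))"
  have e01: "0 \<le> e w" "e w \<le> 1" for w using path_int_nonneg[OF beta_nonneg] by (auto simp: e_def)
  note toM = measurable_from_subalg[OF sub_Gm]
  have [measurable]: "(\<lambda>w. path_int \<xi> \<beta> (r w) (mot w u)) \<in> borel_measurable M"
    by (rule path_int_measurable[OF beta_measurable toM[OF r(1)] mot_measurable])
  have em [measurable]: "e \<in> borel_measurable M" unfolding e_def by measurable
  note [measurable] = toM[OF X] toM[OF r(1)] life_measurable[of u] born_G(4)[of u] branched_sets(1)[of u]
  have ageM [measurable]: "age u \<in> borel_measurable M" unfolding age_def[abs_def] by measurable
  define b where "b = (indicator (born u) :: 'm \<Rightarrow> ennreal)"
  have bm [measurable]: "b \<in> borel_measurable M" unfolding b_def by measurable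
  have trunc: "(\<integral>\<^sup>+w. b w * (min (X w) (of_nat n) * (if ennreal (r w) < life w u then 1 else 0)) \<partial>M)
     = (\<integral>\<^sup>+w. b w * (min (X w) (of_nat n) * ennreal (e w)) \<partial>M)" for n
  proof -
    define Xn where "Xn = (\<lambda>w. min (X w) (of_nat n))"
    have XnG: "Xn \<in> borel_measurable (Gm u)" unfolding Xn_def using X by measurable
    note [measurable] = toM[OF XnG]
    define I1 where "I1 = (\<integral>\<^sup>+w. indicator (born u \<inter> branched u) w * (Xn w * indicator {..r w} (age u w)) \<partial>M)"
    have fin: "(\<integral>\<^sup>+w. b w * (Xn w * f w) \<partial>M) \<noteq> top" if "\<And>w. f w \<le> 1" for f
    proof -
      have "(\<integral>\<^sup>+w. b w * (Xn w * f w) \<partial>M) \<le> (\<integral>\<^sup>+w. 1 * (of_nat n * 1) \<partial>M)"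
        using that by (intro nn_integral_mono mult_mono) (auto simp: b_def Xn_def indicator_def)
      also have "\<dots> < top" using emeasure_space_1 by (simp add: of_nat_less_top)
      finally show ?thesis by simp
    qed
    have "I1 = (\<integral>\<^sup>+w. b w * (\<integral>\<^sup>+s. Xn w * indicator {..r w} s \<partial>age_law (mot w u)) \<partial>M)"
    proof -
      have "(\<lambda>p. Xn (fst p) * indicator {..r (fst p)} (snd p)) \<in> borel_measurable (Gm u \<Otimes>\<^sub>M borel)"
        using XnG r(1) unfolding indicator_def atMost_iff of_bool_def by measurable
      from age_disintegration[OF this] show ?thesis by (simp add: I1_def b_def)
    qed
    also have "\<dots> = (\<integral>\<^sup>+w. b w * (Xn w * ennreal (1 - e w)) \<partial>M)"
    proof (intro nn_integral_cong arg_cong2[where f = "(*)"] refl)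
      fix w
      have "(\<integral>\<^sup>+s. Xn w * indicator {..r w} s \<partial>age_law (mot w u)) = Xn w * emeasure (age_law (mot w u)) {..r w}"
        by (simp add: nn_integral_cmult_indicator)
      then show "(\<integral>\<^sup>+s. Xn w * indicator {..r w} s \<partial>age_law (mot w u)) = Xn w * ennreal (1 - e w)"
        using r(2)[of w] by (simp add: emeasure_age_law_atMost e_def)
    qed
    finally have I1: "I1 = (\<integral>\<^sup>+w. b w * (Xn w * ennreal (1 - e w)) \<partial>M)" .
    have I1_fin: "I1 \<noteq> top" unfolding I1 by (rule fin) (use e01 in \<open>simp add: ennreal_le_1\<close>)
    have "I1 + (\<integral>\<^sup>+w. b w * (Xn w * (if ennreal (r w) < life w u then 1 else 0)) \<partial>M)
       = (\<integral>\<^sup>+w. indicator (born u \<inter> branched u) w * (Xn w * indicator {..r w} (age u w)) + b w * (Xn w * (if ennreal (r w) < life w u then 1 else 0)) \<partial>M)"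
      unfolding I1_def
    proof (rule nn_integral_add[symmetric])
      show "(\<lambda>w. indicator (born u \<inter> branched u) w * (Xn w * indicator {..r w} (age u w))) \<in> borel_measurable M"
        unfolding indicator_def[of "{..r _}"] atMost_iff of_bool_def by measurable
    qed measurable
    also have "\<dots> = (\<integral>\<^sup>+w. b w * Xn w \<partial>M)"
    proof (intro nn_integral_cong)
      fix w assume w: "w \<in> space M"
      have "(life w u < \<infinity> \<and> age u w \<le> r w) \<longleftrightarrow> \<not> ennreal (r w) < life w u"
      proof (cases "life w u")
        case (real x)
        then show ?thesis using r(2)[of w] by (simp add: age_def infinity_ennreal_def ennreal_less_iff not_less)
      next
        case top
        then show ?thesis by (simp add: infinity_ennreal_def)
      qed
      then show "indicator (born u \<inter> branched u) w * (Xn w * indicator {..r w} (age u w)) + b w * (Xn w * (if ennreal (r w) < life w u then 1 else 0)) = b w * Xn w"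
        using w by (auto simp: b_def branched_def indicator_def)
    qed
    also have "\<dots> = (\<integral>\<^sup>+w. b w * (Xn w * ennreal (1 - e w)) + b w * (Xn w * ennreal (e w)) \<partial>M)"
    proof (intro nn_integral_cong)
      fix w
      have "ennreal (1 - e w) + ennreal (e w) = 1" using e01[of w] by (simp flip: ennreal_plus)
      then show "b w * Xn w = b w * (Xn w * ennreal (1 - e w)) + b w * (Xn w * ennreal (e w))"
        by (simp add: distrib_left[symmetric])
    qed
    also have "\<dots> = I1 + (\<integral>\<^sup>+w. b w * (Xn w * ennreal (e w)) \<partial>M)"
      unfolding I1 by (rule nn_integral_add) measurable
    finally show ?thesis using I1_fin by (simp add: ennreal_add_left_cancel infinity_ennreal_def Xn_def)
  qed
  have lim: "(\<integral>\<^sup>+w. b w * (X w * f w) \<partial>M) = (SUP n. \<integral>\<^sup>+w. b w * (min (X w) (of_nat n) * f w) \<partial>M)"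
    if [measurable]: "f \<in> borel_measurable M" for f
  proof -
    have "(\<integral>\<^sup>+w. b w * (X w * f w) \<partial>M) = (\<integral>\<^sup>+w. (SUP n. b w * (min (X w) (of_nat n) * f w)) \<partial>M)"
      by (simp only: SUP_mult_left_ennreal[symmetric] SUP_mult_right_ennreal[symmetric] SUP_min_of_nat)
    also have "\<dots> = (SUP n. \<integral>\<^sup>+w. b w * (min (X w) (of_nat n) * f w) \<partial>M)"
    proof (rule nn_integral_monotone_convergence_SUP)
      show "incseq (\<lambda>n w. b w * (min (X w) (of_nat n) * f w))"
        by (auto simp: incseq_def le_fun_def intro!: mult_left_mono mult_right_mono min.mono)
    qed measurable
    finally show ?thesis .
  qed
  have fm: "(\<lambda>w. if ennreal (r w) < life w u then 1 else 0 :: ennreal) \<in> borel_measurable M" by measurable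
  have fm2: "(\<lambda>w. ennreal (e w)) \<in> borel_measurable M" by measurable
  show ?thesis using lim[OF fm] lim[OF fm2] unfolding trunc unfolding b_def e_def by simp
qed

lemma alive_step:
  assumes Y: "Y \<in> borel_measurable (G u)" and g: "g \<in> borel_measurable borel"
  shows "(\<integral>\<^sup>+y. Y y * av t g u y \<partial>M) = (\<integral>\<^sup>+y. indicator (born u) y * (Y y * alive_mean 0 t g (rb u y) (B u y)) \<partial>M)"
proof -
  define r where "r = (\<lambda>y. max 0 (t - rb u y))"
  have rG: "r \<in> borel_measurable (G u)" unfolding r_def using rb_G by measurable
  define X where "X = (\<lambda>y. Y y * (if rb u y \<le> t then ext g (\<xi> (max 0 (r y)) (mot y u)) else 0))"
  have Xm: "X \<in> borel_measurable (Gm u)"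
  proof -
    note [measurable] = G_to_Gm[OF Y] G_to_Gm[OF rb_G] measurable_compose[OF xi_measurable[OF G_to_Gm[OF rG] mot_Gm] ext_measurable_ennreal[OF g]]
    show ?thesis unfolding X_def by measurable
  qed
  have r0: "0 \<le> r y" for y by (simp add: r_def)
  have "(\<integral>\<^sup>+y. Y y * av t g u y \<partial>M) = (\<integral>\<^sup>+y. indicator (born u) y * (X y * (if ennreal (r y) < life y u then 1 else 0)) \<partial>M)"
    by (intro nn_integral_cong) (auto simp: av_def X_def r_def born_def indicator_def)
  also have "\<dots> = (\<integral>\<^sup>+y. indicator (born u) y * (X y * ennreal (surv (r y) (mot y u))) \<partial>M)"
    by (rule survival[OF Xm G_to_Gm[OF rG] r0])
  also have "\<dots> = (\<integral>\<^sup>+y. indicator (born u) y * (Y y * alive_mean 0 t g (rb u y) (B u y)) \<partial>M)"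
  proof -
    define P where "P = (\<lambda>(y, w). if rb u y \<le> t then ennreal (surv (r y) w) * ext g (\<xi> (max 0 (r y)) w) else 0)"
    have Pm: "P \<in> borel_measurable (G u \<Otimes>\<^sub>M path_algebra \<xi>)"
    proof -
      note rm = measurable_compose[OF measurable_fst rG, of "path_algebra \<xi>"]
      note [measurable] = rb_G path_int_measurable[OF beta_measurable rm measurable_snd] measurable_compose[OF xi_measurable[OF rm measurable_snd] ext_measurable_ennreal[OF g]]
      show ?thesis unfolding P_def split_beta' by measurable
    qed
    have YP: "(\<lambda>p. Y (fst p) * P p) \<in> borel_measurable (G u \<Otimes>\<^sub>M path_algebra \<xi>)" using Y Pm by measurable
    have "(\<integral>\<^sup>+y. indicator (born u) y * (X y * ennreal (surv (r y) (mot y u))) \<partial>M)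
      = (\<integral>\<^sup>+y. indicator (born u) y * (Y y * P (y, mot y u)) \<partial>M)"
      by (intro nn_integral_cong) (simp add: X_def P_def mult_ac)
    also have "\<dots> = (\<integral>\<^sup>+y. indicator (born u) y * (\<integral>\<^sup>+w. Y y * P (y, w) \<partial>law (B u y)) \<partial>M)"
      using motion_disintegration[OF YP] by simp
    also have "\<dots> = (\<integral>\<^sup>+y. indicator (born u) y * (Y y * alive_mean 0 t g (rb u y) (B u y)) \<partial>M)"
    proof (intro nn_integral_cong arg_cong2[where f = "(*)"] refl)
      fix y assume y: "y \<in> space M"
      have "(\<lambda>w. P (y, w)) \<in> borel_measurable (path_algebra \<xi>)"
        using measurable_compose[OF measurable_Pair1' Pm] y by simp
      then have "(\<integral>\<^sup>+w. Y y * P (y, w) \<partial>law (B u y)) = Y y * (\<integral>\<^sup>+w. P (y, w) \<partial>law (B u y))"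
        by (intro nn_integral_cmult borel_measurable_law)
      also have "(\<integral>\<^sup>+w. P (y, w) \<partial>law (B u y)) = alive_mean 0 t g (rb u y) (B u y)"
        by (simp add: P_def alive_mean_def mean_gen_def r_def)
      finally show "(\<integral>\<^sup>+w. Y y * P (y, w) \<partial>law (B u y)) = Y y * alive_mean 0 t g (rb u y) (B u y)" .
    qed
    finally show ?thesis .
  qed
  finally show ?thesis .
qed

end

context branching_system
begin

text \<open>The sum of \<open>F\<close> over the \<open>n\<close>-th generation of descendants of \<open>u\<close>.\<close>

primrec dsum :: "nat \<Rightarrow> (label \<Rightarrow> 'm \<Rightarrow> ennreal) \<Rightarrow> label \<Rightarrow> 'm \<Rightarrow> ennreal" where
  "dsum 0 F u w = F u w"
| "dsum (Suc n) F u w = (\<Sum>i. dsum n F (i # u) w)"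

lemma dsum_measurable:
  assumes "\<And>v. suffix u v \<Longrightarrow> F v \<in> borel_measurable N"
  shows "dsum n F u \<in> borel_measurable N"
  using assms
proof (induction n arbitrary: u)
  case 0
  have "dsum 0 F u = F u" by (rule ext) simp
  then show ?case using 0 by simp
next
  case (Suc n)
  have "dsum n F (i # u) \<in> borel_measurable N" for i
    by (rule Suc.IH) (meson Suc.prems suffix_ConsD)
  moreover have "dsum (Suc n) F u = (\<lambda>w. \<Sum>i. dsum n F (i # u) w)" by (rule ext) simp
  ultimately show ?case by simp
qed

lemma jm_birth_measurable:
  assumes \<psi>: "jm \<psi>" and B: "B v \<in> N \<rightarrow>\<^sub>M Edel" "rb v \<in> borel_measurable N"
  shows "(\<lambda>w. \<psi> (rb v w) (B v w)) \<in> borel_measurable N"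
  using measurable_compose[OF measurable_Pair[OF B(2,1)] \<psi>] by simp

lemma rb_birth_G:
  assumes "\<And>v'. strict_suffix v' v \<Longrightarrow> \<not> suffix u v'" shows "rb v \<in> borel_measurable (G u)"
  using birth_G(2)[OF assms] unfolding rb_def[abs_def] by measurable

lemma born_child_iff:
  assumes "u \<noteq> []"
  shows "B (i # u) w \<noteq> None \<longleftrightarrow> (B u w \<noteq> None \<and> life w u < \<infinity> \<and> death_place u w \<noteq> None) \<and> i < kids w u"
    and "B (i # u) w \<noteq> None \<Longrightarrow> B (i # u) w = death_place u w"
  using assms by (auto simp: B_child split: if_splits)

text \<open>Raising the generation by one applies \<open>Kop\<close> to the conditional expectation given the birth:
  given the parent, the number of children and their common birth place are integrated out.\<close>

lemma dsum_expectation: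
  assumes F: "\<And>u Y. u \<noteq> [] \<Longrightarrow> Y \<in> borel_measurable (G u) \<Longrightarrow>
      (\<integral>\<^sup>+w. Y w * F u w \<partial>M) = (\<integral>\<^sup>+w. indicator (born u) w * (Y w * \<psi> (rb u w) (B u w)) \<partial>M)"
    and Fm: "\<And>u. u \<noteq> [] \<Longrightarrow> F u \<in> borel_measurable M" and \<psi>: "jm \<psi>"
    and u: "u \<noteq> []" and Y: "Y \<in> borel_measurable (G u)"
  shows "(\<integral>\<^sup>+w. Y w * dsum n F u w \<partial>M) = (\<integral>\<^sup>+w. indicator (born u) w * (Y w * (Kop ^^ n) \<psi> (rb u w) (B u w)) \<partial>M)"
  using u Y
proof (induction n arbitrary: u Y)
  case 0
  then show ?case using F[OF 0] by simp
next
  case (Suc n)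
  note u = Suc.prems(1) and Y = Suc.prems(2)
  let ?\<psi> = "(Kop ^^ n) \<psi>"
  have \<psi>n: "jm ?\<psi>" by (rule Kop_pow_measurable[OF \<psi>])
  have sfx: "suffix u (i # u)" for i by (simp add: suffix_ConsI)
  have Yi: "Y \<in> borel_measurable (G (i # u))" for i by (rule G_mono[OF sfx Y])
  note [measurable] = G_to_M[OF Y] born_G(4)
  have dm [measurable]: "dsum n F (i # u) \<in> borel_measurable M" for i
    by (rule dsum_measurable) (use Fm u in \<open>auto simp: suffix_def\<close>)
  have m [measurable]: "(\<lambda>w. ?\<psi> (rb (i # u) w) (B (i # u) w)) \<in> borel_measurable M" for i
    by (rule jm_birth_measurable[OF \<psi>n G_to_M[OF B_G] G_to_M[OF rb_G]])
  define E where "E = (\<lambda>w. B u w \<noteq> None \<and> life w u < \<infinity> \<and> death_place u w \<noteq> None)"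
  have "(\<integral>\<^sup>+w. Y w * dsum (Suc n) F u w \<partial>M) = (\<integral>\<^sup>+w. (\<Sum>i. Y w * dsum n F (i # u) w) \<partial>M)"
    by (simp add: ennreal_suminf_cmult)
  also have "\<dots> = (\<Sum>i. \<integral>\<^sup>+w. Y w * dsum n F (i # u) w \<partial>M)"
    by (rule nn_integral_suminf) measurable
  also have "\<dots> = (\<Sum>i. \<integral>\<^sup>+w. indicator (born (i # u)) w * (Y w * ?\<psi> (rb (i # u) w) (B (i # u) w)) \<partial>M)"
    by (intro suminf_cong Suc.IH Yi) simp
  also have "\<dots> = (\<integral>\<^sup>+w. (\<Sum>i. indicator (born (i # u)) w * (Y w * ?\<psi> (rb (i # u) w) (B (i # u) w))) \<partial>M)"
    by (rule nn_integral_suminf[symmetric]) measurable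
  also have "\<dots> = (\<integral>\<^sup>+w. Y w * (if E w then of_nat (kids w u) * ?\<psi> (rb u w + age u w) (death_place u w) else 0) \<partial>M)"
  proof (intro nn_integral_cong)
    fix w assume w: "w \<in> space M"
    have "indicator (born (i # u)) w * (Y w * ?\<psi> (rb (i # u) w) (B (i # u) w)) =
        (if i < kids w u then (if E w then Y w * ?\<psi> (rb u w + age u w) (death_place u w) else 0) else 0)" for i
      using born_child_iff[OF u, of i w] rb_child[OF u, of i w] w
      by (auto simp: born_def E_def simp del: not_None_eq)
    then have "(\<Sum>i. indicator (born (i # u)) w * (Y w * ?\<psi> (rb (i # u) w) (B (i # u) w))) =
        of_nat (kids w u) * (if E w then Y w * ?\<psi> (rb u w + age u w) (death_place u w) else 0)"
      by (simp only: suminf_indicator_lessThan)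
    then show "(\<Sum>i. indicator (born (i # u)) w * (Y w * ?\<psi> (rb (i # u) w) (B (i # u) w))) =
        Y w * (if E w then of_nat (kids w u) * ?\<psi> (rb u w + age u w) (death_place u w) else 0)"
      by (simp add: mult_ac)
  qed
  also have "\<dots> = (\<integral>\<^sup>+w. indicator (born u) w * (Y w * branch_int (\<lambda>x. ennreal (\<beta> x) * (\<integral>\<^sup>+k. of_nat k \<partial>measure_pmf (off x))) (\<lambda>s. ?\<psi> (rb u w + s)) (B u w)) \<partial>M)"
    unfolding E_def by (rule branch_step[OF Y \<psi>n])
  also have "(\<lambda>x. ennreal (\<beta> x) * (\<integral>\<^sup>+k. of_nat k \<partial>measure_pmf (off x))) = (\<lambda>x. ennreal (birth_rate x))"
    using beta_nonneg off_mean(2) by (simp add: mean_offspring birth_rate_def ennreal_mult)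
  finally show ?case by (simp add: Kop_def)
qed

lemma av_measurable:
  assumes g: "g \<in> borel_measurable borel" and v: "\<not> suffix u v"
  shows "av t g v \<in> borel_measurable (G u)"
proof -
  have *: "\<not> suffix u v'" if "strict_suffix v' v" for v'
    using v that suffix_order.trans by (auto simp: strict_suffix_def)
  have rm: "(\<lambda>w. t - rb v w) \<in> borel_measurable (G u)" using rb_birth_G[OF *] by measurable
  note [measurable] = not_None_pred[OF birth_G(1)[OF *]] rb_birth_G[OF *] component_G(2)[OF v]
    measurable_compose[OF xi_measurable[OF rm component_G(1)[OF v]] ext_measurable_ennreal[OF g]]
  have "(\<lambda>w. if B v w \<noteq> None \<and> rb v w \<le> t \<and> ennreal (t - rb v w) < life w v
     then ext g (\<xi> (max 0 (t - rb v w)) (mot w v)) else 0) \<in> borel_measurable (G u)" by measurable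
  moreover have "av t g v = (\<lambda>w. if B v w \<noteq> None \<and> rb v w \<le> t \<and> ennreal (t - rb v w) < life w v
     then ext g (\<xi> (max 0 (t - rb v w)) (mot w v)) else 0)"
    by (rule ext) (auto simp: av_def)
  ultimately show ?thesis by simp
qed

lemma av_measurable_M:
  assumes g: "g \<in> borel_measurable borel" shows "av t g v \<in> borel_measurable M"
proof (rule G_to_M[OF av_measurable[OF g]])
  show "\<not> suffix (0 # v) v" using suffix_length_le by fastforce
qed

text \<open>The sum of \<open>g\<close> over the positions at time \<open>t\<close> of the descendants of \<open>u\<close>.\<close>

definition Z :: "real \<Rightarrow> ('a \<Rightarrow> ennreal) \<Rightarrow> label \<Rightarrow> 'm \<Rightarrow> ennreal" where
  "Z t g u w = (\<Sum>n. dsum n (av t g) u w)"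

lemma Z_measurable:
  assumes g: "g \<in> borel_measurable borel" and v: "\<And>v'. suffix v v' \<Longrightarrow> \<not> suffix u v'"
  shows "Z t g v \<in> borel_measurable (G u)"
proof -
  have "dsum n (av t g) v \<in> borel_measurable (G u)" for n
    by (rule dsum_measurable) (rule av_measurable[OF g v])
  then show ?thesis unfolding Z_def[abs_def] by measurable
qed

lemma Z_measurable_M: "g \<in> borel_measurable borel \<Longrightarrow> Z t g v \<in> borel_measurable M"
  unfolding Z_def[abs_def] using dsum_measurable[OF av_measurable_M] by measurable

text \<open>Summed over all generations, the expected contributions form the Feynman--Kac semigroup.\<close>

theorem Z_expectation:
  assumes g: "g \<in> borel_measurable borel" and u: "u \<noteq> []" and Y: "Y \<in> borel_measurable (G u)"
  shows "(\<integral>\<^sup>+w. Y w * Z t g u w \<partial>M) = (\<integral>\<^sup>+w. indicator (born u) w * (Y w * FKm t g (rb u w) (B u w)) \<partial>M)"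
proof -
  note [measurable] = G_to_M[OF Y] born_G(4) dsum_measurable[OF av_measurable_M[OF g]]
  have [measurable]: "(\<lambda>w. alive_mean n t g (rb u w) (B u w)) \<in> borel_measurable M" for n
    by (rule jm_birth_measurable[OF alive_mean_measurable[OF g] G_to_M[OF B_G] G_to_M[OF rb_G]])
  have "(\<integral>\<^sup>+w. Y w * Z t g u w \<partial>M) = (\<integral>\<^sup>+w. (\<Sum>n. Y w * dsum n (av t g) u w) \<partial>M)"
    by (simp add: Z_def ennreal_suminf_cmult)
  also have "\<dots> = (\<Sum>n. \<integral>\<^sup>+w. Y w * dsum n (av t g) u w \<partial>M)"
    by (rule nn_integral_suminf) measurable
  also have "\<dots> = (\<Sum>n. \<integral>\<^sup>+w. indicator (born u) w * (Y w * alive_mean n t g (rb u w) (B u w)) \<partial>M)"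
    using dsum_expectation[OF alive_step[OF _ g] av_measurable_M[OF g] alive_mean_measurable[OF g] u Y]
    by (simp add: Kop_pow_alive_mean[OF g])
  also have "\<dots> = (\<integral>\<^sup>+w. (\<Sum>n. indicator (born u) w * (Y w * alive_mean n t g (rb u w) (B u w))) \<partial>M)"
    by (rule nn_integral_suminf[symmetric]) measurable
  also have "\<dots> = (\<integral>\<^sup>+w. indicator (born u) w * (Y w * FKm t g (rb u w) (B u w)) \<partial>M)"
    by (simp add: ennreal_suminf_cmult alive_mean_sums[OF g])
  finally show ?thesis .
qed

section \<open>The second moment\<close>

text \<open>\<open>R t g h u\<close> collects the pairs of descendants of \<open>u\<close> alive at time \<open>t\<close> whose last common
  ancestor is \<open>u\<close>.\<close>

definition R :: "real \<Rightarrow> ('a \<Rightarrow> ennreal) \<Rightarrow> ('a \<Rightarrow> ennreal) \<Rightarrow> label \<Rightarrow> 'm \<Rightarrow> ennreal" where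
  "R t g h u w = av t (\<lambda>x. g x * h x) u w + (\<Sum>i. \<Sum>j. if i \<noteq> j then Z t g (i # u) w * Z t h (j # u) w else 0)"

lemma av_mult: "av t (\<lambda>x. g x * h x) u w = av t g u w * av t h u w"
proof -
  have "ext (\<lambda>x. g x * h x) z = ext g z * ext h z" for z by (cases z) auto
  then show ?thesis by (simp add: av_def)
qed

lemma ennreal_suminf_swap: "(\<Sum>n. \<Sum>i. (f n i :: ennreal)) = (\<Sum>i. \<Sum>n. f n i)"
proof -
  have "(\<Sum>i. \<Sum>n. f n i) = (\<integral>\<^sup>+i. (\<Sum>n. f n i) \<partial>count_space UNIV)"
    by (rule nn_integral_count_space_nat[symmetric])
  also have "\<dots> = (\<Sum>n. \<integral>\<^sup>+i. f n i \<partial>count_space UNIV)" by (rule nn_integral_suminf) simp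
  finally show ?thesis by (simp add: nn_integral_count_space_nat)
qed

lemma Z_step: "Z t g u w = av t g u w + (\<Sum>i. Z t g (i # u) w)"
proof -
  have "Z t g u w = (\<Sum>n. dsum (Suc n) (av t g) u w) + dsum 0 (av t g) u w"
    unfolding Z_def by (subst suminf_offset[where i = 1]) (auto simp: summableI)
  also have "(\<Sum>n. dsum (Suc n) (av t g) u w) = (\<Sum>i. Z t g (i # u) w)"
    unfolding Z_def dsum.simps by (rule ennreal_suminf_swap)
  finally show ?thesis by (simp add: add.commute)
qed

lemma late_zero:
  assumes "u \<noteq> []" "B u w = None \<or> t < rb u w"
  shows "dsum n (av t g) u w = 0"
  using assms
proof (induction n arbitrary: u)
  case 0
  then show ?case by (auto simp: av_def)
next
  case (Suc n)
  have "dsum n (av t g) (i # u) w = 0" for i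
  proof (rule Suc.IH)
    show "B (i # u) w = None \<or> t < rb (i # u) w"
      using Suc.prems born_child_iff(1)[of u i w] rb_child[of u i w] age_nonneg[of u w] by fastforce
  qed simp
  then show ?case by simp
qed

text \<open>The children of an individual alive at time \<open>t\<close> are born after \<open>t\<close>.\<close>

lemma alive_no_children:
  assumes u: "u \<noteq> []" and a: "av t g u w \<noteq> 0" shows "Z t h (i # u) w = 0"
proof -
  have al: "B u w \<noteq> None" "rb u w \<le> t" "ennreal (t - rb u w) < life w u"
    using a by (auto simp: av_def split: if_splits)
  have "B (i # u) w = None \<or> t < rb (i # u) w"
  proof (rule ccontr)
    assume "\<not> ?thesis"
    then have c: "B (i # u) w \<noteq> None" "rb (i # u) w \<le> t" by auto
    then have "life w u < \<infinity>" "rb u w + age u w \<le> t"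
      using born_child_iff(1)[OF u, of i w] rb_child[OF u c(1)] by auto
    then have "life w u = ennreal (age u w)" "age u w \<le> t - rb u w"
      by (auto simp: age_def infinity_ennreal_def)
    then have "life w u \<le> ennreal (t - rb u w)" by (simp add: ennreal_leI)
    then show False using al(3) by (simp add: not_le[symmetric])
  qed
  then have "dsum n (av t h) (i # u) w = 0" for n by (intro late_zero) auto
  then show ?thesis by (simp add: Z_def)
qed

text \<open>Pairs of descendants of \<open>u\<close> are split according to whether both descend from the same child. A pair of
  \<open>u\<close> and a proper descendant does not contribute.\<close>

lemma Z_mult_step:
  assumes u: "u \<noteq> []"
  shows "Z t g u w * Z t h u w = R t g h u w + (\<Sum>i. Z t g (i # u) w * Z t h (i # u) w)"
proof -
  define x y where "x = (\<lambda>i. Z t g (i # u) w)" and "y = (\<lambda>i. Z t h (i # u) w)"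
  have "av t g u w * (\<Sum>j. y j) = 0"
    using alive_no_children[OF u, of t g w h] by (cases "av t g u w = 0") (auto simp: y_def)
  moreover have "(\<Sum>i. x i) * av t h u w = 0"
    using alive_no_children[OF u, of t h w g] by (cases "av t h u w = 0") (auto simp: x_def)
  ultimately have "Z t g u w * Z t h u w = av t (\<lambda>x. g x * h x) u w + (\<Sum>i. x i) * (\<Sum>j. y j)"
    unfolding Z_step[of t g u] Z_step[of t h u] x_def[symmetric] y_def[symmetric] av_mult
    by (simp add: distrib_left distrib_right)
  also have "(\<Sum>i. x i) * (\<Sum>j. y j) = (\<Sum>i. \<Sum>j. x i * y j)"
    by (simp add: ennreal_suminf_cmult ennreal_suminf_multc)
  also have "\<dots> = (\<Sum>i. (\<Sum>j. if i \<noteq> j then x i * y j else 0) + x i * y i)"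
  proof (rule suminf_cong)
    fix i
    have "(\<Sum>j. x i * y j) = (\<Sum>j. (if i \<noteq> j then x i * y j else 0) + (if j = i then x i * y i else 0))"
      by (rule suminf_cong) auto
    also have "\<dots> = (\<Sum>j. if i \<noteq> j then x i * y j else 0) + (\<Sum>j. if j = i then x i * y i else 0)"
      by (rule suminf_add[symmetric]) (auto simp: summableI)
    also have "(\<Sum>j. if j = i then x i * y i else 0) = x i * y i"
      using suminf_finite[of "{i}" "\<lambda>j. if j = i then x i * y i else 0"] by simp
    finally show "(\<Sum>j. x i * y j) = (\<Sum>j. if i \<noteq> j then x i * y j else 0) + x i * y i" .
  qed
  also have "\<dots> = (\<Sum>i. \<Sum>j. if i \<noteq> j then x i * y j else 0) + (\<Sum>i. x i * y i)"
    by (rule suminf_add[symmetric]) (auto simp: summableI)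
  finally show ?thesis unfolding R_def x_def y_def by (simp only: add.assoc)
qed

lemma dsum_add: "dsum n (\<lambda>u w. F u w + F' u w) u w = dsum n F u w + dsum n F' u w"
proof (induction n arbitrary: u)
  case (Suc n)
  then show ?case by (simp add: suminf_add[symmetric] summableI)
qed simp

lemma dsum_cong: "(\<And>v. v \<noteq> [] \<Longrightarrow> F v w = F' v w) \<Longrightarrow> u \<noteq> [] \<Longrightarrow> dsum n F u w = dsum n F' u w"
  by (induction n arbitrary: u) (auto intro!: suminf_cong)

lemma dsum_Suc: "dsum (Suc n) F u w = dsum n (\<lambda>v w. \<Sum>i. F (i # v) w) u w"
proof (induction n arbitrary: u)
  case (Suc n)
  have "dsum (Suc (Suc n)) F u w = (\<Sum>i. dsum (Suc n) F (i # u) w)" by (rule dsum.simps(2))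
  also have "\<dots> = dsum (Suc n) (\<lambda>v w. \<Sum>i. F (i # v) w) u w" by (simp only: Suc.IH dsum.simps(2)[of n "\<lambda>v w. \<Sum>i. F (i # v) w"])
  finally show ?case .
qed simp

lemma Z_mult_expansion:
  assumes u: "u \<noteq> []"
  shows "Z t g u w * Z t h u w = (\<Sum>l<n. dsum l (R t g h) u w) + dsum n (\<lambda>v w. Z t g v w * Z t h v w) u w"
proof (induction n)
  case (Suc n)
  have "dsum n (\<lambda>v w. Z t g v w * Z t h v w) u w =
      dsum n (\<lambda>v w. R t g h v w + (\<Sum>i. Z t g (i # v) w * Z t h (i # v) w)) u w"
    by (rule dsum_cong[OF _ u]) (rule Z_mult_step)
  also have "\<dots> = dsum n (R t g h) u w + dsum (Suc n) (\<lambda>v w. Z t g v w * Z t h v w) u w"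
    unfolding dsum_add dsum_Suc ..
  finally show ?case using Suc by (simp add: add.assoc del: dsum.simps(2))
qed simp

lemma dsum_zeroI: "(\<And>w. length w = n \<Longrightarrow> F (w @ u) y = 0) \<Longrightarrow> dsum n F u y = 0"
proof (induction n arbitrary: u)
  case 0
  then show ?case using 0[of "[]"] by simp
next
  case (Suc n)
  have "dsum n F (i # u) y = 0" for i
  proof (rule Suc.IH)
    fix w :: label assume "length w = n"
    then show "F (w @ i # u) y = 0" using Suc.prems[of "w @ [i]"] by simp
  qed
  then show ?case by simp
qed

lemma dsum_ge: "length w = n \<Longrightarrow> F (w @ u) y \<le> dsum n F u y"
proof (induction n arbitrary: u w)
  case (Suc n)
  obtain w' i where w: "w = w' @ [i]" using Suc.prems by (metis length_Suc_conv_rev)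
  have "F (w @ u) y \<le> dsum n F (i # u) y" using Suc.IH[of w' "i # u"] Suc.prems by (simp add: w)
  also have "\<dots> \<le> (\<Sum>i. dsum n F (i # u) y)"
    using sum_le_suminf[of "\<lambda>i. dsum n F (i # u) y" "{i}"] by (simp add: summableI)
  finally show ?case by simp
qed simp

text \<open>If finitely many descendants are alive, none is alive beyond some generation, so the remainder
  in the expansion of the product vanishes eventually.\<close>

lemma Z_mult_eq:
  assumes u: "u \<noteq> []" and fin: "Z t (\<lambda>x. 1) u y < top"
  shows "Z t g u y * Z t h u y = (\<Sum>l. dsum l (R t g h) u y)"
proof -
  have "\<exists>n. \<forall>l\<ge>n. dsum l (av t (\<lambda>x. 1)) u y < 1"
  proof -
    define a where "a = (\<lambda>l. enn2real (dsum l (av t (\<lambda>x. 1)) u y))"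
    have le: "dsum l (av t (\<lambda>x. 1)) u y \<le> Z t (\<lambda>x. 1) u y" for l
      unfolding Z_def using sum_le_suminf[of "\<lambda>l. dsum l (av t (\<lambda>x. 1)) u y" "{l}"] by (simp add: summableI)
    have a: "ennreal (a l) = dsum l (av t (\<lambda>x. 1)) u y" for l
      unfolding a_def by (rule ennreal_enn2real) (rule le_less_trans[OF le fin])
    have "summable a"
      by (rule summable_suminf_not_top) (use fin in \<open>auto simp: a Z_def, simp add: a_def\<close>)
    then have "a \<longlonglongrightarrow> 0" by (rule summable_LIMSEQ_zero)
    then have "\<forall>\<^sub>F l in sequentially. a l < 1" by (rule order_tendstoD) simp
    then obtain n where "\<And>l. n \<le> l \<Longrightarrow> a l < 1" by (auto simp: eventually_sequentially)
    then have "dsum l (av t (\<lambda>x. 1)) u y < 1" if "n \<le> l" for l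
      using that a[of l] by (metis ennreal_less_one_iff)
    then show ?thesis by blast
  qed
  then obtain n where n: "\<And>l. n \<le> l \<Longrightarrow> dsum l (av t (\<lambda>x. 1)) u y < 1" by blast
  have dead: "av t f (w @ u) y = 0" if "n \<le> length w" for w f
  proof -
    have "av t (\<lambda>x. 1) (w @ u) y < 1" using dsum_ge[of w "length w" "av t (\<lambda>x. 1)" u y] n[OF that] by simp
    then show ?thesis by (auto simp: av_def ext_def split: if_splits option.splits)
  qed
  have Z0: "Z t f (w @ u) y = 0" if "n \<le> length w" for w f
  proof -
    have "dsum l (av t f) (w @ u) y = 0" for l
    proof (rule dsum_zeroI)
      fix w' :: label
      show "av t f (w' @ w @ u) y = 0" using dead[of "w' @ w"] that by simp
    qed
    then show ?thesis by (simp add: Z_def)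
  qed
  have zero: "dsum l (\<lambda>v y. Z t g v y * Z t h v y) u y = 0" if "n \<le> l" for l
    by (rule dsum_zeroI) (use Z0 that in simp)
  have "Z t g u y * Z t h u y = (\<Sum>l<m. dsum l (R t g h) u y)" if "n \<le> m" for m
    using Z_mult_expansion[OF u, of t g y h m] zero[OF that] by simp
  then have "\<forall>\<^sub>F m in sequentially. (\<Sum>l<m. dsum l (R t g h) u y) = Z t g u y * Z t h u y"
    unfolding eventually_sequentially by metis
  moreover have "(\<lambda>m. \<Sum>l<m. dsum l (R t g h) u y) \<longlonglongrightarrow> (\<Sum>l. dsum l (R t g h) u y)"
    using summable_LIMSEQ[OF summableI] .
  ultimately show ?thesis
    by (metis LIMSEQ_unique tendsto_eventually)
qed

text \<open>The branching rate weighted with the mean number of ordered pairs of children.\<close>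

definition pair_rate :: "'a \<Rightarrow> ennreal" where
  "pair_rate x = ennreal (\<beta> x) * (\<integral>\<^sup>+k. of_nat (k * (k - 1)) \<partial>measure_pmf (off x))"

lemma pair_rate_measurable [measurable]: "pair_rate \<in> borel_measurable borel"
  unfolding pair_rate_def using off_integral_measurable[of "\<lambda>k. of_nat (k * (k - 1))"] by measurable

lemma pair_rate_bound: "pair_rate x \<le> ennreal (beta_bound * off_bound)"
proof -
  have "pair_rate x \<le> ennreal beta_bound * ennreal off_bound"
    unfolding pair_rate_def using beta_bound(1)[of x] pair_offspring[of x] by (intro mult_mono ennreal_leI) auto
  then show ?thesis using beta_bound(2) off_bound(1) by (simp add: ennreal_mult)
qed

text \<open>The expected value of \<open>\<psi>\<close> at the branching of an individual born at time \<open>b\<close> in \<open>z\<close>, counted once for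
  each ordered pair of its children.\<close>

definition fork :: "(real \<Rightarrow> 'a option \<Rightarrow> ennreal) \<Rightarrow> real \<Rightarrow> 'a option \<Rightarrow> ennreal" where
  "fork \<psi> b z = branch_int pair_rate (\<lambda>s. \<psi> (b + s)) z"

lemma fork_measurable: "jm \<psi> \<Longrightarrow> jm (fork \<psi>)"
  unfolding fork_def by (rule branch_int_shift_measurable) measurable

lemma siblings_disjoint: "i \<noteq> j \<Longrightarrow> suffix (j # u) v' \<Longrightarrow> \<not> suffix (i # u) v'"
  using suffix_length_suffix[of "i # u" v' "j # u"] by (auto simp: suffix_def)

text \<open>Given the birth of two siblings, their descents are independent: each is integrated out in turn,
  the other one being an event outside its descent.\<close>

lemma sibling_expectation:
  assumes g: "g \<in> borel_measurable borel" and h: "h \<in> borel_measurable borel" and u: "u \<noteq> []" and Y: "Y \<in> borel_measurable (G u)"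
    and ij: "i \<noteq> j"
  shows "(\<integral>\<^sup>+w. Y w * (Z t g (i # u) w * Z t h (j # u) w) \<partial>M) =
    (\<integral>\<^sup>+w. indicator (born (j # u)) w * (indicator (born (i # u)) w * (Y w * FKm t g (rb (i # u) w) (B (i # u) w)) * FKm t h (rb (j # u) w) (B (j # u) w)) \<partial>M)"
proof -
  have sfx: "suffix u (k # u)" for k by (simp add: suffix_ConsI)
  have Yk: "Y \<in> borel_measurable (G (k # u))" for k by (rule G_mono[OF sfx Y])
  have Zh: "Z t h (j # u) \<in> borel_measurable (G (i # u))"
    by (rule Z_measurable[OF h]) (rule siblings_disjoint[OF ij])
  have "(\<integral>\<^sup>+w. Y w * (Z t g (i # u) w * Z t h (j # u) w) \<partial>M) = (\<integral>\<^sup>+w. (Y w * Z t h (j # u) w) * Z t g (i # u) w \<partial>M)"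
    by (simp add: mult_ac)
  also have "\<dots> = (\<integral>\<^sup>+w. indicator (born (i # u)) w * ((Y w * Z t h (j # u) w) * FKm t g (rb (i # u) w) (B (i # u) w)) \<partial>M)"
    by (rule Z_expectation[OF g]) (use Yk Zh in auto)
  also have "\<dots> = (\<integral>\<^sup>+w. (indicator (born (i # u)) w * (Y w * FKm t g (rb (i # u) w) (B (i # u) w))) * Z t h (j # u) w \<partial>M)"
    by (simp add: mult_ac)
  also have "\<dots> = (\<integral>\<^sup>+w. indicator (born (j # u)) w * (indicator (born (i # u)) w * (Y w * FKm t g (rb (i # u) w) (B (i # u) w)) * FKm t h (rb (j # u) w) (B (j # u) w)) \<partial>M)"
  proof (rule Z_expectation[OF h])
    have *: "\<not> suffix (j # u) v'" if "strict_suffix v' (i # u)" for v'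
    proof
      assume "suffix (j # u) v'"
      then have "length (j # u) \<le> length v'" by (rule suffix_length_le)
      moreover have "length v' < length (i # u)" using that by (rule suffix_length_less)
      ultimately show False by simp
    qed
    note Bi = birth_G(1)[OF *] and ri = rb_birth_G[OF *]
    have "{w \<in> space (G (j # u)). B (i # u) w \<noteq> None} \<in> sets (G (j # u))"
      using not_None_pred[OF Bi] by (simp add: pred_def)
    then have [measurable]: "born (i # u) \<in> sets (G (j # u))" by (simp add: born_def)
    note [measurable] = Yk[of j] jm_birth_measurable[OF FKm_measurable[OF g] Bi ri]
    show "(\<lambda>w. indicator (born (i # u)) w * (Y w * FKm t g (rb (i # u) w) (B (i # u) w))) \<in> borel_measurable (G (j # u))"
      by measurable
  qed simp
  finally show ?thesis .
qed

text \<open>The expected product of two independent sums, of \<open>g\<close> and of \<open>h\<close>, over the descendants of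
  individuals with the same birth.\<close>

definition gap :: "real \<Rightarrow> ('a \<Rightarrow> ennreal) \<Rightarrow> ('a \<Rightarrow> ennreal) \<Rightarrow> real \<Rightarrow> 'a option \<Rightarrow> ennreal" where
  "gap t g h b z = FKm t g b z * FKm t h b z"

lemma gap_measurable: "g \<in> borel_measurable borel \<Longrightarrow> h \<in> borel_measurable borel \<Longrightarrow> jm (gap t g h)"
  unfolding gap_def by (rule borel_measurable_times_ennreal[OF FKm_measurable FKm_measurable])

lemma R_measurable:
  assumes "g \<in> borel_measurable borel" "h \<in> borel_measurable borel"
  shows "R t g h u \<in> borel_measurable M"
proof -
  have gh: "(\<lambda>x. g x * h x) \<in> borel_measurable borel" using assms by measurable
  note [measurable] = Z_measurable_M[OF assms(1)] Z_measurable_M[OF assms(2)] av_measurable_M[OF gh]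
  have "(\<lambda>w. \<Sum>j. if i \<noteq> j then Z t g (i # u) w * Z t h (j # u) w else 0) \<in> borel_measurable M" for i
  proof (rule borel_measurable_suminf_order)
    show "(\<lambda>w. if i \<noteq> j then Z t g (i # u) w * Z t h (j # u) w else 0) \<in> borel_measurable M" for j
      by (cases "i = j") (simp_all, measurable)
  qed
  then show ?thesis unfolding R_def[abs_def] by measurable
qed

lemma R_expectation:
  assumes g: "g \<in> borel_measurable borel" and h: "h \<in> borel_measurable borel" and u: "u \<noteq> []" and Y: "Y \<in> borel_measurable (G u)"
  shows "(\<integral>\<^sup>+w. Y w * R t g h u w \<partial>M) =
    (\<integral>\<^sup>+w. indicator (born u) w * (Y w * (alive_mean 0 t (\<lambda>x. g x * h x) (rb u w) (B u w) + fork (gap t g h) (rb u w) (B u w))) \<partial>M)"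
proof -
  have gh [measurable]: "(\<lambda>x. g x * h x) \<in> borel_measurable borel" using g h by measurable
  note [measurable] = G_to_M[OF Y] born_G(4) Z_measurable_M[OF g] Z_measurable_M[OF h] av_measurable_M[OF gh]
    jm_birth_measurable[OF FKm_measurable[OF g] G_to_M[OF B_G] G_to_M[OF rb_G]]
    jm_birth_measurable[OF FKm_measurable[OF h] G_to_M[OF B_G] G_to_M[OF rb_G]]
    jm_birth_measurable[OF fork_measurable[OF gap_measurable[OF g h]] G_to_M[OF B_G] G_to_M[OF rb_G]]
    jm_birth_measurable[OF alive_mean_measurable[OF gh] G_to_M[OF B_G] G_to_M[OF rb_G]]
  define E where "E = (\<lambda>w. B u w \<noteq> None \<and> life w u < \<infinity> \<and> death_place u w \<noteq> None)"
  define c where "c = (\<lambda>i j w. if i \<noteq> j then Y w * (Z t g (i # u) w * Z t h (j # u) w) else 0)"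
  define d where "d = (\<lambda>i j w. if i \<noteq> j then indicator (born (j # u)) w * (indicator (born (i # u)) w * (Y w * FKm t g (rb (i # u) w) (B (i # u) w)) * FKm t h (rb (j # u) w) (B (j # u) w)) else 0)"
  have cm [measurable]: "c i j \<in> borel_measurable M" for i j
    unfolding c_def by (cases "i = j") (simp_all, measurable)
  have dm [measurable]: "d i j \<in> borel_measurable M" for i j
    unfolding d_def by (cases "i = j") (simp_all, measurable)
  have cd: "(\<integral>\<^sup>+w. c i j w \<partial>M) = (\<integral>\<^sup>+w. d i j w \<partial>M)" for i j
    using sibling_expectation[OF g h u Y, of i j t] by (cases "i = j") (simp_all add: c_def d_def)
  have sum_c: "Y w * (\<Sum>i. \<Sum>j. if i \<noteq> j then Z t g (i # u) w * Z t h (j # u) w else 0) = (\<Sum>i. \<Sum>j. c i j w)" for w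
    unfolding ennreal_suminf_cmult[symmetric] c_def by (intro suminf_cong) simp
  have sum_d: "(\<Sum>i. \<Sum>j. d i j w) = Y w * (if E w then of_nat (kids w u * (kids w u - 1)) * gap t g h (rb u w + age u w) (death_place u w) else 0)"
    if w: "w \<in> space M" for w
  proof -
    have "d i j w = (if i \<noteq> j \<and> i < kids w u \<and> j < kids w u then (if E w then Y w * gap t g h (rb u w + age u w) (death_place u w) else 0) else 0)" for i j
    proof -
      have b: "indicator (born (k # u)) w = (if E w \<and> k < kids w u then 1 else 0 :: ennreal)" for k
        using born_child_iff(1)[OF u, of k w] w by (auto simp: born_def E_def simp del: not_None_eq)
      have p: "B (k # u) w = death_place u w" "rb (k # u) w = rb u w + age u w" if "E w" "k < kids w u" for k
      proof -
        have "B (k # u) w \<noteq> None" using born_child_iff(1)[OF u, of k w] that by (simp add: E_def)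
        then show "B (k # u) w = death_place u w" "rb (k # u) w = rb u w + age u w"
          using born_child_iff(2)[OF u] rb_child[OF u] by auto
      qed
      show ?thesis unfolding d_def b using p[of i] p[of j] by (auto simp: gap_def mult_ac)
    qed
    then have "(\<Sum>i. \<Sum>j. d i j w) = of_nat (kids w u * (kids w u - 1)) * (if E w then Y w * gap t g h (rb u w + age u w) (death_place u w) else 0)"
      by (simp only: suminf_pairs_lessThan)
    then show ?thesis by (simp add: mult_ac)
  qed
  have "(\<integral>\<^sup>+w. (\<Sum>i. \<Sum>j. c i j w) \<partial>M) = (\<Sum>i. \<Sum>j. \<integral>\<^sup>+w. c i j w \<partial>M)"
    by (simp add: nn_integral_suminf)
  also have "\<dots> = (\<integral>\<^sup>+w. (\<Sum>i. \<Sum>j. d i j w) \<partial>M)" unfolding cd by (simp add: nn_integral_suminf)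
  also have "\<dots> = (\<integral>\<^sup>+w. Y w * (if E w then of_nat (kids w u * (kids w u - 1)) * gap t g h (rb u w + age u w) (death_place u w) else 0) \<partial>M)"
    by (rule nn_integral_cong) (rule sum_d)
  also have "\<dots> = (\<integral>\<^sup>+w. indicator (born u) w * (Y w * fork (gap t g h) (rb u w) (B u w)) \<partial>M)"
    unfolding E_def fork_def pair_rate_def[abs_def] by (rule branch_step[OF Y gap_measurable[OF g h]])
  finally have cross: "(\<integral>\<^sup>+w. (\<Sum>i. \<Sum>j. c i j w) \<partial>M) = (\<integral>\<^sup>+w. indicator (born u) w * (Y w * fork (gap t g h) (rb u w) (B u w)) \<partial>M)" .
  have "(\<integral>\<^sup>+w. Y w * R t g h u w \<partial>M) = (\<integral>\<^sup>+w. Y w * av t (\<lambda>x. g x * h x) u w + (\<Sum>i. \<Sum>j. c i j w) \<partial>M)"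
    unfolding R_def distrib_left sum_c ..
  also have "\<dots> = (\<integral>\<^sup>+w. Y w * av t (\<lambda>x. g x * h x) u w \<partial>M) + (\<integral>\<^sup>+w. (\<Sum>i. \<Sum>j. c i j w) \<partial>M)"
    by (rule nn_integral_add) measurable
  also have "\<dots> = (\<integral>\<^sup>+w. indicator (born u) w * (Y w * alive_mean 0 t (\<lambda>x. g x * h x) (rb u w) (B u w)) \<partial>M)
      + (\<integral>\<^sup>+w. indicator (born u) w * (Y w * fork (gap t g h) (rb u w) (B u w)) \<partial>M)"
    unfolding cross alive_step[OF Y gh] ..
  also have "\<dots> = (\<integral>\<^sup>+w. indicator (born u) w * (Y w * alive_mean 0 t (\<lambda>x. g x * h x) (rb u w) (B u w))
      + indicator (born u) w * (Y w * fork (gap t g h) (rb u w) (B u w)) \<partial>M)"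
    by (rule nn_integral_add[symmetric]) measurable
  finally show ?thesis by (simp add: distrib_left)
qed

end

section \<open>The time of separation\<close>

context branching_model
begin

lemma ext_mult_jm:
  assumes c: "c \<in> borel_measurable borel" and \<psi>: "jm \<psi>"
  shows "jm (\<lambda>\<tau>. ext (\<lambda>x. c x * \<psi> \<tau> (Some x)))"
proof -
  have "ext (\<lambda>x. c x * \<psi> \<tau> (Some x)) z = ext c z * \<psi> \<tau> z" for \<tau> z by (cases z) auto
  moreover have "(\<lambda>p. ext c (snd p) * \<psi> (fst p) (snd p)) \<in> borel_measurable (borel \<Otimes>\<^sub>M Edel)"
    by (rule borel_measurable_times_ennreal[OF measurable_compose[OF measurable_snd ext_measurable_ennreal[OF c]] \<psi>])
  ultimately show ?thesis by simp
qed

lemma section_measurable: "jm \<psi> \<Longrightarrow> (\<lambda>x. \<psi> \<tau> (Some x)) \<in> borel_measurable borel"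
  using measurable_compose[OF measurable_Pair[OF measurable_const Some_measurable], of \<tau> borel "\<lambda>p. \<psi> (fst p) (snd p)" borel] by simp

lemma alive_mean_parameter_measurable:
  assumes \<Psi>: "jm (\<lambda>\<tau>. ext (\<Psi> \<tau>))"
  shows "(\<lambda>p. alive_mean n (fst p) (\<Psi> (fst p)) (fst (snd p)) (snd (snd p))) \<in> borel_measurable (borel \<Otimes>\<^sub>M (borel \<Otimes>\<^sub>M Edel))"
proof -
  define W where "W = (\<lambda>s y. ennreal (surv s y * (path_int \<xi> birth_rate s y)^n / fact n))"
  have W: "(\<lambda>p. W (fst p) (snd p)) \<in> borel_measurable (borel \<Otimes>\<^sub>M path_algebra \<xi>)"
    unfolding W_def using path_int_pair_measurable[OF beta_measurable] path_int_pair_measurable[OF birth_rate_measurable] by measurable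
  let ?N = "borel \<Otimes>\<^sub>M (borel \<Otimes>\<^sub>M Edel) :: (real \<times> real \<times> 'a option) measure"
  let ?d = "\<lambda>p :: real \<times> real \<times> 'a option. max 0 (fst p - fst (snd p))"
  have d [measurable]: "?d \<in> borel_measurable ?N" by measurable
  have "(\<lambda>p. \<integral>\<^sup>+y. W (?d p) y * ext (\<Psi> (fst p)) (\<xi> (?d p) y) \<partial>law (snd (snd p))) \<in> borel_measurable ?N"
  proof (rule nn_integral_measurable_subprob_algebra2[where N="path_algebra \<xi>"])
    have "(\<lambda>p. snd (snd p)) \<in> ?N \<rightarrow>\<^sub>M Edel" by measurable
    then show "(\<lambda>p. law (snd (snd p))) \<in> ?N \<rightarrow>\<^sub>M subprob_algebra (path_algebra \<xi>)"
      by (rule measurable_compose[OF _ law_subprob])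
    let ?P = "?N \<Otimes>\<^sub>M path_algebra \<xi>"
    have d': "(\<lambda>p. ?d (fst p)) \<in> borel_measurable ?P" by (rule measurable_compose[OF measurable_fst d])
    have w: "(\<lambda>p. snd p) \<in> ?P \<rightarrow>\<^sub>M path_algebra \<xi>" by measurable
    have f: "(\<lambda>p. fst (fst p)) \<in> borel_measurable ?P"
      using measurable_compose[OF measurable_fst measurable_fst] by blast
    have x: "(\<lambda>p. \<xi> (max 0 (?d (fst p))) (snd p)) \<in> ?P \<rightarrow>\<^sub>M Edel" by (rule xi_measurable[OF d' w])
    have 1: "(\<lambda>p. W (?d (fst p)) (snd p)) \<in> borel_measurable ?P"
      using measurable_compose[OF measurable_Pair[OF d' w] W] by simp
    have 2: "(\<lambda>p. ext (\<Psi> (fst (fst p))) (\<xi> (max 0 (?d (fst p))) (snd p))) \<in> borel_measurable ?P"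
      using measurable_compose[OF measurable_Pair[OF f x] \<Psi>] by simp
    have "(\<lambda>p. W (?d (fst p)) (snd p) * ext (\<Psi> (fst (fst p))) (\<xi> (?d (fst p)) (snd p))) \<in> borel_measurable ?P"
      using borel_measurable_times_ennreal[OF 1 2] by simp
    then show "(\<lambda>(p, y). W (?d p) y * ext (\<Psi> (fst p)) (\<xi> (?d p) y)) \<in> borel_measurable ?P"
      unfolding split_beta' .
  qed
  then have "(\<lambda>p. if fst (snd p) \<le> fst p then \<integral>\<^sup>+y. W (?d p) y * ext (\<Psi> (fst p)) (\<xi> (?d p) y) \<partial>law (snd (snd p)) else 0) \<in> borel_measurable ?N"
    by measurable
  moreover have "(\<lambda>p. if fst (snd p) \<le> fst p then \<integral>\<^sup>+y. W (?d p) y * ext (\<Psi> (fst p)) (\<xi> (?d p) y) \<partial>law (snd (snd p)) else 0)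
      = (\<lambda>p. alive_mean n (fst p) (\<Psi> (fst p)) (fst (snd p)) (snd (snd p)))"
    by (rule ext) (auto simp: alive_mean_def mean_gen_def W_def max_def)
  ultimately show ?thesis by simp
qed

text \<open>The age \<open>s\<close> at branching is replaced by the time \<open>b + s\<close>.\<close>

lemma branch_int_time:
  assumes c: "c \<in> borel_measurable borel" and \<psi>: "jm \<psi>"
  shows "branch_int c (\<lambda>s. \<psi> (b + s)) z = (\<integral>\<^sup>+\<tau>. alive_mean 0 \<tau> (\<lambda>x. c x * \<psi> \<tau> (Some x)) b z \<partial>lborel)"
proof -
  define H where "H = (\<lambda>\<tau>. alive_mean 0 \<tau> (\<lambda>x. c x * \<psi> \<tau> (Some x)) b z)"
  have Hm: "H \<in> borel_measurable borel"
  proof -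
    have "(\<lambda>\<tau>. (\<tau>, b, z)) \<in> borel \<rightarrow>\<^sub>M borel \<Otimes>\<^sub>M (borel \<Otimes>\<^sub>M Edel)" by measurable
    from measurable_compose[OF this alive_mean_parameter_measurable[OF ext_mult_jm[OF c \<psi>], of 0]]
    show ?thesis by (simp add: H_def)
  qed
  have \<psi>b: "(\<lambda>p. \<psi> (b + fst p) (snd p)) \<in> borel_measurable (borel \<Otimes>\<^sub>M Edel)"
  proof -
    have "(\<lambda>p. (b + fst p, snd p)) \<in> borel \<Otimes>\<^sub>M Edel \<rightarrow>\<^sub>M (borel :: real measure) \<Otimes>\<^sub>M Edel" by measurable
    from measurable_compose[OF this \<psi>] show ?thesis by simp
  qed
  have e: "ext (\<lambda>x. c x * \<psi> \<tau> (Some x)) y = ext c y * \<psi> \<tau> y" for \<tau> y by (cases y) auto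
  have "branch_int c (\<lambda>s. \<psi> (b + s)) z = (\<integral>\<^sup>+s. H (b + 1 * s) \<partial>lborel)"
    unfolding branch_int_swap(1)[OF c \<psi>b]
  proof (rule nn_integral_cong)
    fix s :: real
    show "indicator {0..} s * (\<integral>\<^sup>+w. ennreal (surv s w) * ext c (\<xi> (max 0 s) w) * \<psi> (b + s) (\<xi> (max 0 s) w) \<partial>law z) = H (b + 1 * s)"
      by (cases "0 \<le> s") (simp_all add: H_def alive_mean_def mean_gen_def e mult.assoc max_def)
  qed
  also have "\<dots> = (\<integral>\<^sup>+\<tau>. H \<tau> \<partial>lborel)" using nn_integral_real_affine[OF Hm, of 1 b] by simp
  finally show ?thesis by (simp add: H_def)
qed

lemma branch_int_Fubini:
  fixes F :: "real \<Rightarrow> real \<Rightarrow> 'a option \<Rightarrow> ennreal"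
  assumes c: "c \<in> borel_measurable borel"
    and F: "(\<lambda>p. F (fst p) (fst (snd p)) (snd (snd p))) \<in> borel_measurable (borel \<Otimes>\<^sub>M (borel \<Otimes>\<^sub>M Edel))"
  shows "branch_int c (\<lambda>s z. \<integral>\<^sup>+\<tau>. F \<tau> s z \<partial>lborel) y = (\<integral>\<^sup>+\<tau>. branch_int c (F \<tau>) y \<partial>lborel)"
proof -
  interpret P: prob_space "law y" by (rule prob_law)
  interpret pair_sigma_finite "law y" "lborel :: real measure" ..
  define w where "w = (\<lambda>s v. branch_dens c s v)"
  have w_eq: "branch_dens c s v = w s v" for s v
    by (simp add: w_def)
  define H where "H = (\<lambda>v \<tau> s. w s v * F \<tau> s (\<xi> (max 0 s) v))"
  let ?Q = "law y \<Otimes>\<^sub>M (lborel \<Otimes>\<^sub>M lborel) :: ('w \<times> real \<times> real) measure"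
  have om: "(\<lambda>p. fst p) \<in> ?Q \<rightarrow>\<^sub>M path_algebra \<xi>"
    using measurable_fst[of "law y" "lborel \<Otimes>\<^sub>M lborel"] by (simp add: measurable_cong_sets[OF refl sets_law])
  have s: "(\<lambda>p. snd (snd p)) \<in> borel_measurable ?Q" and \<tau>: "(\<lambda>p. fst (snd p)) \<in> borel_measurable ?Q" by measurable
  have x: "(\<lambda>p. \<xi> (max 0 (snd (snd p))) (fst p)) \<in> ?Q \<rightarrow>\<^sub>M Edel" by (rule xi_measurable[OF s om])
  have wm: "(\<lambda>p. w (snd (snd p)) (fst p)) \<in> borel_measurable ?Q"
  proof -
    note [measurable] = s measurable_compose[OF measurable_Pair[OF s om] path_int_pair_measurable[OF beta_measurable], simplified]
      measurable_compose[OF x ext_measurable_ennreal[OF c]]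
    show ?thesis unfolding w_def by measurable
  qed
  have "(\<lambda>p. F (fst (snd p)) (snd (snd p)) (\<xi> (max 0 (snd (snd p))) (fst p))) \<in> borel_measurable ?Q"
    using measurable_compose[OF measurable_Pair[OF \<tau> measurable_Pair[OF s x]] F] by simp
  from borel_measurable_times_ennreal[OF wm this]
  have Hm: "(\<lambda>p. H (fst p) (fst (snd p)) (snd (snd p))) \<in> borel_measurable ?Q" by (simp add: H_def)
  have w_sec: "(\<lambda>s. w s v) \<in> borel_measurable lborel" for v
  proof -
    have "(\<lambda>s. (v, 0, s)) \<in> lborel \<rightarrow>\<^sub>M ?Q" by (rule measurable_Pair) (simp_all add: space_law)
    from measurable_compose[OF this wm] show ?thesis by simp
  qed
  have H_sec: "(\<lambda>(\<tau>, s). H v \<tau> s) \<in> borel_measurable (lborel \<Otimes>\<^sub>M lborel)" for v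
  proof -
    have "(\<lambda>p. (v, p)) \<in> lborel \<Otimes>\<^sub>M lborel \<rightarrow>\<^sub>M ?Q" by (rule measurable_Pair) (simp_all add: space_law)
    from measurable_compose[OF this Hm] show ?thesis by (simp add: split_beta')
  qed
  have F_sec: "(\<lambda>\<tau>. F \<tau> s z) \<in> borel_measurable lborel" for s z
  proof -
    have "(\<lambda>\<tau>. (\<tau>, s, z)) \<in> lborel \<rightarrow>\<^sub>M borel \<Otimes>\<^sub>M (borel \<Otimes>\<^sub>M Edel)" by measurable
    from measurable_compose[OF this F] show ?thesis by simp
  qed
  have H_int: "(\<lambda>(v, \<tau>). \<integral>\<^sup>+s. H v \<tau> s \<partial>lborel) \<in> borel_measurable (law y \<Otimes>\<^sub>M lborel)"
  proof -
    have "(\<lambda>p. (fst (fst p), snd (fst p), snd p)) \<in> (law y \<Otimes>\<^sub>M lborel) \<Otimes>\<^sub>M lborel \<rightarrow>\<^sub>M ?Q" by measurable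
    from measurable_compose[OF this Hm]
    have "(\<lambda>(p, s). H (fst p) (snd p) s) \<in> borel_measurable ((law y \<Otimes>\<^sub>M lborel) \<Otimes>\<^sub>M lborel)" by (simp add: split_beta')
    from lborel.borel_measurable_nn_integral[OF this] show ?thesis by (simp add: split_beta')
  qed
  have "branch_int c (\<lambda>s z. \<integral>\<^sup>+\<tau>. F \<tau> s z \<partial>lborel) y = (\<integral>\<^sup>+v. \<integral>\<^sup>+s. \<integral>\<^sup>+\<tau>. H v \<tau> s \<partial>lborel \<partial>lborel \<partial>law y)"
    unfolding branch_int_def w_eq H_def nn_integral_cmult[OF F_sec] ..
  also have "\<dots> = (\<integral>\<^sup>+v. \<integral>\<^sup>+\<tau>. \<integral>\<^sup>+s. H v \<tau> s \<partial>lborel \<partial>lborel \<partial>law y)"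
    using lborel_pair.Fubini'[OF H_sec] by simp
  also have "\<dots> = (\<integral>\<^sup>+\<tau>. \<integral>\<^sup>+v. \<integral>\<^sup>+s. H v \<tau> s \<partial>lborel \<partial>law y \<partial>lborel)"
    using Fubini'[OF H_int] by simp
  also have "\<dots> = (\<integral>\<^sup>+\<tau>. branch_int c (F \<tau>) y \<partial>lborel)"
    unfolding branch_int_def w_eq H_def ..
  finally show ?thesis .
qed

text \<open>A cascade of \<open>n\<close> ordinary branchings followed by one branching of density \<open>c\<close> is reorganised
  according to the time \<open>\<tau>\<close> of the last one.\<close>

lemma Kop_pow_time:
  assumes c: "c \<in> borel_measurable borel" and \<psi>: "jm \<psi>"
  shows "(Kop ^^ n) (\<lambda>b. branch_int c (\<lambda>s. \<psi> (b + s))) b z = (\<integral>\<^sup>+\<tau>. alive_mean n \<tau> (\<lambda>x. c x * \<psi> \<tau> (Some x)) b z \<partial>lborel)"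
proof (induction n arbitrary: b z)
  case 0
  show ?case using branch_int_time[OF c \<psi>] by simp
next
  case (Suc n)
  let ?\<Psi> = "\<lambda>\<tau> x. c x * \<psi> \<tau> (Some x)"
  have IH: "(Kop ^^ n) (\<lambda>b. branch_int c (\<lambda>s. \<psi> (b + s))) = (\<lambda>b z. \<integral>\<^sup>+\<tau>. alive_mean n \<tau> (?\<Psi> \<tau>) b z \<partial>lborel)"
    using Suc.IH by (intro ext)
  have g: "?\<Psi> \<tau> \<in> borel_measurable borel" for \<tau>
    by (rule borel_measurable_times_ennreal[OF c section_measurable[OF \<psi>]])
  have m: "(\<lambda>p. alive_mean n (fst p) (?\<Psi> (fst p)) (b + fst (snd p)) (snd (snd p))) \<in> borel_measurable (borel \<Otimes>\<^sub>M (borel \<Otimes>\<^sub>M Edel))"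
  proof -
    have "(\<lambda>p. (fst p, b + fst (snd p), snd (snd p))) \<in> borel \<Otimes>\<^sub>M (borel \<Otimes>\<^sub>M Edel) \<rightarrow>\<^sub>M (borel :: real measure) \<Otimes>\<^sub>M ((borel :: real measure) \<Otimes>\<^sub>M Edel)"
      by measurable
    from measurable_compose[OF this alive_mean_parameter_measurable[OF ext_mult_jm[OF c \<psi>], of n]] show ?thesis by simp
  qed
  have "(Kop ^^ Suc n) (\<lambda>b. branch_int c (\<lambda>s. \<psi> (b + s))) b z
      = branch_int (\<lambda>x. ennreal (birth_rate x)) (\<lambda>s z. \<integral>\<^sup>+\<tau>. alive_mean n \<tau> (?\<Psi> \<tau>) (b + s) z \<partial>lborel) z"
    by (simp add: IH Kop_def)
  also have "\<dots> = (\<integral>\<^sup>+\<tau>. branch_int (\<lambda>x. ennreal (birth_rate x)) (\<lambda>s z. alive_mean n \<tau> (?\<Psi> \<tau>) (b + s) z) z \<partial>lborel)"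
    by (rule branch_int_Fubini[OF _ m]) measurable
  also have "\<dots> = (\<integral>\<^sup>+\<tau>. alive_mean (Suc n) \<tau> (?\<Psi> \<tau>) b z \<partial>lborel)"
    by (rule nn_integral_cong) (simp add: Kop_alive_mean[OF g, symmetric] Kop_def)
  finally show ?case .
qed

lemma time_measurable:
  assumes c: "c \<in> borel_measurable borel" and \<psi>: "jm \<psi>"
  shows "(\<lambda>\<tau>. alive_mean n \<tau> (\<lambda>x. c x * \<psi> \<tau> (Some x)) b z) \<in> borel_measurable lborel"
    and "(\<lambda>\<tau>. FKm \<tau> (\<lambda>x. c x * \<psi> \<tau> (Some x)) b z) \<in> borel_measurable lborel"
proof -
  have "(\<lambda>\<tau>. (\<tau>, b, z)) \<in> lborel \<rightarrow>\<^sub>M borel \<Otimes>\<^sub>M (borel \<Otimes>\<^sub>M Edel)" by measurable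
  from measurable_compose[OF this alive_mean_parameter_measurable[OF ext_mult_jm[OF c \<psi>]]]
  have m: "(\<lambda>\<tau>. alive_mean n \<tau> (\<lambda>x. c x * \<psi> \<tau> (Some x)) b z) \<in> borel_measurable lborel" for n by simp
  have g: "(\<lambda>x. c x * \<psi> \<tau> (Some x)) \<in> borel_measurable borel" for \<tau>
    by (rule borel_measurable_times_ennreal[OF c section_measurable[OF \<psi>]])
  show "(\<lambda>\<tau>. alive_mean n \<tau> (\<lambda>x. c x * \<psi> \<tau> (Some x)) b z) \<in> borel_measurable lborel" by (rule m)
  have "(\<lambda>\<tau>. \<Sum>n. alive_mean n \<tau> (\<lambda>x. c x * \<psi> \<tau> (Some x)) b z) \<in> borel_measurable lborel"
    by (rule borel_measurable_suminf_order[OF m])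
  then show "(\<lambda>\<tau>. FKm \<tau> (\<lambda>x. c x * \<psi> \<tau> (Some x)) b z) \<in> borel_measurable lborel"
    by (simp only: alive_mean_sums[OF g])
qed

lemma branching_cascade:
  assumes c: "c \<in> borel_measurable borel" and \<psi>: "jm \<psi>"
  shows "(\<Sum>n. (Kop ^^ n) (\<lambda>b. branch_int c (\<lambda>s. \<psi> (b + s))) b z) = (\<integral>\<^sup>+\<tau>. FKm \<tau> (\<lambda>x. c x * \<psi> \<tau> (Some x)) b z \<partial>lborel)"
proof -
  have g: "(\<lambda>x. c x * \<psi> \<tau> (Some x)) \<in> borel_measurable borel" for \<tau>
    by (rule borel_measurable_times_ennreal[OF c section_measurable[OF \<psi>]])
  have "(\<Sum>n. (Kop ^^ n) (\<lambda>b. branch_int c (\<lambda>s. \<psi> (b + s))) b z) = (\<integral>\<^sup>+\<tau>. (\<Sum>n. alive_mean n \<tau> (\<lambda>x. c x * \<psi> \<tau> (Some x)) b z) \<partial>lborel)"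
    unfolding Kop_pow_time[OF c \<psi>] by (rule nn_integral_suminf[symmetric]) (rule time_measurable(1)[OF c \<psi>])
  then show ?thesis by (simp only: alive_mean_sums[OF g])
qed

lemma branch_int_add:
  assumes c: "c \<in> borel_measurable borel" and a: "jm a" and a': "jm a'"
  shows "branch_int c (\<lambda>s z. a s z + a' s z) y = branch_int c a y + branch_int c a' y"
proof -
  define I where "I = (\<lambda>\<psi> w s. branch_dens c s w * (\<psi> s (\<xi> (max 0 s) w) :: ennreal))"
  have m1: "I \<psi> w \<in> borel_measurable lborel" if "jm \<psi>" for \<psi> w
  proof -
    have "(\<lambda>s. (s, w)) \<in> lborel \<rightarrow>\<^sub>M borel \<Otimes>\<^sub>M path_algebra \<xi>" by (rule measurable_Pair) (simp_all add: nat_filt_def)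
    from measurable_compose[OF this branch_int_swap(2)[OF c that]] show ?thesis by (simp add: I_def)
  qed
  have m2: "(\<lambda>w. \<integral>\<^sup>+s. I \<psi> w s \<partial>lborel) \<in> borel_measurable (law y)" if "jm \<psi>" for \<psi>
    unfolding I_def using branch_integrand_measurable[OF c that, of "\<lambda>_. 0" "path_algebra \<xi>" "\<lambda>x. x"] by (intro law_measurableI) simp
  have "branch_int c (\<lambda>s z. a s z + a' s z) y = (\<integral>\<^sup>+w. \<integral>\<^sup>+s. I a w s + I a' w s \<partial>lborel \<partial>law y)"
    unfolding branch_int_def I_def distrib_left ..
  also have "\<dots> = (\<integral>\<^sup>+w. (\<integral>\<^sup>+s. I a w s \<partial>lborel) + (\<integral>\<^sup>+s. I a' w s \<partial>lborel) \<partial>law y)"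
    by (intro nn_integral_cong nn_integral_add m1 a a')
  also have "\<dots> = (\<integral>\<^sup>+w. \<integral>\<^sup>+s. I a w s \<partial>lborel \<partial>law y) + (\<integral>\<^sup>+w. \<integral>\<^sup>+s. I a' w s \<partial>lborel \<partial>law y)"
    by (rule nn_integral_add[OF m2[OF a] m2[OF a']])
  finally show ?thesis by (simp only: branch_int_def I_def)
qed

lemma Kop_add:
  assumes "jm a" "jm a'"
  shows "Kop (\<lambda>b z. a b z + a' b z) = (\<lambda>b z. Kop a b z + Kop a' b z)"
proof (intro ext)
  fix b z
  have sh: "jm (\<lambda>s. \<psi> (b + s))" if "jm \<psi>" for \<psi>
  proof -
    have "(\<lambda>p. (b + fst p, snd p)) \<in> borel \<Otimes>\<^sub>M Edel \<rightarrow>\<^sub>M (borel :: real measure) \<Otimes>\<^sub>M Edel" by measurable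
    from measurable_compose[OF this that] show ?thesis by simp
  qed
  show "Kop (\<lambda>b z. a b z + a' b z) b z = Kop a b z + Kop a' b z"
    unfolding Kop_def by (rule branch_int_add[OF _ sh[OF assms(1)] sh[OF assms(2)]]) measurable
qed

lemma Kop_pow_add:
  assumes "jm a" "jm a'"
  shows "(Kop ^^ n) (\<lambda>b z. a b z + a' b z) = (\<lambda>b z. (Kop ^^ n) a b z + (Kop ^^ n) a' b z)"
  by (induction n) (simp_all add: Kop_add Kop_pow_measurable assms)

end

context branching_system
begin

lemma root_birth:
  assumes "i < length xs"
  shows "rb [i] w = 0" "B [i] w = Some (xs ! i)" "w \<in> space M \<Longrightarrow> indicator (born [i]) w = (1 :: ennreal)"
  using assms by (simp_all add: rb_def B_root born_def)

lemma Z_mean: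
  assumes g: "g \<in> borel_measurable borel" and i: "i < length xs" and t: "0 \<le> t"
  shows "(\<integral>\<^sup>+w. Z t g [i] w \<partial>M) = FK t g (Some (xs ! i))"
proof -
  have "(\<integral>\<^sup>+w. Z t g [i] w \<partial>M) = (\<integral>\<^sup>+w. indicator (born [i]) w * (1 * FKm t g (rb [i] w) (B [i] w)) \<partial>M)"
    using Z_expectation[OF g, of "[i]" "\<lambda>_. 1" t] by simp
  also have "\<dots> = (\<integral>\<^sup>+w. FK t g (Some (xs ! i)) \<partial>M)"
    by (intro nn_integral_cong) (simp add: root_birth[OF i] FKm_def t)
  finally show ?thesis by (simp add: emeasure_space_1)
qed

lemma Z_finite:
  assumes g: "g \<in> borel_measurable borel" and i: "i < length xs" and t: "0 \<le> t" and "FK t g (Some (xs ! i)) < top"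
  shows "AE w in M. Z t g [i] w < top"
proof -
  have "(\<integral>\<^sup>+w. Z t g [i] w \<partial>M) \<noteq> \<infinity>" using assms by (simp add: Z_mean infinity_ennreal_def)
  from nn_integral_PInf_AE[OF Z_measurable_M[OF g] this] show ?thesis
    by (rule eventually_mono) (simp add: less_top infinity_ennreal_def)
qed

text \<open>The time \<open>\<tau>\<close> is the time at which the lines of the two descendants separate.\<close>

theorem many_to_two:
  assumes g: "g \<in> borel_measurable borel" and h: "h \<in> borel_measurable borel" and i: "i < length xs" and t: "0 \<le> t"
  shows "(\<integral>\<^sup>+w. Z t g [i] w * Z t h [i] w \<partial>M) = FK t (\<lambda>x. g x * h x) (Some (xs ! i)) +
    (\<integral>\<^sup>+\<tau>. FKm \<tau> (\<lambda>x. pair_rate x * gap t g h \<tau> (Some x)) 0 (Some (xs ! i)) \<partial>lborel)"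
proof -
  let ?x = "Some (xs ! i)"
  have gh: "(\<lambda>x. g x * h x) \<in> borel_measurable borel" using g h by measurable
  define \<psi> where "\<psi> = (\<lambda>b z. alive_mean 0 t (\<lambda>x. g x * h x) b z + fork (gap t g h) b z)"
  have fm: "jm (fork (gap t g h))" by (rule fork_measurable[OF gap_measurable[OF g h]])
  have \<psi>: "jm \<psi>" unfolding \<psi>_def by (rule borel_measurable_add[OF alive_mean_measurable[OF gh] fm])
  have one: "AE w in M. Z t (\<lambda>x. 1) [i] w < top"
    by (rule Z_finite[OF _ i t]) (use FK_one[OF t, of ?x] in \<open>auto intro: le_less_trans\<close>)
  have dm: "dsum l (R t g h) [i] \<in> borel_measurable M" for l by (rule dsum_measurable) (rule R_measurable[OF g h])
  have e: "(\<integral>\<^sup>+w. dsum l (R t g h) [i] w \<partial>M) = (Kop ^^ l) \<psi> 0 ?x" for l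
  proof -
    have "(\<integral>\<^sup>+w. 1 * dsum l (R t g h) [i] w \<partial>M) = (\<integral>\<^sup>+w. indicator (born [i]) w * (1 * (Kop ^^ l) \<psi> (rb [i] w) (B [i] w)) \<partial>M)"
    proof (rule dsum_expectation[OF _ R_measurable[OF g h] \<psi>])
      show "(\<integral>\<^sup>+w. Y w * R t g h u w \<partial>M) = (\<integral>\<^sup>+w. indicator (born u) w * (Y w * \<psi> (rb u w) (B u w)) \<partial>M)"
        if "u \<noteq> []" "Y \<in> borel_measurable (G u)" for u Y
        unfolding \<psi>_def by (rule R_expectation[OF g h that])
    qed simp_all
    also have "\<dots> = (\<integral>\<^sup>+w. (Kop ^^ l) \<psi> 0 ?x \<partial>M)" by (intro nn_integral_cong) (simp add: root_birth[OF i])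
    finally show ?thesis by (simp add: emeasure_space_1)
  qed
  have "(\<integral>\<^sup>+w. Z t g [i] w * Z t h [i] w \<partial>M) = (\<integral>\<^sup>+w. (\<Sum>l. dsum l (R t g h) [i] w) \<partial>M)"
    by (rule nn_integral_cong_AE) (use one in \<open>auto elim!: eventually_mono intro: Z_mult_eq\<close>)
  also have "\<dots> = (\<Sum>l. (Kop ^^ l) \<psi> 0 ?x)" unfolding e[symmetric] by (rule nn_integral_suminf[OF dm])
  also have "\<dots> = (\<Sum>l. alive_mean l t (\<lambda>x. g x * h x) 0 ?x + (Kop ^^ l) (fork (gap t g h)) 0 ?x)"
    unfolding \<psi>_def Kop_pow_add[OF alive_mean_measurable[OF gh] fm] Kop_pow_alive_mean[OF gh] ..
  also have "\<dots> = (\<Sum>l. alive_mean l t (\<lambda>x. g x * h x) 0 ?x) + (\<Sum>l. (Kop ^^ l) (fork (gap t g h)) 0 ?x)"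
    by (rule suminf_add[symmetric]) (rule summableI)+
  also have "(\<Sum>l. alive_mean l t (\<lambda>x. g x * h x) 0 ?x) = FK t (\<lambda>x. g x * h x) ?x"
    by (simp add: alive_mean_sums[OF gh] FKm_def t)
  also have "(\<Sum>l. (Kop ^^ l) (fork (gap t g h)) 0 ?x) = (\<integral>\<^sup>+\<tau>. FKm \<tau> (\<lambda>x. pair_rate x * gap t g h \<tau> (Some x)) 0 ?x \<partial>lborel)"
    unfolding fork_def[abs_def] by (rule branching_cascade[OF pair_rate_measurable gap_measurable[OF g h]])
  finally show ?thesis .
qed

abbreviation fork_rate :: ennreal where "fork_rate \<equiv> ennreal (beta_bound * off_bound)"

lemma gap_forks_bound:
  assumes g: "g \<in> borel_measurable borel" and h: "h \<in> borel_measurable borel" and t: "0 \<le> t"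
    and K: "\<And>\<tau>. 0 \<le> \<tau> \<Longrightarrow> \<tau> < t \<Longrightarrow> FK \<tau> (\<lambda>y. pair_rate y * (FK (t - \<tau>) g (Some y) * FK (t - \<tau>) h (Some y))) z \<le> K"
  shows "(\<integral>\<^sup>+\<tau>. FKm \<tau> (\<lambda>x. pair_rate x * gap t g h \<tau> (Some x)) 0 z \<partial>lborel) \<le> K * ennreal t"
proof -
  have "AE \<tau> in lborel. FKm \<tau> (\<lambda>x. pair_rate x * gap t g h \<tau> (Some x)) 0 z \<le> K * indicator {0..t} \<tau>"
    using AE_lborel_singleton[of t]
  proof eventually_elim
    case (elim \<tau>)
    have e0: "ext (\<lambda>x. 0 :: ennreal) y = 0" for y :: "'a option" by (cases y) auto
    consider "\<tau> < 0" | "0 \<le> \<tau>" "\<tau> < t" | "t < \<tau>" using elim by linarith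
    then show ?case
    proof cases
      case 1
      then show ?thesis by (simp add: FKm_def)
    next
      case 2
      then show ?thesis using K[OF 2] by (simp add: FKm_def gap_def)
    next
      case 3
      then have "gap t g h \<tau> (Some x) = 0" for x by (simp add: gap_def FKm_def)
      then show ?thesis by (simp add: FKm_def FK_def e0)
    qed
  qed
  then have "(\<integral>\<^sup>+\<tau>. FKm \<tau> (\<lambda>x. pair_rate x * gap t g h \<tau> (Some x)) 0 z \<partial>lborel) \<le> (\<integral>\<^sup>+\<tau>. K * indicator {0..t} \<tau> \<partial>lborel)"
    by (rule nn_integral_mono_AE)
  also have "\<dots> = K * ennreal t" using t by (simp add: nn_integral_cmult_indicator)
  finally show ?thesis .
qed

text \<open>Jensen's inequality bounds the integrand at each time of separation by a multiple of
  \<open>FK t (w\<^sup>2)\<close>.\<close>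

lemma Z_second_moment_finite:
  assumes w: "w \<in> L2_space \<mu>" "(\<lambda>x. (w x)^2) \<in> L2_space \<mu>" "\<And>x. 0 \<le> w x" and i: "i < length xs" and t: "0 < t"
  shows "(\<integral>\<^sup>+z. Z t (\<lambda>x. ennreal (w x)) [i] z * Z t (\<lambda>x. ennreal (w x)) [i] z \<partial>M) < top"
proof -
  define W where "W = (\<lambda>x. ennreal (w x))"
  have W: "W \<in> borel_measurable borel" unfolding W_def using L2_borel[OF w(1)] by measurable
  have W2: "(\<lambda>x. (W x)^2) \<in> borel_measurable borel" using W by measurable
  have t0: "0 \<le> t" using t by simp
  define F where "F = FK t (\<lambda>x. (W x)^2) (Some (xs ! i))"
  have "(\<lambda>x. (W x)^2) = (\<lambda>x. ennreal \<bar>(w x)^2\<bar>)" unfolding W_def using w(3) by (simp add: ennreal_power)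
  then have F: "F < top" unfolding F_def using FK_finite_L2[OF w(2) t] by simp
  define e where "e = ennreal (exp (growth_rate * t))"
  have "FK \<tau> (\<lambda>y. pair_rate y * (FK (t - \<tau>) W (Some y) * FK (t - \<tau>) W (Some y))) (Some (xs ! i)) \<le> fork_rate * e * F"
    if \<tau>: "0 \<le> \<tau>" "\<tau> < t" for \<tau>
  proof -
    have r: "0 \<le> t - \<tau>" using \<tau> by simp
    have "FK (t - \<tau>) W (Some y) * FK (t - \<tau>) W (Some y) \<le> e * FK (t - \<tau>) (\<lambda>x. (W x)^2) (Some y)" for y
    proof -
      have "(FK (t - \<tau>) W (Some y))^2 \<le> ennreal (exp (growth_rate * (t - \<tau>))) * FK (t - \<tau>) (\<lambda>x. (W x)^2) (Some y)"
        by (rule FK_Jensen[OF W r])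
      also have "\<dots> \<le> e * FK (t - \<tau>) (\<lambda>x. (W x)^2) (Some y)"
        unfolding e_def using \<tau> growth_rate_nonneg by (intro mult_right_mono ennreal_leI) (auto intro: mult_left_mono)
      finally show ?thesis by (simp add: power2_eq_square)
    qed
    then have "FK \<tau> (\<lambda>y. pair_rate y * (FK (t - \<tau>) W (Some y) * FK (t - \<tau>) W (Some y))) (Some (xs ! i))
        \<le> FK \<tau> (\<lambda>y. fork_rate * (e * FK (t - \<tau>) (\<lambda>x. (W x)^2) (Some y))) (Some (xs ! i))"
      by (intro FK_mono mult_mono[OF pair_rate_bound]) auto
    also have "\<dots> = FK \<tau> (\<lambda>y. fork_rate * e * FK (t - \<tau>) (\<lambda>x. (W x)^2) (Some y)) (Some (xs ! i))"
      by (simp add: mult.assoc)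
    also have "\<dots> = fork_rate * e * FK \<tau> (\<lambda>y. FK (t - \<tau>) (\<lambda>x. (W x)^2) (Some y)) (Some (xs ! i))"
      by (rule FK_cmult[OF FK_measurable_place(2)[OF W2 r] \<tau>(1)])
    also have "FK \<tau> (\<lambda>y. FK (t - \<tau>) (\<lambda>x. (W x)^2) (Some y)) (Some (xs ! i)) = F"
      unfolding F_def using FK_semigroup[OF \<tau>(1) r W2, of "Some (xs ! i)"] by simp
    finally show ?thesis .
  qed
  note b = gap_forks_bound[OF W W t0 this]
  have "fork_rate * e * F * ennreal t < top" unfolding ennreal_mult_less_top using F by (simp add: e_def)
  with b have "(\<integral>\<^sup>+\<tau>. FKm \<tau> (\<lambda>x. pair_rate x * gap t W W \<tau> (Some x)) 0 (Some (xs ! i)) \<partial>lborel) < top"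
    by (rule le_less_trans)
  then have "(\<integral>\<^sup>+z. Z t W [i] z * Z t W [i] z \<partial>M) < top"
    unfolding many_to_two[OF W W i t0] using F by (simp add: F_def power2_eq_square)
  then show ?thesis by (simp add: W_def)
qed

lemma square_diff_ennreal:
  assumes "0 \<le> a" "0 \<le> b"
  shows "ennreal a * ennreal a + ennreal b * ennreal b = ennreal ((a - b)^2) + 2 * (ennreal a * ennreal b)"
proof -
  have "ennreal (a * a + b * b) = ennreal ((a - b)^2 + 2 * (a * b))"
    by (simp add: power2_eq_square algebra_simps)
  also have "\<dots> = ennreal ((a - b)^2) + ennreal (2 * (a * b))" using assms by (intro ennreal_plus) auto
  also have "ennreal (2 * (a * b)) = 2 * (ennreal a * ennreal b)" using assms by (simp add: ennreal_mult)
  finally show ?thesis using assms by (simp add: ennreal_mult ennreal_plus)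
qed

text \<open>The second moments of the positive and negative parts are compared with their mixed moment,
  which is finite and cancels.\<close>

lemma variance_bound:
  assumes g: "g \<in> L2_space \<mu>" and g2: "(\<lambda>x. (g x)^2) \<in> L2_space \<mu>" and i: "i < length xs" and t: "0 < t"
    and K: "\<And>\<tau>. 0 \<le> \<tau> \<Longrightarrow> \<tau> \<le> t \<Longrightarrow> FK \<tau> (\<lambda>y. ennreal ((TS (t - \<tau>) g y)^2)) (Some (xs ! i)) \<le> K"
  shows "(\<integral>\<^sup>+z. ennreal ((enn2real (Z t (\<lambda>x. ennreal (g x)) [i] z) - enn2real (Z t (\<lambda>x. ennreal (- g x)) [i] z))^2) \<partial>M)
    \<le> FK t (\<lambda>x. ennreal ((g x)^2)) (Some (xs ! i)) + fork_rate * K * ennreal t"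
proof -
  let ?x = "Some (xs ! i)"
  define u v where "u = (\<lambda>x. max 0 (g x))" and "v = (\<lambda>x. max 0 (- g x))"
  note parts = pos_neg_parts[OF g, folded u_def v_def]
  have sq: "(\<lambda>x. (u x)^2) \<in> L2_space \<mu>" "(\<lambda>x. (v x)^2) \<in> L2_space \<mu>"
  proof -
    have b: "(\<lambda>x. (w x)^2) \<in> L2_space \<mu>" if "w \<in> L2_space \<mu>" "\<And>x. (w x)^2 \<le> (g x)^2" for w
    proof -
      have wm [measurable]: "w \<in> borel_measurable \<mu>" using that(1) by (simp add: L2_space_def)
      have "integrable \<mu> (\<lambda>x. ((g x)^2)^2)" using g2 by (simp add: L2_space_def)
      then have "integrable \<mu> (\<lambda>x. ((w x)^2)^2)"
        by (rule Bochner_Integration.integrable_bound) (use power_mono[OF that(2) zero_le_power2, of _ 2] in simp_all)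
      then show ?thesis by (simp add: L2_space_def)
    qed
    show "(\<lambda>x. (u x)^2) \<in> L2_space \<mu>" by (rule b[OF parts(1)]) (auto simp: u_def max_def)
    show "(\<lambda>x. (v x)^2) \<in> L2_space \<mu>" by (rule b[OF parts(2)]) (auto simp: v_def max_def)
  qed
  have nn: "0 \<le> u x" "0 \<le> v x" for x by (auto simp: u_def v_def)
  have t0: "0 \<le> t" using t by simp
  define U V where "U = (\<lambda>x. ennreal (u x))" and "V = (\<lambda>x. ennreal (v x))"
  have UV: "(\<lambda>x. ennreal (g x)) = U" "(\<lambda>x. ennreal (- g x)) = V"
    by (auto simp: U_def V_def u_def v_def max_def ennreal_neg)
  have Um: "U \<in> borel_measurable borel" and Vm: "V \<in> borel_measurable borel"
    unfolding U_def V_def using L2_borel[OF parts(1)] L2_borel[OF parts(2)] by measurable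
  have UV0: "(\<lambda>x. U x * V x) = (\<lambda>x. 0)" by (auto simp: U_def V_def u_def v_def max_def)
  have U2: "(\<lambda>x. U x * U x) \<in> borel_measurable borel" and V2: "(\<lambda>x. V x * V x) \<in> borel_measurable borel"
    using Um Vm by measurable
  have g2e: "(\<lambda>x. U x * U x + V x * V x) = (\<lambda>x. ennreal ((g x)^2))"
    by (rule ext) (auto simp: U_def V_def u_def v_def max_def power2_eq_square ennreal_mult''[symmetric] ennreal_mult[symmetric])
  define J where "J = (\<lambda>a b. (\<integral>\<^sup>+\<tau>. FKm \<tau> (\<lambda>x. pair_rate x * gap t a b \<tau> (Some x)) 0 ?x \<partial>lborel))"
  define I where "I = (\<lambda>a b. (\<integral>\<^sup>+z. Z t a [i] z * Z t b [i] z \<partial>M))"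
  have e0: "FK t (\<lambda>x. 0) ?x = 0"
  proof -
    have "ext (\<lambda>x. 0 :: ennreal) y = 0" for y :: "'a option" by (cases y) auto
    then show ?thesis by (simp add: FK_def)
  qed
  have IJ: "I U U = FK t (\<lambda>x. U x * U x) ?x + J U U" "I V V = FK t (\<lambda>x. V x * V x) ?x + J V V" "I U V = J U V"
    unfolding I_def J_def many_to_two[OF Um Um i t0] many_to_two[OF Vm Vm i t0] many_to_two[OF Um Vm i t0] UV0 e0 by simp_all
  have fin: "I U U < top" "I V V < top"
    unfolding I_def U_def V_def
    by (rule Z_second_moment_finite[OF parts(1) sq(1) nn(1) i t] Z_second_moment_finite[OF parts(2) sq(2) nn(2) i t])+
  note [measurable] = Z_measurable_M[OF Um] Z_measurable_M[OF Vm]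
  have fU: "AE z in M. Z t U [i] z < top" and fV: "AE z in M. Z t V [i] z < top"
    by (rule Z_finite[OF Um i t0] Z_finite[OF Vm i t0],
        use TS_L2_nonneg(3)[OF parts(1) nn(1) t] TS_L2_nonneg(3)[OF parts(2) nn(2) t] in \<open>simp add: U_def V_def\<close>)+
  define D where "D = (\<lambda>z. ennreal ((enn2real (Z t U [i] z) - enn2real (Z t V [i] z))^2))"
  have Dm [measurable]: "D \<in> borel_measurable M" unfolding D_def by measurable
  have "AE z in M. Z t U [i] z * Z t U [i] z + Z t V [i] z * Z t V [i] z = D z + 2 * (Z t U [i] z * Z t V [i] z)"
    using fU fV
  proof eventually_elim
    case (elim z)
    then show ?case
      using square_diff_ennreal[of "enn2real (Z t U [i] z)" "enn2real (Z t V [i] z)"] by (simp add: D_def)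
  qed
  then have "(\<integral>\<^sup>+z. Z t U [i] z * Z t U [i] z + Z t V [i] z * Z t V [i] z \<partial>M) = (\<integral>\<^sup>+z. D z + 2 * (Z t U [i] z * Z t V [i] z) \<partial>M)"
    by (rule nn_integral_cong_AE)
  then have DI: "I U U + I V V = (\<integral>\<^sup>+z. D z \<partial>M) + 2 * I U V"
    by (simp add: I_def nn_integral_add nn_integral_cmult)
  have "I U V < top"
  proof -
    have "2 * I U V \<le> I U U + I V V" unfolding DI by simp
    also have "\<dots> < top" using fin by simp
    finally show ?thesis by (auto simp: ennreal_mult_less_top)
  qed
  have "J U U + J V V \<le> fork_rate * K * ennreal t + 2 * J U V"
  proof -
    note tm = time_measurable(2)[OF pair_rate_measurable gap_measurable]
    define j where "j = (\<lambda>a b \<tau>. FKm \<tau> (\<lambda>x. pair_rate x * gap t a b \<tau> (Some x)) 0 ?x)"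
    have [measurable]: "j U U \<in> borel_measurable lborel" "j V V \<in> borel_measurable lborel" "j U V \<in> borel_measurable lborel"
      unfolding j_def by (rule tm[OF Um Um] tm[OF Vm Vm] tm[OF Um Vm])+
    have "AE \<tau> in lborel. j U U \<tau> + j V V \<tau> \<le> fork_rate * K * indicator {0..t} \<tau> + 2 * j U V \<tau>"
      using AE_lborel_singleton[of t]
    proof eventually_elim
      case (elim \<tau>)
      have e0: "ext (\<lambda>x. 0 :: ennreal) y = 0" for y :: "'a option" by (cases y) auto
      consider "\<tau> < 0" | "t < \<tau>" | "0 \<le> \<tau>" "\<tau> < t" using elim by linarith
      then show ?case
      proof cases
        case 1
        then show ?thesis by (simp add: j_def FKm_def)
      next
        case 2
        then have "gap t a b \<tau> (Some x) = 0" for x a b by (simp add: gap_def FKm_def)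
        then show ?thesis by (simp add: j_def FKm_def FK_def e0)
      next
        case 3
        have r: "0 < t - \<tau>" "0 \<le> t - \<tau>" using 3 by auto
        define pU pV pD where "pU = (\<lambda>y. FK (t - \<tau>) U (Some y))" and "pV = (\<lambda>y. FK (t - \<tau>) V (Some y))"
          and "pD = (\<lambda>y. ennreal ((TS (t - \<tau>) g y)^2))"
        have [measurable]: "pU \<in> borel_measurable borel" "pV \<in> borel_measurable borel" "pD \<in> borel_measurable borel"
          unfolding pU_def pV_def pD_def using FK_measurable_place(2)[OF Um r(2)] FK_measurable_place(2)[OF Vm r(2)] L2_borel[OF TS_L2[OF r(2) g]]
          by measurable
        have pt: "pU y * pU y + pV y * pV y = pD y + 2 * (pU y * pV y)" for y
          using square_diff_ennreal[OF TS_L2_nonneg(2)[OF parts(1) nn(1) r(1)] TS_L2_nonneg(2)[OF parts(2) nn(2) r(1)], of y y]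
          by (simp add: pU_def pV_def pD_def U_def V_def TS_L2_nonneg(1)[OF parts(1) nn(1) r(1)] TS_L2_nonneg(1)[OF parts(2) nn(2) r(1)]
              TS_parts[OF g r(1), folded u_def v_def])
        have jj: "j U U \<tau> = FK \<tau> (\<lambda>y. pair_rate y * (pU y * pU y)) ?x" "j V V \<tau> = FK \<tau> (\<lambda>y. pair_rate y * (pV y * pV y)) ?x"
          "j U V \<tau> = FK \<tau> (\<lambda>y. pair_rate y * (pU y * pV y)) ?x"
          using 3 by (simp_all add: j_def FKm_def gap_def pU_def pV_def)
        have "j U U \<tau> + j V V \<tau> = FK \<tau> (\<lambda>y. pair_rate y * (pU y * pU y) + pair_rate y * (pV y * pV y)) ?x"
          unfolding jj by (rule FK_add[symmetric, OF _ _ 3(1)]) measurable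
        also have "\<dots> \<le> FK \<tau> (\<lambda>y. fork_rate * pD y + 2 * (pair_rate y * (pU y * pV y))) ?x"
        proof (rule FK_mono)
          fix y
          have "pair_rate y * (pU y * pU y) + pair_rate y * (pV y * pV y) = pair_rate y * pD y + 2 * (pair_rate y * (pU y * pV y))"
            unfolding distrib_left[symmetric] pt by (simp add: distrib_left mult_ac)
          also have "\<dots> \<le> fork_rate * pD y + 2 * (pair_rate y * (pU y * pV y))"
            by (intro add_mono mult_right_mono pair_rate_bound) auto
          finally show "pair_rate y * (pU y * pU y) + pair_rate y * (pV y * pV y) \<le> \<dots>" .
        qed
        also have "\<dots> = FK \<tau> (\<lambda>y. fork_rate * pD y) ?x + FK \<tau> (\<lambda>y. 2 * (pair_rate y * (pU y * pV y))) ?x"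
          by (rule FK_add[OF _ _ 3(1)]) measurable
        also have "FK \<tau> (\<lambda>y. fork_rate * pD y) ?x = fork_rate * FK \<tau> pD ?x"
          by (rule FK_cmult[OF _ 3(1)]) measurable
        also have "FK \<tau> (\<lambda>y. 2 * (pair_rate y * (pU y * pV y))) ?x = 2 * j U V \<tau>"
          unfolding jj by (rule FK_cmult[OF _ 3(1)]) measurable
        also have "fork_rate * FK \<tau> pD ?x \<le> fork_rate * K"
          unfolding pD_def using 3 by (intro mult_left_mono K) auto
        finally show ?thesis using 3 by (simp add: add_right_mono)
      qed
    qed
    then have "(\<integral>\<^sup>+\<tau>. j U U \<tau> + j V V \<tau> \<partial>lborel) \<le> (\<integral>\<^sup>+\<tau>. fork_rate * K * indicator {0..t} \<tau> + 2 * j U V \<tau> \<partial>lborel)"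
      by (rule nn_integral_mono_AE)
    also have "\<dots> = fork_rate * K * ennreal t + 2 * (\<integral>\<^sup>+\<tau>. j U V \<tau> \<partial>lborel)"
      using t0 by (simp add: nn_integral_add nn_integral_cmult nn_integral_cmult_indicator)
    finally have "(\<integral>\<^sup>+\<tau>. j U U \<tau> \<partial>lborel) + (\<integral>\<^sup>+\<tau>. j V V \<tau> \<partial>lborel) \<le> fork_rate * K * ennreal t + 2 * (\<integral>\<^sup>+\<tau>. j U V \<tau> \<partial>lborel)"
      by (simp add: nn_integral_add)
    then show ?thesis unfolding J_def j_def .
  qed
  then have JJ: "J U U + J V V \<le> fork_rate * K * ennreal t + 2 * I U V" by (simp only: IJ(3))
  have "(\<integral>\<^sup>+z. D z \<partial>M) + 2 * I U V = (FK t (\<lambda>x. U x * U x) ?x + J U U) + (FK t (\<lambda>x. V x * V x) ?x + J V V)"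
    by (simp only: DI[symmetric] IJ(1,2))
  also have "\<dots> = FK t (\<lambda>x. ennreal ((g x)^2)) ?x + (J U U + J V V)"
    by (simp only: g2e[symmetric] FK_add[OF U2 V2 t0] ac_simps)
  also have "\<dots> \<le> FK t (\<lambda>x. ennreal ((g x)^2)) ?x + (fork_rate * K * ennreal t + 2 * I U V)"
    by (rule add_left_mono[OF JJ])
  finally have "2 * I U V + (\<integral>\<^sup>+z. D z \<partial>M) \<le> 2 * I U V + (FK t (\<lambda>x. ennreal ((g x)^2)) ?x + fork_rate * K * ennreal t)"
    by (simp only: ac_simps)
  moreover have "2 * I U V \<noteq> \<infinity>" using \<open>I U V < top\<close> by (simp add: infinity_ennreal_def ennreal_mult_eq_top_iff)
  ultimately have "(\<integral>\<^sup>+z. D z \<partial>M) \<le> FK t (\<lambda>x. ennreal ((g x)^2)) ?x + fork_rate * K * ennreal t"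
    unfolding ennreal_add_left_cancel_le by blast
  then show ?thesis unfolding UV D_def .
qed

section \<open>The population as a sum over the tree\<close>

lemma nn_integral_labels:
  fixes F :: "label \<Rightarrow> ennreal"
  shows "(\<integral>\<^sup>+w. F w \<partial>count_space UNIV) = F [] + (\<integral>\<^sup>+w. (\<Sum>i. F (i # w)) \<partial>count_space UNIV)"
proof -
  have b: "bij_betw (\<lambda>p. fst p # snd p) (UNIV :: (nat \<times> label) set) (- {[]})"
  proof (rule bij_betwI')
    fix y :: label assume "y \<in> - {[]}"
    then obtain i w where "y = i # w" by (cases y) auto
    then show "\<exists>x\<in>UNIV. y = fst x # snd x" by (intro bexI[of _ "(i, w)"]) auto
  qed (auto simp: prod_eq_iff)
  have "(\<integral>\<^sup>+w. F w \<partial>count_space UNIV) = (\<integral>\<^sup>+w. F [] * indicator {[]} w + F w * indicator (- {[]}) w \<partial>count_space UNIV)"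
    by (rule nn_integral_cong) (auto simp: indicator_def)
  also have "\<dots> = F [] + (\<integral>\<^sup>+w. F w * indicator (- {[]}) w \<partial>count_space UNIV)"
    by (simp add: nn_integral_add nn_integral_cmult)
  also have "(\<integral>\<^sup>+w. F w * indicator (- {[]}) w \<partial>count_space UNIV) = (\<integral>\<^sup>+w. F w \<partial>count_space (- {[]}))"
    by (rule nn_integral_count_space_indicator[symmetric]) simp
  also have "\<dots> = (\<integral>\<^sup>+p. F (fst p # snd p) \<partial>count_space UNIV)"
    by (rule nn_integral_bij_count_space[OF b, symmetric])
  also have "\<dots> = (\<integral>\<^sup>+w. \<integral>\<^sup>+i. F (i # w) \<partial>count_space UNIV \<partial>count_space UNIV)"
    using nn_integral_snd_count_space[of "\<lambda>p. F (fst p # snd p)"] by simp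
  finally show ?thesis by (simp add: nn_integral_count_space_nat)
qed

lemma dsum_generation: "dsum n F [] y = (\<integral>\<^sup>+w. F w y * indicator {w. length w = n} w \<partial>count_space UNIV)"
proof (induction n arbitrary: F)
  case 0
  show ?case unfolding nn_integral_labels[of "\<lambda>w. F w y * indicator {w. length w = 0} w"] by simp
next
  case (Suc n)
  have "dsum (Suc n) F [] y = (\<integral>\<^sup>+w. (\<Sum>i. F (i # w) y) * indicator {w. length w = n} w \<partial>count_space UNIV)"
    unfolding dsum_Suc by (rule Suc.IH)
  also have "\<dots> = (\<integral>\<^sup>+w. (\<Sum>i. F (i # w) y * indicator {w. length w = Suc n} (i # w)) \<partial>count_space UNIV)"
    by (rule nn_integral_cong) (simp add: indicator_def)
  also have "\<dots> = (\<integral>\<^sup>+w. F w y * indicator {w. length w = Suc n} w \<partial>count_space UNIV)"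
    unfolding nn_integral_labels[of "\<lambda>w. F w y * indicator {w. length w = Suc n} w"] by simp
  finally show ?case .
qed

lemma av_tree_sum: "(\<integral>\<^sup>+v. av t g v y \<partial>count_space UNIV) = (\<Sum>i<length xs. Z t g [i] y)"
proof -
  have one: "(\<Sum>n. a * indicator {w. length w = n} v) = a" for a :: ennreal and v :: label
    using suminf_finite[of "{length v}" "\<lambda>n. a * indicator {w. length w = n} v"] by simp
  have "(\<integral>\<^sup>+v. av t g v y \<partial>count_space UNIV) = (\<integral>\<^sup>+v. (\<Sum>n. av t g v y * indicator {w. length w = n} v) \<partial>count_space UNIV)"
    unfolding one ..
  also have "\<dots> = (\<Sum>n. dsum n (av t g) [] y)"
    unfolding dsum_generation by (rule nn_integral_suminf) simp
  also have "\<dots> = (\<Sum>n. dsum (Suc n) (av t g) [] y) + dsum 0 (av t g) [] y"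
    by (subst suminf_offset[where i = 1]) (auto simp: summableI)
  also have "dsum 0 (av t g) [] y = 0" by (simp add: av_def)
  also have "(\<Sum>n. dsum (Suc n) (av t g) [] y) = (\<Sum>i. Z t g [i] y)"
    unfolding Z_def dsum.simps by (rule ennreal_suminf_swap)
  also have "\<dots> = (\<Sum>i<length xs. Z t g [i] y)"
  proof (rule suminf_finite)
    fix i assume "i \<notin> {..<length xs}"
    then have "B [i] y = None" by (simp add: B_root)
    then have "dsum n (av t g) [i] y = 0" for n by (intro late_zero) auto
    then show "Z t g [i] y = 0" by (simp add: Z_def)
  qed simp
  finally show ?thesis by simp
qed

abbreviation X :: "real \<Rightarrow> 'm \<Rightarrow> 'a measure" where
  "X \<equiv> branching_process \<xi> xs mot life kids"

lemma population_nn_integral: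
  assumes g: "g \<in> borel_measurable borel" and t: "0 \<le> t"
  shows "(\<integral>\<^sup>+x. g x \<partial>X t w) = (\<Sum>i<length xs. Z t g [i] w)"
proof -
  let ?A = "alive \<xi> xs (mot w) (life w) (kids w) t"
  have p: "g (the (location \<xi> (mot w) (life w) t v)) * indicator ?A v = av t g v w" for v
  proof (cases "B v w = None")
    case True
    then show ?thesis by (simp add: av_def alive_def born_at_def)
  next
    case False
    have b: "birth_time (life w) v = ennreal (rb v w)" by (rule birth_time_eq[OF False])
    have loc: "location \<xi> (mot w) (life w) t v = \<xi> (t - rb v w) (mot w v)" by (simp add: location_def rb_def)
    have "ennreal t < ennreal (rb v w) + life w v \<longleftrightarrow> ennreal (t - rb v w) < life w v" if "rb v w \<le> t"
    proof -
      have "ennreal t = ennreal (rb v w) + ennreal (t - rb v w)" using that rb_nonneg[of v w] by (simp flip: ennreal_plus)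
      then show ?thesis by (simp add: ennreal_add_left_cancel_less infinity_ennreal_def)
    qed
    then have "v \<in> ?A \<longleftrightarrow> rb v w \<le> t \<and> ennreal (t - rb v w) < life w v \<and> \<xi> (t - rb v w) (mot w v) \<noteq> None"
      using False t by (auto simp: alive_def b loc born_at_def[symmetric])
    then show ?thesis using False by (auto simp: av_def loc indicator_def)
  qed
  have "(\<integral>\<^sup>+x. g x \<partial>X t w) = (\<integral>\<^sup>+v. g (the (location \<xi> (mot w) (life w) t v)) \<partial>count_space ?A)"
    unfolding branching_process_def population_def by (rule nn_integral_distr) (use g in auto)
  also have "\<dots> = (\<integral>\<^sup>+v. g (the (location \<xi> (mot w) (life w) t v)) * indicator ?A v \<partial>count_space UNIV)"
    by (rule nn_integral_count_space_indicator) simp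
  finally show ?thesis unfolding p av_tree_sum .
qed

lemma borel_population [simp]: "sets (X t w) = sets borel"
  by (simp add: branching_process_def population_def)

lemma population_integrable_iff:
  assumes f: "f \<in> borel_measurable borel" and t: "0 \<le> t"
  shows "integrable (X t w) f \<longleftrightarrow> (\<Sum>i<length xs. Z t (\<lambda>x. ennreal (f x)) [i] w) < top \<and> (\<Sum>i<length xs. Z t (\<lambda>x. ennreal (- f x)) [i] w) < top"
proof -
  have "(\<lambda>x. ennreal (f x)) \<in> borel_measurable borel" "(\<lambda>x. ennreal (- f x)) \<in> borel_measurable borel" using f by measurable
  from this[THEN population_nn_integral, OF t] show ?thesis
    using f by (simp add: real_integrable_def measurable_cong_sets[OF borel_population refl] less_top infinity_ennreal_def)
qed

text \<open>For a function that is not integrable against the population, the Bochner integral is 0. Spelling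
  this out yields measurability without an exceptional set.\<close>

lemma population_integral:
  fixes f :: "'a \<Rightarrow> real"
  assumes f: "f \<in> borel_measurable borel" and t: "0 \<le> t"
  shows "(\<integral>x. f x \<partial>X t w) = (if (\<Sum>i<length xs. Z t (\<lambda>x. ennreal (f x)) [i] w) < top \<and> (\<Sum>i<length xs. Z t (\<lambda>x. ennreal (- f x)) [i] w) < top
    then enn2real (\<Sum>i<length xs. Z t (\<lambda>x. ennreal (f x)) [i] w) - enn2real (\<Sum>i<length xs. Z t (\<lambda>x. ennreal (- f x)) [i] w) else 0)"
proof -
  have "(\<lambda>x. ennreal (f x)) \<in> borel_measurable borel" "(\<lambda>x. ennreal (- f x)) \<in> borel_measurable borel" using f by measurable
  note nn = this[THEN population_nn_integral, OF t]
  show ?thesis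
    unfolding population_integrable_iff[OF f t, symmetric]
    by (simp add: real_lebesgue_integral_def nn not_integrable_integral_eq)
qed

lemma population_integral_measurable:
  fixes f :: "'a \<Rightarrow> real"
  assumes f: "f \<in> borel_measurable borel" and t: "0 \<le> t"
  shows "(\<lambda>w. \<integral>x. f x \<partial>X t w) \<in> borel_measurable M"
proof -
  have "(\<lambda>x. ennreal (f x)) \<in> borel_measurable borel" "(\<lambda>x. ennreal (- f x)) \<in> borel_measurable borel" using f by measurable
  note [measurable] = this[THEN Z_measurable_M]
  show ?thesis unfolding population_integral[OF f t] by measurable
qed

lemma L2_Z_finite:
  assumes f: "f \<in> L2_space \<mu>" and t: "0 < t"
  shows "AE w in M. \<forall>i<length xs. Z t (\<lambda>x. ennreal (f x)) [i] w < top \<and> Z t (\<lambda>x. ennreal (- f x)) [i] w < top"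
proof -
  note fm = L2_borel[OF f]
  have "(\<lambda>x. ennreal (f x)) \<in> borel_measurable borel" "(\<lambda>x. ennreal (- f x)) \<in> borel_measurable borel" using fm by measurable
  note Zf = this[THEN Z_finite, OF _ less_imp_le[OF t]]
  have "FK t (\<lambda>x. ennreal (f x)) (Some y) \<le> FK t (\<lambda>x. ennreal \<bar>f x\<bar>) (Some y)"
    "FK t (\<lambda>x. ennreal (- f x)) (Some y) \<le> FK t (\<lambda>x. ennreal \<bar>f x\<bar>) (Some y)" for y
    by (rule FK_mono, rule ennreal_leI, simp)+
  note fin = this[THEN le_less_trans, OF FK_finite_L2[OF f t]]
  have "AE w in M. Z t (\<lambda>x. ennreal (f x)) [i] w < top \<and> Z t (\<lambda>x. ennreal (- f x)) [i] w < top" if "i < length xs" for i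
    using Zf(1)[OF that fin(1)] Zf(2)[OF that fin(2)] by eventually_elim simp
  then have "AE w in M. \<forall>i\<in>{..<length xs}. Z t (\<lambda>x. ennreal (f x)) [i] w < top \<and> Z t (\<lambda>x. ennreal (- f x)) [i] w < top"
    by (intro AE_finite_allI) auto
  then show ?thesis by (rule eventually_mono) simp
qed

lemma L2_population_integrable:
  assumes f: "f \<in> L2_space \<mu>" and t: "0 < t"
  shows "AE w in M. integrable (X t w) f"
  using L2_Z_finite[OF assms] unfolding population_integrable_iff[OF L2_borel[OF f] less_imp_le[OF t]]
  by (rule eventually_mono) simp

lemma population_second_moment:
  assumes g: "g \<in> L2_space \<mu>" and g2: "(\<lambda>x. (g x)^2) \<in> L2_space \<mu>" and t: "0 < t"
    and K: "\<And>i \<tau>. i < length xs \<Longrightarrow> 0 \<le> \<tau> \<Longrightarrow> \<tau> \<le> t \<Longrightarrow> FK \<tau> (\<lambda>y. ennreal ((TS (t - \<tau>) g y)^2)) (Some (xs ! i)) \<le> K"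
    and K': "\<And>i. i < length xs \<Longrightarrow> FK t (\<lambda>x. ennreal ((g x)^2)) (Some (xs ! i)) \<le> K"
  shows "(\<integral>\<^sup>+w. ennreal ((\<integral>x. g x \<partial>X t w)^2) \<partial>M) \<le> of_nat (length xs) * (of_nat (length xs) * (K + fork_rate * K * ennreal t))"
proof -
  define d where "d = (\<lambda>i w. enn2real (Z t (\<lambda>x. ennreal (g x)) [i] w) - enn2real (Z t (\<lambda>x. ennreal (- g x)) [i] w))"
  have gm: "(\<lambda>x. ennreal (g x)) \<in> borel_measurable borel" "(\<lambda>x. ennreal (- g x)) \<in> borel_measurable borel"
    using L2_borel[OF g] by measurable
  note [measurable] = gm[THEN Z_measurable_M]
  have [measurable]: "d i \<in> borel_measurable M" for i unfolding d_def by measurable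
  have "AE w in M. ennreal ((\<integral>x. g x \<partial>X t w)^2) \<le> of_nat (length xs) * (\<Sum>i<length xs. ennreal ((d i w)^2))"
    using L2_Z_finite[OF g t]
  proof eventually_elim
    case (elim w)
    have "(\<integral>x. g x \<partial>X t w) = (\<Sum>i<length xs. d i w)"
      using elim unfolding population_integral[OF L2_borel[OF g] less_imp_le[OF t]] d_def
      by (simp add: sum_subtractf) (subst (1 2) enn2real_sum; simp)
    then have "(\<integral>x. g x \<partial>X t w)^2 \<le> (\<Sum>i<length xs. (d i w)^2) * length xs"
      using sum_squared_le_sum_of_squares[of "\<lambda>i. d i w" "{..<length xs}"] by simp
    then have "ennreal ((\<integral>x. g x \<partial>X t w)^2) \<le> ennreal ((\<Sum>i<length xs. (d i w)^2) * real (length xs))" by (rule ennreal_leI)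
    also have "\<dots> = of_nat (length xs) * (\<Sum>i<length xs. ennreal ((d i w)^2))"
      by (simp add: ennreal_mult sum_nonneg mult.commute flip: ennreal_of_nat_eq_real_of_nat sum_ennreal)
    finally show ?case .
  qed
  then have "(\<integral>\<^sup>+w. ennreal ((\<integral>x. g x \<partial>X t w)^2) \<partial>M) \<le> (\<integral>\<^sup>+w. of_nat (length xs) * (\<Sum>i<length xs. ennreal ((d i w)^2)) \<partial>M)"
    by (rule nn_integral_mono_AE)
  also have "\<dots> = of_nat (length xs) * (\<Sum>i<length xs. \<integral>\<^sup>+w. ennreal ((d i w)^2) \<partial>M)"
    by (simp add: nn_integral_cmult nn_integral_sum del: sum_ennreal)
  also have "\<dots> \<le> of_nat (length xs) * (\<Sum>i<length xs. K + fork_rate * K * ennreal t)"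
  proof (intro mult_left_mono sum_mono)
    fix i assume i: "i \<in> {..<length xs}"
    then have i: "i < length xs" by simp
    have "(\<integral>\<^sup>+w. ennreal ((d i w)^2) \<partial>M) \<le> FK t (\<lambda>x. ennreal ((g x)^2)) (Some (xs ! i)) + fork_rate * K * ennreal t"
      unfolding d_def by (rule variance_bound[OF g g2 i t K[OF i]])
    also have "\<dots> \<le> K + fork_rate * K * ennreal t" by (intro add_right_mono K'[OF i])
    finally show "(\<integral>\<^sup>+w. ennreal ((d i w)^2) \<partial>M) \<le> K + fork_rate * K * ennreal t" .
  qed simp
  finally show ?thesis by simp
qed

end

section \<open>Eigenfunctions\<close>

lemma square_L2_add:
  assumes "g \<in> borel_measurable M" "h \<in> borel_measurable M" "(\<lambda>x. (g x)^2) \<in> L2_space M" "(\<lambda>x. (h x)^2) \<in> L2_space M"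
  shows "(\<lambda>x. (g x + h x)^2) \<in> L2_space M"
proof -
  note [measurable] = assms(1,2)
  have L: "(\<lambda>x. 2 * (g x)^2 + 2 * (h x)^2) \<in> L2_space M" by (rule L2_lincomb[OF assms(3,4)])
  have "integrable M (\<lambda>x. ((g x + h x)^2)^2)"
  proof (rule Bochner_Integration.integrable_bound)
    show "integrable M (\<lambda>x. (2 * (g x)^2 + 2 * (h x)^2)^2)" using L by (simp add: L2_space_def)
    have "((a + b)^2)^2 \<le> (2 * a^2 + 2 * b^2)^2" for a b :: real
    proof (rule power_mono)
      show "(a + b)^2 \<le> 2 * a^2 + 2 * b^2"
        using zero_le_power2[of "a - b"] by (simp add: power2_eq_square algebra_simps)
    qed simp
    then have "norm (((g x + h x)^2)^2) \<le> norm ((2 * (g x)^2 + 2 * (h x)^2)^2)" for x by (simp only: real_norm_def abs_power2 abs_of_nonneg[OF zero_le_power2])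
    then show "AE x in M. norm (((g x + h x)^2)^2) \<le> norm ((2 * (g x)^2 + 2 * (h x)^2)^2)" by (rule AE_I2)
  qed measurable
  then show ?thesis by (simp add: L2_space_def)
qed

lemma square_L2_scale: "(\<lambda>x. (g x)^2) \<in> L2_space M \<Longrightarrow> (\<lambda>x. (c * g x)^2) \<in> L2_space M"
  using L2_scale[of "\<lambda>x. (g x)^2" M "c^2"] by (simp add: power_mult_distrib)

lemma square_L2_sum:
  assumes "finite I" "\<And>i. i \<in> I \<Longrightarrow> g i \<in> borel_measurable M" "\<And>i. i \<in> I \<Longrightarrow> (\<lambda>x. (g i x)^2) \<in> L2_space M"
  shows "(\<lambda>x. (\<Sum>i\<in>I. g i x)^2) \<in> L2_space M"
  using assms
proof (induction I rule: finite_induct)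
  case empty
  then show ?case by (simp add: L2_zero)
next
  case (insert i I)
  have "(\<lambda>x. (g i x + (\<Sum>i\<in>I. g i x))^2) \<in> L2_space M"
    by (rule square_L2_add) (use insert in auto)
  then show ?case using insert by simp
qed

lemma L2_inner_sum:
  assumes "finite I" "\<And>i. i \<in> I \<Longrightarrow> e i \<in> L2_space M" "h \<in> L2_space M"
  shows "L2_inner M (\<lambda>x. \<Sum>i\<in>I. c i * e i x) h = (\<Sum>i\<in>I. c i * L2_inner M (e i) h)"
  using assms
proof (induction I rule: finite_induct)
  case empty
  then show ?case by (simp add: L2_inner_def)
next
  case (insert i I)
  have "L2_inner M (\<lambda>x. c i * e i x + 1 * (\<Sum>i\<in>I. c i * e i x)) h = c i * L2_inner M (e i) h + 1 * L2_inner M (\<lambda>x. \<Sum>i\<in>I. c i * e i x) h"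
    by (rule L2_inner_lincomb) (use insert in \<open>auto intro!: L2_sum L2_scale\<close>)
  then show ?case using insert by simp
qed

context branching_model
begin

abbreviation L_gen :: "('a \<Rightarrow> real) \<Rightarrow> ('a \<Rightarrow> real) \<Rightarrow> bool" where "L_gen \<equiv> generator \<mu> TS"

lemma phi_generator:
  assumes "k \<in> ev_index nev" "j \<in> {1..dimE k}" shows "L_gen (\<phi> k j) (\<lambda>x. - lam k * \<phi> k j x)"
  using eigenbasis[OF assms(1)] assms(2) by (auto simp: orthonormal_basis_of_def eigenspace_def)

lemma phi_L2: "k \<in> ev_index nev \<Longrightarrow> j \<in> {1..dimE k} \<Longrightarrow> \<phi> k j \<in> L2_space \<mu>"
  using phi_generator by (auto simp: generator_def)

lemma phi_orthonormal:
  "k \<in> ev_index nev \<Longrightarrow> i \<in> {1..dimE k} \<Longrightarrow> j \<in> {1..dimE k} \<Longrightarrow> L2_inner \<mu> (\<phi> k i) (\<phi> k j) = (if i = j then 1 else 0)"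
  using eigenbasis[of k] by (simp add: orthonormal_basis_of_def)

lemma eigenfunctions_orthogonal:
  assumes g: "L_gen g (\<lambda>x. y * g x)" and h: "L_gen h (\<lambda>x. z * h x)" and yz: "y \<noteq> z"
  shows "L2_inner \<mu> g h = 0"
proof -
  have gL: "g \<in> L2_space \<mu>" and hL: "h \<in> L2_space \<mu>" using g h by (auto simp: generator_def)
  have e: "L2_inner \<mu> (TS 1 a) b = exp x * L2_inner \<mu> a b" if "L_gen a (\<lambda>w. x * a w)" "a \<in> L2_space \<mu>" "b \<in> L2_space \<mu>" for a b x
  proof -
    have "AE w in \<mu>. TS 1 a w = exp (x * 1) * a w" by (rule FKsg.eigenfunction_evolution[OF that(1)]) simp
    then have "L2_inner \<mu> (TS 1 a) b = L2_inner \<mu> (\<lambda>w. exp x * a w) b"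
      using that by (intro L2_inner_cong_AE TS_L2 L2_scale) auto
    then show ?thesis by (simp add: L2_inner_scale)
  qed
  have "exp y * L2_inner \<mu> g h = L2_inner \<mu> g (TS 1 h)" using e[OF g gL hL] TS_symmetric[of 1 g h] gL hL by simp
  also have "\<dots> = exp z * L2_inner \<mu> g h" using e[OF h hL gL] by (simp add: L2_inner_commute[of \<mu> g])
  finally show ?thesis using yz by simp
qed

lemma eigenvalue_index:
  assumes g: "L_gen g (\<lambda>x. z * g x)" and n: "L2_norm \<mu> g \<noteq> 0"
  shows "\<exists>k\<in>ev_index nev. z = - lam k"
proof -
  have gL: "g \<in> L2_space \<mu>" using g by (simp add: generator_def)
  have "\<not> in_resolvent_set \<mu> L_gen z"
  proof
    assume "in_resolvent_set \<mu> L_gen z"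
    then have "AE x in \<mu>. g x = 0" unfolding in_resolvent_set_def using g by fastforce
    then show False using n L2_norm_zero_iff_AE[OF gL] by simp
  qed
  then have "z \<in> spectrum \<mu> L_gen" by (simp add: spectrum_def)
  then show ?thesis unfolding spectrum_L by auto
qed

lemma orthogonal_eigenfunction_zero:
  assumes k: "k \<in> ev_index nev" and g: "L_gen g (\<lambda>x. - lam k * g x)" and o: "\<And>j. j \<in> {1..dimE k} \<Longrightarrow> L2_inner \<mu> g (\<phi> k j) = 0"
  shows "L2_norm \<mu> g = 0"
proof -
  have gL: "g \<in> L2_space \<mu>" using g by (simp add: generator_def)
  have "g \<in> eigenspace L_gen (- lam k)" using g by (simp add: eigenspace_def)
  then obtain c where c: "AE x in \<mu>. g x = (\<Sum>j=1..dimE k. c j * \<phi> k j x)"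
    using eigenbasis[OF k] unfolding orthonormal_basis_of_def by blast
  have "L2_inner \<mu> g g = L2_inner \<mu> (\<lambda>x. \<Sum>j=1..dimE k. c j * \<phi> k j x) g"
    by (rule L2_inner_cong_AE[OF gL _ gL c]) (intro L2_sum L2_scale phi_L2[OF k])
  also have "\<dots> = (\<Sum>j=1..dimE k. c j * L2_inner \<mu> (\<phi> k j) g)"
    by (rule L2_inner_sum) (use phi_L2[OF k] gL in auto)
  also have "\<dots> = 0" using o by (simp add: L2_inner_commute[of \<mu> _ g])
  finally show ?thesis using L2_norm_power2[of \<mu> g] by simp
qed

lemma one_ev_index: "1 \<in> ev_index nev"
  using nev_pos by (simp add: ev_index_def one_enat_def)

lemma lam_mono: "j \<in> ev_index nev \<Longrightarrow> k \<in> ev_index nev \<Longrightarrow> j \<le> k \<Longrightarrow> lam j \<le> lam k"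
  using lam_increasing by (cases "j = k") (auto simp: strict_mono_on_def less_imp_le)

lemma principal_growth: "\<exists>C>0. \<forall>g\<in>L2_space \<mu>. \<forall>t\<ge>0. L2_norm \<mu> (TS t g) \<le> C * exp (- lam 1 * t) * L2_norm \<mu> g"
proof -
  have "\<exists>C>0. \<forall>g\<in>L2_space \<mu>. (\<forall>e\<in>{}. L2_inner \<mu> g e = 0) \<longrightarrow> (\<forall>t\<ge>0. L2_norm \<mu> (TS t g) \<le> C * exp (- lam 1 * t) * L2_norm \<mu> g)"
  proof (rule FKsg.decay_orthogonal_to_eigenfunctions)
    fix g z assume "L_gen g (\<lambda>x. z * g x)" "L2_norm \<mu> g \<noteq> 0"
    then obtain k where k: "k \<in> ev_index nev" "z = - lam k" using eigenvalue_index by blast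
    then have "1 \<le> k" by (simp add: ev_index_def)
    then show "z \<le> - lam 1" using lam_mono[OF one_ev_index k(1)] k(2) by simp
  qed simp
  then show ?thesis by simp
qed

text \<open>An eigenfunction orthogonal to the first \<open>k\<close> eigenspaces has an eigenvalue \<open>- lam m\<close> with \<open>m > k\<close>.\<close>

lemma spectral_gap_decay:
  assumes l: "\<And>m. m \<in> ev_index nev \<Longrightarrow> k < m \<Longrightarrow> l \<le> lam m"
  shows "\<exists>C>0. \<forall>g\<in>L2_space \<mu>. (\<forall>k'\<in>ev_index nev. k' \<le> k \<longrightarrow> (\<forall>j\<in>{1..dimE k'}. L2_inner \<mu> g (\<phi> k' j) = 0)) \<longrightarrow>
    (\<forall>t\<ge>0. L2_norm \<mu> (TS t g) \<le> C * exp (- l * t) * L2_norm \<mu> g)"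
proof -
  define B where "B = {\<phi> k' j | k' j. k' \<in> ev_index nev \<and> k' \<le> k \<and> j \<in> {1..dimE k'}}"
  have "\<exists>C>0. \<forall>g\<in>L2_space \<mu>. (\<forall>e\<in>B. L2_inner \<mu> g e = 0) \<longrightarrow> (\<forall>t\<ge>0. L2_norm \<mu> (TS t g) \<le> C * exp (- l * t) * L2_norm \<mu> g)"
  proof (rule FKsg.decay_orthogonal_to_eigenfunctions)
    show "\<exists>z. L_gen e (\<lambda>x. z * e x)" if "e \<in> B" for e
      using that phi_generator unfolding B_def by blast
    fix g z assume g: "L_gen g (\<lambda>x. z * g x)" "\<And>e. e \<in> B \<Longrightarrow> L2_inner \<mu> g e = 0" "L2_norm \<mu> g \<noteq> 0"
    then obtain m where m: "m \<in> ev_index nev" "z = - lam m" using eigenvalue_index by blast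
    have "k < m"
    proof (rule ccontr)
      assume "\<not> k < m"
      then have "m \<le> k" by simp
      then have "\<phi> m j \<in> B" if "j \<in> {1..dimE m}" for j using that m(1) unfolding B_def by blast
      then have "L2_inner \<mu> g (\<phi> m j) = 0" if "j \<in> {1..dimE m}" for j using that by (intro g(2))
      then show False using orthogonal_eigenfunction_zero[OF m(1)] g(1,3) m(2) by blast
    qed
    then show "z \<le> - l" using l[OF m(1)] m(2) by simp
  qed
  moreover have "(\<forall>e\<in>B. L2_inner \<mu> g e = 0) \<longleftrightarrow> (\<forall>k'\<in>ev_index nev. k' \<le> k \<longrightarrow> (\<forall>j\<in>{1..dimE k'}. L2_inner \<mu> g (\<phi> k' j) = 0))" for g
    unfolding B_def by blast
  ultimately show ?thesis by simp
qed

text \<open>An eigenfunction is a multiple of its image under the semigroup, whose square is bounded by a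
  multiple of the square integrable function \<open>p t0 x x\<close>.\<close>

lemma phi_square_L2:
  assumes k: "k \<in> ev_index nev" and j: "j \<in> {1..dimE k}"
  shows "(\<lambda>x. (\<phi> k j x)^2) \<in> L2_space \<mu>"
proof -
  obtain t0 where t0: "0 < t0" "(\<lambda>x. p t0 x x) \<in> L2_space \<mu>" using diagonal_L2 by blast
  define r where "r = t0 / 2"
  have r: "0 < r" "2 * r = t0" using t0 by (auto simp: r_def)
  define e c where "e = exp (- lam k * (r + 1))" and "c = exp (2 * growth_rate * r) * (L2_norm \<mu> (TS 1 (\<phi> k j)))^2 / e^2"
  note L = phi_L2[OF k j]
  have pL: "\<phi> k j \<in> borel_measurable \<mu>" using L by (simp add: L2_space_def)
  have b: "AE x in \<mu>. (\<phi> k j x)^2 \<le> c * p t0 x x"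
  proof -
    have "AE x in \<mu>. TS (r + 1) (\<phi> k j) x = e * \<phi> k j x"
      unfolding e_def by (rule FKsg.eigenfunction_evolution[OF phi_generator[OF k j]]) (use r in simp)
    then show ?thesis
    proof eventually_elim
      case (elim x)
      have "e^2 * (\<phi> k j x)^2 = (TS (r + 1) (\<phi> k j) x)^2" by (simp only: elim power_mult_distrib)
      also have "\<dots> \<le> exp (2 * growth_rate * r) * p (2 * r) x x * (L2_norm \<mu> (TS 1 (\<phi> k j)))^2"
        by (rule TS_pointwise[OF r(1) _ L]) simp
      finally have "e^2 * (\<phi> k j x)^2 \<le> exp (2 * growth_rate * r) * p t0 x x * (L2_norm \<mu> (TS 1 (\<phi> k j)))^2"
        unfolding r(2) .
      moreover have "0 < e^2" by (simp add: e_def)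
      ultimately show ?case by (simp add: c_def field_simps)
    qed
  qed
  have cp: "(\<lambda>x. c * p t0 x x) \<in> L2_space \<mu>" by (rule L2_scale[OF t0(2)])
  have "integrable \<mu> (\<lambda>x. ((\<phi> k j x)^2)^2)"
  proof (rule Bochner_Integration.integrable_bound)
    show "integrable \<mu> (\<lambda>x. (c * p t0 x x)^2)" using cp by (simp add: L2_space_def)
    show "(\<lambda>x. ((\<phi> k j x)^2)^2) \<in> borel_measurable \<mu>" using pL by measurable
    show "AE x in \<mu>. norm (((\<phi> k j x)^2)^2) \<le> norm ((c * p t0 x x)^2)"
      using b
    proof eventually_elim
      case (elim x)
      have "((\<phi> k j x)^2)^2 \<le> (c * p t0 x x)^2" by (rule power_mono[OF elim]) simp
      then show ?case by (simp only: real_norm_def abs_power2 abs_of_nonneg[OF zero_le_power2])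
    qed
  qed
  then show ?thesis using pL by (simp add: L2_space_def)
qed

end

section \<open>Convergence\<close>

lemma L2_tendsto_add:
  assumes "L2_tendsto M Y Z F" "L2_tendsto M Y' Z' F"
  shows "L2_tendsto M (\<lambda>i x. Y i x + Y' i x) (\<lambda>x. Z x + Z' x) F"
proof -
  have Z: "Z \<in> L2_space M" "Z' \<in> L2_space M" and ev: "\<forall>\<^sub>F i in F. Y i \<in> L2_space M" "\<forall>\<^sub>F i in F. Y' i \<in> L2_space M"
    and lim: "((\<lambda>i. L2_norm M (\<lambda>x. Y i x - Z x)) \<longlongrightarrow> 0) F" "((\<lambda>i. L2_norm M (\<lambda>x. Y' i x - Z' x)) \<longlongrightarrow> 0) F"
    using assms by (auto simp: L2_tendsto_def)
  have "((\<lambda>i. L2_norm M (\<lambda>x. Y i x + Y' i x - (Z x + Z' x))) \<longlongrightarrow> 0) F"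
  proof (rule Lim_null_comparison)
    show "((\<lambda>i. L2_norm M (\<lambda>x. Y i x - Z x) + L2_norm M (\<lambda>x. Y' i x - Z' x)) \<longlongrightarrow> 0) F"
      using tendsto_add[OF lim] by simp
    show "\<forall>\<^sub>F i in F. norm (L2_norm M (\<lambda>x. Y i x + Y' i x - (Z x + Z' x))) \<le> L2_norm M (\<lambda>x. Y i x - Z x) + L2_norm M (\<lambda>x. Y' i x - Z' x)"
      using ev
    proof eventually_elim
      case (elim i)
      have "(\<lambda>x. Y i x + Y' i x - (Z x + Z' x)) = (\<lambda>x. (Y i x - Z x) + (Y' i x - Z' x))" by (simp add: algebra_simps)
      then show ?case
        using L2_norm_triangle[OF L2_diff[OF elim(1) Z(1)] L2_diff[OF elim(2) Z(2)]] by (simp add: L2_norm_nonneg)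
    qed
  qed
  moreover have "\<forall>\<^sub>F i in F. (\<lambda>x. Y i x + Y' i x) \<in> L2_space M" using ev by eventually_elim (rule L2_add)
  ultimately show ?thesis using L2_add[OF Z] by (simp add: L2_tendsto_def)
qed

lemma L2_tendsto_scale:
  assumes "L2_tendsto M Y Z F" shows "L2_tendsto M (\<lambda>i x. c * Y i x) (\<lambda>x. c * Z x) F"
proof -
  have "((\<lambda>i. \<bar>c\<bar> * L2_norm M (\<lambda>x. Y i x - Z x)) \<longlongrightarrow> 0) F"
    using assms by (auto simp: L2_tendsto_def intro: tendsto_mult_right_zero)
  then have "((\<lambda>i. L2_norm M (\<lambda>x. c * Y i x - c * Z x)) \<longlongrightarrow> 0) F"
    by (simp only: L2_norm_scale[symmetric] right_diff_distrib)
  moreover have "\<forall>\<^sub>F i in F. (\<lambda>x. c * Y i x) \<in> L2_space M"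
    using assms by (auto simp: L2_tendsto_def elim!: eventually_mono intro: L2_scale)
  ultimately show ?thesis using assms by (simp add: L2_tendsto_def L2_scale)
qed

lemma L2_tendsto_sum:
  assumes "finite I" "\<And>i. i \<in> I \<Longrightarrow> L2_tendsto M (Y i) (Z i) F"
  shows "L2_tendsto M (\<lambda>t x. \<Sum>i\<in>I. Y i t x) (\<lambda>x. \<Sum>i\<in>I. Z i x) F"
  using assms
proof (induction I rule: finite_induct)
  case empty
  then show ?case by (simp add: L2_tendsto_def L2_zero L2_norm_def)
next
  case (insert i I)
  have "L2_tendsto M (\<lambda>t x. Y i t x + (\<Sum>i\<in>I. Y i t x)) (\<lambda>x. Z i x + (\<Sum>i\<in>I. Z i x)) F"
    by (rule L2_tendsto_add) (use insert in auto)
  then show ?case using insert by simp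
qed

lemma L2_tendsto_cong_AE:
  assumes Y: "L2_tendsto M Y Z F" and m: "\<forall>\<^sub>F i in F. Y' i \<in> borel_measurable M" and e: "\<forall>\<^sub>F i in F. AE x in M. Y i x = Y' i x"
  shows "L2_tendsto M Y' Z F"
proof -
  have ev: "\<forall>\<^sub>F i in F. Y i \<in> L2_space M" and Z: "Z \<in> L2_space M" and lim: "((\<lambda>i. L2_norm M (\<lambda>x. Y i x - Z x)) \<longlongrightarrow> 0) F"
    using Y by (auto simp: L2_tendsto_def)
  have L: "\<forall>\<^sub>F i in F. Y' i \<in> L2_space M" using ev m e by eventually_elim (rule L2_cong_AE)
  have "\<forall>\<^sub>F i in F. L2_norm M (\<lambda>x. Y i x - Z x) = L2_norm M (\<lambda>x. Y' i x - Z x)"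
    using ev L e by eventually_elim (intro L2_norm_cong_AE L2_diff Z; auto)
  then have "((\<lambda>i. L2_norm M (\<lambda>x. Y' i x - Z x)) \<longlongrightarrow> 0) F" using lim by (rule Lim_transform_eventually[rotated])
  then show ?thesis using L Z by (simp add: L2_tendsto_def)
qed

lemma linear_times_exp_bound:
  assumes "0 < d" "0 \<le> c" "0 \<le> (t::real)"
  shows "(1 + c * t) * exp (- d * t) \<le> (1 + 2 * c / d) * exp (- (d / 2) * t)"
proof -
  have "(d / 2) * t \<le> exp ((d / 2) * t)" using exp_ge_add_one_self[of "(d / 2) * t"] by linarith
  then have "t \<le> (2 / d) * exp ((d / 2) * t)" using assms(1) by (simp add: field_simps)
  then have "c * t \<le> c * ((2 / d) * exp ((d / 2) * t))" using assms(2) by (rule mult_left_mono)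
  moreover have "1 \<le> exp ((d / 2) * t)" using assms by simp
  moreover have "(1 + 2 * c / d) * exp ((d / 2) * t) = exp ((d / 2) * t) + c * ((2 / d) * exp ((d / 2) * t))"
    by (simp add: algebra_simps)
  ultimately have "1 + c * t \<le> (1 + 2 * c / d) * exp ((d / 2) * t)" by linarith
  then have "(1 + c * t) * exp (- d * t) \<le> (1 + 2 * c / d) * exp ((d / 2) * t) * exp (- d * t)"
    by (rule mult_right_mono) simp
  also have "\<dots> = (1 + 2 * c / d) * exp (- (d / 2) * t)" by (simp add: mult.assoc mult_exp_exp)
  finally show ?thesis .
qed

lemma exp_decay_tendsto: "0 < d \<Longrightarrow> ((\<lambda>t::real. A * exp (- d * t)) \<longlongrightarrow> 0) at_top"
proof -
  assume d: "0 < d"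
  have "filterlim (\<lambda>t::real. d * t) at_top at_top"
    by (rule filterlim_tendsto_pos_mult_at_top[OF tendsto_const d filterlim_ident])
  then have "filterlim (\<lambda>t::real. - (d * t)) at_bot at_top" by (simp add: filterlim_uminus_at_bot)
  from filterlim_compose[OF exp_at_bot this] show ?thesis by (intro tendsto_mult_right_zero) simp
qed

lemma uniform_constant:
  fixes P :: "nat \<Rightarrow> real \<Rightarrow> bool"
  assumes "\<And>i. i < n \<Longrightarrow> \<exists>C\<ge>0. P i C" and mono: "\<And>i C D. P i C \<Longrightarrow> C \<le> D \<Longrightarrow> P i D"
  shows "\<exists>C\<ge>0. \<forall>i<n. P i C"
  using assms(1)
proof (induction n)
  case (Suc n)
  obtain C where C: "0 \<le> C" "\<forall>i<n. P i C" using Suc by auto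
  obtain D where D: "0 \<le> D" "P n D" using Suc.prems by blast
  have "\<forall>i<Suc n. P i (max C D)" using C D mono by (metis less_Suc_eq max.cobounded1 max.cobounded2)
  then show ?case using C(1) by (intro exI[of _ "max C D"]) auto
qed auto

context branching_system
begin

text \<open>The second moment of the integral is of order \<open>(1 + t) * exp (- 2 * l * t)\<close>, where the factor
  \<open>1 + t\<close> comes from the integration over the time of separation.\<close>

lemma remainder_tendsto_zero:
  assumes g: "g \<in> L2_space \<mu>" and g2: "(\<lambda>x. (g x)^2) \<in> L2_space \<mu>"
    and decay: "\<And>t. 0 \<le> t \<Longrightarrow> L2_norm \<mu> (TS t g) \<le> b * exp (- l * t)" and l: "2 * l \<le> lam 1" and a: "a < l"
  shows "L2_tendsto M (\<lambda>t w. exp (a * t) * (\<integral>x. g x \<partial>X t w)) (\<lambda>w. 0) at_top"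
proof -
  obtain t0 where t0: "0 < t0" "(\<lambda>x. p t0 x x) \<in> L2_space \<mu>" using diagonal_L2 by blast
  define r where "r = t0 / 2"
  have r: "0 < r" "2 * r = t0" using t0 by (auto simp: r_def)
  obtain C1 where C1: "0 < C1" "\<And>h t. h \<in> L2_space \<mu> \<Longrightarrow> 0 \<le> t \<Longrightarrow> L2_norm \<mu> (TS t h) \<le> C1 * exp (- lam 1 * t) * L2_norm \<mu> h"
    using principal_growth by blast
  define B' where "B' = max b C1"
  have B': "0 \<le> B'" "b \<le> B'" "C1 \<le> B'" using C1(1) by (auto simp: B'_def)
  have d1: "L2_norm \<mu> (TS t g) \<le> B' * exp (- l * t)" if "0 \<le> t" for t
    using decay[OF that] mult_right_mono[OF B'(2), of "exp (- l * t)"] by (meson exp_ge_zero order_trans)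
  have d2: "L2_norm \<mu> (TS t h) \<le> B' * exp (- (2 * l) * t) * L2_norm \<mu> h" if "0 \<le> t" "h \<in> L2_space \<mu>" for t h
  proof -
    have "C1 * exp (- lam 1 * t) \<le> B' * exp (- (2 * l) * t)"
      using B' C1(1) mult_right_mono[OF l that(1)] by (intro mult_mono) auto
    from mult_right_mono[OF this L2_norm_nonneg[of \<mu> h]] show ?thesis using C1(2)[OF that(2,1)] by linarith
  qed
  have diag: "(\<lambda>z. p (2 * r) z z) \<in> L2_space \<mu>" unfolding r(2) by (rule t0(2))
  note V = variance_integrand_decay[OF r(1) diag g g2 d1 B'(1) d2]
  have mono: "ennreal (C * exp (- (2 * l) * t)) \<le> ennreal (D * exp (- (2 * l) * t))" if "C \<le> D" for C D t
    using that by (intro ennreal_leI mult_right_mono) auto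
  have "\<exists>C\<ge>0. \<forall>i<length xs. \<forall>t>4 * r. \<forall>s\<in>{0..t}. FK s (\<lambda>z. ennreal ((TS (t - s) g z)^2)) (Some (xs ! i)) \<le> ennreal (C * exp (- (2 * l) * t))"
    by (rule uniform_constant[OF V(1)]) (meson mono order_trans)+
  then obtain C2 where C2: "0 \<le> C2" "\<And>i t s. i < length xs \<Longrightarrow> t > 4 * r \<Longrightarrow> s \<in> {0..t} \<Longrightarrow>
      FK s (\<lambda>z. ennreal ((TS (t - s) g z)^2)) (Some (xs ! i)) \<le> ennreal (C2 * exp (- (2 * l) * t))" by blast
  have "\<exists>C\<ge>0. \<forall>i<length xs. \<forall>t>4 * r. FK t (\<lambda>z. ennreal ((g z)^2)) (Some (xs ! i)) \<le> ennreal (C * exp (- (2 * l) * t))"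
    by (rule uniform_constant[OF V(2)]) (meson mono order_trans)+
  then obtain C3 where C3: "0 \<le> C3" "\<And>i t. i < length xs \<Longrightarrow> t > 4 * r \<Longrightarrow>
      FK t (\<lambda>z. ennreal ((g z)^2)) (Some (xs ! i)) \<le> ennreal (C3 * exp (- (2 * l) * t))" by blast
  define n where "n = real (length xs)"
  define C where "C = max C2 C3"
  define c where "c = beta_bound * off_bound"
  have c0: "0 \<le> c" using beta_bound(2) off_bound(1) by (simp add: c_def)
  have C0: "0 \<le> C" using C2(1) by (simp add: C_def)
  have second: "(\<integral>\<^sup>+w. ennreal ((\<integral>x. g x \<partial>X t w)^2) \<partial>M) \<le> ennreal (n * (n * (C * ((1 + c * t) * exp (- (2 * l) * t)))))" if t: "t > 4 * r" for t
  proof -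
    have tp: "0 < t" using t r by linarith
    define k where "k = C * exp (- (2 * l) * t)"
    have k0: "0 \<le> k" using C0 by (simp add: k_def)
    have "(\<integral>\<^sup>+w. ennreal ((\<integral>x. g x \<partial>X t w)^2) \<partial>M) \<le> of_nat (length xs) * (of_nat (length xs) * (ennreal k + fork_rate * ennreal k * ennreal t))"
    proof (rule population_second_moment[OF g g2 tp])
      show "FK \<tau> (\<lambda>y. ennreal ((TS (t - \<tau>) g y)^2)) (Some (xs ! i)) \<le> ennreal k" if "i < length xs" "0 \<le> \<tau>" "\<tau> \<le> t" for i \<tau>
        unfolding k_def using C2(2)[OF that(1) t, of \<tau>] mono[of C2 C t] that by (auto simp: C_def intro: order_trans)
      show "FK t (\<lambda>x. ennreal ((g x)^2)) (Some (xs ! i)) \<le> ennreal k" if "i < length xs" for i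
        unfolding k_def using C3(2)[OF that t] mono[of C3 C t] by (auto simp: C_def intro: order_trans)
    qed
    also have "\<dots> = ennreal (n * (n * (k + c * k * t)))"
      using k0 c0 tp by (simp add: n_def c_def ennreal_mult ennreal_plus ennreal_of_nat_eq_real_of_nat)
    also have "n * (n * (k + c * k * t)) = n * (n * (C * ((1 + c * t) * exp (- (2 * l) * t))))"
      by (simp add: k_def algebra_simps)
    finally show ?thesis .
  qed
  have gm: "g \<in> borel_measurable borel" by (rule L2_borel[OF g])
  have L: "(\<lambda>w. \<integral>x. g x \<partial>X t w) \<in> L2_space M" if t: "t > 4 * r" for t
  proof -
    have tp: "0 \<le> t" using t r by linarith
    note m [measurable] = population_integral_measurable[OF gm tp]
    have "integrable M (\<lambda>w. (\<integral>x. g x \<partial>X t w)^2)"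
      by (rule integrableI_nonneg) (use le_less_trans[OF second[OF t], of top] in \<open>auto simp: infinity_ennreal_def\<close>)
    then show ?thesis using m by (simp add: L2_space_def)
  qed
  define d where "d = 2 * (l - a)"
  have d: "0 < d" using a by (simp add: d_def)
  define A where "A = n * (n * (C * (1 + 2 * c / d)))"
  have norm: "L2_norm M (\<lambda>w. exp (a * t) * (\<integral>x. g x \<partial>X t w)) \<le> sqrt (A * exp (- (d / 2) * t))" if t: "t > 4 * r" for t
  proof -
    have tp: "0 \<le> t" using t r by linarith
    let ?I = "\<integral>w. (\<integral>x. g x \<partial>X t w)^2 \<partial>M"
    have int: "integrable M (\<lambda>w. (\<integral>x. g x \<partial>X t w)^2)" using L[OF t] by (simp add: L2_space_def)
    have nn: "0 \<le> n * (n * (C * ((1 + c * t) * exp (- (2 * l) * t))))"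
      using c0 C0 tp by (simp add: n_def)
    have "ennreal ?I = (\<integral>\<^sup>+w. ennreal ((\<integral>x. g x \<partial>X t w)^2) \<partial>M)"
      by (rule nn_integral_eq_integral[symmetric, OF int]) simp
    then have "ennreal ?I \<le> ennreal (n * (n * (C * ((1 + c * t) * exp (- (2 * l) * t)))))" using second[OF t] by (simp only:)
    then have I: "?I \<le> n * (n * (C * ((1 + c * t) * exp (- (2 * l) * t))))" unfolding ennreal_le_iff[OF nn] .
    have "(L2_norm M (\<lambda>w. exp (a * t) * (\<integral>x. g x \<partial>X t w)))^2 = exp (a * t) * exp (a * t) * ?I"
      unfolding L2_norm_scale by (simp add: L2_norm_def power_mult_distrib power2_eq_square)
    also have "\<dots> \<le> exp (a * t) * exp (a * t) * (n * (n * (C * ((1 + c * t) * exp (- (2 * l) * t)))))"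
      by (rule mult_left_mono[OF I]) simp
    also have "\<dots> = n * (n * (C * ((1 + c * t) * (exp (a * t) * exp (a * t) * exp (- (2 * l) * t)))))" by (simp add: mult_ac)
    also have "exp (a * t) * exp (a * t) * exp (- (2 * l) * t) = exp (- d * t)"
      by (simp add: mult_exp_exp d_def algebra_simps)
    also have "n * (n * (C * ((1 + c * t) * exp (- d * t)))) \<le> n * (n * (C * ((1 + 2 * c / d) * exp (- (d / 2) * t))))"
      by (intro mult_left_mono linear_times_exp_bound d c0 tp C0) (simp_all add: n_def)
    also have "\<dots> = A * exp (- (d / 2) * t)" by (simp add: A_def mult_ac)
    finally show ?thesis by (rule real_le_rsqrt)
  qed
  have late: "\<forall>\<^sub>F t in at_top. t > 4 * r" by (rule eventually_gt_at_top)
  have "((\<lambda>t. L2_norm M (\<lambda>w. exp (a * t) * (\<integral>x. g x \<partial>X t w) - 0)) \<longlongrightarrow> 0) at_top"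
  proof (rule Lim_null_comparison)
    show "\<forall>\<^sub>F t in at_top. norm (L2_norm M (\<lambda>w. exp (a * t) * (\<integral>x. g x \<partial>X t w) - 0)) \<le> sqrt (A * exp (- (d / 2) * t))"
      using late by eventually_elim (use norm in \<open>simp add: L2_norm_nonneg\<close>)
    have "((\<lambda>t. sqrt (A * exp (- (d / 2) * t))) \<longlongrightarrow> sqrt 0) at_top"
      by (rule tendsto_real_sqrt) (use exp_decay_tendsto[of "d / 2" A] d in simp)
    then show "((\<lambda>t. sqrt (A * exp (- (d / 2) * t))) \<longlongrightarrow> 0) at_top" by simp
  qed
  moreover have "\<forall>\<^sub>F t in at_top. (\<lambda>w. exp (a * t) * (\<integral>x. g x \<partial>X t w)) \<in> L2_space M"
    using late by eventually_elim (intro L2_scale L)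
  ultimately show ?thesis unfolding L2_tendsto_def by (simp add: L2_zero)
qed

text \<open>The component of \<open>f\<close> in the \<open>k\<close>-th eigenspace produces the martingales, and the remainder \<open>g\<close> is
  negligible.\<close>

theorem L2_convergence:
  assumes f: "f \<in> L2_space \<mu> \<inter> L4_space \<mu>" and k: "k \<in> ev_index nev"
    and low: "\<And>m j. m \<in> ev_index nev \<Longrightarrow> m < k \<Longrightarrow> j \<in> {1..dimE m} \<Longrightarrow> L2_inner \<mu> f (\<phi> m j) = 0"
    and crit: "2 * lam k < lam 1"
    and H: "\<And>j. j \<in> {1..dimE k} \<Longrightarrow> L2_tendsto M (H_martingale X lam \<phi> k j) (H j) at_top"
  shows "L2_tendsto M (\<lambda>t w. exp (lam k * t) * (\<integral>x. f x \<partial>X t w)) (\<lambda>w. \<Sum>j=1..dimE k. L2_inner \<mu> f (\<phi> k j) * H j w) at_top"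
proof -
  define a where "a = (\<lambda>j. L2_inner \<mu> f (\<phi> k j))"
  define h where "h = (\<lambda>x. \<Sum>j=1..dimE k. a j * \<phi> k j x)"
  define g where "g = (\<lambda>x. f x - h x)"
  have fL: "f \<in> L2_space \<mu>" and f2: "(\<lambda>x. (f x)^2) \<in> L2_space \<mu>" using f by (auto simp: L2_space_def L4_space_def)
  have aL: "(\<lambda>x. a j * \<phi> k j x) \<in> L2_space \<mu>" if "j \<in> {1..dimE k}" for j
    by (rule L2_scale[OF phi_L2[OF k that]])
  have hL: "h \<in> L2_space \<mu>" unfolding h_def by (rule L2_sum[OF aL])
  have gL: "g \<in> L2_space \<mu>" unfolding g_def by (rule L2_diff[OF fL hL])
  have h2: "(\<lambda>x. (h x)^2) \<in> L2_space \<mu>"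
    unfolding h_def by (rule square_L2_sum) (auto intro: L2_spaceD(1)[OF aL] square_L2_scale[OF phi_square_L2[OF k]])
  have g2: "(\<lambda>x. (g x)^2) \<in> L2_space \<mu>"
    using square_L2_add[OF L2_spaceD(1)[OF fL] L2_spaceD(1)[OF L2_scale[OF hL, of "-1"]] f2 square_L2_scale[OF h2, of "-1"]]
    by (simp add: g_def)
  have orth: "L2_inner \<mu> g (\<phi> m i) = 0" if m: "m \<in> ev_index nev" "m \<le> k" and i: "i \<in> {1..dimE m}" for m i
  proof -
    note mi = phi_L2[OF m(1) i]
    have "L2_inner \<mu> h (\<phi> m i) = (\<Sum>j=1..dimE k. a j * L2_inner \<mu> (\<phi> k j) (\<phi> m i))"
      unfolding h_def by (rule L2_inner_sum) (use phi_L2[OF k] mi in auto)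
    also have "\<dots> = L2_inner \<mu> f (\<phi> m i)"
    proof (cases "m = k")
      case True
      have "(\<Sum>j=1..dimE k. a j * L2_inner \<mu> (\<phi> k j) (\<phi> m i)) = (\<Sum>j=1..dimE k. if j = i then a j else 0)"
        using True i by (intro sum.cong) (auto simp: phi_orthonormal[OF k])
      also have "\<dots> = a i" using i True by (simp add: sum.delta)
      finally show ?thesis by (simp add: a_def True)
    next
      case False
      then have mk: "m < k" using m by simp
      then have "lam m < lam k" using lam_increasing m k by (auto simp: strict_mono_on_def)
      then have "L2_inner \<mu> (\<phi> k j) (\<phi> m i) = 0" if "j \<in> {1..dimE k}" for j
        by (intro eigenfunctions_orthogonal[OF phi_generator[OF k that] phi_generator[OF m(1) i]]) simp
      then show ?thesis by (simp add: low[OF m(1) mk i])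
    qed
    finally show ?thesis unfolding g_def by (simp add: L2_inner_diff[OF fL hL mi])
  qed
  \<comment> \<open>\<open>l\<close> separates \<open>lam k\<close> from the later \<open>lam m\<close>; the bound \<open>lam 1 / 2\<close> makes it slow enough for
    the growth of second moments.\<close>
  define l where "l = (if Suc k \<in> ev_index nev then min (lam (Suc k)) (lam 1 / 2) else lam 1 / 2)"
  have l: "2 * l \<le> lam 1" by (auto simp: l_def)
  have kl: "lam k < l" using crit lam_increasing k by (auto simp: l_def strict_mono_on_def)
  have above: "l \<le> lam m" if m: "m \<in> ev_index nev" "k < m" for m
  proof -
    have S: "Suc k \<in> ev_index nev"
      using m by (auto simp: ev_index_def intro: order_trans[of "enat (Suc k)" "enat m"])
    have "lam (Suc k) \<le> lam m" by (rule lam_mono[OF S m(1)]) (use m in simp)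
    then show ?thesis using S by (simp add: l_def)
  qed
  obtain C where C: "\<And>t. 0 \<le> t \<Longrightarrow> L2_norm \<mu> (TS t g) \<le> C * exp (- l * t) * L2_norm \<mu> g"
    using spectral_gap_decay[of k l, OF above] gL orth by blast
  have "L2_norm \<mu> (TS t g) \<le> (C * L2_norm \<mu> g) * exp (- l * t)" if "0 \<le> t" for t
    using C[OF that] by (simp add: mult_ac)
  note rem = remainder_tendsto_zero[OF gL g2 this l kl]
  have "L2_tendsto M (\<lambda>t w. \<Sum>j=1..dimE k. a j * H_martingale X lam \<phi> k j t w) (\<lambda>w. \<Sum>j=1..dimE k. a j * H j w) at_top"
    by (intro L2_tendsto_sum L2_tendsto_scale H) auto
  from L2_tendsto_add[OF rem this]
  have lim: "L2_tendsto M (\<lambda>t w. exp (lam k * t) * (\<integral>x. g x \<partial>X t w) + (\<Sum>j=1..dimE k. a j * H_martingale X lam \<phi> k j t w))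
      (\<lambda>w. \<Sum>j=1..dimE k. a j * H j w) at_top" by simp
  have late: "\<forall>\<^sub>F t in at_top. t > (0::real)" by (rule eventually_gt_at_top)
  have "L2_tendsto M (\<lambda>t w. exp (lam k * t) * (\<integral>x. f x \<partial>X t w)) (\<lambda>w. \<Sum>j=1..dimE k. a j * H j w) at_top"
  proof (rule L2_tendsto_cong_AE[OF lim])
    show "\<forall>\<^sub>F t in at_top. (\<lambda>w. exp (lam k * t) * (\<integral>x. f x \<partial>X t w)) \<in> borel_measurable M"
      using late
    proof eventually_elim
      case (elim t)
      note [measurable] = population_integral_measurable[OF L2_borel[OF fL] less_imp_le[OF elim]]
      show ?case by measurable
    qed
    show "\<forall>\<^sub>F t in at_top. AE w in M. exp (lam k * t) * (\<integral>x. g x \<partial>X t w) + (\<Sum>j=1..dimE k. a j * H_martingale X lam \<phi> k j t w)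
        = exp (lam k * t) * (\<integral>x. f x \<partial>X t w)"
      using late
    proof eventually_elim
      case (elim t)
      have "AE w in M. \<forall>j\<in>{1..dimE k}. integrable (X t w) (\<phi> k j)"
        by (rule AE_finite_allI) (use L2_population_integrable[OF phi_L2[OF k] elim] in auto)
      then show ?case using L2_population_integrable[OF fL elim]
      proof eventually_elim
        case (elim w)
        have "(\<integral>x. g x \<partial>X t w) = (\<integral>x. f x \<partial>X t w) - (\<integral>x. h x \<partial>X t w)"
          unfolding g_def h_def by (rule Bochner_Integration.integral_diff) (use elim in auto)
        also have "(\<integral>x. h x \<partial>X t w) = (\<Sum>j=1..dimE k. a j * (\<integral>x. \<phi> k j x \<partial>X t w))"
          unfolding h_def by (subst Bochner_Integration.integral_sum) (use elim in auto)
        finally show ?case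
          by (simp add: H_martingale_def right_diff_distrib sum_distrib_left mult_ac)
      qed
    qed
  qed
  then show ?thesis by (simp add: a_def)
qed

end

lemma gamma_index_cases:
  assumes "gamma_index \<mu> nev dimE \<phi> f \<noteq> \<infinity>"
  obtains k j where "gamma_index \<mu> nev dimE \<phi> f = enat k" "k \<in> ev_index nev"
    "\<And>m j. m \<in> ev_index nev \<Longrightarrow> m < k \<Longrightarrow> j \<in> {1..dimE m} \<Longrightarrow> L2_inner \<mu> f (\<phi> m j) = 0"
proof -
  define A where "A = {enat k | k. k \<in> ev_index nev \<and> (\<exists>j\<in>{1..dimE k}. L2_inner \<mu> f (\<phi> k j) \<noteq> 0)}"
  have g: "gamma_index \<mu> nev dimE \<phi> f = Inf A" by (simp add: gamma_index_def A_def)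
  have "A \<noteq> {}" using assms unfolding g by (auto simp: Inf_enat_def)
  then have "Inf A \<in> A" unfolding Inf_enat_def by (auto intro: LeastI)
  then obtain k where k: "Inf A = enat k" "k \<in> ev_index nev" unfolding A_def by blast
  have "L2_inner \<mu> f (\<phi> m j) = 0" if "m \<in> ev_index nev" "m < k" "j \<in> {1..dimE m}" for m j
  proof (rule ccontr)
    assume "L2_inner \<mu> f (\<phi> m j) \<noteq> 0"
    then have "enat m \<in> A" using that by (auto simp: A_def)
    then have "Inf A \<le> enat m" by (rule Inf_lower)
    then show False using k(1) that(2) by simp
  qed
  then show ?thesis using that k g by metis
qed

theorem theorem1p6:
  fixes \<xi> :: "real \<Rightarrow> 'w \<Rightarrow> 'a::{metric_space, second_countable_topology} option"
    and law :: "'a option \<Rightarrow> 'w measure"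
    and \<mu> \<nu> :: "'a measure"
    and p q :: "real \<Rightarrow> 'a \<Rightarrow> 'a \<Rightarrow> real"
    and \<beta> f :: "'a \<Rightarrow> real"
    and off :: "'a \<Rightarrow> nat pmf"
    and nev :: enat
    and lam :: "nat \<Rightarrow> real"
    and dimE :: "nat \<Rightarrow> nat"
    and \<phi> :: "nat \<Rightarrow> nat \<Rightarrow> 'a \<Rightarrow> real"
    and M :: "'m measure"
    and xs :: "'a list"
    and mot :: "'m \<Rightarrow> label \<Rightarrow> 'w"
    and life :: "'m \<Rightarrow> label \<Rightarrow> ennreal"
    and kids :: "'m \<Rightarrow> label \<Rightarrow> nat"
    and X :: "real \<Rightarrow> 'm \<Rightarrow> 'a measure"
    and H_inf :: "nat \<Rightarrow> nat \<Rightarrow> 'm \<Rightarrow> real"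
    and \<gamma> :: enat
  assumes "f \<in> L2_space \<mu> \<inter> L4_space \<mu>"
    and "\<gamma> = gamma_index \<mu> nev dimE \<phi> f"
    and "ereal (lam 1) > 2 * lam_ext lam \<gamma>"
    and "\<nu> \<in> finite_atomic_measures" and "\<nu> \<noteq> null_measure borel"
    and "\<nu> = dirac_sum xs"
    and "branching_system \<xi> law \<mu> p \<beta> off q nev lam dimE \<phi> M xs mot life kids"
    and "X = branching_process \<xi> xs mot life kids"
    and "\<And>k j. k \<in> ev_index nev \<Longrightarrow> lam 1 > 2 * lam k \<Longrightarrow> j \<in> {1..dimE k} \<Longrightarrow>
           is_as_L2_limit M (H_martingale X lam \<phi> k j) (H_inf k j)"
  shows "L2_tendsto M
           (\<lambda>t \<omega>. exp (lam (the_enat \<gamma>) * t) * (\<integral>x. f x \<partial>X t \<omega>))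
           (\<lambda>\<omega>. \<Sum>j=1..dimE (the_enat \<gamma>). L2_inner \<mu> f (\<phi> (the_enat \<gamma>) j) * H_inf (the_enat \<gamma>) j \<omega>)
           at_top"
proof -
  interpret bs: branching_system \<xi> law \<mu> p \<beta> off q nev lam dimE \<phi> M xs mot life kids by fact
  have "\<gamma> \<noteq> \<infinity>"
  proof
    assume "\<gamma> = \<infinity>"
    then have "2 * lam_ext lam \<gamma> = \<infinity>" by (simp add: lam_ext_def)
    then show False using assms(3) by simp
  qed
  then obtain k where k: "\<gamma> = enat k" "k \<in> ev_index nev"
    and low: "\<And>m j. m \<in> ev_index nev \<Longrightarrow> m < k \<Longrightarrow> j \<in> {1..dimE m} \<Longrightarrow> L2_inner \<mu> f (\<phi> m j) = 0"
    using gamma_index_cases[of \<mu> nev dimE \<phi> f] unfolding assms(2) by metis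
  have "ereal (2 * lam k) < ereal (lam 1)" using assms(3) by (simp add: k(1) lam_ext_def flip: times_ereal.simps(1))
  then have crit: "2 * lam k < lam 1" by simp
  have "L2_tendsto M (H_martingale (branching_process \<xi> xs mot life kids) lam \<phi> k j) (H_inf k j) at_top" if "j \<in> {1..dimE k}" for j
    using assms(9)[OF k(2) crit that] unfolding assms(8) is_as_L2_limit_def by blast
  from bs.L2_convergence[OF assms(1) k(2) low crit this] show ?thesis by (simp add: assms(8) k(1))
qed

end
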